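(* Let $1<p<+\infty$ and let $\mu\in\mathcal{M}_0^p(\mathbb{R}^N)$. The following assertions are equivalent. (1) $w_\mu\in L^1(\mathbb{R}^N)$. (2) $W^{1,p}_\mu\subset L^1(\mathbb{R}^N)$ and the injection is continuous. Moreover, if one of the two assertions above holds, then the embedding $W^{1,p}_\mu\hookrightarrow L^1(\mathbb{R}^N)$ is compact.
   Context: $p$-capacity: for $E\subset\mathbb{R}^N$, $\operatorname{cap}_p(E)=\inf\{\int_{\mathbb{R}^N}|\nabla u|^p+|u|^p\,dx : u\in W^{1,p}(\mathbb{R}^N),\ u\ge 1\text{ a.e. in a neighbourhood of }E\}$. "Quasi-everywhere" (q.e.) means except on a set of $p$-capacity zero. Every $u\in W^{1,p}(\mathbb{R}^N)$ is identified with its ($p$-)quasi-continuous representative. $\mathcal{M}_0^p(\mathbb{R}^N)$ is the family of all nonnegative regular Borel measures on $\mathbb{R}^N$, possibly $+\infty$ valued, that vanish on all sets of $p$-capacity zero. $W^{1,p}_\mu=W^{1,p}(\mathbb{R}^N)\cap L^p(\mathbb{R}^N,\mu)$, a Banach space with norm $\|u\|_{1,\mu}^p=\int_{\mathbb{R}^N}(|\nabla u|^p+|u|^p)\,dx+\int_{\mathbb{R}^N}|u|^p\,d\mu$. $\infty_S(B)=0$ if $\operatorname{cap}_p(B\cap S)=0$ and $+\infty$ otherwise; the Dirichlet restriction is $\mu\lceil\Omega=\mu+\infty_{\mathbb{R}^N\setminus\Omega}$, so $W^{1,p}_{\mu\lceil\Omega}=\{u\in W^{1,p}_\mu:u=0\text{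 q.e. on }\mathbb{R}^N\setminus\Omega\}$. $B_R$ is the ball of radius $R$ centred at the origin. $\mathcal{R}_{\mu\lceil B_R}(1)$ is the unique $u\in W^{1,p}_{\mu\lceil B_R}$ such that $\int_{\mathbb{R}^N}(|\nabla u|^{p-2}\nabla u\cdot\nabla\varphi+|u|^{p-2}u\varphi)\,dx+\int_{\mathbb{R}^N}|u|^{p-2}u\varphi\,d\mu=\int_{\mathbb{R}^N}\varphi\,dx$ for all $\varphi\in W^{1,p}_{\mu\lceil B_R}$. Then $w_\mu=\lim_{R\to+\infty}\mathcal{R}_{\mu\lceil B_R}(1)$ (pointwise limit, monotone nondecreasing in $R$). *)

theory Defs
  imports "HOL-Analysis.Analysis"
begin

section \<open>The Sobolev space \<open>W\<^sup>1\<^sup>,\<^sup>p\<close> on a Euclidean space\<close>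

primrec Ck :: "nat \<Rightarrow> ('a::euclidean_space \<Rightarrow> real) \<Rightarrow> bool" where
  "Ck 0 f \<longleftrightarrow> continuous_on UNIV f"
| "Ck (Suc k) f \<longleftrightarrow> (\<forall>x. f differentiable (at x)) \<and>
     (\<forall>b\<in>Basis. Ck k (\<lambda>x. frechet_derivative f (at x) b))"

definition test_functions :: "('a::euclidean_space \<Rightarrow> real) set" where
  "test_functions = {\<phi>. (\<forall>k. Ck k \<phi>) \<and> compact (closure {x. \<phi> x \<noteq> 0})}"

definition locally_integrable ::
    "('a::euclidean_space \<Rightarrow> 'b::{banach, second_countable_topology}) \<Rightarrow> bool" where
  "locally_integrable f \<longleftrightarrow> (\<forall>K. compact K \<longrightarrow> set_integrable lebesgue K f)"

definition has_weak_gradient ::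
    "('a::euclidean_space \<Rightarrow> real) \<Rightarrow> ('a \<Rightarrow> 'a) \<Rightarrow> bool" where
  "has_weak_gradient u G \<longleftrightarrow> locally_integrable u \<and> locally_integrable G \<and>
     (\<forall>\<phi>\<in>test_functions. \<forall>b\<in>Basis.
        (\<integral>x. u x * frechet_derivative \<phi> (at x) b \<partial>lebesgue) =
        - (\<integral>x. (G x \<bullet> b) * \<phi> x \<partial>lebesgue))"

text \<open>The weak gradient is unique only up to null sets; it is used only under integrals with
  respect to Lebesgue measure.\<close>

definition weak_gradient :: "('a::euclidean_space \<Rightarrow> real) \<Rightarrow> 'a \<Rightarrow> 'a" where
  "weak_gradient u = (SOME G. has_weak_gradient u G)"

definition sobolev :: "real \<Rightarrow> ('a::euclidean_space \<Rightarrow> real) set" where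
  "sobolev p = {u. u \<in> borel_measurable lebesgue \<and>
     integrable lebesgue (\<lambda>x. \<bar>u x\<bar> powr p) \<and>
     (\<exists>G. has_weak_gradient u G \<and> integrable lebesgue (\<lambda>x. norm (G x) powr p))}"


section \<open>Capacity and quasi-continuity\<close>

text \<open>The infimum is taken in \<^typ>\<open>ennreal\<close>, so the capacity is infinite when there is no
  admissible function.\<close>

definition pcap :: "real \<Rightarrow> 'a::euclidean_space set \<Rightarrow> ennreal" where
  "pcap p E = (INF u \<in> {u \<in> sobolev p. \<exists>U. open U \<and> E \<subseteq> U \<and> (AE x in lebesgue. x \<in> U \<longrightarrow> u x \<ge> 1)}.
     \<integral>\<^sup>+x. ennreal (norm (weak_gradient u x) powr p + \<bar>u x\<bar> powr p) \<partial>lebesgue)"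

definition quasi_everywhere :: "real \<Rightarrow> ('a::euclidean_space \<Rightarrow> bool) \<Rightarrow> bool" where
  "quasi_everywhere p P \<longleftrightarrow> pcap p {x. \<not> P x} = 0"

definition quasi_continuous :: "real \<Rightarrow> ('a::euclidean_space \<Rightarrow> real) \<Rightarrow> bool" where
  "quasi_continuous p u \<longleftrightarrow>
     (\<forall>\<epsilon>>0. \<exists>G. open G \<and> pcap p G < ennreal \<epsilon> \<and> continuous_on (- G) u)"

definition quasi_open :: "real \<Rightarrow> 'a::euclidean_space set \<Rightarrow> bool" where
  "quasi_open p A \<longleftrightarrow> (\<forall>\<epsilon>>0. \<exists>G. open G \<and> pcap p G < ennreal \<epsilon> \<and> open (A \<union> G))"

text \<open>Sobolev functions given by a quasi-continuous representative; two such representatives of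
  the same class agree quasi-everywhere.\<close>

definition sobolev_qc :: "real \<Rightarrow> ('a::euclidean_space \<Rightarrow> real) set" where
  "sobolev_qc p = {u \<in> sobolev p. quasi_continuous p u}"


section \<open>Capacitary measures\<close>

text \<open>Regularity is meant in the sense usual for capacitary measures (Dal Maso), i.e. outer
  regularity with respect to quasi-open sets: outer regularity with respect to open sets would
  exclude measures such as \<open>\<infinity>\<^sub>S\<close> below. Quasi-open sets need not be Borel, but every quasi-open
  set is contained in a quasi-open \<open>G\<^sub>\<delta>\<close> set from which it differs by a set of capacity zero, so
  nothing is lost by letting only Borel sets compete.

  Sets of capacity zero need not be Borel either. Such a set is null for a Borel measure when
  it is a null set of the completion. Quasi-continuous functions are therefore measurable for
  the completion, which is why integrals are taken with respect to the completion.\<close>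

definition capacitary_measures :: "real \<Rightarrow> 'a::euclidean_space measure set" where
  "capacitary_measures p = {\<mu>. sets \<mu> = sets borel \<and>
     (\<forall>E. pcap p E = 0 \<longrightarrow> E \<in> null_sets (completion \<mu>)) \<and>
     (\<forall>B\<in>sets borel. emeasure \<mu> B =
        (INF U \<in> {U \<in> sets borel. quasi_open p U \<and> B \<subseteq> U}. emeasure \<mu> U))}"

definition sobolev_mu :: "real \<Rightarrow> 'a::euclidean_space measure \<Rightarrow> ('a \<Rightarrow> real) set" where
  "sobolev_mu p \<mu> = {u \<in> sobolev_qc p. integrable (completion \<mu>) (\<lambda>x. \<bar>u x\<bar> powr p)}"

definition sobolev_mu_norm :: "real \<Rightarrow> 'a::euclidean_space measure \<Rightarrow> ('a \<Rightarrow> real) \<Rightarrow> real" where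
  "sobolev_mu_norm p \<mu> u =
     ((\<integral>x. norm (weak_gradient u x) powr p + \<bar>u x\<bar> powr p \<partial>lebesgue) +
      (\<integral>x. \<bar>u x\<bar> powr p \<partial>completion \<mu>)) powr (1 / p)"

definition infinity_on :: "real \<Rightarrow> 'a::euclidean_space set \<Rightarrow> 'a set \<Rightarrow> ennreal" where
  "infinity_on p S B = (if pcap p (B \<inter> S) = 0 then 0 else \<infinity>)"

definition dirichlet_restriction ::
    "real \<Rightarrow> 'a::euclidean_space measure \<Rightarrow> 'a set \<Rightarrow> 'a measure" where
  "dirichlet_restriction p \<mu> \<Omega> =
     measure_of UNIV (sets borel) (\<lambda>B. emeasure \<mu> B + infinity_on p (- \<Omega>) B)"


section \<open>The function \<open>w\<^sub>\<mu>\<close>\<close>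

definition is_resolvent_one ::
    "real \<Rightarrow> 'a::euclidean_space measure \<Rightarrow> real \<Rightarrow> ('a \<Rightarrow> real) \<Rightarrow> bool" where
  "is_resolvent_one p \<mu> R u \<longleftrightarrow>
     u \<in> sobolev_mu p (dirichlet_restriction p \<mu> (ball 0 R)) \<and>
     (\<forall>\<phi> \<in> sobolev_mu p (dirichlet_restriction p \<mu> (ball 0 R)).
        (\<integral>x. norm (weak_gradient u x) powr (p - 2) * (weak_gradient u x \<bullet> weak_gradient \<phi> x)
             + \<bar>u x\<bar> powr (p - 2) * u x * \<phi> x \<partial>lebesgue)
        + (\<integral>x. \<bar>u x\<bar> powr (p - 2) * u x * \<phi> x \<partial>completion \<mu>)
        = (\<integral>x. \<phi> x \<partial>lebesgue))"

text \<open>The solution is unique as an element of the Sobolev space, i.e. up to equality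
  quasi-everywhere.\<close>

definition resolvent_one :: "real \<Rightarrow> 'a::euclidean_space measure \<Rightarrow> real \<Rightarrow> 'a \<Rightarrow> real" where
  "resolvent_one p \<mu> R = (SOME u. is_resolvent_one p \<mu> R u)"

text \<open>Each \<^term>\<open>resolvent_one p \<mu> R\<close> is determined only up to a set of capacity zero depending
  on \<open>R\<close>, so the pointwise limit over the uncountable family of all radii is formed along
  arbitrary sequences of radii tending to infinity, with one and the same limit function. This
  determines the limit up to equality quasi-everywhere. It may take the value \<open>\<infinity>\<close>.\<close>

definition is_w_limit :: "real \<Rightarrow> 'a::euclidean_space measure \<Rightarrow> ('a \<Rightarrow> ereal) \<Rightarrow> bool" where
  "is_w_limit p \<mu> w \<longleftrightarrow>
     (\<forall>R :: nat \<Rightarrow> real. filterlim R at_top sequentially \<longrightarrow>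
        quasi_everywhere p (\<lambda>x. (\<lambda>n. ereal (resolvent_one p \<mu> (R n) x)) \<longlonglongrightarrow> w x))"

definition w_mu :: "real \<Rightarrow> 'a::euclidean_space measure \<Rightarrow> 'a \<Rightarrow> ereal" where
  "w_mu p \<mu> = (SOME w. is_w_limit p \<mu> w)"

definition ereal_integrable :: "('a::euclidean_space \<Rightarrow> ereal) \<Rightarrow> bool" where
  "ereal_integrable f \<longleftrightarrow> f \<in> borel_measurable lebesgue \<and>
     (\<integral>\<^sup>+x. e2ennreal \<bar>f x\<bar> \<partial>lebesgue) < \<infinity>"


section \<open>The embedding into \<open>L\<^sup>1\<close>\<close>

definition L1_norm :: "('a::euclidean_space \<Rightarrow> real) \<Rightarrow> real" where
  "L1_norm u = (\<integral>x. \<bar>u x\<bar> \<partial>lebesgue)"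

definition embedded_in_L1 :: "real \<Rightarrow> 'a::euclidean_space measure \<Rightarrow> bool" where
  "embedded_in_L1 p \<mu> \<longleftrightarrow> sobolev_mu p \<mu> \<subseteq> {u. integrable lebesgue u}"

definition continuous_injection_L1 :: "real \<Rightarrow> 'a::euclidean_space measure \<Rightarrow> bool" where
  "continuous_injection_L1 p \<mu> \<longleftrightarrow>
     (\<forall>u\<in>sobolev_mu p \<mu>. \<forall>\<epsilon>>0. \<exists>\<delta>>0. \<forall>v\<in>sobolev_mu p \<mu>.
        sobolev_mu_norm p \<mu> (\<lambda>x. v x - u x) < \<delta> \<longrightarrow> L1_norm (\<lambda>x. v x - u x) < \<epsilon>)"

definition compact_embedding_L1 :: "real \<Rightarrow> 'a::euclidean_space measure \<Rightarrow> bool" where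
  "compact_embedding_L1 p \<mu> \<longleftrightarrow> embedded_in_L1 p \<mu> \<and> continuous_injection_L1 p \<mu> \<and>
     (\<forall>u :: nat \<Rightarrow> 'a \<Rightarrow> real.
        (\<forall>n. u n \<in> sobolev_mu p \<mu>) \<and> (\<exists>C. \<forall>n. sobolev_mu_norm p \<mu> (u n) \<le> C) \<longrightarrow>
        (\<exists>r v. strict_mono (r :: nat \<Rightarrow> nat) \<and> integrable lebesgue v \<and>
           (\<lambda>n. L1_norm (\<lambda>x. u (r n) x - v x)) \<longlonglongrightarrow> 0))"

end

theory Submission
  imports Defs "HOL-Library.Diagonal_Subsequence"
begin

text \<open>Let \<open>u\<^sub>n\<close> be the resolvent of \<open>1\<close> on the ball of radius \<open>n\<close>. The \<open>u\<^sub>n\<close> increase to \<open>w\<^sub>\<mu>\<close>,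
  so \<open>w\<^sub>\<mu>\<close> is integrable iff the integrals of the \<open>u\<^sub>n\<close> are bounded. Testing the equation of \<open>u\<^sub>n\<close>
  with \<open>u\<^sub>n\<close> shows that this integral equals \<open>\<parallel>u\<^sub>n\<parallel>\<^sup>p\<close>; if the embedding is continuous, then
  \<open>\<parallel>u\<^sub>n\<parallel>\<^sup>p \<le> C \<parallel>u\<^sub>n\<parallel>\<close>, which is a bound since \<open>p > 1\<close>.

  Conversely, testing the equation of \<open>u\<^sub>n\<close> with \<open>\<zeta> \<bar>u\<bar>\<close> for a smooth weight \<open>\<zeta>\<close> cut off inside the ball
  and using Young's inequality bounds the integral of \<open>\<zeta> \<bar>u\<bar>\<close> by the integral of \<open>\<zeta> w\<^sub>\<mu>\<close>, the norm of
  \<open>u\<close> and the size of the gradient of \<open>\<zeta>\<close>. The weight \<open>\<zeta> = 1\<close> gives the continuous embedding. A weight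
  vanishing on a large ball gives tails that are uniformly small on bounded sets, so that compactness
  follows from local compactness (Rellich).

  The resolvents exist by the direct method: the functional is uniformly convex, so minimizing
  sequences are Cauchy, and rapidly Cauchy sequences converge quasi-everywhere to a
  quasi-continuous function.\<close>

section \<open>Smooth functions\<close>

text \<open>The test functions involve |u|, positive parts and products with cut-offs, so a chain
  rule for weak gradients has to come before everything else. It is obtained without mollification:
  weak derivatives are characterised as local L^1 limits of difference quotients, and the freedom in
  the sign of the steps shows at the same time that the gradient vanishes a.e. on the zero set.

  Only the smallness of capacities matters, never exact subadditivity. Series are therefore weighted
  by 2^((k+1)p), so that a weighted sum of p-th powers bounds the p-th power of the sum with
  constant 1. This takes the place of Minkowski's inequality and of suprema of Sobolev functions.

  Young's inequality for \<zeta>|u| leaves k^p times the \<zeta>-weighted energy of the resolvent,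
  with \<open>k\<close> free. A second test, with \<zeta> times the resolvent, turns this energy
  into the integral of \<zeta> times the resolvent. For continuity \<open>k\<close> is small; for
  tails \<open>k\<close> is fixed by the norm bound, and only then is the weight pushed to
  infinity.\<close>

lemma Ck_coinduct:
  assumes "\<And>f. f \<in> X \<Longrightarrow> (\<forall>x. f differentiable (at x)) \<and> (\<forall>b\<in>Basis. (\<lambda>x. frechet_derivative f (at x) b) \<in> X)"
    and "f \<in> X"
  shows "Ck k f"
  using assms(2)
proof (induction k arbitrary: f)
  case 0
  then show ?case
    using assms(1)[OF 0] by (auto intro!: continuous_at_imp_continuous_on differentiable_imp_continuous_within)
next
  case (Suc k)
  then show ?case using assms(1)[OF Suc.prems] by auto
qed

lemma Ck_SucD: "Ck (Suc k) f \<Longrightarrow> Ck k f"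
  by (induction k arbitrary: f)
    (auto intro!: continuous_at_imp_continuous_on differentiable_imp_continuous_within)

lemma Ck_const: "Ck k (\<lambda>x. c)"
  by (induction k arbitrary: c) (auto simp: frechet_derivative_const)

lemma Ck_add: "Ck k f \<Longrightarrow> Ck k g \<Longrightarrow> Ck k (\<lambda>x. f x + g x)"
proof (induction k arbitrary: f g)
  case (Suc k)
  then have d: "\<And>x. f differentiable (at x)" "\<And>x. g differentiable (at x)" by auto
  have "frechet_derivative (\<lambda>x. f x + g x) (at x) b = frechet_derivative f (at x) b + frechet_derivative g (at x) b" for x b
  proof -
    have "((\<lambda>x. f x + g x) has_derivative
        (\<lambda>h. frechet_derivative f (at x) h + frechet_derivative g (at x) h)) (at x)"
      using d by (intro has_derivative_add) (auto simp: frechet_derivative_works[symmetric])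
    from frechet_derivative_at[OF this] show ?thesis by metis
  qed
  then show ?case using Suc d by simp
qed (simp add: continuous_on_add)

lemma frechet_derivative_mult_real:
  fixes f g :: "'a::euclidean_space \<Rightarrow> real"
  assumes "f differentiable (at x)" "g differentiable (at x)"
  shows "frechet_derivative (\<lambda>x. f x * g x) (at x) b =
    f x * frechet_derivative g (at x) b + frechet_derivative f (at x) b * g x"
proof -
  have "((\<lambda>x. f x * g x) has_derivative
      (\<lambda>h. f x * frechet_derivative g (at x) h + frechet_derivative f (at x) h * g x)) (at x)"
    using assms by (intro has_derivative_mult) (auto simp: frechet_derivative_works[symmetric])
  from frechet_derivative_at[OF this] show ?thesis by metis
qed

lemma Ck_mult: "Ck k f \<Longrightarrow> Ck k g \<Longrightarrow> Ck k (\<lambda>x. f x * g x)"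
proof (induction k arbitrary: f g)
  case (Suc k)
  then have d: "\<And>x. f differentiable (at x)" "\<And>x. g differentiable (at x)" by auto
  have "Ck k f" "Ck k g" using Suc.prems Ck_SucD by blast+
  then show ?case using Suc d
    by (simp add: frechet_derivative_mult_real Ck_add)
qed (simp add: continuous_on_mult)

text \<open>The factor \<open>(1/t)^n\<close> makes the family closed under differentiation.\<close>

definition flat :: "nat \<Rightarrow> real \<Rightarrow> real" where
  "flat n t = (if t > 0 then (1/t)^n / exp (1/t) else 0)"

lemma flat_tendsto_0: "(flat n \<longlongrightarrow> 0) (at 0)"
proof -
  have "((\<lambda>t. (1/t)^n / exp (1/t)) \<longlongrightarrow> 0) (at_right (0::real))"
    using filterlim_compose[OF tendsto_power_div_exp_0 filterlim_inverse_at_top_right, of n]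
    by (simp add: inverse_eq_divide)
  then have "(flat n \<longlongrightarrow> 0) (at_right 0)"
    by (rule Lim_transform_eventually) (auto simp: flat_def eventually_at_filter)
  moreover have "(flat n \<longlongrightarrow> 0) (at_left 0)"
    by (rule tendsto_eventually) (auto simp: flat_def eventually_at_filter)
  ultimately show ?thesis by (simp add: filterlim_split_at)
qed

lemma flat_DERIV: "(flat n has_real_derivative (flat (n + 2) t - n * flat (n + 1) t)) (at t)"
proof (cases "t = 0")
  case True
  \<comment> \<open>The difference quotient of \<open>flat n\<close> at 0 is
    \<open>flat (Suc n)\<close>, so the limit at 0 is needed for every power and not only for
    \<open>n = 0\<close>.\<close>
  have "((\<lambda>h. (flat n (0 + h) - flat n 0) / h) \<longlongrightarrow> 0) (at 0)"
    by (rule Lim_transform_eventually[OF flat_tendsto_0[of "Suc n"]])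
       (auto simp: flat_def eventually_at_filter)
  then show ?thesis using True by (simp add: DERIV_def flat_def)
next
  case False
  then consider "t > 0" | "t < 0" by linarith
  then show ?thesis
  proof cases
    case 1
    define y where "y = 1/t"
    have "((\<lambda>t. (1/t)^n / exp (1/t)) has_real_derivative
        ((n * y^(n-1) * (- (y*y))) * exp y - y^n * (exp y * (- (y*y)))) / (exp y * exp y)) (at t)"
      unfolding y_def using 1 by (auto intro!: derivative_eq_intros simp: power2_eq_square)
    moreover have "((n * y^(n-1) * (- (y*y))) * exp y - y^n * (exp y * (- (y*y)))) / (exp y * exp y) =
        flat (n + 2) t - n * flat (n + 1) t"
      using 1 by (cases n) (auto simp: flat_def y_def[symmetric] field_simps)
    ultimately have "((\<lambda>t. (1/t)^n / exp (1/t)) has_real_derivative (flat (n + 2) t - n * flat (n + 1) t)) (at t)"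
      by simp
    then show ?thesis
      by (rule has_field_derivative_transform_within_open[where S="{0<..}"]) (use 1 in \<open>auto simp: flat_def\<close>)
  next
    case 2
    have "((\<lambda>t. 0) has_real_derivative (flat (n + 2) t - n * flat (n + 1) t)) (at t)"
      using 2 by (simp add: flat_def)
    then show ?thesis
      by (rule has_field_derivative_transform_within_open[where S="{..<0}"]) (use 2 in \<open>auto simp: flat_def\<close>)
  qed
qed

text \<open>A set of functions closed under partial derivatives consists of smooth functions. These
  terms have that closure and contain compactly supported members: \<open>flat\<close> supplies the
  cut-offs, and \<open>exp\<close> is used in the test functions 1 - exp(-k\<beta>) that exhaust a
  box.\<close>

inductive_set smooth_terms :: "('a::euclidean_space \<Rightarrow> real) set" where
  const: "(\<lambda>x. c) \<in> smooth_terms"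
| inner: "(\<lambda>x. x \<bullet> b) \<in> smooth_terms"
| add: "f \<in> smooth_terms \<Longrightarrow> g \<in> smooth_terms \<Longrightarrow> (\<lambda>x. f x + g x) \<in> smooth_terms"
| mult: "f \<in> smooth_terms \<Longrightarrow> g \<in> smooth_terms \<Longrightarrow> (\<lambda>x. f x * g x) \<in> smooth_terms"
| exp: "f \<in> smooth_terms \<Longrightarrow> (\<lambda>x. exp (f x)) \<in> smooth_terms"
| flat: "f \<in> smooth_terms \<Longrightarrow> (\<lambda>x. flat n (f x)) \<in> smooth_terms"

text \<open>The total derivative is carried along as \<open>D\<close>, because the cases
  \<open>exp\<close> and \<open>flat\<close> need the chain rule; closure is recorded for its value
  in each direction.\<close>

lemma smooth_terms_has_derivative:
  assumes "f \<in> smooth_terms"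
  shows "\<exists>D. (\<forall>x. (f has_derivative D x) (at x)) \<and> (\<forall>b. (\<lambda>x. D x b) \<in> smooth_terms)"
  using assms
proof induction
  case (const c)
  show ?case by (rule exI[of _ "\<lambda>x b. 0"]) (auto intro: smooth_terms.intros)
next
  case (inner b)
  show ?case by (rule exI[of _ "\<lambda>x c. c \<bullet> b"]) (auto intro!: smooth_terms.intros derivative_eq_intros)
next
  case (add f g)
  then obtain D E where D: "\<forall>x. (f has_derivative D x) (at x)" "\<forall>b. (\<lambda>x. D x b) \<in> smooth_terms"
    and E: "\<forall>x. (g has_derivative E x) (at x)" "\<forall>b. (\<lambda>x. E x b) \<in> smooth_terms" by blast
  show ?case by (rule exI[of _ "\<lambda>x b. D x b + E x b"])
     (use D E in \<open>auto intro!: smooth_terms.intros has_derivative_add\<close>)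
next
  case (mult f g)
  then obtain D E where D: "\<forall>x. (f has_derivative D x) (at x)" "\<forall>b. (\<lambda>x. D x b) \<in> smooth_terms"
    and E: "\<forall>x. (g has_derivative E x) (at x)" "\<forall>b. (\<lambda>x. E x b) \<in> smooth_terms" by blast
  show ?case by (rule exI[of _ "\<lambda>x b. f x * E x b + D x b * g x"])
     (use D E mult in \<open>auto intro!: smooth_terms.intros has_derivative_mult\<close>)
next
  case (exp f)
  then obtain D where D: "\<And>x. (f has_derivative D x) (at x)" "\<And>b. (\<lambda>x. D x b) \<in> smooth_terms" by blast
  show ?case
  proof (rule exI[of _ "\<lambda>x b. exp (f x) * D x b"], intro conjI allI)
    show "((\<lambda>x. exp (f x)) has_derivative (\<lambda>b. exp (f x) * D x b)) (at x)" for x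
      using D(1)[of x] by (auto intro!: derivative_eq_intros)
  qed (use D exp in \<open>auto intro!: smooth_terms.intros\<close>)
next
  case (flat f n)
  then obtain D where D: "\<And>x. (f has_derivative D x) (at x)" "\<And>b. (\<lambda>x. D x b) \<in> smooth_terms" by blast
  show ?case
  proof (rule exI[of _ "\<lambda>x b. (flat (n+2) (f x) + (- real n) * flat (n+1) (f x)) * D x b"], intro conjI allI)
    fix x
    have "(flat n has_derivative times (flat (n + 2) (f x) - n * flat (n + 1) (f x))) (at (f x))"
      using flat_DERIV[of n "f x"] by (simp add: has_field_derivative_def)
    from has_derivative_compose[OF D(1)[of x] this]
    show "((\<lambda>x. flat n (f x)) has_derivative (\<lambda>b. (flat (n+2) (f x) + (- real n) * flat (n+1) (f x)) * D x b)) (at x)"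
      by simp
  next
    show "(\<lambda>x. (flat (n + 2) (f x) + - real n * flat (n + 1) (f x)) * D x b) \<in> smooth_terms" for b
      using D(2)[of b] flat(1) by (intro smooth_terms.intros)
  qed
qed

lemma smooth_terms_Ck:
  assumes "f \<in> smooth_terms" shows "Ck k f"
proof (rule Ck_coinduct[where X = smooth_terms])
  fix f :: "'a \<Rightarrow> real" assume "f \<in> smooth_terms"
  then obtain D where D: "\<And>x. (f has_derivative D x) (at x)" "\<And>b. (\<lambda>x. D x b) \<in> smooth_terms"
    using smooth_terms_has_derivative by blast
  then have "frechet_derivative f (at x) = D x" for x
    by (metis frechet_derivative_at)
  then show "(\<forall>x. f differentiable (at x)) \<and> (\<forall>b\<in>Basis. (\<lambda>x. frechet_derivative f (at x) b) \<in> smooth_terms)"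
    using D by (auto simp: differentiable_def)
qed (fact assms)

lemma smooth_terms_sum:
  assumes "\<And>i. i \<in> I \<Longrightarrow> f i \<in> smooth_terms" shows "(\<lambda>x. \<Sum>i\<in>I. f i x) \<in> smooth_terms"
  using assms by (induction I rule: infinite_finite_induct) (auto intro: smooth_terms.intros)

lemma smooth_terms_prod:
  assumes "\<And>i. i \<in> I \<Longrightarrow> f i \<in> smooth_terms" shows "(\<lambda>x. \<Prod>i\<in>I. f i x) \<in> smooth_terms"
  using assms by (induction I rule: infinite_finite_induct) (auto intro: smooth_terms.intros)

section \<open>Test functions: supports, bounds, products\<close>

lemma test_functionD:
  assumes "\<phi> \<in> test_functions"
  shows test_differentiable: "\<phi> differentiable (at x)"
    and test_continuous: "continuous_on UNIV \<phi>"
    and test_deriv_continuous: "b \<in> Basis \<Longrightarrow> continuous_on UNIV (\<lambda>x. frechet_derivative \<phi> (at x) b)"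
proof -
  have *: "Ck k \<phi>" for k using assms by (auto simp: test_functions_def)
  show "\<phi> differentiable (at x)" using *[of 1] by simp
  show "continuous_on UNIV \<phi>" using *[of 0] by simp
  show "b \<in> Basis \<Longrightarrow> continuous_on UNIV (\<lambda>x. frechet_derivative \<phi> (at x) b)" using *[of 1] by simp
qed

lemma test_support:
  assumes "\<phi> \<in> test_functions"
  obtains R where "R > 0" "\<And>x. norm x \<ge> R \<Longrightarrow> \<phi> x = 0"
    "\<And>x b. norm x \<ge> R \<Longrightarrow> frechet_derivative \<phi> (at x) b = 0"
proof -
  have "compact (closure {x. \<phi> x \<noteq> 0})" using assms by (auto simp: test_functions_def)
  then have "bounded {x. \<phi> x \<noteq> 0}" using compact_imp_bounded bounded_subset closure_subset by blast
  then obtain R0 where R0: "R0 > 0" "\<And>x. \<phi> x \<noteq> 0 \<Longrightarrow> norm x \<le> R0"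
    by (auto simp: bounded_pos)
  have z: "\<phi> x = 0" if "norm x > R0" for x using R0(2)[of x] that by force
  \<comment> \<open>The extra 1 puts the points considered into the open exterior of
    \<open>cball 0 R0\<close>, where the function is locally zero, so its derivative vanishes there
    as well.\<close>
  show thesis
  proof (rule that[of "R0 + 1"])
    fix x b assume x: "norm (x::'a) \<ge> R0 + 1"
    have "(\<phi> has_derivative (\<lambda>h. 0)) (at x)"
    proof (rule has_derivative_transform_within_open[of "\<lambda>x. 0"])
      show "open (- cball (0::'a) R0)" by auto
    qed (use x z in auto)
    then show "frechet_derivative \<phi> (at x) b = 0"
      by (metis frechet_derivative_at)
  qed (use R0 z in auto)
qed

lemma continuous_support_bounded:
  fixes f :: "'a::euclidean_space \<Rightarrow> real"
  assumes "continuous_on UNIV f" "\<And>x. norm x \<ge> R \<Longrightarrow> f x = 0"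
  obtains B where "B > 0" "\<And>x. \<bar>f x\<bar> \<le> B"
proof -
  have "compact (f ` cball 0 R)" using assms(1) by (intro compact_continuous_image) (auto intro: continuous_on_subset)
  then obtain B where B: "B > 0" "\<And>x. x \<in> cball 0 R \<Longrightarrow> \<bar>f x\<bar> \<le> B"
    by (metis (no_types, lifting) bounded_pos compact_imp_bounded image_eqI real_norm_def)
  show thesis by (rule that[of B]) (use B assms(2) in \<open>auto, smt (verit)\<close>)
qed

lemma test_bounded:
  assumes "\<phi> \<in> test_functions"
  obtains B where "B > 0" "\<And>x. \<bar>\<phi> x\<bar> \<le> B" "\<And>x b. b \<in> Basis \<Longrightarrow> \<bar>frechet_derivative \<phi> (at x) b\<bar> \<le> B"
proof -
  obtain R where R: "R > 0" "\<And>x. norm x \<ge> R \<Longrightarrow> \<phi> x = 0"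
    "\<And>x b. norm x \<ge> R \<Longrightarrow> frechet_derivative \<phi> (at x) b = 0" using test_support[OF assms] by blast
  obtain B0 where B0: "B0 > 0" "\<And>x. \<bar>\<phi> x\<bar> \<le> B0"
    using continuous_support_bounded[OF test_continuous[OF assms] R(2)] by blast
  have "\<forall>b\<in>Basis. \<exists>B>0. \<forall>x. \<bar>frechet_derivative \<phi> (at x) b\<bar> \<le> B"
    using continuous_support_bounded[OF test_deriv_continuous[OF assms] R(3)] by metis
  then obtain B where B: "\<And>b. b\<in>Basis \<Longrightarrow> B b > 0 \<and> (\<forall>x. \<bar>frechet_derivative \<phi> (at x) b\<bar> \<le> B b)"
    by metis
  show thesis
  proof (rule that[of "B0 + (\<Sum>b\<in>Basis. B b)"])
    have nn: "(\<Sum>b\<in>Basis. B b) \<ge> 0" using B by (intro sum_nonneg) (auto simp: less_imp_le)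
    show "B0 + (\<Sum>b\<in>Basis. B b) > 0" "\<And>x. \<bar>\<phi> x\<bar> \<le> B0 + (\<Sum>b\<in>Basis. B b)"
      using B0 nn by (auto simp: add_increasing2)
    fix x b assume b: "b \<in> (Basis::'a set)"
    have "B b \<le> (\<Sum>b\<in>Basis. B b)" using B b by (intro member_le_sum) (auto simp: less_imp_le)
    then show "\<bar>frechet_derivative \<phi> (at x) b\<bar> \<le> B0 + (\<Sum>b\<in>Basis. B b)" using conjunct2[OF B[OF b], rule_format, of x] B0(1) by linarith
  qed
qed

lemma test_mult_smooth:
  assumes "\<phi> \<in> test_functions" "\<And>k. Ck k \<eta>"
  shows "(\<lambda>x. \<eta> x * \<phi> x) \<in> test_functions"
proof -
  have "closure {x. \<eta> x * \<phi> x \<noteq> 0} \<subseteq> closure {x. \<phi> x \<noteq> 0}" by (rule closure_mono) auto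
  moreover have "compact (closure {x. \<phi> x \<noteq> 0})" using assms by (auto simp: test_functions_def)
  ultimately have "compact (closure {x. \<eta> x * \<phi> x \<noteq> 0})"
    using compact_closure bounded_subset compact_imp_bounded closure_subset by metis
  then show ?thesis using assms by (auto simp: test_functions_def intro: Ck_mult)
qed

lemma test_functionI:
  assumes "\<phi> \<in> smooth_terms" "\<And>x. norm x \<ge> R \<Longrightarrow> \<phi> x = 0"
  shows "\<phi> \<in> test_functions"
proof -
  have "{x. \<phi> x \<noteq> 0} \<subseteq> cball 0 R" using assms(2) by (auto, smt (verit))
  then have "bounded {x. \<phi> x \<noteq> 0}" using bounded_cball bounded_subset by blast
  then show ?thesis using assms(1) smooth_terms_Ck by (auto simp: test_functions_def)
qed

section \<open>Locally integrable functions\<close>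

lemma compact_lebesgue: "compact K \<Longrightarrow> K \<in> sets lebesgue"
  by (simp add: borel_compact)

lemma locally_integrable_cball:
  "locally_integrable f \<Longrightarrow> set_integrable lebesgue (cball 0 R) f"
  by (auto simp: locally_integrable_def)

lemma locally_integrableI:
  fixes f :: "'a::euclidean_space \<Rightarrow> 'b::{banach, second_countable_topology}"
  assumes "\<And>n::nat. set_integrable lebesgue (cball 0 (real n)) f"
  shows "locally_integrable f"
  unfolding locally_integrable_def
proof (intro allI impI)
  fix K :: "'a set" assume K: "compact K"
  then obtain R where R: "\<And>x. x \<in> K \<Longrightarrow> norm x \<le> R" by (meson bounded_iff compact_imp_bounded)
  obtain n where "R \<le> real n" using real_arch_simple by blast
  then have "K \<subseteq> cball 0 (real n)" using R by force
  then show "set_integrable lebesgue K f"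
    using assms[of n] K by (rule_tac set_integrable_subset[of _ "cball 0 (real n)"]) (auto intro: compact_lebesgue)
qed

lemma locally_integrable_measurable:
  fixes f :: "'a::euclidean_space \<Rightarrow> 'b::{banach, second_countable_topology}"
  assumes "locally_integrable f" shows "f \<in> borel_measurable lebesgue"
proof -
  have m: "(\<lambda>x. indicator (cball 0 (real n)) x *\<^sub>R f x) \<in> borel_measurable lebesgue" for n :: nat
    using locally_integrable_cball[OF assms, of n] unfolding set_integrable_def by auto
  have "(\<lambda>n. indicator (cball 0 (real n)) x *\<^sub>R f x) \<longlonglongrightarrow> f x" for x
  proof (rule tendsto_eventually)
    obtain N where "norm x \<le> real N" using real_arch_simple by blast
    then show "\<forall>\<^sub>F n in sequentially. indicator (cball 0 (real n)) x *\<^sub>R f x = f x"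
      by (intro eventually_sequentiallyI[of N]) (auto simp: indicator_def)
  qed
  then show ?thesis by (rule borel_measurable_LIMSEQ_metric[OF m])
qed

lemma locally_integrable_bound:
  fixes f :: "'a::euclidean_space \<Rightarrow> 'b::{banach, second_countable_topology}"
    and g :: "'a \<Rightarrow> 'c::{banach, second_countable_topology}"
  assumes "locally_integrable f" "g \<in> borel_measurable lebesgue" "AE x in lebesgue. norm (g x) \<le> norm (f x)"
  shows "locally_integrable g"
  unfolding locally_integrable_def set_integrable_def
proof (intro allI impI)
  fix K :: "'a set" assume K: "compact K"
  show "integrable lebesgue (\<lambda>x. indicat_real K x *\<^sub>R g x)"
  proof (rule Bochner_Integration.integrable_bound)
    show "integrable lebesgue (\<lambda>x. indicat_real K x *\<^sub>R f x)"
      using assms(1) K by (auto simp: locally_integrable_def set_integrable_def)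
    show "(\<lambda>x. indicat_real K x *\<^sub>R g x) \<in> borel_measurable lebesgue"
      using K assms(2) by (auto intro!: borel_measurable_scaleR borel_measurable_indicator intro: compact_lebesgue)
    show "AE x in lebesgue. norm (indicat_real K x *\<^sub>R g x) \<le> norm (indicat_real K x *\<^sub>R f x)"
      using assms(3) by eventually_elim (auto simp: indicator_def)
  qed
qed

lemma locally_integrable_add:
  "locally_integrable f \<Longrightarrow> locally_integrable g \<Longrightarrow> locally_integrable (\<lambda>x. f x + g x)"
  by (auto simp: locally_integrable_def)

lemma locally_integrable_scaleR:
  "locally_integrable f \<Longrightarrow> locally_integrable (\<lambda>x. c *\<^sub>R f x)"
  by (auto simp: locally_integrable_def set_integrable_scaleR_right)

lemma locally_integrable_continuous_mult:
  fixes f :: "'a::euclidean_space \<Rightarrow> real"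
  assumes "locally_integrable f" "continuous_on UNIV \<phi>" "\<And>x. norm x \<ge> R \<Longrightarrow> \<phi> x = 0"
  shows "integrable lebesgue (\<lambda>x. f x * \<phi> x)"
proof -
  obtain B where B: "B > 0" "\<And>x. \<bar>\<phi> x\<bar> \<le> B" using continuous_support_bounded[OF assms(2,3)] by blast
  have m: "\<phi> \<in> borel_measurable lebesgue"
    using assms(2) by (simp add: borel_measurable_continuous_onI measurable_completion)
  show ?thesis
  proof (rule Bochner_Integration.integrable_bound)
    show "integrable lebesgue (\<lambda>x. B * (indicat_real (cball 0 R) x *\<^sub>R f x))"
      using locally_integrable_cball[OF assms(1), of R] by (auto simp: set_integrable_def)
    show "(\<lambda>x. f x * \<phi> x) \<in> borel_measurable lebesgue"
      using m locally_integrable_measurable[OF assms(1)] by auto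
    show "AE x in lebesgue. norm (f x * \<phi> x) \<le> norm (B * (indicat_real (cball 0 R) x *\<^sub>R f x))"
      using B assms(3) by (intro AE_I2) (auto simp: indicator_def abs_mult intro!: mult_left_mono mult_mono
        simp: mult.commute[of B])
  qed
qed

lemma integrable_locally_integrable: "integrable lebesgue f \<Longrightarrow> locally_integrable f"
  by (auto simp: locally_integrable_def set_integrable_def intro!: integrable_mult_indicator intro: compact_lebesgue)

lemma locally_integrable_inner:
  fixes G :: "'a::euclidean_space \<Rightarrow> 'a"
  shows "locally_integrable G \<Longrightarrow> locally_integrable (\<lambda>x. G x \<bullet> b)"
  unfolding locally_integrable_def set_integrable_def
  using integrable_inner_left[of b] by fastforce

section \<open>The fundamental lemma of the calculus of variations\<close>

lemma integrable_box_integrals_zero: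
  fixes f :: "'a::euclidean_space \<Rightarrow> real"
  assumes f: "integrable lebesgue f" and z: "\<And>a b. (\<integral>x. f x * indicator (box a b) x \<partial>lebesgue) = 0"
  shows "AE x in lebesgue. f x = 0"
proof -
  obtain F where F [measurable]: "F \<in> borel_measurable lborel" and fF: "AE x in lborel. f x = F x"
    using completion_ex_borel_measurable_real[of f lborel] f by auto
  have fF': "AE x in lebesgue. f x = F x" using fF by (rule AE_completion)
  have F_int: "integrable lborel F"
    using integrable_cong_AE_imp[OF f, of F] fF' by (simp add: integrable_completion measurable_completion)
  \<comment> \<open>The positive and negative parts of a Borel representative become densities of
    two finite measures. The measures agree on open boxes, which are stable under intersection and
    generate the Borel sets; hence they are equal, and densities of equal finite measures agree
    a.e.\<close>
  define P N where "P = (\<lambda>x. ennreal (F x))" and "N = (\<lambda>x. ennreal (- F x))"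
  have [measurable]: "P \<in> borel_measurable lborel" "N \<in> borel_measurable lborel" by (auto simp: P_def N_def)
  have fin: "(\<integral>\<^sup>+x. P x \<partial>lborel) \<noteq> \<infinity>" "(\<integral>\<^sup>+x. N x \<partial>lborel) \<noteq> \<infinity>"
    using F_int by (auto simp: P_def N_def real_integrable_def)
  have box: "emeasure (density lborel P) (box a b) = emeasure (density lborel N) (box a b)" for a b
  proof -
    have i: "integrable lborel (\<lambda>x. F x * indicator (box a b) x)"
      using F_int by (simp add: integrable_real_mult_indicator)
    have "(\<integral>x. F x * indicator (box a b) x \<partial>lebesgue) = 0"
      unfolding z[of a b, symmetric]
    proof (rule integral_cong_AE)
      show "(\<lambda>x. F x * indicator (box a b) x) \<in> borel_measurable lebesgue"
        by (rule measurable_completion) simp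
      show "(\<lambda>x. f x * indicator (box a b) x) \<in> borel_measurable lebesgue"
        using f by (intro borel_measurable_times borel_measurable_indicator) (auto simp: borel_measurable_integrable)
      show "AE x in lebesgue. F x * indicator (box a b) x = f x * indicator (box a b) x"
        using fF' by eventually_elim simp
    qed
    then have "(\<integral>x. F x * indicator (box a b) x \<partial>lborel) = 0" by (simp add: integral_completion)
    then have "enn2real (\<integral>\<^sup>+x. ennreal (F x * indicator (box a b) x) \<partial>lborel) =
      enn2real (\<integral>\<^sup>+x. ennreal (- (F x * indicator (box a b) x)) \<partial>lborel)"
      using real_lebesgue_integral_def[OF i] by simp
    moreover have "(\<integral>\<^sup>+x. ennreal (F x * indicator (box a b) x) \<partial>lborel) < top"
      "(\<integral>\<^sup>+x. ennreal (- (F x * indicator (box a b) x)) \<partial>lborel) < top"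
      using i by (auto simp: real_integrable_def less_top)
    ultimately have "(\<integral>\<^sup>+x. ennreal (F x * indicator (box a b) x) \<partial>lborel) =
      (\<integral>\<^sup>+x. ennreal (- (F x * indicator (box a b) x)) \<partial>lborel)"
      by (metis ennreal_enn2real)
    moreover have "ennreal (F x * indicator (box a b) x) = P x * indicator (box a b) x"
      "ennreal (- (F x * indicator (box a b) x)) = N x * indicator (box a b) x" for x
      by (auto simp: P_def N_def indicator_def)
    ultimately show ?thesis by (simp add: emeasure_density)
  qed
  have "density lborel P = density lborel N"
  proof (rule measure_eqI_generator_eq)
    let ?E = "range (\<lambda>(a, b). box a b::'a set)"
    show "Int_stable ?E"
      by (auto simp: Int_stable_def box_Int_box)
    show "?E \<subseteq> Pow UNIV" "sets (density lborel P) = sigma_sets UNIV ?E" "sets (density lborel N) = sigma_sets UNIV ?E"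
      by (simp_all add: borel_eq_box)
    let ?A = "\<lambda>n::nat. box (- (real n *\<^sub>R One)) (real n *\<^sub>R One) :: 'a set"
    show "range ?A \<subseteq> ?E" "(\<Union>i. ?A i) = UNIV"
      unfolding UN_box_eq_UNIV by auto
    have "emeasure (density lborel P) (?A i) \<le> emeasure (density lborel P) UNIV" for i
      by (rule emeasure_mono) auto
    moreover have "emeasure (density lborel P) UNIV = (\<integral>\<^sup>+x. P x \<partial>lborel)"
      by (simp add: emeasure_density)
    ultimately show "emeasure (density lborel P) (?A i) \<noteq> \<infinity>" for i
      using fin(1) by (metis infinity_ennreal_def neq_top_trans)
    show "emeasure (density lborel P) X = emeasure (density lborel N) X" if "X \<in> ?E" for X
      using that box by auto
  qed
  then have "AE x in lborel. P x = N x"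
    using fin by (intro finite_density_unique[THEN iffD1]) auto
  then have "AE x in lebesgue. P x = N x" by (rule AE_completion)
  then show ?thesis using fF'
  proof eventually_elim
    case (elim x)
    then show ?case by (cases "F x \<ge> 0") (auto simp: P_def N_def ennreal_neg ennreal_eq_0_iff)
  qed
qed

lemma fundamental_lemma:
  fixes f :: "'a::euclidean_space \<Rightarrow> real"
  assumes f: "locally_integrable f"
    and z: "\<And>\<phi>. \<phi> \<in> test_functions \<Longrightarrow> (\<integral>x. f x * \<phi> x \<partial>lebesgue) = 0"
  shows "AE x in lebesgue. f x = 0"
proof -
  have box: "(\<integral>x. f x * indicator (box a b) x \<partial>lebesgue) = 0" for a b
  proof -
    \<comment> \<open>Smooth and positive exactly on the open box: each factor vanishes beyond one
      of the hyperplanes that bound it.\<close>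
    define \<beta> where "\<beta> = (\<lambda>x::'a. \<Prod>i\<in>Basis. flat 0 ((x - a) \<bullet> i) * flat 0 ((b - x) \<bullet> i))"
    have \<beta>: "\<beta> \<in> smooth_terms"
    proof -
      have eq: "(\<lambda>x. (x - a) \<bullet> i) = (\<lambda>x. x \<bullet> i + (- a \<bullet> i))" "(\<lambda>x. (b - x) \<bullet> i) = (\<lambda>x. x \<bullet> (- i) + (b \<bullet> i))" for i
        by (auto simp: inner_diff_left)
      have "(\<lambda>x. (x - a) \<bullet> i) \<in> smooth_terms" "(\<lambda>x. (b - x) \<bullet> i) \<in> smooth_terms" for i
        unfolding eq by (rule smooth_terms.intros)+
      then show ?thesis unfolding \<beta>_def
        by (intro smooth_terms_prod smooth_terms.mult smooth_terms.flat)
    qed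
    have pos: "\<beta> x > 0" if "x \<in> box a b" for x
      unfolding \<beta>_def using that by (intro prod_pos) (auto simp: flat_def box_def inner_diff_left)
    have zero: "\<beta> x = 0" if x: "x \<notin> box a b" for x
    proof -
      obtain i where "i \<in> Basis" "\<not> (a \<bullet> i < x \<bullet> i \<and> x \<bullet> i < b \<bullet> i)" using x by (auto simp: box_def)
      then have "flat 0 ((x - a) \<bullet> i) * flat 0 ((b - x) \<bullet> i) = 0" by (auto simp: flat_def inner_diff_left)
      then show ?thesis unfolding \<beta>_def using \<open>i \<in> Basis\<close> by (intro prod_zero) auto
    qed
    have nn: "\<beta> x \<ge> 0" for x using pos[of x] zero[of x] by force
    \<comment> \<open>As \<open>k\<close> grows these functions tend pointwise to the indicator of
      the box, since \<beta> is positive inside and zero outside; they stay between 0 and 1.\<close>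
    define \<phi> where "\<phi> = (\<lambda>(k::nat) x. 1 - exp (- real k * \<beta> x))"
    obtain R where R: "R > 0" "box a b \<subseteq> ball 0 R"
      using bounded_subset_ballD[OF bounded_box] by blast
    have test: "\<phi> k \<in> test_functions" for k
    proof (rule test_functionI[where R = R])
      have "(\<lambda>x. 1 + (-1) * exp ((- real k) * \<beta> x)) \<in> smooth_terms" using \<beta> by (intro smooth_terms.intros)
      then show "\<phi> k \<in> smooth_terms" by (simp add: \<phi>_def)
      show "\<phi> k x = 0" if "norm x \<ge> R" for x
        using R that zero[of x] by (force simp: \<phi>_def)
    qed
    have "(\<lambda>k. \<integral>x. f x * \<phi> k x \<partial>lebesgue) \<longlonglongrightarrow> (\<integral>x. f x * indicator (box a b) x \<partial>lebesgue)"
    proof (rule integral_dominated_convergence)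
      show "(\<lambda>x. f x * indicat_real (box a b) x) \<in> borel_measurable lebesgue"
        using locally_integrable_measurable[OF f] by (intro borel_measurable_times borel_measurable_indicator) auto
      show "(\<lambda>x. f x * \<phi> k x) \<in> borel_measurable lebesgue" for k
        using locally_integrable_measurable[OF f] test_continuous[OF test[of k]]
        by (intro borel_measurable_times) (simp_all add: borel_measurable_continuous_onI measurable_completion)
      show "integrable lebesgue (\<lambda>x. \<bar>indicator (cball 0 R) x *\<^sub>R f x\<bar>)"
        using locally_integrable_cball[OF f, of R] unfolding set_integrable_def by (rule integrable_abs)
      show "AE x in lebesgue. norm (f x * \<phi> k x) \<le> \<bar>indicat_real (cball 0 R) x *\<^sub>R f x\<bar>" for k
      proof (rule AE_I2)
        fix x
        have "\<bar>\<phi> k x\<bar> \<le> 1" using nn[of x] by (auto simp: \<phi>_def)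
        moreover have "\<phi> k x = 0" if "x \<notin> cball 0 R" using that R zero[of x] by (force simp: \<phi>_def)
        ultimately show "norm (f x * \<phi> k x) \<le> \<bar>indicat_real (cball 0 R) x *\<^sub>R f x\<bar>"
          by (auto simp: indicator_def abs_mult mult_left_le)
      qed
      show "AE x in lebesgue. (\<lambda>k. f x * \<phi> k x) \<longlonglongrightarrow> f x * indicat_real (box a b) x"
      proof (rule AE_I2, rule tendsto_mult_left)
        fix x
        show "(\<lambda>k. \<phi> k x) \<longlonglongrightarrow> indicat_real (box a b) x"
        proof (cases "x \<in> box a b")
          case True
          have "(\<lambda>k. exp (- \<beta> x) ^ k) \<longlonglongrightarrow> 0"
            by (rule LIMSEQ_power_zero) (use pos[OF True] in simp)
          then have "(\<lambda>k. 1 - exp (- \<beta> x) ^ k) \<longlonglongrightarrow> 1 - 0" by (intro tendsto_diff tendsto_const)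
          moreover have "exp (- \<beta> x) ^ k = exp (- real k * \<beta> x)" for k
            by (simp flip: exp_of_nat_mult)
          ultimately show ?thesis using True by (simp add: \<phi>_def)
        qed (simp add: \<phi>_def zero)
      qed
    qed
    then have "(\<lambda>k::nat. 0::real) \<longlonglongrightarrow> (\<integral>x. f x * indicator (box a b) x \<partial>lebesgue)" using z[OF test] by simp
    then show ?thesis by (simp add: LIMSEQ_const_iff)
  qed
  \<comment> \<open>Local integrability is reduced to integrability by cutting off on cubes that
    exhaust the space. The product of two box indicators is again a box indicator, so the hypothesis
    on boxes survives the cut-off.\<close>
  have "AE x in lebesgue. f x * indicator (box (- (real n *\<^sub>R One)) (real n *\<^sub>R One)) x = 0" for n
  proof (rule integrable_box_integrals_zero)
    let ?B = "box (- (real n *\<^sub>R One)) (real n *\<^sub>R One) :: 'a set"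
    obtain R where R: "?B \<subseteq> ball 0 R"
      using bounded_subset_ballD[OF bounded_box] by blast
    have "set_integrable lebesgue ?B f"
      by (rule set_integrable_subset[OF locally_integrable_cball[OF f, of R]]) (use R in auto)
    then show "integrable lebesgue (\<lambda>x. f x * indicat_real ?B x)" by (simp add: set_integrable_def mult.commute)
    show "(\<integral>x. f x * indicat_real ?B x * indicat_real (box a b) x \<partial>lebesgue) = 0" for a b
      using box by (simp add: mult.assoc box_Int_box flip: indicator_inter_arith)
  qed
  then have "AE x in lebesgue. \<forall>n::nat. f x * indicator (box (- (real n *\<^sub>R One)) (real n *\<^sub>R One)) x = 0"
    unfolding AE_all_countable by blast
  then show ?thesis
  proof eventually_elim
    case (elim x)
    obtain n :: nat where "x \<in> box (- (real n *\<^sub>R One)) (real n *\<^sub>R One)" using UN_box_eq_UNIV by blast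
    then show ?case using elim by (metis indicator_simps(1) mult_cancel_left1 mult.right_neutral)
  qed
qed

section \<open>Translations\<close>

lemma cball_lebesgue [simp]: "cball a r \<in> sets lebesgue" by simp

lemma
  fixes c :: "'a::euclidean_space"
  shows lebesgue_translation_measurable: "(\<lambda>x. x + c) \<in> lebesgue \<rightarrow>\<^sub>M lebesgue"
    and lebesgue_distr_translation: "distr lebesgue lebesgue (\<lambda>x. x + c) = lebesgue"
proof -
  have eq: "(\<lambda>x. c + (\<Sum>j\<in>Basis. (1 * (x \<bullet> j)) *\<^sub>R j)) = (\<lambda>x::'a. x + c)"
    by (simp add: euclidean_representation add.commute)
  show "(\<lambda>x. x + c) \<in> lebesgue \<rightarrow>\<^sub>M lebesgue"
    using lebesgue_affine_measurable[of "\<lambda>_. 1" c] unfolding eq by simp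
  show "distr lebesgue lebesgue (\<lambda>x. x + c) = lebesgue"
    using lebesgue_affine_euclidean[of "\<lambda>_. 1" c] unfolding eq by (simp add: density_1)
qed

lemma measurable_translate:
  fixes f :: "'a::euclidean_space \<Rightarrow> 'b::topological_space"
  shows "f \<in> borel_measurable lebesgue \<Longrightarrow> (\<lambda>x. f (x + c)) \<in> borel_measurable lebesgue"
  by (rule measurable_compose[OF lebesgue_translation_measurable])

lemma nn_integral_translate:
  fixes f :: "'a::euclidean_space \<Rightarrow> ennreal"
  assumes "f \<in> borel_measurable lebesgue"
  shows "(\<integral>\<^sup>+x. f (x + c) \<partial>lebesgue) = (\<integral>\<^sup>+x. f x \<partial>lebesgue)"
  using nn_integral_distr[OF lebesgue_translation_measurable, of f c] assms
  by (simp add: lebesgue_distr_translation)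

lemma integral_translate:
  fixes f :: "'a::euclidean_space \<Rightarrow> real"
  assumes "f \<in> borel_measurable lebesgue"
  shows "(\<integral>x. f (x + c) \<partial>lebesgue) = (\<integral>x. f x \<partial>lebesgue)"
  using integral_distr[OF lebesgue_translation_measurable assms, of c]
  by (simp add: lebesgue_distr_translation)

lemma integrable_translate:
  fixes f :: "'a::euclidean_space \<Rightarrow> real"
  assumes "integrable lebesgue f"
  shows "integrable lebesgue (\<lambda>x. f (x + c))"
  using integrable_distr[OF lebesgue_translation_measurable, of c f] assms
  by (simp add: lebesgue_distr_translation)

lemma AE_translate:
  fixes P :: "'a::euclidean_space \<Rightarrow> bool"
  assumes "AE x in lebesgue. P x"
  shows "AE x in lebesgue. P (x + c)"
proof -
  obtain N where N: "N \<in> null_sets lebesgue" "{x \<in> space lebesgue. \<not> P x} \<subseteq> N" using assms by (auto simp: eventually_ae_filter)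
  have "(\<lambda>x. x + c) -` N \<inter> space lebesgue \<in> null_sets lebesgue"
  proof -
    have "emeasure lebesgue ((\<lambda>x. x + c) -` N \<inter> space lebesgue) = emeasure (distr lebesgue lebesgue (\<lambda>x. x + c)) N"
      using N by (subst emeasure_distr[OF lebesgue_translation_measurable]) auto
    moreover have "(\<lambda>x. x + c) -` N \<inter> space lebesgue \<in> sets lebesgue"
      using N by (intro measurable_sets[OF lebesgue_translation_measurable]) auto
    ultimately show ?thesis using N by (auto simp: lebesgue_distr_translation null_sets_def)
  qed
  then show ?thesis by (rule AE_I') (use N in auto)
qed

lemma locally_integrable_translate:
  fixes f :: "'a::euclidean_space \<Rightarrow> real"
  assumes "locally_integrable f" shows "locally_integrable (\<lambda>x. f (x + c))"
proof (rule locally_integrableI)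
  fix n :: nat
  have "integrable lebesgue (\<lambda>x. indicator (cball 0 (real n + norm c)) x * f x)"
    using locally_integrable_cball[OF assms, of "real n + norm c"] by (simp add: set_integrable_def)
  from integrable_translate[OF this, of c]
  have i: "integrable lebesgue (\<lambda>x. indicator (cball 0 (real n + norm c)) (x + c) * f (x + c))" .
  show "set_integrable lebesgue (cball 0 (real n)) (\<lambda>x. f (x + c))"
    unfolding set_integrable_def
  proof (rule Bochner_Integration.integrable_bound[OF i])
    show "(\<lambda>x. indicat_real (cball 0 (real n)) x *\<^sub>R f (x + c)) \<in> borel_measurable lebesgue"
      using measurable_translate[OF locally_integrable_measurable[OF assms]]
      by (intro borel_measurable_scaleR borel_measurable_indicator) auto
    show "AE x in lebesgue. norm (indicat_real (cball 0 (real n)) x *\<^sub>R f (x + c))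
         \<le> norm (indicat_real (cball 0 (real n + norm c)) (x + c) * f (x + c))"
    proof (rule AE_I2)
      fix x
      have "norm (x + c) \<le> norm x + norm c" by (rule norm_triangle_ineq)
      then show "norm (indicat_real (cball 0 (real n)) x *\<^sub>R f (x + c))
         \<le> norm (indicat_real (cball 0 (real n + norm c)) (x + c) * f (x + c))"
        by (auto simp: indicator_def)
    qed
  qed
qed

section \<open>Local \<open>L^1\<close> seminorms and continuity of translations\<close>

lemma integrable_cball:
  fixes f :: "'a::euclidean_space \<Rightarrow> real"
  assumes "locally_integrable f"
  shows "integrable lebesgue (\<lambda>x. f x * indicator (cball 0 R) x)"
  using locally_integrable_cball[OF assms, of R] by (simp add: set_integrable_def mult.commute)

lemma locally_integrable_abs:
  fixes f :: "'a::euclidean_space \<Rightarrow> real"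
  shows "locally_integrable f \<Longrightarrow> locally_integrable (\<lambda>x. \<bar>f x\<bar>)"
  by (rule locally_integrable_bound) (auto dest: locally_integrable_measurable intro!: borel_measurable_abs)

lemma locally_integrable_diff:
  fixes f g :: "'a::euclidean_space \<Rightarrow> real"
  shows "locally_integrable f \<Longrightarrow> locally_integrable g \<Longrightarrow> locally_integrable (\<lambda>x. f x - g x)"
  using locally_integrable_add[of f "\<lambda>x. (-1) *\<^sub>R g x"] locally_integrable_scaleR[of g "-1"] by simp

lemma locally_integrable_cmult:
  fixes f :: "'a::euclidean_space \<Rightarrow> real"
  shows "locally_integrable f \<Longrightarrow> locally_integrable (\<lambda>x. c * f x)"
  using locally_integrable_scaleR[of f c] by simp

text \<open>The seminorms of local \<open>L^1\<close> convergence. Balls are used instead of the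
  whole space because weak derivatives are only assumed to be locally integrable.\<close>

abbreviation L1c :: "real \<Rightarrow> ('a::euclidean_space \<Rightarrow> real) \<Rightarrow> real" where
  "L1c R f \<equiv> \<integral>x. \<bar>f x\<bar> * indicator (cball 0 R) x \<partial>lebesgue"

lemma L1c_integrable:
  fixes f :: "'a::euclidean_space \<Rightarrow> real"
  shows "locally_integrable f \<Longrightarrow> integrable lebesgue (\<lambda>x. \<bar>f x\<bar> * indicator (cball 0 R) x)"
  by (rule integrable_cball[OF locally_integrable_abs])

lemma L1c_triangle:
  fixes f g :: "'a::euclidean_space \<Rightarrow> real"
  assumes "locally_integrable f" "locally_integrable g"
  shows "L1c R (\<lambda>x. f x + g x) \<le> L1c R f + L1c R g"
proof -
  have "L1c R (\<lambda>x. f x + g x) \<le> (\<integral>x. \<bar>f x\<bar> * indicator (cball 0 R) x + \<bar>g x\<bar> * indicator (cball 0 R) x \<partial>lebesgue)"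
    by (intro integral_mono Bochner_Integration.integrable_add L1c_integrable locally_integrable_add assms)
       (auto simp: indicator_def)
  then show ?thesis using assms by (simp add: L1c_integrable)
qed

text \<open>Induction on integrable functions: indicators by regularity of Lebesgue measure, sums by
  the triangle inequality, limits by dominated convergence. The restriction to a ball makes the set
  of the base case bounded, so that its closed inner approximation is compact and keeps a positive
  distance from the complement of its open outer approximation.\<close>

lemma translation_continuous_integrable:
  fixes f :: "'a::euclidean_space \<Rightarrow> real"
  assumes "integrable lebesgue f"
  shows "\<forall>R. \<forall>\<epsilon>>0. \<exists>\<delta>>0. \<forall>z. norm z < \<delta> \<longrightarrow> L1c R (\<lambda>x. f (x + z) - f x) \<le> \<epsilon>"
  using assms
proof (induction rule: integrable_induct)
  case (base A c)
  show ?case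
  proof (intro allI impI)
    fix R \<epsilon> :: real assume "\<epsilon> > 0"
    define A' where "A' = A \<inter> cball 0 (R + 1)"
    \<comment> \<open>The final bound is 2|c| times the measure of \<open>D\<close>, which is at
      most 2\<open>e\<close>; the summand 1 covers the case c = 0.\<close>
    define e where "e = \<epsilon> / (4 * (\<bar>c\<bar> + 1))"
    have e: "e > 0" using \<open>\<epsilon> > 0\<close> by (simp add: e_def)
    have A': "A' \<in> sets lebesgue" unfolding A'_def using base(1) by auto
    obtain K where K: "closed K" "K \<subseteq> A'" "A' - K \<in> lmeasurable" "emeasure lebesgue (A' - K) < ennreal e"
      using sets_lebesgue_inner_closed[OF A' e] by blast
    obtain U where U: "open U" "A' \<subseteq> U" "U - A' \<in> lmeasurable" "emeasure lebesgue (U - A') < ennreal e"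
      using sets_lebesgue_outer_open[OF A' e] by blast
    have "compact K" using K by (auto simp: compact_eq_bounded_closed A'_def intro: bounded_subset[OF bounded_cball])
    then obtain d where d: "d > 0" "(\<Union>x\<in>K. ball x d) \<subseteq> U"
      using compact_subset_open_imp_ball_epsilon_subset[of K U] K U by blast
    define D where "D = (A' - K) \<union> (U - A')"
    have D: "D \<in> lmeasurable" unfolding D_def using K U by (intro fmeasurable.Un)
    have "measure lebesgue D \<le> measure lebesgue (A' - K) + measure lebesgue (U - A')"
      unfolding D_def using K U by (intro measure_Un_le) auto
    also have "\<dots> \<le> e + e"
      using K(3,4) U(3,4) e by (intro add_mono) (auto simp: emeasure_eq_measure2 ennreal_less_iff intro: less_imp_le)
    finally have mD: "measure lebesgue D \<le> 2 * e" by simp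
    have iD: "integrable lebesgue (indicat_real D)" using D by (intro integrable_real_indicator) (auto simp: fmeasurable_def)
    \<comment> \<open>Suppose exactly one of \<open>x\<close> and \<open>x + z\<close> lies in
      \<open>A'\<close> and neither in \<open>D\<close>. The one in \<open>A'\<close> then lies in
      \<open>K\<close>, so the other, at distance less than \<open>d\<close>, lies in
      \<open>U\<close> but not in \<open>A'\<close>, which puts it into \<open>D\<close> after
      all.\<close>
    have key: "\<bar>indicat_real A (x + z) *\<^sub>R c - indicat_real A x *\<^sub>R c\<bar> * indicator (cball 0 R) x
          \<le> \<bar>c\<bar> * indicat_real D (x + z) + \<bar>c\<bar> * indicat_real D x" if z: "norm z < min d 1" for x z
    proof (cases "x \<in> cball 0 R \<and> (x + z \<in> A) \<noteq> (x \<in> A)")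
      case True
      have "norm (x + z) \<le> R + 1" using True z norm_triangle_ineq[of x z] by auto
      then have "(x + z \<in> A') \<noteq> (x \<in> A')" using True by (auto simp: A'_def)
      moreover have "x + z \<in> U" if "x \<in> K"
      proof -
        have "x + z \<in> ball x d" using z by (simp add: dist_norm)
        then show ?thesis using d(2) that by blast
      qed
      moreover have "x \<in> U" if "x + z \<in> K"
      proof -
        have "x \<in> ball (x + z) d" using z by (simp add: dist_norm)
        then show ?thesis using d(2) that by blast
      qed
      ultimately have "x \<in> D \<or> x + z \<in> D" unfolding D_def by blast
      then show ?thesis by (auto simp: indicator_def)
    qed (auto simp: indicator_def)
    show "\<exists>\<delta>>0. \<forall>z. norm z < \<delta> \<longrightarrow> L1c R (\<lambda>x. indicat_real A (x + z) *\<^sub>R c - indicat_real A x *\<^sub>R c) \<le> \<epsilon>"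
    proof (intro exI conjI allI impI)
      show "min d 1 > 0" using d by simp
      fix z :: 'a assume z: "norm z < min d 1"
      have int: "integrable lebesgue (\<lambda>x. \<bar>c\<bar> * indicat_real D (x + z))" "integrable lebesgue (\<lambda>x. \<bar>c\<bar> * indicat_real D x)"
        using integrable_translate[OF iD, of z] iD by auto
      have "L1c R (\<lambda>x. indicat_real A (x + z) *\<^sub>R c - indicat_real A x *\<^sub>R c) \<le>
        (\<integral>x. \<bar>c\<bar> * indicat_real D (x + z) + \<bar>c\<bar> * indicat_real D x \<partial>lebesgue)"
        using int by (intro Bochner_Integration.integral_mono' Bochner_Integration.integrable_add key z) auto
      also have "\<dots> = \<bar>c\<bar> * measure lebesgue D + \<bar>c\<bar> * measure lebesgue D"
        using int D integral_translate[of "indicat_real D" z] by (simp add: fmeasurableD)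
      also have "\<dots> \<le> (\<bar>c\<bar> + 1) * (2 * e) + (\<bar>c\<bar> + 1) * (2 * e)"
        using mD by (intro add_mono mult_mono) auto
      also have "\<dots> = 4 * (\<bar>c\<bar> + 1) * e" by (simp add: algebra_simps)
      also have "\<dots> = \<epsilon>" by (simp add: e_def)
      finally show "L1c R (\<lambda>x. indicat_real A (x + z) *\<^sub>R c - indicat_real A x *\<^sub>R c) \<le> \<epsilon>" .
    qed
  qed
next
  case (add f g)
  show ?case
  proof (intro allI impI)
    fix R \<epsilon> :: real assume "\<epsilon> > 0"
    then have "\<epsilon>/2 > 0" by simp
    obtain d1 where d1: "d1 > 0" "\<And>z. norm z < d1 \<Longrightarrow> L1c R (\<lambda>x. f (x + z) - f x) \<le> \<epsilon>/2"
      using add.IH(1)[rule_format, OF \<open>\<epsilon>/2 > 0\<close>, of R] by blast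
    obtain d2 where d2: "d2 > 0" "\<And>z. norm z < d2 \<Longrightarrow> L1c R (\<lambda>x. g (x + z) - g x) \<le> \<epsilon>/2"
      using add.IH(2)[rule_format, OF \<open>\<epsilon>/2 > 0\<close>, of R] by blast
    note d = d1(1) d2(1) d1(2) d2(2)
    have l: "locally_integrable (\<lambda>x. f (x + z) - f x)" "locally_integrable (\<lambda>x. g (x + z) - g x)" for z
      using add by (auto intro!: integrable_locally_integrable integrable_translate)
    have "L1c R (\<lambda>x. (f (x + z) + g (x + z)) - (f x + g x)) \<le> \<epsilon>" if "norm z < min d1 d2" for z
    proof -
      have "L1c R (\<lambda>x. (f (x + z) - f x) + (g (x + z) - g x)) \<le> \<epsilon>"
        using L1c_triangle[OF l(1)[of z] l(2)[of z], of R] d(3,4)[of z] that by linarith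
      moreover have "(f (x + z) + g (x + z)) - (f x + g x) = (f (x + z) - f x) + (g (x + z) - g x)" for x by simp
      ultimately show ?thesis by presburger
    qed
    then show "\<exists>\<delta>>0. \<forall>z. norm z < \<delta> \<longrightarrow> L1c R (\<lambda>x. (f (x + z) + g (x + z)) - (f x + g x)) \<le> \<epsilon>"
      using d(1,2) by (intro exI[of _ "min d1 d2"]) auto
  qed
next
  case (lim f s)
  show ?case
  proof (intro allI impI)
    fix R \<epsilon> :: real assume "\<epsilon> > 0"
    have "(\<lambda>i. \<integral>x. \<bar>s i x - f x\<bar> \<partial>lebesgue) \<longlonglongrightarrow> (\<integral>x. 0 \<partial>(lebesgue::'a measure))"
    proof (rule integral_dominated_convergence[where w = "\<lambda>x. 3 * \<bar>f x\<bar>"])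
      show "AE x in lebesgue. (\<lambda>i. \<bar>s i x - f x\<bar>) \<longlonglongrightarrow> 0"
        using lim.hyps(2) by (auto intro!: AE_I2 tendsto_rabs_zero LIM_zero)
      show "AE x in lebesgue. norm \<bar>s i x - f x\<bar> \<le> 3 * \<bar>f x\<bar>" for i
      proof (rule AE_I2)
        fix x :: 'a
        have "\<bar>s i x\<bar> \<le> 2 * \<bar>f x\<bar>" using lim.hyps(3)[of x i] by simp
        then show "norm \<bar>s i x - f x\<bar> \<le> 3 * \<bar>f x\<bar>" by simp
      qed
    qed (use lim in auto)
    then have "\<forall>\<^sub>F i in sequentially. (\<integral>x. \<bar>s i x - f x\<bar> \<partial>lebesgue) < \<epsilon>/3"
      using \<open>\<epsilon> > 0\<close> by (intro order_tendstoD) auto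
    then obtain i where i: "(\<integral>x. \<bar>s i x - f x\<bar> \<partial>lebesgue) < \<epsilon>/3" by (auto simp: eventually_sequentially)
    obtain d where d: "d > 0" "\<And>z. norm z < d \<Longrightarrow> L1c R (\<lambda>x. s i (x + z) - s i x) \<le> \<epsilon>/3"
      using lim.IH[of i] \<open>\<epsilon> > 0\<close> by (metis divide_pos_pos zero_less_numeral)
    have I: "integrable lebesgue (\<lambda>x. \<bar>s i x - f x\<bar>)" using lim by auto
    have bnd: "L1c R (\<lambda>x. f (x + z) - f x) \<le> \<epsilon>" if z: "norm z < d" for z
    proof -
      let ?A = "\<lambda>x. \<bar>s i (x + z) - f (x + z)\<bar>" and ?B = "\<lambda>x. \<bar>s i x - f x\<bar>"
        and ?C = "\<lambda>x. \<bar>s i (x + z) - s i x\<bar> * indicat_real (cball 0 R) x"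
      have A: "integrable lebesgue ?A" using integrable_translate[OF I, of z] by simp
      have C: "integrable lebesgue ?C"
        using lim.hyps(1)[of i] by (intro L1c_integrable integrable_locally_integrable) (auto intro: integrable_translate)
      have "L1c R (\<lambda>x. f (x + z) - f x) \<le> (\<integral>x. ?A x + ?B x + ?C x \<partial>lebesgue)"
        using A C I by (intro Bochner_Integration.integral_mono' Bochner_Integration.integrable_add)
           (auto simp: indicator_def)
      also have "\<dots> = (\<integral>x. ?A x \<partial>lebesgue) + (\<integral>x. ?B x \<partial>lebesgue) + (\<integral>x. ?C x \<partial>lebesgue)"
        using A C I by simp
      also have "(\<integral>x. ?A x \<partial>lebesgue) = (\<integral>x. ?B x \<partial>lebesgue)"
        using integral_translate[of ?B z] I by (simp add: borel_measurable_integrable)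
      finally show ?thesis using d(2)[OF z] i by simp
    qed
    show "\<exists>\<delta>>0. \<forall>z. norm z < \<delta> \<longrightarrow> L1c R (\<lambda>x. f (x + z) - f x) \<le> \<epsilon>"
      using bnd d(1) by blast
  qed
qed

text \<open>Cutting off at radius \<open>R + 1\<close> changes nothing on \<open>cball 0 R\<close>
  as long as the shift is shorter than 1.\<close>

lemma translation_continuous:
  fixes f :: "'a::euclidean_space \<Rightarrow> real"
  assumes f: "locally_integrable f" and "\<epsilon> > 0"
  obtains \<delta> where "\<delta> > 0" "\<And>z. norm z < \<delta> \<Longrightarrow> L1c R (\<lambda>x. f (x + z) - f x) \<le> \<epsilon>"
proof -
  let ?f = "\<lambda>x. f x * indicator (cball 0 (R + 1)) x"
  obtain d where d: "d > 0" "\<And>z. norm z < d \<Longrightarrow> L1c R (\<lambda>x. ?f (x + z) - ?f x) \<le> \<epsilon>"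
    using translation_continuous_integrable[OF integrable_cball[OF f, of "R+1"]] \<open>\<epsilon> > 0\<close> by blast
  show thesis
  proof (rule that[of "min d 1"])
    fix z :: 'a assume z: "norm z < min d 1"
    have "\<bar>?f (x + z) - ?f x\<bar> * indicator (cball 0 R) x = \<bar>f (x + z) - f x\<bar> * indicat_real (cball 0 R) x" for x
      using z norm_triangle_ineq[of x z] by (auto simp: indicator_def)
    then show "L1c R (\<lambda>x. f (x + z) - f x) \<le> \<epsilon>" using d(2)[of z] z by (simp only: min_less_iff_conj)
  qed (use d in auto)
qed

lemma integral_abs_le:
  fixes f g :: "'a \<Rightarrow> real"
  assumes "integrable M f" "integrable M g" "\<And>x. \<bar>f x\<bar> \<le> g x"
  shows "\<bar>\<integral>x. f x \<partial>M\<bar> \<le> (\<integral>x. g x \<partial>M)"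
proof -
  have "\<bar>\<integral>x. f x \<partial>M\<bar> \<le> (\<integral>x. \<bar>f x\<bar> \<partial>M)" by (rule integral_abs_bound)
  also have "\<dots> \<le> (\<integral>x. g x \<partial>M)" using assms by (intro integral_mono) auto
  finally show ?thesis .
qed

section \<open>Weak partial derivatives\<close>

text \<open>One direction at a time, since the calculus below works with difference quotients along
  a single basis vector.\<close>

definition weak_pd :: "'a \<Rightarrow> ('a::euclidean_space \<Rightarrow> real) \<Rightarrow> ('a \<Rightarrow> real) \<Rightarrow> bool" where
  "weak_pd b u g \<longleftrightarrow> locally_integrable u \<and> locally_integrable g \<and>
     (\<forall>\<phi>\<in>test_functions. (\<integral>x. u x * frechet_derivative \<phi> (at x) b \<partial>lebesgue) = - (\<integral>x. g x * \<phi> x \<partial>lebesgue))"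

lemma has_weak_gradient_iff:
  "has_weak_gradient u G \<longleftrightarrow> locally_integrable u \<and> locally_integrable G \<and> (\<forall>b\<in>Basis. weak_pd b u (\<lambda>x. G x \<bullet> b))"
  by (auto simp: has_weak_gradient_def weak_pd_def locally_integrable_inner)

lemma test_integrable:
  assumes "locally_integrable u" "\<phi> \<in> test_functions"
  shows "integrable lebesgue (\<lambda>x. u x * \<phi> x)"
proof -
  obtain R where "R > 0" "\<And>x. norm x \<ge> R \<Longrightarrow> \<phi> x = 0" using test_support[OF assms(2)] by metis
  then show ?thesis using locally_integrable_continuous_mult[OF assms(1) test_continuous[OF assms(2)]] by blast
qed

lemma test_deriv_integrable:
  assumes "locally_integrable u" "\<phi> \<in> test_functions" "b \<in> Basis"
  shows "integrable lebesgue (\<lambda>x. u x * frechet_derivative \<phi> (at x) b)"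
proof -
  obtain R where "R > 0" "\<And>x. norm x \<ge> R \<Longrightarrow> frechet_derivative \<phi> (at x) b = 0" using test_support[OF assms(2)] by metis
  then show ?thesis using locally_integrable_continuous_mult[OF assms(1) test_deriv_continuous[OF assms(2,3)]] by blast
qed

lemma weak_pd_unique:
  assumes "weak_pd b u g" "weak_pd b u h"
  shows "AE x in lebesgue. g x = h x"
proof -
  have l: "locally_integrable g" "locally_integrable h" using assms by (auto simp: weak_pd_def)
  have "AE x in lebesgue. g x - h x = 0"
  proof (rule fundamental_lemma)
    show "locally_integrable (\<lambda>x. g x - h x)" using l by (rule locally_integrable_diff)
    fix \<phi> :: "'a \<Rightarrow> real" assume \<phi>: "\<phi> \<in> test_functions"
    have "(\<integral>x. g x * \<phi> x \<partial>lebesgue) = (\<integral>x. h x * \<phi> x \<partial>lebesgue)" using assms \<phi> unfolding weak_pd_def by force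
    then show "(\<integral>x. (g x - h x) * \<phi> x \<partial>lebesgue) = 0"
      using test_integrable[OF l(1) \<phi>] test_integrable[OF l(2) \<phi>] by (simp add: left_diff_distrib)
  qed
  then show ?thesis by eventually_elim simp
qed

lemma weak_pd_cong:
  assumes "weak_pd b u g" "AE x in lebesgue. u x = u' x" "AE x in lebesgue. g x = g' x" "b \<in> Basis"
    "u' \<in> borel_measurable lebesgue" "g' \<in> borel_measurable lebesgue"
  shows "weak_pd b u' g'"
proof -
  have l: "locally_integrable u" "locally_integrable g" using assms by (auto simp: weak_pd_def)
  have l': "locally_integrable u'" "locally_integrable g'"
    by (rule locally_integrable_bound[OF l(1)], use assms in auto) (rule locally_integrable_bound[OF l(2)], use assms in auto)
  have "(\<integral>x. u' x * frechet_derivative \<phi> (at x) b \<partial>lebesgue) = (\<integral>x. u x * frechet_derivative \<phi> (at x) b \<partial>lebesgue)"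
    "(\<integral>x. g' x * \<phi> x \<partial>lebesgue) = (\<integral>x. g x * \<phi> x \<partial>lebesgue)" if \<phi>: "\<phi> \<in> test_functions" for \<phi>
  proof -
    show "(\<integral>x. u' x * frechet_derivative \<phi> (at x) b \<partial>lebesgue) = (\<integral>x. u x * frechet_derivative \<phi> (at x) b \<partial>lebesgue)"
      using test_deriv_integrable[OF l(1) \<phi> assms(4)] test_deriv_integrable[OF l'(1) \<phi> assms(4)] assms(2)
      by (intro integral_cong_AE) auto
    show "(\<integral>x. g' x * \<phi> x \<partial>lebesgue) = (\<integral>x. g x * \<phi> x \<partial>lebesgue)"
      using test_integrable[OF l(2) \<phi>] test_integrable[OF l'(2) \<phi>] assms(3)
      by (intro integral_cong_AE) auto
  qed
  then show ?thesis using assms(1) l' by (auto simp: weak_pd_def)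
qed

lemma weak_pd_lincomb:
  assumes "weak_pd b u g" "weak_pd b v h" "b \<in> Basis"
  shows "weak_pd b (\<lambda>x. s * u x + t * v x) (\<lambda>x. s * g x + t * h x)"
proof -
  have l: "locally_integrable u" "locally_integrable g" "locally_integrable v" "locally_integrable h"
    using assms by (auto simp: weak_pd_def)
  have "(\<integral>x. (s * u x + t * v x) * frechet_derivative \<phi> (at x) b \<partial>lebesgue) = - (\<integral>x. (s * g x + t * h x) * \<phi> x \<partial>lebesgue)"
    if \<phi>: "\<phi> \<in> test_functions" for \<phi>
  proof -
    have "(\<integral>x. (s * u x + t * v x) * frechet_derivative \<phi> (at x) b \<partial>lebesgue) =
       (\<integral>x. s * (u x * frechet_derivative \<phi> (at x) b) + t * (v x * frechet_derivative \<phi> (at x) b) \<partial>lebesgue)"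
      by (simp add: algebra_simps)
    also have "\<dots> = s * (\<integral>x. u x * frechet_derivative \<phi> (at x) b \<partial>lebesgue) + t * (\<integral>x. v x * frechet_derivative \<phi> (at x) b \<partial>lebesgue)"
      using test_deriv_integrable[OF l(1) \<phi> assms(3)] test_deriv_integrable[OF l(3) \<phi> assms(3)] by simp
    also have "\<dots> = - (s * (\<integral>x. g x * \<phi> x \<partial>lebesgue) + t * (\<integral>x. h x * \<phi> x \<partial>lebesgue))"
      using assms \<phi> by (simp add: weak_pd_def algebra_simps)
    also have "s * (\<integral>x. g x * \<phi> x \<partial>lebesgue) + t * (\<integral>x. h x * \<phi> x \<partial>lebesgue) = (\<integral>x. s * (g x * \<phi> x) + t * (h x * \<phi> x) \<partial>lebesgue)"
      using test_integrable[OF l(2) \<phi>] test_integrable[OF l(4) \<phi>] by simp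
    finally show ?thesis by (simp add: algebra_simps)
  qed
  then show ?thesis using l by (auto simp: weak_pd_def intro!: locally_integrable_add locally_integrable_cmult)
qed

section \<open>From difference quotients to weak derivatives\<close>

lemma frechet_derivative_real_bounded:
  fixes \<phi> :: "'a::euclidean_space \<Rightarrow> real"
  assumes "\<And>x. \<phi> differentiable (at x)" "\<And>x. \<bar>frechet_derivative \<phi> (at x) b\<bar> \<le> B"
  shows "\<bar>\<phi> (x + t *\<^sub>R b) - \<phi> x\<bar> \<le> B * \<bar>t\<bar>"
    and "((\<lambda>t. \<phi> (x + t *\<^sub>R b)) has_real_derivative frechet_derivative \<phi> (at (x + t *\<^sub>R b)) b) (at t)"
proof -
  have der: "((\<lambda>t. \<phi> (x + t *\<^sub>R b)) has_real_derivative frechet_derivative \<phi> (at (x + t *\<^sub>R b)) b) (at t)" for t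
  proof -
    let ?D = "frechet_derivative \<phi> (at (x + t *\<^sub>R b))"
    have D: "(\<phi> has_derivative ?D) (at (x + t *\<^sub>R b))" using assms(1) by (simp add: frechet_derivative_works[symmetric])
    have "((\<lambda>t. x + t *\<^sub>R b) has_derivative (\<lambda>s. s *\<^sub>R b)) (at t)" by (auto intro!: derivative_eq_intros)
    from has_derivative_compose[OF this D]
    have "((\<lambda>t. \<phi> (x + t *\<^sub>R b)) has_derivative (\<lambda>s. ?D (s *\<^sub>R b))) (at t)" .
    moreover have "?D (s *\<^sub>R b) = ?D b * s" for s
      using linear_frechet_derivative[OF assms(1)] by (simp add: linear_cmul)
    ultimately show ?thesis by (simp add: has_field_derivative_def)
  qed
  then show "((\<lambda>t. \<phi> (x + t *\<^sub>R b)) has_real_derivative frechet_derivative \<phi> (at (x + t *\<^sub>R b)) b) (at t)" .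
  have "norm (\<phi> (x + t *\<^sub>R b) - \<phi> (x + 0 *\<^sub>R b)) \<le> B * norm (t - 0)"
    by (rule field_differentiable_bound[where S=UNIV and f'="\<lambda>t. frechet_derivative \<phi> (at (x + t *\<^sub>R b)) b"])
       (use der assms in auto)
  then show "\<bar>\<phi> (x + t *\<^sub>R b) - \<phi> x\<bar> \<le> B * \<bar>t\<bar>" by simp
qed

text \<open>Summation by parts: the difference quotient of \<open>u\<close> tested against \<phi> is
  \<open>u\<close> tested against a difference quotient of \<phi>, and both sides converge. A single
  sequence of steps is asked for, and it may depend on \<open>R\<close>; this leaves room to choose
  the sign of the steps and to pass to subsequences.\<close>

lemma weak_pd_from_quotients:
  assumes u: "locally_integrable u" "locally_integrable g" and b: "b \<in> Basis"
    and q: "\<And>R. \<exists>h. h \<longlonglongrightarrow> 0 \<and> (\<forall>n::nat. h n \<noteq> 0) \<and> (\<lambda>n. L1c R (\<lambda>x. (u (x + h n *\<^sub>R b) - u x) / h n - g x)) \<longlonglongrightarrow> 0"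
  shows "weak_pd b u g"
  unfolding weak_pd_def
proof (intro conjI ballI u)
  fix \<phi> :: "'a \<Rightarrow> real" assume \<phi>: "\<phi> \<in> test_functions"
  obtain R where R: "R > 0" "\<And>x. norm x \<ge> R \<Longrightarrow> \<phi> x = 0" using test_support[OF \<phi>] by metis
  obtain B where B: "B > 0" "\<And>x. \<bar>\<phi> x\<bar> \<le> B" "\<And>x. \<bar>frechet_derivative \<phi> (at x) b\<bar> \<le> B"
    using test_bounded[OF \<phi>] b by metis
  obtain h where h: "h \<longlonglongrightarrow> 0" "\<And>n::nat. h n \<noteq> 0"
     "(\<lambda>n. L1c R (\<lambda>x. (u (x + h n *\<^sub>R b) - u x) / h n - g x)) \<longlonglongrightarrow> 0" using q by blast
  define D where "D n x = (u (x + h n *\<^sub>R b) - u x) / h n" for n x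
  have D_loc: "locally_integrable (D n)" for n
    unfolding D_def using locally_integrable_cmult[OF locally_integrable_diff[OF locally_integrable_translate[OF u(1)] u(1)], of "1 / h n"]
    by simp
  \<comment> \<open>A bound for all steps, so that the quotients of the test function share the
    support \<open>cball 0 (R + S)\<close> and \<open>u\<close> restricted to it gives a common
    majorant.\<close>
  obtain S where S: "\<And>n. \<bar>h n\<bar> \<le> S"
    using convergent_imp_bounded[of h 0] h(1) by (auto simp: bounded_iff)
  have m\<phi>: "\<phi> \<in> borel_measurable lebesgue"
    using test_continuous[OF \<phi>] by (simp add: borel_measurable_continuous_onI measurable_completion)
  have 1: "(\<lambda>n. \<integral>x. D n x * \<phi> x \<partial>lebesgue) \<longlonglongrightarrow> (\<integral>x. g x * \<phi> x \<partial>lebesgue)"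
  proof -
    have "(\<lambda>n. (\<integral>x. D n x * \<phi> x \<partial>lebesgue) - (\<integral>x. g x * \<phi> x \<partial>lebesgue)) \<longlonglongrightarrow> 0"
    proof (rule Lim_null_comparison)
      show "(\<lambda>n. B * L1c R (\<lambda>x. D n x - g x)) \<longlonglongrightarrow> 0" using tendsto_mult_left[OF h(3), of B] by (simp add: D_def)
      show "\<forall>\<^sub>F n in sequentially. norm ((\<integral>x. D n x * \<phi> x \<partial>lebesgue) - (\<integral>x. g x * \<phi> x \<partial>lebesgue)) \<le> B * L1c R (\<lambda>x. D n x - g x)"
      proof (rule always_eventually, rule allI)
        fix n
        have l: "locally_integrable (\<lambda>x. D n x - g x)" using D_loc u by (intro locally_integrable_diff)
        have "(\<integral>x. D n x * \<phi> x \<partial>lebesgue) - (\<integral>x. g x * \<phi> x \<partial>lebesgue) = (\<integral>x. (D n x - g x) * \<phi> x \<partial>lebesgue)"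
          using test_integrable[OF D_loc \<phi>] test_integrable[OF u(2) \<phi>] by (simp add: left_diff_distrib)
        also have "norm \<dots> \<le> (\<integral>x. B * (\<bar>D n x - g x\<bar> * indicator (cball 0 R) x) \<partial>lebesgue)"
          unfolding real_norm_def
        proof (rule integral_abs_le)
          show "integrable lebesgue (\<lambda>x. (D n x - g x) * \<phi> x)" by (rule test_integrable[OF l \<phi>])
          show "integrable lebesgue (\<lambda>x. B * (\<bar>D n x - g x\<bar> * indicator (cball 0 R) x))"
            using L1c_integrable[OF l] by simp
          show "\<bar>(D n x - g x) * \<phi> x\<bar> \<le> B * (\<bar>D n x - g x\<bar> * indicator (cball 0 R) x)" for x
            using R(2)[of x] mult_right_mono[OF B(2)[of x], of "\<bar>D n x - g x\<bar>"] by (auto simp: indicator_def abs_mult mult.commute)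
        qed
        finally show "norm ((\<integral>x. D n x * \<phi> x \<partial>lebesgue) - (\<integral>x. g x * \<phi> x \<partial>lebesgue)) \<le> B * L1c R (\<lambda>x. D n x - g x)" by simp
      qed
    qed
    then show ?thesis by (simp add: LIM_zero_iff)
  qed
  define Q where "Q n x = (\<phi> (x - h n *\<^sub>R b) - \<phi> x) / h n" for n x
  have 2: "(\<integral>x. D n x * \<phi> x \<partial>lebesgue) = (\<integral>x. u x * Q n x \<partial>lebesgue)" for n
  proof -
    have iA: "integrable lebesgue (\<lambda>x. u (x + h n *\<^sub>R b) * \<phi> x)"
      by (rule test_integrable[OF locally_integrable_translate[OF u(1)] \<phi>])
    have iB: "integrable lebesgue (\<lambda>x. u x * \<phi> x)"
      by (rule test_integrable[OF u(1) \<phi>])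
    have iC: "integrable lebesgue (\<lambda>x. u x * \<phi> (x - h n *\<^sub>R b))"
      using integrable_translate[OF iA, of "- h n *\<^sub>R b"] by simp
    have "(\<integral>x. D n x * \<phi> x \<partial>lebesgue) = (\<integral>x. (u (x + h n *\<^sub>R b) * \<phi> x - u x * \<phi> x) / h n \<partial>lebesgue)"
      by (simp add: D_def field_simps)
    also have "\<dots> = ((\<integral>x. u (x + h n *\<^sub>R b) * \<phi> x \<partial>lebesgue) - (\<integral>x. u x * \<phi> x \<partial>lebesgue)) / h n"
      using iA iB by simp
    also have "(\<integral>x. u (x + h n *\<^sub>R b) * \<phi> x \<partial>lebesgue) = (\<integral>x. u x * \<phi> (x - h n *\<^sub>R b) \<partial>lebesgue)"
      using integral_translate[of "\<lambda>x. u (x + h n *\<^sub>R b) * \<phi> x" "- h n *\<^sub>R b"] iA by simp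
    also have "((\<integral>x. u x * \<phi> (x - h n *\<^sub>R b) \<partial>lebesgue) - (\<integral>x. u x * \<phi> x \<partial>lebesgue)) / h n =
       (\<integral>x. (u x * \<phi> (x - h n *\<^sub>R b) - u x * \<phi> x) / h n \<partial>lebesgue)"
      using iB iC by simp
    finally show ?thesis by (simp add: Q_def field_simps)
  qed
  have 3: "(\<lambda>n. \<integral>x. u x * Q n x \<partial>lebesgue) \<longlonglongrightarrow> (\<integral>x. u x * (- frechet_derivative \<phi> (at x) b) \<partial>lebesgue)"
  proof (rule integral_dominated_convergence)
    show "integrable lebesgue (\<lambda>x. B * (\<bar>u x\<bar> * indicator (cball 0 (R + S)) x))"
      using L1c_integrable[OF u(1)] by simp
    have mu: "u \<in> borel_measurable lebesgue" using u by (intro locally_integrable_measurable)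
    show "(\<lambda>x. u x * (- frechet_derivative \<phi> (at x) b)) \<in> borel_measurable lebesgue"
      using borel_measurable_integrable[OF test_deriv_integrable[OF u(1) \<phi> b]] by simp
    show "(\<lambda>x. u x * Q n x) \<in> borel_measurable lebesgue" for n
      unfolding Q_def using measurable_translate[OF m\<phi>, of "- h n *\<^sub>R b"] mu m\<phi> by auto
    have lip: "\<bar>Q n x\<bar> \<le> B" for n x
      using frechet_derivative_real_bounded(1)[OF test_differentiable[OF \<phi>] B(3), of x "- h n"] h(2)[of n]
      by (simp add: Q_def field_simps)
    show "AE x in lebesgue. norm (u x * Q n x) \<le> B * (\<bar>u x\<bar> * indicator (cball 0 (R + S)) x)" for n
    proof (rule AE_I2)
      fix x
      have "Q n x = 0" if "norm x > R + S"
      proof -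
        have "norm (h n *\<^sub>R b) \<le> S" using S[of n] b by simp
        then have "norm (x - h n *\<^sub>R b) \<ge> R" using that norm_triangle_ineq2[of x "h n *\<^sub>R b"] by linarith
        moreover have "norm x \<ge> R" using that S[of 0] by simp
        ultimately show ?thesis using R(2) by (simp add: Q_def)
      qed
      then show "norm (u x * Q n x) \<le> B * (\<bar>u x\<bar> * indicator (cball 0 (R + S)) x)"
        using mult_left_mono[OF lip[of n x], of "\<bar>u x\<bar>"] by (auto simp: indicator_def abs_mult mult.commute)
    qed
    show "AE x in lebesgue. (\<lambda>n. u x * Q n x) \<longlonglongrightarrow> u x * (- frechet_derivative \<phi> (at x) b)"
    proof (rule AE_I2, rule tendsto_mult_left)
      fix x
      have "((\<lambda>t. (\<phi> (x + (0 + t) *\<^sub>R b) - \<phi> (x + 0 *\<^sub>R b)) / t) \<longlongrightarrow> frechet_derivative \<phi> (at x) b) (at 0)"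
        using frechet_derivative_real_bounded(2)[OF test_differentiable[OF \<phi>] B(3), of x 0]
        by (simp add: DERIV_def)
      moreover have "filterlim (\<lambda>n. - h n) (at 0) sequentially"
        using h tendsto_minus[OF h(1)] by (auto simp: filterlim_at)
      ultimately have "(\<lambda>n. (\<phi> (x + (0 + (- h n)) *\<^sub>R b) - \<phi> (x + 0 *\<^sub>R b)) / (- h n)) \<longlonglongrightarrow> frechet_derivative \<phi> (at x) b"
        by (rule filterlim_compose)
      from tendsto_minus[OF this] show "(\<lambda>n. Q n x) \<longlonglongrightarrow> - frechet_derivative \<phi> (at x) b"
        by (simp add: Q_def)
    qed
  qed
  have "(\<integral>x. g x * \<phi> x \<partial>lebesgue) = (\<integral>x. u x * (- frechet_derivative \<phi> (at x) b) \<partial>lebesgue)"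
    using LIMSEQ_unique[OF 1] 3 unfolding 2 by blast
  then show "(\<integral>x. u x * frechet_derivative \<phi> (at x) b \<partial>lebesgue) = - (\<integral>x. g x * \<phi> x \<partial>lebesgue)" by simp
qed

section \<open>Increments as averages of the weak derivative\<close>

lemma cball_borel [measurable]: "cball a r \<in> sets borel"
  by simp

lemma Ck_translate:
  fixes f :: "'a::euclidean_space \<Rightarrow> real"
  shows "Ck k f \<Longrightarrow> Ck k (\<lambda>x. f (x + c))"
    and frechet_derivative_translate:
      "f differentiable (at (x + c)) \<Longrightarrow> frechet_derivative (\<lambda>x. f (x + c)) (at x) = frechet_derivative f (at (x + c))"
proof -
  have D: "((\<lambda>x. f (x + c)) has_derivative frechet_derivative f (at (x + c))) (at x)"
    if "f differentiable (at (x + c))" for f :: "'a \<Rightarrow> real" and x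
  proof -
    have "(f has_derivative frechet_derivative f (at (x + c))) (at (x + c))"
      using that by (simp add: frechet_derivative_works[symmetric])
    moreover have "((\<lambda>x. x + c) has_derivative (\<lambda>h. h)) (at x)" by (auto intro!: derivative_eq_intros)
    ultimately show ?thesis using has_derivative_compose by blast
  qed
  then have E: "f differentiable (at (x + c)) \<Longrightarrow> frechet_derivative (\<lambda>x. f (x + c)) (at x) = frechet_derivative f (at (x + c))"
    for f :: "'a \<Rightarrow> real" and x
    by (metis frechet_derivative_at)
  show "f differentiable (at (x + c)) \<Longrightarrow> frechet_derivative (\<lambda>x. f (x + c)) (at x) = frechet_derivative f (at (x + c))"
    by (rule E)
  show "Ck k f \<Longrightarrow> Ck k (\<lambda>x. f (x + c))"
  proof (induction k arbitrary: f)
    case 0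
    then show ?case by (auto intro!: continuous_on_compose2[of UNIV f] continuous_intros)
  next
    case (Suc k)
    have d: "f differentiable (at x)" and c: "b \<in> Basis \<Longrightarrow> Ck k (\<lambda>x. frechet_derivative f (at x) b)" for x b
      using Suc.prems by auto
    have "(\<lambda>x. f (x + c)) differentiable (at x)" for x
      using D[OF d] unfolding differentiable_def by blast
    moreover have "Ck k (\<lambda>x. frechet_derivative (\<lambda>x. f (x + c)) (at x) b)" if "b \<in> Basis" for b
      unfolding E[OF d] by (rule Suc.IH[OF c[OF that]])
    ultimately show ?case by simp
  qed
qed

lemma test_translate:
  fixes \<phi> :: "'a::euclidean_space \<Rightarrow> real"
  assumes "\<phi> \<in> test_functions" shows "(\<lambda>x. \<phi> (x + c)) \<in> test_functions"
proof -
  have "bounded (closure {x. \<phi> x \<noteq> 0})" using assms by (auto simp: test_functions_def compact_imp_bounded)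
  then have "bounded {x. \<phi> x \<noteq> 0}" using bounded_subset closure_subset by blast
  then obtain B where B: "\<And>x. \<phi> x \<noteq> 0 \<Longrightarrow> norm x \<le> B" by (auto simp: bounded_iff)
  have "bounded {x. \<phi> (x + c) \<noteq> 0}"
    unfolding bounded_iff
  proof (intro exI ballI)
    fix x assume "x \<in> {x. \<phi> (x + c) \<noteq> 0}"
    then have "norm (x + c) \<le> B" using B by auto
    then show "norm x \<le> B + norm c" using norm_triangle_ineq4[of "x + c" c] by simp
  qed
  then show ?thesis using assms Ck_translate(1) by (auto simp: test_functions_def)
qed

text \<open>The integral of a non-integrable function is 0 by convention, so the inequality covers
  that case too.\<close>

lemma nn_abs_integral_le:
  fixes f :: "'a \<Rightarrow> real"
  shows "ennreal \<bar>\<integral>t. f t \<partial>M\<bar> \<le> (\<integral>\<^sup>+t. ennreal \<bar>f t\<bar> \<partial>M)"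
proof (cases "integrable M f")
  case True then show ?thesis using integral_norm_bound_ennreal[of M f] by simp
qed (simp add: not_integrable_integral_eq)

lemma locally_integrable_nn_cball:
  fixes g :: "'a::euclidean_space \<Rightarrow> real"
  assumes "locally_integrable g"
  shows "(\<integral>\<^sup>+x. ennreal (\<bar>g x\<bar> * indicator (cball 0 R) x) \<partial>lborel) < \<infinity>"
  using L1c_integrable[OF assms, of R]
  by (simp add: integrable_iff_bounded nn_integral_completion)

lemma nn_integral_translate_borel:
  fixes f :: "'a::euclidean_space \<Rightarrow> ennreal"
  assumes "f \<in> borel_measurable borel"
  shows "(\<integral>\<^sup>+x. f (x + c) \<partial>lborel) = (\<integral>\<^sup>+x. f x \<partial>lborel)"
  using nn_integral_translate[of f c] assms by (simp add: measurable_completion nn_integral_completion)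

text \<open>Prepares the applications of Fubini's theorem: the parameter \<open>t\<close> runs
  through the unit interval and the slices in \<open>x\<close> have \<open>L^1\<close> norms bounded
  uniformly in \<open>t\<close>.\<close>

lemma pair_integrable_unit:
  fixes F :: "real \<Rightarrow> 'a::euclidean_space \<Rightarrow> real"
  assumes [measurable]: "(\<lambda>(t, x). F t x) \<in> borel_measurable (lborel \<Otimes>\<^sub>M lborel)"
    and C: "C < \<infinity>" "\<And>t. (\<integral>\<^sup>+x. ennreal \<bar>F t x\<bar> \<partial>lborel) \<le> C * indicator {0..1} t"
  shows "integrable (lborel \<Otimes>\<^sub>M lborel) (\<lambda>(t, x). F t x)"
proof (rule integrableI_bounded)
  have "(\<integral>\<^sup>+z. ennreal (norm (case z of (t, x) \<Rightarrow> F t x)) \<partial>(lborel \<Otimes>\<^sub>M lborel)) = (\<integral>\<^sup>+t. (\<integral>\<^sup>+x. ennreal \<bar>F t x\<bar> \<partial>lborel) \<partial>lborel)"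
    by (subst lborel.nn_integral_fst[symmetric]) auto
  also have "\<dots> \<le> (\<integral>\<^sup>+t. C * indicator {0..1::real} t \<partial>lborel)"
    by (intro nn_integral_mono C)
  also have "\<dots> = C" by (subst nn_integral_cmult_indicator) auto
  finally show "(\<integral>\<^sup>+z. ennreal (norm (case z of (t, x) \<Rightarrow> F t x)) \<partial>(lborel \<Otimes>\<^sub>M lborel)) < \<infinity>"
    using C(1) by (simp add: le_less_trans)
qed fact

text \<open>Where \<open>k\<close> lives, the shifted point stays in the ball of radius
  \<open>R + H\<close>; translation invariance then removes the shift.\<close>

lemma shifted_slice_bound:
  fixes g k :: "'a::euclidean_space \<Rightarrow> real"
  assumes [measurable]: "g \<in> borel_measurable borel" "k \<in> borel_measurable borel"
    and B: "\<And>x. \<bar>k x\<bar> \<le> B * indicator (cball 0 R) x" "B \<ge> 0" and c: "norm c \<le> H"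
  shows "(\<integral>\<^sup>+x. ennreal \<bar>g (x + c) * k x\<bar> \<partial>lborel) \<le> ennreal B * (\<integral>\<^sup>+x. ennreal (\<bar>g x\<bar> * indicator (cball 0 (R + H)) x) \<partial>lborel)"
proof -
  define q where "q x = ennreal (\<bar>g x\<bar> * indicator (cball 0 (R + H)) x)" for x
  have [measurable]: "q \<in> borel_measurable borel" unfolding q_def by measurable
  have "(\<integral>\<^sup>+x. ennreal \<bar>g (x + c) * k x\<bar> \<partial>lborel) \<le>
     (\<integral>\<^sup>+x. ennreal B * ennreal (\<bar>g (x + c)\<bar> * indicator (cball 0 (R + H)) (x + c)) \<partial>lborel)"
  proof (rule nn_integral_mono)
    fix x
    have "\<bar>g (x + c) * k x\<bar> \<le> B * (\<bar>g (x + c)\<bar> * indicator (cball 0 (R + H)) (x + c))"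
    proof (cases "norm x \<le> R")
      case True
      then have "norm (x + c) \<le> R + H" using c norm_triangle_ineq[of x c] by simp
      then show ?thesis
        using mult_left_mono[OF B(1)[of x], of "\<bar>g (x + c)\<bar>"] True by (simp add: abs_mult mult_ac)
    next
      case False
      then have "k x = 0" using B(1)[of x] by simp
      then show ?thesis using B(2) by simp
    qed
    then show "ennreal \<bar>g (x + c) * k x\<bar> \<le> ennreal B * ennreal (\<bar>g (x + c)\<bar> * indicator (cball 0 (R + H)) (x + c))"
      using B(2) by (simp flip: ennreal_mult')
  qed
  also have "\<dots> = ennreal B * (\<integral>\<^sup>+x. q (x + c) \<partial>lborel)"
    unfolding q_def[symmetric] by (rule nn_integral_cmult) measurable
  also have "(\<integral>\<^sup>+x. q (x + c) \<partial>lborel) = (\<integral>\<^sup>+x. q x \<partial>lborel)"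
    by (rule nn_integral_translate_borel) measurable
  finally show ?thesis by (simp add: q_def)
qed

lemma integral_translate_borel:
  fixes f :: "'a::euclidean_space \<Rightarrow> real"
  assumes "f \<in> borel_measurable borel"
  shows "(\<integral>x. f (x + c) \<partial>lborel) = (\<integral>x. f x \<partial>lborel)"
proof -
  have "f \<in> borel_measurable lebesgue" using assms by (intro measurable_completion) simp
  moreover have "(\<lambda>x. f (x + c)) \<in> borel_measurable borel" using assms by measurable
  ultimately show ?thesis using integral_translate[of f c] assms by (simp add: integral_completion)
qed

text \<open>The fundamental theorem of calculus on almost every line, proved by testing: Fubini's
  theorem moves the average over \<open>t\<close> onto the test function, where the classical
  theorem applies. Borel functions are taken so that the integrand is measurable in the pair of
  \<open>t\<close> and \<open>x\<close>. The second claim excludes that the inner integral is merely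
  the default value 0 of a non-integrable function.\<close>

lemma weak_pd_translation_borel:
  fixes u g :: "'a::euclidean_space \<Rightarrow> real"
  assumes wp: "weak_pd b u g" and b: "b \<in> Basis"
    and [measurable]: "u \<in> borel_measurable borel" "g \<in> borel_measurable borel"
  shows "AE x in lebesgue. u (x + h *\<^sub>R b) - u x = h * (\<integral>t. indicator {0..1} t * g (x + (t * h) *\<^sub>R b) \<partial>lborel)"
    and "AE x in lborel. integrable lborel (\<lambda>t. indicator {0..1} t * g (x + (t * h) *\<^sub>R b))"
proof -
  have lu: "locally_integrable u" and lg: "locally_integrable g" using wp by (auto simp: weak_pd_def)
  define I where "I x = (\<integral>t. indicator {0..1} t * g (x + (t * h) *\<^sub>R b) \<partial>lborel)" for x
  define H where "H = \<bar>h\<bar>"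
  have H: "norm ((t * h) *\<^sub>R b) \<le> H" if "t \<in> {0..1}" for t
    using that b by (simp add: H_def abs_mult mult_left_le_one_le)
  have pair: "integrable (lborel \<Otimes>\<^sub>M lborel) (\<lambda>(t, x). indicator {0..1} t * (w (x + (t * h) *\<^sub>R b) * k x))"
    if [measurable]: "w \<in> borel_measurable borel" "k \<in> borel_measurable borel"
    and w: "locally_integrable w" and B: "\<And>x. \<bar>k x\<bar> \<le> B * indicator (cball 0 R) x" "B \<ge> 0" for w k :: "'a \<Rightarrow> real" and B R
  proof (rule pair_integrable_unit)
    let ?C = "ennreal B * (\<integral>\<^sup>+x. ennreal (\<bar>w x\<bar> * indicator (cball 0 (R + H)) x) \<partial>lborel)"
    show "?C < \<infinity>" using locally_integrable_nn_cball[OF w, of "R + H"] by (simp add: ennreal_mult_less_top)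
    show "(\<integral>\<^sup>+x. ennreal \<bar>indicator {0..1} t * (w (x + (t * h) *\<^sub>R b) * k x)\<bar> \<partial>lborel) \<le> ?C * indicator {0..1} t" for t
      using shifted_slice_bound[of w k B R "(t * h) *\<^sub>R b" H] B w H[of t] by (cases "t \<in> {0..1}") auto
  qed measurable
  have slice: "integrable (lborel \<Otimes>\<^sub>M lborel) (\<lambda>(t, x). indicator {0..1} t * (g (x + (t * h) *\<^sub>R b) * indicat_real (cball 0 R) x))" for R
    by (rule pair[where B = 1 and R = R]) (auto simp: lg intro!: borel_measurable_indicator)
  have IR: "integrable lborel (\<lambda>x. I x * indicator (cball 0 R) x)" for R
  proof -
    have "integrable lborel (\<lambda>x. \<integral>t. indicator {0..1} t * (g (x + (t * h) *\<^sub>R b) * indicat_real (cball 0 R) x) \<partial>lborel)"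
      using lborel_pair.integrable_snd[OF slice[of R]] .
    moreover have "(\<integral>t. indicator {0..1} t * (g (x + (t * h) *\<^sub>R b) * indicat_real (cball 0 R) x) \<partial>lborel) = I x * indicator (cball 0 R) x" for x
      unfolding I_def by (cases "x \<in> cball 0 R") auto
    ultimately show ?thesis by simp
  qed
  show "AE x in lborel. integrable lborel (\<lambda>t. indicator {0..1} t * g (x + (t * h) *\<^sub>R b))"
  proof -
    have "AE x in lborel. integrable lborel (\<lambda>t. indicator {0..1} t * (g (x + (t * h) *\<^sub>R b) * indicat_real (cball 0 (real R)) x))" for R :: nat
      using lborel_pair.AE_integrable_snd[OF slice[of "real R"]] .
    then have "AE x in lborel. \<forall>R::nat. integrable lborel (\<lambda>t. indicator {0..1} t * (g (x + (t * h) *\<^sub>R b) * indicat_real (cball 0 (real R)) x))"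
      unfolding AE_all_countable by blast
    then show ?thesis
    proof eventually_elim
      case (elim x)
      obtain R :: nat where "norm x \<le> real R" using real_arch_simple by blast
      then have "indicat_real (cball 0 (real R)) x = 1" by (auto simp: indicator_def)
      then show ?case using elim[rule_format, of R] by simp
    qed
  qed
  have lI: "locally_integrable I"
  proof (rule locally_integrableI)
    fix n :: nat
    have [measurable]: "I \<in> borel_measurable lborel" unfolding I_def by measurable
    show "set_integrable lebesgue (cball 0 (real n)) I"
      unfolding set_integrable_def using IR[of n]
      by (simp add: integrable_completion mult.commute)
  qed
  have "AE x in lebesgue. (u (x + h *\<^sub>R b) - u x) - h * I x = 0"
  proof (rule fundamental_lemma)
    show "locally_integrable (\<lambda>x. (u (x + h *\<^sub>R b) - u x) - h * I x)"
      by (intro locally_integrable_diff locally_integrable_translate lu lI locally_integrable_cmult)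
    fix \<phi> :: "'a \<Rightarrow> real" assume \<phi>: "\<phi> \<in> test_functions"
    obtain R where R: "R > 0" "\<And>x. norm x \<ge> R \<Longrightarrow> \<phi> x = 0" "\<And>x. norm x \<ge> R \<Longrightarrow> frechet_derivative \<phi> (at x) b = 0"
      using test_support[OF \<phi>] by metis
    obtain B where B: "B > 0" "\<And>x. \<bar>\<phi> x\<bar> \<le> B" "\<And>x. \<bar>frechet_derivative \<phi> (at x) b\<bar> \<le> B"
      using test_bounded[OF \<phi>] b by metis
    define \<psi> where "\<psi> x = frechet_derivative \<phi> (at x) b" for x
    have [measurable]: "\<phi> \<in> borel_measurable borel" "\<psi> \<in> borel_measurable borel"
      using test_continuous[OF \<phi>] test_deriv_continuous[OF \<phi> b] by (auto simp: \<psi>_def[abs_def] intro: borel_measurable_continuous_onI)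
    have b\<phi>: "\<bar>\<phi> x\<bar> \<le> B * indicator (cball 0 R) x" "\<bar>\<psi> x\<bar> \<le> B * indicator (cball 0 R) x" for x
      using R(2,3)[of x] B(2,3)[of x] by (auto simp: indicator_def \<psi>_def)
    have d: "\<phi> differentiable (at x)" for x by (rule test_differentiable[OF \<phi>])
    \<comment> \<open>The defining identity of the weak derivative for the translate \<phi>(x - c),
      shifted back by \<open>c\<close>.\<close>
    have step: "(\<integral>x. g (x + c) * \<phi> x \<partial>lborel) = - (\<integral>x. u (x + c) * \<psi> x \<partial>lborel)" for c
    proof -
      have t: "(\<lambda>x. \<phi> (x + (- c))) \<in> test_functions" by (rule test_translate[OF \<phi>])
      have "(\<integral>x. u x * frechet_derivative (\<lambda>x. \<phi> (x + (- c))) (at x) b \<partial>lebesgue) = - (\<integral>x. g x * \<phi> (x + (- c)) \<partial>lebesgue)"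
        using wp t by (auto simp: weak_pd_def)
      then have "(\<integral>x. u x * \<psi> (x + (- c)) \<partial>lebesgue) = - (\<integral>x. g x * \<phi> (x + (- c)) \<partial>lebesgue)"
        by (simp only: frechet_derivative_translate[OF d] \<psi>_def)
      then have "(\<integral>x. u x * \<psi> (x + (- c)) \<partial>lborel) = - (\<integral>x. g x * \<phi> (x + (- c)) \<partial>lborel)"
        by (subst (asm) (1 2) integral_completion) auto
      then show ?thesis
        using integral_translate_borel[of "\<lambda>x. u (x + c) * \<psi> x" "-c"] integral_translate_borel[of "\<lambda>x. g (x + c) * \<phi> x" "-c"]
        by simp
    qed
    have Il: "(\<integral>x. I x * \<phi> x \<partial>lebesgue) = (\<integral>x. I x * \<phi> x \<partial>lborel)"
      unfolding I_def by (rule integral_completion) measurable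
    have "(\<integral>x. I x * \<phi> x \<partial>lborel) = (\<integral>x. (\<integral>t. indicator {0..1} t * (g (x + (t * h) *\<^sub>R b) * \<phi> x) \<partial>lborel) \<partial>lborel)"
      unfolding I_def by (simp flip: mult.assoc)
    also have "\<dots> = (\<integral>t. (\<integral>x. indicator {0..1} t * (g (x + (t * h) *\<^sub>R b) * \<phi> x) \<partial>lborel) \<partial>lborel)"
      by (rule lborel_pair.Fubini_integral, rule pair[where B = B and R = R]) (use lg b\<phi> B in auto)
    also have "\<dots> = (\<integral>t. indicator {0..1} t * - (\<integral>x. u (x + (t * h) *\<^sub>R b) * \<psi> x \<partial>lborel) \<partial>lborel)"
      by (simp add: step)
    also have "\<dots> = - (\<integral>t. (\<integral>x. indicator {0..1} t * (u x * \<psi> (x - (t * h) *\<^sub>R b)) \<partial>lborel) \<partial>lborel)"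
    proof -
      have "(\<integral>x. u (x + (t * h) *\<^sub>R b) * \<psi> x \<partial>lborel) = (\<integral>x. u x * \<psi> (x - (t * h) *\<^sub>R b) \<partial>lborel)" for t
        using integral_translate_borel[of "\<lambda>x. u (x + (t * h) *\<^sub>R b) * \<psi> x" "- (t * h) *\<^sub>R b"] by simp
      then show ?thesis by simp
    qed
    also have "(\<integral>t. (\<integral>x. indicator {0..1} t * (u x * \<psi> (x - (t * h) *\<^sub>R b)) \<partial>lborel) \<partial>lborel) =
      (\<integral>x. (\<integral>t. indicator {0..1} t * (u x * \<psi> (x - (t * h) *\<^sub>R b)) \<partial>lborel) \<partial>lborel)"
    proof (rule lborel_pair.Fubini_integral[symmetric], rule pair_integrable_unit)
      let ?C = "ennreal B * (\<integral>\<^sup>+x. ennreal (\<bar>u x\<bar> * indicator (cball 0 (R + H)) x) \<partial>lborel)"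
      show "?C < \<infinity>" using locally_integrable_nn_cball[OF lu, of "R + H"] by (simp add: ennreal_mult_less_top)
      fix t
      show "(\<integral>\<^sup>+x. ennreal \<bar>indicator {0..1} t * (u x * \<psi> (x - (t * h) *\<^sub>R b))\<bar> \<partial>lborel) \<le> ?C * indicator {0..1} t"
      proof (cases "t \<in> {0..1}")
        case True
        have "(\<integral>\<^sup>+x. ennreal \<bar>u x * \<psi> (x - (t * h) *\<^sub>R b)\<bar> \<partial>lborel) = (\<integral>\<^sup>+x. ennreal \<bar>u (x + (t * h) *\<^sub>R b) * \<psi> x\<bar> \<partial>lborel)"
          using nn_integral_translate_borel[of "\<lambda>x. ennreal \<bar>u x * \<psi> (x - (t * h) *\<^sub>R b)\<bar>" "(t * h) *\<^sub>R b"] by simp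
        also have "\<dots> \<le> ?C" using shifted_slice_bound[of u \<psi> B R "(t * h) *\<^sub>R b" H] b\<phi> B H[OF True] by simp
        finally show ?thesis using True by simp
      qed simp
    qed measurable
    also have "\<dots> = (\<integral>x. u x * (\<integral>t. indicator {0..1} t * \<psi> (x - (t * h) *\<^sub>R b) \<partial>lborel) \<partial>lborel)"
      by (simp add: mult.left_commute)
    finally have 1: "h * (\<integral>x. I x * \<phi> x \<partial>lborel) = - (\<integral>x. u x * (h * (\<integral>t. indicator {0..1} t * \<psi> (x - (t * h) *\<^sub>R b) \<partial>lborel)) \<partial>lborel)"
      by (simp add: mult.left_commute)
    have ftc: "h * (\<integral>t. indicator {0..1} t * \<psi> (x - (t * h) *\<^sub>R b) \<partial>lborel) = \<phi> x - \<phi> (x - h *\<^sub>R b)" for x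
    proof -
      have "(\<integral>t. indicator {0..1} t *\<^sub>R (h * \<psi> (x - (t * h) *\<^sub>R b)) \<partial>lborel) = - \<phi> (x - (1 * h) *\<^sub>R b) - - \<phi> (x - (0 * h) *\<^sub>R b)"
      proof (rule integral_FTC_Icc)
        fix t :: real
        have 1: "((\<lambda>s. \<phi> (x + s *\<^sub>R b)) has_real_derivative \<psi> (x + (- (t * h)) *\<^sub>R b)) (at (- (t * h)))"
          unfolding \<psi>_def by (rule frechet_derivative_real_bounded(2)[OF d B(3)])
        have 2: "((\<lambda>t. - (t * h)) has_real_derivative (- h)) (at t)" by (auto intro!: derivative_eq_intros)
        have "((\<lambda>t. - \<phi> (x - (t * h) *\<^sub>R b)) has_real_derivative h * \<psi> (x - (t * h) *\<^sub>R b)) (at t)"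
          using DERIV_minus[OF DERIV_chain2[OF 1 2]] by (simp add: mult.commute)
        then show "((\<lambda>t. - \<phi> (x - (t * h) *\<^sub>R b)) has_vector_derivative h * \<psi> (x - (t * h) *\<^sub>R b)) (at t within {0..1})"
          by (rule has_vector_derivative_at_within[OF has_real_derivative_iff_has_vector_derivative[THEN iffD1]])
      next
        have "continuous_on UNIV \<psi>" using test_deriv_continuous[OF \<phi> b] by (simp add: \<psi>_def[abs_def])
        moreover have "continuous_on {0..1} (\<lambda>t. x - (t * h) *\<^sub>R b)" by (intro continuous_intros)
        ultimately have "continuous_on {0..1} (\<lambda>t. \<psi> (x - (t * h) *\<^sub>R b))"
          by (rule continuous_on_compose2) simp
        then show "continuous_on {0..1} (\<lambda>t. h * \<psi> (x - (t * h) *\<^sub>R b))"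
          by (rule continuous_on_mult_left)
      qed simp
      then show ?thesis by (simp add: mult.left_commute)
    qed
    have i1: "integrable lebesgue (\<lambda>x. u x * \<phi> x)" by (rule test_integrable[OF lu \<phi>])
    have i2: "integrable lebesgue (\<lambda>x. u (x + h *\<^sub>R b) * \<phi> x)" by (rule test_integrable[OF locally_integrable_translate[OF lu] \<phi>])
    have i3: "integrable lebesgue (\<lambda>x. I x * \<phi> x)" by (rule test_integrable[OF lI \<phi>])
    have i4: "integrable lebesgue (\<lambda>x. u x * \<phi> (x - h *\<^sub>R b))" using integrable_translate[OF i2, of "- h *\<^sub>R b"] by simp
    have tr: "(\<integral>x. u (x + h *\<^sub>R b) * \<phi> x \<partial>lebesgue) = (\<integral>x. u x * \<phi> (x - h *\<^sub>R b) \<partial>lebesgue)"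
      using integral_translate[of "\<lambda>x. u (x + h *\<^sub>R b) * \<phi> x" "- h *\<^sub>R b"] i2 by simp
    have "h * (\<integral>x. I x * \<phi> x \<partial>lebesgue) = - (\<integral>x. u x * (\<phi> x - \<phi> (x - h *\<^sub>R b)) \<partial>lborel)"
      using 1 unfolding Il ftc .
    also have "(\<integral>x. u x * (\<phi> x - \<phi> (x - h *\<^sub>R b)) \<partial>lborel) = (\<integral>x. u x * (\<phi> x - \<phi> (x - h *\<^sub>R b)) \<partial>lebesgue)"
      by (rule integral_completion[symmetric]) measurable
    also have "\<dots> = (\<integral>x. u x * \<phi> x \<partial>lebesgue) - (\<integral>x. u (x + h *\<^sub>R b) * \<phi> x \<partial>lebesgue)"
      using i1 i4 by (simp add: right_diff_distrib tr)
    finally have "h * (\<integral>x. I x * \<phi> x \<partial>lebesgue) = (\<integral>x. u (x + h *\<^sub>R b) * \<phi> x \<partial>lebesgue) - (\<integral>x. u x * \<phi> x \<partial>lebesgue)" by simp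
    moreover have "((u (x + h *\<^sub>R b) - u x) - h * I x) * \<phi> x = u (x + h *\<^sub>R b) * \<phi> x - u x * \<phi> x - h * (I x * \<phi> x)" for x
      by (simp add: algebra_simps)
    ultimately show "(\<integral>x. ((u (x + h *\<^sub>R b) - u x) - h * I x) * \<phi> x \<partial>lebesgue) = 0"
      using i1 i2 i3 by simp
  qed
  then show "AE x in lebesgue. u (x + h *\<^sub>R b) - u x = h * (\<integral>t. indicator {0..1} t * g (x + (t * h) *\<^sub>R b) \<partial>lborel)"
    by (simp add: I_def)
qed

text \<open>Weak derivatives do not see null sets, and every Lebesgue measurable function agrees
  a.e. with a Borel one. This makes the integral formula for increments available in
  general.\<close>

lemma weak_pd_borel_rep:
  fixes u g :: "'a::euclidean_space \<Rightarrow> real"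
  assumes "weak_pd b u g" "b \<in> Basis"
  obtains u' g' where "u' \<in> borel_measurable borel" "g' \<in> borel_measurable borel" "weak_pd b u' g'"
    "AE x in lebesgue. u x = u' x" "AE x in lebesgue. g x = g' x"
proof -
  have "u \<in> borel_measurable lebesgue" "g \<in> borel_measurable lebesgue"
    using assms by (auto simp: weak_pd_def intro: locally_integrable_measurable)
  then obtain u' g' where *: "u' \<in> borel_measurable lborel" "AE x in lborel. u x = u' x"
     "g' \<in> borel_measurable lborel" "AE x in lborel. g x = g' x"
    using completion_ex_borel_measurable_real[of u lborel] completion_ex_borel_measurable_real[of g lborel] by blast
  show thesis
  proof (rule that)
    show u: "AE x in lebesgue. u x = u' x" and g: "AE x in lebesgue. g x = g' x"
      using * by (auto intro: AE_completion)
    show "weak_pd b u' g'"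
      by (rule weak_pd_cong[OF assms(1) u g assms(2)]) (use * in \<open>auto intro: measurable_completion\<close>)
  qed (use * in auto)
qed

text \<open>Absolute values go inside the integral formula; by Tonelli and translation invariance
  each slice then contributes the full integral of |g|. The inequality is stated in the extended
  reals because \<open>g\<close> is only locally integrable. It is the source of compactness later
  on.\<close>

lemma weak_pd_translation_L1:
  fixes u g :: "'a::euclidean_space \<Rightarrow> real"
  assumes "weak_pd b u g" "b \<in> Basis"
  shows "(\<integral>\<^sup>+x. ennreal \<bar>u (x + h *\<^sub>R b) - u x\<bar> \<partial>lebesgue) \<le> ennreal \<bar>h\<bar> * (\<integral>\<^sup>+x. ennreal \<bar>g x\<bar> \<partial>lebesgue)"
proof -
  obtain u' g' where m [measurable]: "u' \<in> borel_measurable borel" "g' \<in> borel_measurable borel" and wp: "weak_pd b u' g'"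
    and ae: "AE x in lebesgue. u x = u' x" "AE x in lebesgue. g x = g' x" by (rule weak_pd_borel_rep[OF assms])
  have "(\<integral>\<^sup>+x. ennreal \<bar>u (x + h *\<^sub>R b) - u x\<bar> \<partial>lebesgue) =
     (\<integral>\<^sup>+x. ennreal \<bar>h * (\<integral>t. indicator {0..1} t * g' (x + (t * h) *\<^sub>R b) \<partial>lborel)\<bar> \<partial>lebesgue)"
  proof (rule nn_integral_cong_AE)
    show "AE x in lebesgue. ennreal \<bar>u (x + h *\<^sub>R b) - u x\<bar> =
       ennreal \<bar>h * (\<integral>t. indicator {0..1} t * g' (x + (t * h) *\<^sub>R b) \<partial>lborel)\<bar>"
      using AE_translate[OF ae(1), of "h *\<^sub>R b"] ae(1) weak_pd_translation_borel(1)[OF wp assms(2) m, of h]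
      by eventually_elim simp
  qed
  also have "\<dots> = (\<integral>\<^sup>+x. ennreal \<bar>h * (\<integral>t. indicator {0..1} t * g' (x + (t * h) *\<^sub>R b) \<partial>lborel)\<bar> \<partial>lborel)"
    by (rule nn_integral_completion)
  also have "\<dots> \<le> (\<integral>\<^sup>+x. ennreal \<bar>h\<bar> * (\<integral>\<^sup>+t. indicator {0..1} t * ennreal \<bar>g' (x + (t * h) *\<^sub>R b)\<bar> \<partial>lborel) \<partial>lborel)"
  proof (rule nn_integral_mono)
    fix x
    have "ennreal \<bar>\<integral>t. indicator {0..1} t * g' (x + (t * h) *\<^sub>R b) \<partial>lborel\<bar> \<le> (\<integral>\<^sup>+t. ennreal \<bar>indicator {0..1} t * g' (x + (t * h) *\<^sub>R b)\<bar> \<partial>lborel)"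
      by (rule nn_abs_integral_le)
    also have "\<dots> = (\<integral>\<^sup>+t. indicator {0..1} t * ennreal \<bar>g' (x + (t * h) *\<^sub>R b)\<bar> \<partial>lborel)"
      by (intro nn_integral_cong) (auto simp: indicator_def)
    finally show "ennreal \<bar>h * (\<integral>t. indicator {0..1} t * g' (x + (t * h) *\<^sub>R b) \<partial>lborel)\<bar> \<le>
       ennreal \<bar>h\<bar> * (\<integral>\<^sup>+t. indicator {0..1} t * ennreal \<bar>g' (x + (t * h) *\<^sub>R b)\<bar> \<partial>lborel)"
      by (simp add: abs_mult ennreal_mult' mult_left_mono)
  qed
  also have "\<dots> = ennreal \<bar>h\<bar> * (\<integral>\<^sup>+x. (\<integral>\<^sup>+t. indicator {0..1} t * ennreal \<bar>g' (x + (t * h) *\<^sub>R b)\<bar> \<partial>lborel) \<partial>lborel)"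
    by (rule nn_integral_cmult) measurable
  also have "(\<integral>\<^sup>+x. (\<integral>\<^sup>+t. indicator {0..1} t * ennreal \<bar>g' (x + (t * h) *\<^sub>R b)\<bar> \<partial>lborel) \<partial>lborel) =
    (\<integral>\<^sup>+t. (\<integral>\<^sup>+x. indicator {0..1} t * ennreal \<bar>g' (x + (t * h) *\<^sub>R b)\<bar> \<partial>lborel) \<partial>lborel)"
    by (rule lborel_pair.Fubini') measurable
  also have "\<dots> = (\<integral>\<^sup>+t. (\<integral>\<^sup>+x. ennreal \<bar>g' x\<bar> \<partial>lborel) * indicator {0..1::real} t \<partial>lborel)"
    using nn_integral_translate_borel[of "\<lambda>x. ennreal \<bar>g' x\<bar>"] by (simp add: nn_integral_cmult mult.commute)
  also have "\<dots> = (\<integral>\<^sup>+x. ennreal \<bar>g' x\<bar> \<partial>lborel)" by (subst nn_integral_cmult_indicator) auto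
  also have "\<dots> = (\<integral>\<^sup>+x. ennreal \<bar>g' x\<bar> \<partial>lebesgue)" by (simp add: nn_integral_completion)
  also have "\<dots> = (\<integral>\<^sup>+x. ennreal \<bar>g x\<bar> \<partial>lebesgue)"
  proof (rule nn_integral_cong_AE)
    show "AE x in lebesgue. ennreal \<bar>g' x\<bar> = ennreal \<bar>g x\<bar>" using ae(2) by eventually_elim simp
  qed
  finally show ?thesis .
qed

lemma L1c_eq_nn:
  fixes f :: "'a::euclidean_space \<Rightarrow> real"
  assumes "locally_integrable f"
  shows "ennreal (L1c R f) = (\<integral>\<^sup>+x. ennreal (\<bar>f x\<bar> * indicator (cball 0 R) x) \<partial>lebesgue)"
  using L1c_integrable[OF assms] by (subst nn_integral_eq_integral) auto

text \<open>The converse of \<open>weak_pd_from_quotients\<close>. The quotient minus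
  \<open>g\<close> is an average over t in [0,1] of the differences g(x + t s b) - g(x), and these
  are small in local \<open>L^1\<close> by continuity of translations.\<close>

lemma weak_pd_quotient:
  fixes u g :: "'a::euclidean_space \<Rightarrow> real"
  assumes "weak_pd b u g" "b \<in> Basis" "h \<longlonglongrightarrow> 0" "\<And>n::nat. h n \<noteq> 0"
  shows "(\<lambda>n. L1c R (\<lambda>x. (u (x + h n *\<^sub>R b) - u x) / h n - g x)) \<longlonglongrightarrow> 0"
proof -
  obtain u' g' where m [measurable]: "u' \<in> borel_measurable borel" "g' \<in> borel_measurable borel" and wp: "weak_pd b u' g'"
    and ae: "AE x in lebesgue. u x = u' x" "AE x in lebesgue. g x = g' x" by (rule weak_pd_borel_rep[OF assms(1,2)])
  have lu: "locally_integrable u" and lg: "locally_integrable g" and lg': "locally_integrable g'"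
    using assms(1) wp by (auto simp: weak_pd_def)
  have key: "L1c R (\<lambda>x. (u (x + s *\<^sub>R b) - u x) / s - g x) \<le> \<epsilon>"
    if \<epsilon>: "\<epsilon> > 0" and d: "\<And>z. norm z < d \<Longrightarrow> L1c R (\<lambda>x. g' (x + z) - g' x) \<le> \<epsilon>" and s: "\<bar>s\<bar> < d" "s \<noteq> 0" for \<epsilon> d s
  proof -
    have l: "locally_integrable (\<lambda>x. (u (x + s *\<^sub>R b) - u x) / s - g x)"
      using locally_integrable_diff[OF locally_integrable_cmult[OF locally_integrable_diff[OF locally_integrable_translate[OF lu] lu], of "1/s"] lg]
      by simp
    have "ennreal (L1c R (\<lambda>x. (u (x + s *\<^sub>R b) - u x) / s - g x)) =
       (\<integral>\<^sup>+x. ennreal (\<bar>(u (x + s *\<^sub>R b) - u x) / s - g x\<bar> * indicator (cball 0 R) x) \<partial>lebesgue)"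
      by (rule L1c_eq_nn[OF l])
    also have "\<dots> = (\<integral>\<^sup>+x. ennreal (\<bar>(\<integral>t. indicator {0..1} t * g' (x + (t * s) *\<^sub>R b) \<partial>lborel) - g' x\<bar> * indicator (cball 0 R) x) \<partial>lebesgue)"
    proof (rule nn_integral_cong_AE)
      show "AE x in lebesgue. ennreal (\<bar>(u (x + s *\<^sub>R b) - u x) / s - g x\<bar> * indicator (cball 0 R) x) =
        ennreal (\<bar>(\<integral>t. indicator {0..1} t * g' (x + (t * s) *\<^sub>R b) \<partial>lborel) - g' x\<bar> * indicator (cball 0 R) x)"
        using AE_translate[OF ae(1), of "s *\<^sub>R b"] ae weak_pd_translation_borel(1)[OF wp assms(2) m, of s]
        by eventually_elim (use s in simp)
    qed
    also have "\<dots> = (\<integral>\<^sup>+x. ennreal (\<bar>(\<integral>t. indicator {0..1} t * g' (x + (t * s) *\<^sub>R b) \<partial>lborel) - g' x\<bar> * indicator (cball 0 R) x) \<partial>lborel)"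
      by (rule nn_integral_completion)
    also have "\<dots> \<le> (\<integral>\<^sup>+x. (\<integral>\<^sup>+t. indicator {0..1} t * ennreal (\<bar>g' (x + (t * s) *\<^sub>R b) - g' x\<bar> * indicator (cball 0 R) x) \<partial>lborel) \<partial>lborel)"
    proof (rule nn_integral_mono_AE)
      show "AE x in lborel. ennreal (\<bar>(\<integral>t. indicator {0..1} t * g' (x + (t * s) *\<^sub>R b) \<partial>lborel) - g' x\<bar> * indicator (cball 0 R) x) \<le>
        (\<integral>\<^sup>+t. indicator {0..1} t * ennreal (\<bar>g' (x + (t * s) *\<^sub>R b) - g' x\<bar> * indicator (cball 0 R) x) \<partial>lborel)"
        using weak_pd_translation_borel(2)[OF wp assms(2) m, of s]
      proof eventually_elim
        case (elim x)
        have i: "integrable lborel (\<lambda>t. indicator {0..1::real} t * g' x)" by simp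
        have "(\<integral>t. indicator {0..1} t * g' (x + (t * s) *\<^sub>R b) \<partial>lborel) - g' x =
            (\<integral>t. indicator {0..1} t * g' (x + (t * s) *\<^sub>R b) \<partial>lborel) - (\<integral>t. indicator {0..1::real} t * g' x \<partial>lborel)" by simp
        also have "\<dots> = (\<integral>t. indicator {0..1} t * g' (x + (t * s) *\<^sub>R b) - indicator {0..1::real} t * g' x \<partial>lborel)"
          by (rule Bochner_Integration.integral_diff[OF elim i, symmetric])
        finally have "ennreal \<bar>(\<integral>t. indicator {0..1} t * g' (x + (t * s) *\<^sub>R b) \<partial>lborel) - g' x\<bar> \<le>
           (\<integral>\<^sup>+t. ennreal \<bar>indicator {0..1} t * g' (x + (t * s) *\<^sub>R b) - indicator {0..1::real} t * g' x\<bar> \<partial>lborel)"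
          by (simp only: nn_abs_integral_le)
        also have "\<dots> = (\<integral>\<^sup>+t. indicator {0..1} t * ennreal \<bar>g' (x + (t * s) *\<^sub>R b) - g' x\<bar> \<partial>lborel)"
          by (intro nn_integral_cong) (auto simp: indicator_def)
        finally show ?case by (auto simp: indicator_def)
      qed
    qed
    also have "\<dots> = (\<integral>\<^sup>+t. (\<integral>\<^sup>+x. indicator {0..1} t * ennreal (\<bar>g' (x + (t * s) *\<^sub>R b) - g' x\<bar> * indicator (cball 0 R) x) \<partial>lborel) \<partial>lborel)"
      by (rule lborel_pair.Fubini') measurable
    also have "\<dots> \<le> (\<integral>\<^sup>+t. ennreal \<epsilon> * indicator {0..1::real} t \<partial>lborel)"
    proof (rule nn_integral_mono)
      fix t :: real
      show "(\<integral>\<^sup>+x. indicator {0..1} t * ennreal (\<bar>g' (x + (t * s) *\<^sub>R b) - g' x\<bar> * indicator (cball 0 R) x) \<partial>lborel) \<le> ennreal \<epsilon> * indicator {0..1} t"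
      proof (cases "t \<in> {0..1}")
        case True
        have "\<bar>t * s\<bar> \<le> \<bar>s\<bar>" using True by (simp add: abs_mult mult_left_le_one_le)
        then have "L1c R (\<lambda>x. g' (x + (t * s) *\<^sub>R b) - g' x) \<le> \<epsilon>"
          using s assms(2) by (intro d) simp
        moreover have "ennreal (L1c R (\<lambda>x. g' (x + (t * s) *\<^sub>R b) - g' x)) =
           (\<integral>\<^sup>+x. ennreal (\<bar>g' (x + (t * s) *\<^sub>R b) - g' x\<bar> * indicator (cball 0 R) x) \<partial>lborel)"
          by (subst L1c_eq_nn[OF locally_integrable_diff[OF locally_integrable_translate[OF lg'] lg']]) (simp add: nn_integral_completion)
        ultimately have "(\<integral>\<^sup>+x. ennreal (\<bar>g' (x + (t * s) *\<^sub>R b) - g' x\<bar> * indicator (cball 0 R) x) \<partial>lborel) \<le> ennreal \<epsilon>"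
          by (metis ennreal_leI)
        then show ?thesis using True by simp
      qed simp
    qed
    also have "\<dots> = ennreal \<epsilon>" by (subst nn_integral_cmult_indicator) auto
    finally show ?thesis using \<epsilon> by (simp add: ennreal_le_iff)
  qed
  show ?thesis
  proof (rule LIMSEQ_I)
    fix r :: real assume "r > 0"
    obtain d where d: "d > 0" "\<And>z. norm z < d \<Longrightarrow> L1c R (\<lambda>x. g' (x + z) - g' x) \<le> r/2"
      using translation_continuous[OF lg', of "r/2" R] \<open>r > 0\<close> by auto
    obtain N where N: "\<And>n. n \<ge> N \<Longrightarrow> \<bar>h n\<bar> < d" using LIMSEQ_D[OF assms(3) d(1)] by auto
    have "norm (L1c R (\<lambda>x. (u (x + h n *\<^sub>R b) - u x) / h n - g x) - 0) < r" if "n \<ge> N" for n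
    proof -
      have "L1c R (\<lambda>x. (u (x + h n *\<^sub>R b) - u x) / h n - g x) \<le> r/2"
        by (rule key[OF _ d(2) N[OF that] assms(4)]) (use \<open>r > 0\<close> in auto)
      moreover have "L1c R (\<lambda>x. (u (x + h n *\<^sub>R b) - u x) / h n - g x) \<ge> 0" by (intro integral_nonneg_AE) auto
      ultimately show ?thesis using \<open>r > 0\<close> by simp
    qed
    then show "\<exists>N. \<forall>n\<ge>N. norm (L1c R (\<lambda>x. (u (x + h n *\<^sub>R b) - u x) / h n - g x) - 0) < r" by blast
  qed
qed

section \<open>Calculus of weak gradients\<close>

lemma L1c_nonneg: "L1c R f \<ge> 0"
  by (intro integral_nonneg_AE) auto

text \<open>\<sigma> is the sign of the steps. Where u = 0 the quotient of |u| with step h equals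
  sgn(h) times the modulus of the quotient of u, so it tends to \<sigma>|g|; where u is nonzero its
  sign is eventually constant along the steps. Either sign produces a weak derivative of the same
  function.\<close>

lemma weak_pd_abs_sided:
  fixes u g :: "'a::euclidean_space \<Rightarrow> real"
  assumes wp: "weak_pd b u g" and b: "b \<in> Basis" and \<sigma>: "\<sigma> = 1 \<or> \<sigma> = -1"
  shows "weak_pd b (\<lambda>x. \<bar>u x\<bar>) (\<lambda>x. if u x = 0 then \<sigma> * \<bar>g x\<bar> else sgn (u x) * g x)"
proof -
  define s where "s x = (if u x = 0 then \<sigma> * \<bar>g x\<bar> else sgn (u x) * g x)" for x
  have lu: "locally_integrable u" and lg: "locally_integrable g" using wp by (auto simp: weak_pd_def)
  have mu: "u \<in> borel_measurable lebesgue" and mg: "g \<in> borel_measurable lebesgue"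
    using lu lg by (auto intro: locally_integrable_measurable)
  have abs_s: "\<bar>s x\<bar> = \<bar>g x\<bar>" for x using \<sigma> by (auto simp: s_def abs_mult sgn_if)
  have ls: "locally_integrable s"
  proof (rule locally_integrable_bound[OF lg])
    show "s \<in> borel_measurable lebesgue" unfolding s_def[abs_def] using mu mg by measurable
  qed (simp add: abs_s)
  have "weak_pd b (\<lambda>x. \<bar>u x\<bar>) s"
  proof (rule weak_pd_from_quotients[OF locally_integrable_abs[OF lu] ls b])
    fix R :: real
    define k where "k n = \<sigma> / real (Suc n)" for n
    have k0: "k \<longlonglongrightarrow> 0" and kn: "k n \<noteq> 0" for n
      unfolding k_def using \<sigma> tendsto_mult_right_zero[OF LIMSEQ_inverse_real_of_nat, of \<sigma>]
      by (auto simp: divide_inverse)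
    define D where "D h x = (u (x + h *\<^sub>R b) - u x) / h" for h x
    define E where "E h x = (\<bar>u (x + h *\<^sub>R b)\<bar> - \<bar>u x\<bar>) / h" for h x
    have lD: "locally_integrable (\<lambda>x. D h x - g x)" for h
      using locally_integrable_diff[OF locally_integrable_cmult[OF locally_integrable_diff[OF locally_integrable_translate[OF lu] lu], of "1/h"] lg]
      by (simp add: D_def)
    have lE: "locally_integrable (\<lambda>x. E h x - s x)" for h
      using locally_integrable_diff[OF locally_integrable_cmult[OF locally_integrable_diff[OF locally_integrable_translate[OF locally_integrable_abs[OF lu]] locally_integrable_abs[OF lu]], of "1/h"] ls]
      by (simp add: E_def)
    have conv: "(\<lambda>n. L1c R (\<lambda>x. D (k n) x - g x)) \<longlonglongrightarrow> 0"
      unfolding D_def by (rule weak_pd_quotient[OF wp b k0 kn])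
    \<comment> \<open>The quotients of \<open>u\<close> converge only in \<open>L^1\<close> on the
      ball, while the case distinction on the sign of \<open>u\<close> is pointwise. The subsequence
      depends on \<open>R\<close>, as \<open>weak_pd_from_quotients\<close> permits.\<close>
    have "\<exists>r::nat\<Rightarrow>nat. strict_mono r \<and> (AE x in lebesgue. (\<lambda>n. (D (k (r n)) x - g x) * indicator (cball 0 R) x) \<longlonglongrightarrow> 0)"
    proof (rule tendsto_L1_AE_subseq)
      show "integrable lebesgue (\<lambda>x. (D (k n) x - g x) * indicator (cball 0 R) x)" for n
        by (rule integrable_cball[OF lD])
      show "(\<lambda>n. \<integral>x. norm ((D (k n) x - g x) * indicator (cball 0 R) x) \<partial>lebesgue) \<longlonglongrightarrow> 0"
        using conv by (simp add: abs_mult)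
    qed
    then obtain r :: "nat \<Rightarrow> nat" where r: "strict_mono r"
      and ae: "AE x in lebesgue. (\<lambda>n. (D (k (r n)) x - g x) * indicator (cball 0 R) x) \<longlonglongrightarrow> 0" by blast
    define h where "h = k \<circ> r"
    have h0: "h \<longlonglongrightarrow> 0" unfolding h_def by (rule LIMSEQ_subseq_LIMSEQ[OF k0 r])
    have hn: "h n \<noteq> 0" for n using kn by (simp add: h_def)
    have hs: "h n = \<sigma> * \<bar>h n\<bar>" for n using \<sigma> by (auto simp: h_def k_def abs_if)
    define e F where "e n x = \<bar>D (h n) x - g x\<bar> * indicator (cball 0 R) x"
      and "F n x = \<bar>E (h n) x - s x\<bar> * indicator (cball 0 R) x" for n x
    have ie: "integrable lebesgue (e n)" and iF: "integrable lebesgue (F n)" for n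
      unfolding e_def F_def using L1c_integrable[OF lD] L1c_integrable[OF lE] by auto
    have e0: "(\<lambda>n. \<integral>x. e n x \<partial>lebesgue) \<longlonglongrightarrow> 0"
      using LIMSEQ_subseq_LIMSEQ[OF conv r] by (simp add: e_def h_def o_def)
    have ED: "\<bar>E h x\<bar> \<le> \<bar>D h x\<bar>" for h x
      unfolding E_def D_def by (simp add: abs_divide divide_right_mono)
    \<comment> \<open>A generalised dominated convergence: no integrable majorant of the quotients
      is at hand, but the error for |u| exceeds the error for u by at most 2|g|. The positive part
      of the excess is thus dominated, and the remaining error is known to vanish in
      \<open>L^1\<close>.\<close>
    have Fe: "F n x \<le> e n x + 2 * (\<bar>g x\<bar> * indicator (cball 0 R) x)" for n x
      using ED[of "h n" x] abs_s[of x] by (auto simp: F_def e_def indicator_def)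
    have ptw: "AE x in lebesgue. (\<lambda>n. max (F n x - e n x) 0) \<longlonglongrightarrow> 0"
      using ae
    proof eventually_elim
      case (elim x)
      show ?case
      proof (cases "x \<in> cball 0 R")
        case True
        then have "(\<lambda>n. D (h n) x - g x) \<longlonglongrightarrow> 0" using elim by (simp add: h_def o_def)
        then have Dg: "(\<lambda>n. D (h n) x) \<longlonglongrightarrow> g x" by (simp add: LIM_zero_iff)
        have ueq: "u (x + h n *\<^sub>R b) = u x + h n * D (h n) x" for n using hn by (simp add: D_def)
        have "(\<lambda>n. u x + h n * D (h n) x) \<longlonglongrightarrow> u x + 0 * g x"
          by (intro tendsto_intros h0 Dg)
        then have ul: "(\<lambda>n. u (x + h n *\<^sub>R b)) \<longlonglongrightarrow> u x" by (simp add: ueq)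
        have Es: "(\<lambda>n. E (h n) x) \<longlonglongrightarrow> s x"
        proof -
          consider "u x > 0" | "u x < 0" | "u x = 0" by linarith
          then show ?thesis
          proof cases
            case 1
            have "\<forall>\<^sub>F n in sequentially. u (x + h n *\<^sub>R b) > 0" using order_tendstoD(1)[OF ul 1] .
            then have "\<forall>\<^sub>F n in sequentially. D (h n) x = E (h n) x"
              by eventually_elim (use 1 in \<open>simp add: D_def E_def\<close>)
            then show ?thesis using Lim_transform_eventually[OF Dg] 1 by (simp add: s_def)
          next
            case 2
            have "\<forall>\<^sub>F n in sequentially. u (x + h n *\<^sub>R b) < 0" using order_tendstoD(2)[OF ul 2] .
            then have "\<forall>\<^sub>F n in sequentially. - D (h n) x = E (h n) x"
              by eventually_elim (use 2 in \<open>simp add: D_def E_def diff_divide_distrib\<close>)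
            then show ?thesis using Lim_transform_eventually[OF tendsto_minus[OF Dg]] 2 by (simp add: s_def)
          next
            case 3
            have "E (h n) x = \<sigma> * \<bar>D (h n) x\<bar>" for n
              using \<sigma> hs[of n] hn[of n] 3 by (auto simp: E_def D_def abs_divide field_simps)
            then show ?thesis using tendsto_mult_left[OF tendsto_rabs[OF Dg], of \<sigma>] 3 by (simp add: s_def)
          qed
        qed
        have "(\<lambda>n. max (\<bar>E (h n) x - s x\<bar> - \<bar>D (h n) x - g x\<bar>) 0) \<longlonglongrightarrow> max (\<bar>s x - s x\<bar> - \<bar>g x - g x\<bar>) 0"
          by (intro tendsto_intros Es Dg)
        then show ?thesis using True by (simp add: F_def e_def)
      qed (simp add: F_def e_def)
    qed
    have "(\<lambda>n. \<integral>x. max (F n x - e n x) 0 \<partial>lebesgue) \<longlonglongrightarrow> (\<integral>x. 0 \<partial>(lebesgue::'a measure))"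
    proof (rule integral_dominated_convergence)
      show "integrable lebesgue (\<lambda>x. 2 * (\<bar>g x\<bar> * indicator (cball 0 R) x))" using L1c_integrable[OF lg] by simp
      show "(\<lambda>x. max (F n x - e n x) 0) \<in> borel_measurable lebesgue" for n
        using borel_measurable_integrable[OF ie] borel_measurable_integrable[OF iF] by measurable
      show "AE x in lebesgue. norm (max (F n x - e n x) 0) \<le> 2 * (\<bar>g x\<bar> * indicator (cball 0 R) x)" for n
        using Fe[of n] by (intro AE_I2) (auto simp: max_def algebra_simps)
    qed (use ptw in auto)
    then have T: "(\<lambda>n. (\<integral>x. max (F n x - e n x) 0 \<partial>lebesgue) + (\<integral>x. e n x \<partial>lebesgue)) \<longlonglongrightarrow> 0"
      using tendsto_add[OF _ e0] by fastforce
    have U: "L1c R (\<lambda>x. E (h n) x - s x) \<le> (\<integral>x. max (F n x - e n x) 0 \<partial>lebesgue) + (\<integral>x. e n x \<partial>lebesgue)" for n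
    proof -
      have im: "integrable lebesgue (\<lambda>x. max (F n x - e n x) 0)" using ie iF by auto
      have "(\<integral>x. F n x \<partial>lebesgue) \<le> (\<integral>x. max (F n x - e n x) 0 + e n x \<partial>lebesgue)"
        using ie iF im by (intro integral_mono) auto
      then show ?thesis using im ie by (simp add: F_def)
    qed
    have "(\<lambda>n. L1c R (\<lambda>x. E (h n) x - s x)) \<longlonglongrightarrow> 0"
    proof (rule tendsto_sandwich[OF _ _ tendsto_const T])
      show "\<forall>\<^sub>F n in sequentially. 0 \<le> L1c R (\<lambda>x. E (h n) x - s x)"
        by (rule always_eventually, rule allI, rule L1c_nonneg)
      show "\<forall>\<^sub>F n in sequentially. L1c R (\<lambda>x. E (h n) x - s x) \<le>
         (\<integral>x. max (F n x - e n x) 0 \<partial>lebesgue) + (\<integral>x. e n x \<partial>lebesgue)"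
        by (rule always_eventually, rule allI, rule U)
    qed
    then show "\<exists>h. h \<longlonglongrightarrow> 0 \<and> (\<forall>n::nat. h n \<noteq> 0) \<and>
       (\<lambda>n. L1c R (\<lambda>x. (\<bar>u (x + h n *\<^sub>R b)\<bar> - \<bar>u x\<bar>) / h n - s x)) \<longlonglongrightarrow> 0"
      using h0 hn by (auto simp: E_def)
  qed
  then show ?thesis by (simp add: s_def[abs_def])
qed

text \<open>The derivatives of |u| obtained from positive and from negative steps agree a.e. by
  uniqueness, so |g| = -|g| almost everywhere on the zero set of \<open>u\<close>.\<close>

lemma
  fixes u g :: "'a::euclidean_space \<Rightarrow> real"
  assumes wp: "weak_pd b u g" and b: "b \<in> Basis"
  shows weak_pd_zero_set: "AE x in lebesgue. u x = 0 \<longrightarrow> g x = 0"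
    and weak_pd_abs: "weak_pd b (\<lambda>x. \<bar>u x\<bar>) (\<lambda>x. sgn (u x) * g x)"
proof -
  have lu: "locally_integrable u" and lg: "locally_integrable g" using wp by (auto simp: weak_pd_def)
  have mu: "u \<in> borel_measurable lebesgue" and mg: "g \<in> borel_measurable lebesgue"
    using lu lg by (auto intro: locally_integrable_measurable)
  have 1: "weak_pd b (\<lambda>x. \<bar>u x\<bar>) (\<lambda>x. if u x = 0 then 1 * \<bar>g x\<bar> else sgn (u x) * g x)"
    and 2: "weak_pd b (\<lambda>x. \<bar>u x\<bar>) (\<lambda>x. if u x = 0 then -1 * \<bar>g x\<bar> else sgn (u x) * g x)"
    by (rule weak_pd_abs_sided[OF wp b]; simp)+
  show z: "AE x in lebesgue. u x = 0 \<longrightarrow> g x = 0"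
    using weak_pd_unique[OF 1 2] by eventually_elim auto
  show "weak_pd b (\<lambda>x. \<bar>u x\<bar>) (\<lambda>x. sgn (u x) * g x)"
  proof (rule weak_pd_cong[OF 1 _ _ b])
    show "AE x in lebesgue. (if u x = 0 then 1 * \<bar>g x\<bar> else sgn (u x) * g x) = sgn (u x) * g x"
      using z by eventually_elim auto
  qed (use mu mg in auto)
qed

lemma weak_gradient_eq_AE:
  fixes G H :: "'a::euclidean_space \<Rightarrow> 'a"
  assumes "\<And>b. b \<in> Basis \<Longrightarrow> AE x in lebesgue. G x \<bullet> b = H x \<bullet> b"
  shows "AE x in lebesgue. G x = H x"
proof -
  have "AE x in lebesgue. \<forall>b\<in>Basis. G x \<bullet> b = H x \<bullet> b"
    using assms by (intro AE_finite_allI) auto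
  then show ?thesis by eventually_elim (auto intro: euclidean_eqI)
qed

lemma has_weak_gradient_unique:
  assumes "has_weak_gradient u G" "has_weak_gradient u H"
  shows "AE x in lebesgue. G x = H x"
  using assms by (intro weak_gradient_eq_AE) (auto simp: has_weak_gradient_iff intro: weak_pd_unique)

lemma has_weak_gradient_cong:
  assumes "has_weak_gradient u G" "AE x in lebesgue. u x = v x" "AE x in lebesgue. G x = H x"
    "v \<in> borel_measurable lebesgue" "H \<in> borel_measurable lebesgue"
  shows "has_weak_gradient v H"
  unfolding has_weak_gradient_iff
proof (intro conjI ballI)
  show "locally_integrable v"
    by (rule locally_integrable_bound[of u]) (use assms in \<open>auto simp: has_weak_gradient_iff\<close>)
  show "locally_integrable H"
    by (rule locally_integrable_bound[of G]) (use assms in \<open>auto simp: has_weak_gradient_iff\<close>)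
  fix b :: 'a assume b: "b \<in> Basis"
  have "weak_pd b u (\<lambda>x. G x \<bullet> b)" using assms b by (auto simp: has_weak_gradient_iff)
  then show "weak_pd b v (\<lambda>x. H x \<bullet> b)"
    by (rule weak_pd_cong) (use assms b in auto)
qed

lemma has_weak_gradient_lincomb:
  assumes "has_weak_gradient u G" "has_weak_gradient v H"
  shows "has_weak_gradient (\<lambda>x. s * u x + t * v x) (\<lambda>x. s *\<^sub>R G x + t *\<^sub>R H x)"
  using assms
  by (auto simp: has_weak_gradient_iff inner_add_left intro!: locally_integrable_add locally_integrable_cmult
      locally_integrable_scaleR weak_pd_lincomb)

lemma has_weak_gradient_abs:
  assumes "has_weak_gradient u G"
  shows "has_weak_gradient (\<lambda>x. \<bar>u x\<bar>) (\<lambda>x. sgn (u x) *\<^sub>R G x)"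
    and has_weak_gradient_zero_set: "AE x in lebesgue. u x = 0 \<longrightarrow> G x = 0"
proof -
  have l: "locally_integrable u" "locally_integrable G" and w: "b \<in> Basis \<Longrightarrow> weak_pd b u (\<lambda>x. G x \<bullet> b)" for b
    using assms by (auto simp: has_weak_gradient_iff)
  have m: "u \<in> borel_measurable lebesgue" "G \<in> borel_measurable lebesgue"
    using l by (auto intro: locally_integrable_measurable)
  have "locally_integrable (\<lambda>x. sgn (u x) *\<^sub>R G x)"
    by (rule locally_integrable_bound[OF l(2)]) (use m in \<open>auto simp: sgn_if\<close>)
  then show "has_weak_gradient (\<lambda>x. \<bar>u x\<bar>) (\<lambda>x. sgn (u x) *\<^sub>R G x)"
    using l weak_pd_abs[OF w] by (auto simp: has_weak_gradient_iff intro: locally_integrable_abs)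
  have "AE x in lebesgue. \<forall>b\<in>Basis. u x = 0 \<longrightarrow> G x \<bullet> b = 0"
    using weak_pd_zero_set[OF w] by (intro AE_finite_allI) auto
  then show "AE x in lebesgue. u x = 0 \<longrightarrow> G x = 0"
    by eventually_elim (auto intro: euclidean_eqI)
qed

section \<open>Products with smooth functions and limits in local \<open>L^1\<close>\<close>

definition grad :: "('a::euclidean_space \<Rightarrow> real) \<Rightarrow> 'a \<Rightarrow> 'a" where
  "grad \<eta> x = (\<Sum>b\<in>Basis. frechet_derivative \<eta> (at x) b *\<^sub>R b)"

lemma grad_inner: "b \<in> Basis \<Longrightarrow> grad \<eta> x \<bullet> b = frechet_derivative \<eta> (at x) b"
  by (simp add: grad_def inner_sum_left inner_Basis if_distrib cong: if_cong)

lemma smooth_continuous: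
  assumes "\<And>k. Ck k \<eta>"
  shows "continuous_on UNIV \<eta>" "b \<in> Basis \<Longrightarrow> continuous_on UNIV (\<lambda>x. frechet_derivative \<eta> (at x) b)"
    "continuous_on UNIV (grad \<eta>)" "\<eta> differentiable (at x)"
proof -
  show 1: "b \<in> Basis \<Longrightarrow> continuous_on UNIV (\<lambda>x. frechet_derivative \<eta> (at x) b)" for b
    using assms[of 1] by simp
  show "continuous_on UNIV \<eta>" using assms[of 0] by simp
  show "continuous_on UNIV (grad \<eta>)" unfolding grad_def[abs_def] using 1 by (intro continuous_intros) auto
  show "\<eta> differentiable (at x)" using assms[of 1] by simp
qed

lemma continuous_lebesgue_measurable:
  fixes f :: "'a::euclidean_space \<Rightarrow> 'b::topological_space"
  shows "continuous_on UNIV f \<Longrightarrow> f \<in> borel_measurable lebesgue"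
  by (simp add: borel_measurable_continuous_onI measurable_completion)

lemma locally_integrable_continuous_scaleR:
  fixes f :: "'a::euclidean_space \<Rightarrow> real" and g :: "'a \<Rightarrow> 'c::real_normed_vector" and h :: "'a \<Rightarrow> 'b::euclidean_space"
  assumes "locally_integrable f" "continuous_on UNIV g" "h \<in> borel_measurable lebesgue" "\<And>x. norm (h x) \<le> \<bar>f x\<bar> * norm (g x)"
  shows "locally_integrable h"
proof (rule locally_integrableI)
  fix n :: nat
  have "compact ((\<lambda>x. norm (g x)) ` cball 0 (real n))"
    using assms(2) by (intro compact_continuous_image continuous_intros) (auto intro: continuous_on_subset)
  then obtain B where B: "\<And>x. x \<in> cball 0 (real n) \<Longrightarrow> norm (g x) \<le> B"
    by (metis (no_types, lifting) bounded_real compact_imp_bounded image_eqI abs_norm_cancel)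
  show "set_integrable lebesgue (cball 0 (real n)) h"
    unfolding set_integrable_def
  proof (rule Bochner_Integration.integrable_bound)
    show "integrable lebesgue (\<lambda>x. (f x * indicator (cball 0 (real n)) x) * B)" using integrable_cball[OF assms(1)] by simp
    show "(\<lambda>x. indicat_real (cball 0 (real n)) x *\<^sub>R h x) \<in> borel_measurable lebesgue"
      using assms(3) by (intro borel_measurable_scaleR borel_measurable_indicator) auto
    show "AE x in lebesgue. norm (indicat_real (cball 0 (real n)) x *\<^sub>R h x) \<le> norm ((f x * indicator (cball 0 (real n)) x) * B)"
    proof (rule AE_I2)
      fix x
      show "norm (indicat_real (cball 0 (real n)) x *\<^sub>R h x) \<le> norm ((f x * indicator (cball 0 (real n)) x) * B)"
      proof (cases "x \<in> cball 0 (real n)")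
        case True
        have "norm (h x) \<le> \<bar>f x\<bar> * \<bar>B\<bar>"
          using assms(4)[of x] mult_left_mono[OF B[OF True], of "\<bar>f x\<bar>"] mult_left_mono[OF abs_ge_self[of B], of "\<bar>f x\<bar>"] by simp
        then show ?thesis using True by (simp add: abs_mult)
      qed simp
    qed
  qed
qed

text \<open>The product \<eta>\<phi> is again a test function for \<open>u\<close>, and the
  classical product rule for it is the claim rearranged.\<close>

lemma has_weak_gradient_mult_smooth:
  fixes u \<eta> :: "'a::euclidean_space \<Rightarrow> real"
  assumes "has_weak_gradient u G" and \<eta>: "\<And>k. Ck k \<eta>"
  shows "has_weak_gradient (\<lambda>x. \<eta> x * u x) (\<lambda>x. \<eta> x *\<^sub>R G x + u x *\<^sub>R grad \<eta> x)"
proof -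
  have l: "locally_integrable u" "locally_integrable G" and w: "b \<in> Basis \<Longrightarrow> weak_pd b u (\<lambda>x. G x \<bullet> b)" for b
    using assms by (auto simp: has_weak_gradient_iff)
  have m: "u \<in> borel_measurable lebesgue" "G \<in> borel_measurable lebesgue"
    using l by (auto intro: locally_integrable_measurable)
  have mn: "\<eta> \<in> borel_measurable lebesgue" "grad \<eta> \<in> borel_measurable lebesgue"
    using smooth_continuous(1,3)[OF \<eta>] by (auto intro: continuous_lebesgue_measurable)
  have l1: "locally_integrable (\<lambda>x. \<eta> x * u x)"
    by (rule locally_integrable_continuous_scaleR[OF l(1) smooth_continuous(1)[OF \<eta>]]) (use m mn in \<open>auto simp: abs_mult\<close>)
  have l2: "locally_integrable (\<lambda>x. \<eta> x *\<^sub>R G x)"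
  proof (rule locally_integrable_continuous_scaleR[OF _ smooth_continuous(1)[OF \<eta>]])
    show "locally_integrable (\<lambda>x. norm (G x))" by (rule locally_integrable_bound[OF l(2)]) (use m in auto)
  qed (use m mn in auto)
  have l3: "locally_integrable (\<lambda>x. u x *\<^sub>R grad \<eta> x)"
    by (rule locally_integrable_continuous_scaleR[OF l(1) smooth_continuous(3)[OF \<eta>]]) (use m mn in auto)
  show ?thesis
    unfolding has_weak_gradient_iff
  proof (intro conjI ballI l1 locally_integrable_add l2 l3)
    fix b :: 'a assume b: "b \<in> Basis"
    let ?d = "\<lambda>\<phi> x. frechet_derivative \<phi> (at x) b"
    show "weak_pd b (\<lambda>x. \<eta> x * u x) (\<lambda>x. (\<eta> x *\<^sub>R G x + u x *\<^sub>R grad \<eta> x) \<bullet> b)"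
      unfolding weak_pd_def
    proof (intro conjI ballI l1 locally_integrable_inner locally_integrable_add l2 l3)
      fix \<phi> :: "'a \<Rightarrow> real" assume \<phi>: "\<phi> \<in> test_functions"
      have t: "(\<lambda>x. \<eta> x * \<phi> x) \<in> test_functions" by (rule test_mult_smooth[OF \<phi> \<eta>])
      have d: "frechet_derivative (\<lambda>x. \<eta> x * \<phi> x) (at x) b = \<eta> x * ?d \<phi> x + ?d \<eta> x * \<phi> x" for x
        by (rule frechet_derivative_mult_real[OF smooth_continuous(4)[OF \<eta>] test_differentiable[OF \<phi>]])
      have i1: "integrable lebesgue (\<lambda>x. (\<eta> x * u x) * ?d \<phi> x)" by (rule test_deriv_integrable[OF l1 \<phi> b])
      have i2: "integrable lebesgue (\<lambda>x. (u x * ?d \<eta> x) * \<phi> x)"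
        using test_integrable[OF locally_integrable_inner[OF l3, of b] \<phi>] b by (simp add: grad_inner)
      have i3: "integrable lebesgue (\<lambda>x. (\<eta> x * (G x \<bullet> b)) * \<phi> x)"
        using test_integrable[OF locally_integrable_inner[OF l2, of b] \<phi>] by simp
      have "(\<integral>x. u x * (\<eta> x * ?d \<phi> x + ?d \<eta> x * \<phi> x) \<partial>lebesgue) = - (\<integral>x. (G x \<bullet> b) * (\<eta> x * \<phi> x) \<partial>lebesgue)"
        using w[OF b] t unfolding weak_pd_def d[symmetric] by blast
      moreover have "(\<integral>x. u x * (\<eta> x * ?d \<phi> x + ?d \<eta> x * \<phi> x) \<partial>lebesgue) =
         (\<integral>x. (\<eta> x * u x) * ?d \<phi> x \<partial>lebesgue) + (\<integral>x. (u x * ?d \<eta> x) * \<phi> x \<partial>lebesgue)"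
        using i1 i2 by (subst Bochner_Integration.integral_add[symmetric]) (auto simp: algebra_simps intro!: Bochner_Integration.integral_cong)
      moreover have "(\<integral>x. ((\<eta> x *\<^sub>R G x + u x *\<^sub>R grad \<eta> x) \<bullet> b) * \<phi> x \<partial>lebesgue) =
         (\<integral>x. (\<eta> x * (G x \<bullet> b)) * \<phi> x \<partial>lebesgue) + (\<integral>x. (u x * ?d \<eta> x) * \<phi> x \<partial>lebesgue)"
        using i2 i3 b by (subst Bochner_Integration.integral_add[symmetric]) (auto simp: algebra_simps inner_add_left grad_inner intro!: Bochner_Integration.integral_cong)
      moreover have "(\<integral>x. (\<eta> x * (G x \<bullet> b)) * \<phi> x \<partial>lebesgue) = (\<integral>x. (G x \<bullet> b) * (\<eta> x * \<phi> x) \<partial>lebesgue)"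
        by (simp add: mult_ac)
      ultimately show "(\<integral>x. (\<eta> x * u x) * ?d \<phi> x \<partial>lebesgue) = - (\<integral>x. ((\<eta> x *\<^sub>R G x + u x *\<^sub>R grad \<eta> x) \<bullet> b) * \<phi> x \<partial>lebesgue)"
        by simp
    qed
  qed
qed

lemma test_integral_tendsto:
  fixes f :: "nat \<Rightarrow> 'a::euclidean_space \<Rightarrow> real"
  assumes f: "\<And>n. locally_integrable (f n)" "locally_integrable F"
    and lim: "\<And>R. (\<lambda>n. L1c R (\<lambda>x. f n x - F x)) \<longlonglongrightarrow> 0"
    and \<psi>: "continuous_on UNIV \<psi>" "\<And>x. norm x \<ge> R \<Longrightarrow> \<psi> x = 0"
  shows "(\<lambda>n. \<integral>x. f n x * \<psi> x \<partial>lebesgue) \<longlonglongrightarrow> (\<integral>x. F x * \<psi> x \<partial>lebesgue)"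
proof -
  obtain B where B: "B > 0" "\<And>x. \<bar>\<psi> x\<bar> \<le> B" using continuous_support_bounded[OF \<psi>] by blast
  note i = locally_integrable_continuous_mult[OF _ \<psi>]
  have "(\<lambda>n. (\<integral>x. f n x * \<psi> x \<partial>lebesgue) - (\<integral>x. F x * \<psi> x \<partial>lebesgue)) \<longlonglongrightarrow> 0"
  proof (rule Lim_null_comparison)
    show "(\<lambda>n. B * L1c R (\<lambda>x. f n x - F x)) \<longlonglongrightarrow> 0" using tendsto_mult_left[OF lim, of B] by simp
    show "\<forall>\<^sub>F n in sequentially. norm ((\<integral>x. f n x * \<psi> x \<partial>lebesgue) - (\<integral>x. F x * \<psi> x \<partial>lebesgue)) \<le> B * L1c R (\<lambda>x. f n x - F x)"
    proof (rule always_eventually, rule allI)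
      fix n
      have l: "locally_integrable (\<lambda>x. f n x - F x)" using f by (intro locally_integrable_diff)
      have "(\<integral>x. f n x * \<psi> x \<partial>lebesgue) - (\<integral>x. F x * \<psi> x \<partial>lebesgue) = (\<integral>x. (f n x - F x) * \<psi> x \<partial>lebesgue)"
        using i[OF f(1)] i[OF f(2)] by (simp add: left_diff_distrib)
      also have "norm \<dots> \<le> (\<integral>x. B * (\<bar>f n x - F x\<bar> * indicator (cball 0 R) x) \<partial>lebesgue)"
        unfolding real_norm_def
      proof (rule integral_abs_le)
        show "integrable lebesgue (\<lambda>x. (f n x - F x) * \<psi> x)" by (rule i[OF l])
        show "integrable lebesgue (\<lambda>x. B * (\<bar>f n x - F x\<bar> * indicator (cball 0 R) x))"
          using L1c_integrable[OF l] by simp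
        show "\<bar>(f n x - F x) * \<psi> x\<bar> \<le> B * (\<bar>f n x - F x\<bar> * indicator (cball 0 R) x)" for x
          using \<psi>(2)[of x] mult_right_mono[OF B(2)[of x], of "\<bar>f n x - F x\<bar>"] by (auto simp: indicator_def abs_mult mult.commute)
      qed
      finally show "norm ((\<integral>x. f n x * \<psi> x \<partial>lebesgue) - (\<integral>x. F x * \<psi> x \<partial>lebesgue)) \<le> B * L1c R (\<lambda>x. f n x - F x)" by simp
    qed
  qed
  then show ?thesis by (simp add: LIM_zero_iff)
qed

text \<open>A test function and its derivatives are bounded with bounded support, so both sides of
  the defining identity are continuous under local \<open>L^1\<close> convergence.\<close>

lemma has_weak_gradient_limit:
  assumes w: "\<And>n. has_weak_gradient (u n) (G n)"
    and l: "locally_integrable v" "locally_integrable H"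
    and lu: "\<And>R. (\<lambda>n. L1c R (\<lambda>x. u n x - v x)) \<longlonglongrightarrow> 0"
    and lG: "\<And>R b. b \<in> Basis \<Longrightarrow> (\<lambda>n. L1c R (\<lambda>x. G n x \<bullet> b - H x \<bullet> b)) \<longlonglongrightarrow> 0"
  shows "has_weak_gradient v H"
  unfolding has_weak_gradient_def
proof (intro conjI ballI l)
  fix \<phi> :: "'a \<Rightarrow> real" and b :: 'a assume \<phi>: "\<phi> \<in> test_functions" and b: "b \<in> Basis"
  let ?d = "\<lambda>x. frechet_derivative \<phi> (at x) b"
  obtain R where R: "R > 0" "\<And>x. norm x \<ge> R \<Longrightarrow> \<phi> x = 0" "\<And>x. norm x \<ge> R \<Longrightarrow> ?d x = 0"
    using test_support[OF \<phi>] by metis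
  have lw: "locally_integrable (u n)" "locally_integrable (G n)" for n using w[of n] by (auto simp: has_weak_gradient_def)
  have 1: "(\<lambda>n. \<integral>x. u n x * ?d x \<partial>lebesgue) \<longlonglongrightarrow> (\<integral>x. v x * ?d x \<partial>lebesgue)"
    by (rule test_integral_tendsto[OF lw(1) l(1) lu test_deriv_continuous[OF \<phi> b] R(3)])
  have 2: "(\<lambda>n. \<integral>x. (G n x \<bullet> b) * \<phi> x \<partial>lebesgue) \<longlonglongrightarrow> (\<integral>x. (H x \<bullet> b) * \<phi> x \<partial>lebesgue)"
    by (rule test_integral_tendsto[OF locally_integrable_inner[OF lw(2)] locally_integrable_inner[OF l(2)] lG[OF b] test_continuous[OF \<phi>] R(2)])
  have "(\<integral>x. u n x * ?d x \<partial>lebesgue) = - (\<integral>x. (G n x \<bullet> b) * \<phi> x \<partial>lebesgue)" for n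
    using w[of n] \<phi> b by (auto simp: has_weak_gradient_def)
  then show "(\<integral>x. v x * ?d x \<partial>lebesgue) = - (\<integral>x. (H x \<bullet> b) * \<phi> x \<partial>lebesgue)"
    using LIMSEQ_unique[OF 1] tendsto_minus[OF 2] by simp
qed

section \<open>Powers and \<open>L\<^sup>p\<close> functions\<close>

text \<open>With m the larger of the two norms, |a + b| \<le> 2m. The constant is crude, but this
  argument works for every p > 0.\<close>

lemma powr_add_le:
  fixes a b :: "'b::real_normed_vector" and p :: real
  assumes "p > 0"
  shows "norm (a + b) powr p \<le> 2 powr p * (norm a powr p + norm b powr p)"
proof -
  define m where "m = max (norm a) (norm b)"
  have "norm (a + b) \<le> 2 * m" using norm_triangle_ineq[of a b] by (simp add: m_def)
  then have "norm (a + b) powr p \<le> (2 * m) powr p" using assms by (intro powr_mono2) auto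
  also have "\<dots> = 2 powr p * m powr p" by (simp add: m_def powr_mult)
  also have "m powr p \<le> norm a powr p + norm b powr p" by (auto simp: m_def max_def)
  finally show ?thesis by simp
qed

text \<open>Takes the place of Hoelder's inequality in passing from \<open>L^p\<close> to
  \<open>L^1\<close> on bounded sets, where the constant 1 is integrable.\<close>

lemma le_one_plus_powr:
  fixes t p :: real assumes "t \<ge> 0" "p \<ge> 1" shows "t \<le> 1 + t powr p"
proof (cases "t \<le> 1")
  case False
  then have "t powr 1 \<le> t powr p" using assms by (intro powr_mono) auto
  then show ?thesis using False by simp
qed (use assms in \<open>simp add: add_increasing2\<close>)

definition Lp :: "'m measure \<Rightarrow> real \<Rightarrow> ('m \<Rightarrow> 'b::euclidean_space) \<Rightarrow> bool" where
  "Lp M p f \<longleftrightarrow> f \<in> borel_measurable M \<and> integrable M (\<lambda>x. norm (f x) powr p)"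

lemma Lp_bound:
  fixes f :: "'m \<Rightarrow> 'b::euclidean_space" and g :: "'m \<Rightarrow> 'c::euclidean_space"
  assumes "Lp M p f" "g \<in> borel_measurable M" "AE x in M. norm (g x) \<le> norm (f x)" "p \<ge> 0"
  shows "Lp M p g"
  unfolding Lp_def
proof (intro conjI)
  show "integrable M (\<lambda>x. norm (g x) powr p)"
  proof (rule Bochner_Integration.integrable_bound)
    show "integrable M (\<lambda>x. norm (f x) powr p)" using assms by (simp add: Lp_def)
    show "AE x in M. norm (norm (g x) powr p) \<le> norm (norm (f x) powr p)"
      using assms(3) by eventually_elim (use assms(4) in \<open>auto intro: powr_mono2\<close>)
  qed (use assms in measurable)
qed fact

lemma Lp_add:
  fixes f g :: "'m \<Rightarrow> 'b::euclidean_space"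
  assumes "Lp M p f" "Lp M p g" "p > 0"
  shows "Lp M p (\<lambda>x. f x + g x)"
  unfolding Lp_def
proof (intro conjI)
  have [measurable]: "f \<in> borel_measurable M" "g \<in> borel_measurable M" using assms by (auto simp: Lp_def)
  show "(\<lambda>x. f x + g x) \<in> borel_measurable M" by measurable
  show "integrable M (\<lambda>x. norm (f x + g x) powr p)"
  proof (rule Bochner_Integration.integrable_bound)
    show "integrable M (\<lambda>x. 2 powr p * (norm (f x) powr p + norm (g x) powr p))" using assms by (simp add: Lp_def)
    show "AE x in M. norm (norm (f x + g x) powr p) \<le> norm (2 powr p * (norm (f x) powr p + norm (g x) powr p))"
      using powr_add_le[OF assms(3)] by (intro AE_I2) simp
  qed measurable
qed

lemma Lp_scaleR:
  fixes f :: "'m \<Rightarrow> 'b::euclidean_space"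
  assumes "Lp M p f" shows "Lp M p (\<lambda>x. c *\<^sub>R f x)"
  using assms by (auto simp: Lp_def powr_mult)

lemma Lp_cmult:
  fixes f :: "'m \<Rightarrow> real"
  assumes "Lp M p f" shows "Lp M p (\<lambda>x. c * f x)"
  using Lp_scaleR[OF assms, of c] by simp

lemma Lp_cong:
  fixes f g :: "'m \<Rightarrow> 'b::euclidean_space"
  assumes "Lp M p f" "AE x in M. f x = g x" "g \<in> borel_measurable M" "p \<ge> 0"
  shows "Lp M p g"
  using assms(1,3) _ assms(4)
  by (rule Lp_bound) (use assms(2) in eventually_elim, simp)

lemma Lp_locally_integrable:
  fixes f :: "'a::euclidean_space \<Rightarrow> 'b::euclidean_space"
  assumes "Lp lebesgue p f" "p \<ge> 1"
  shows "locally_integrable f"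
proof (rule locally_integrable_bound)
  have "locally_integrable (\<lambda>x::'a. 1::real)"
    by (rule locally_integrableI)
       (auto simp: set_integrable_def emeasure_lborel_cball_finite[unfolded infinity_ennreal_def] intro!: integrable_real_indicator)
  moreover have "locally_integrable (\<lambda>x. norm (f x) powr p)"
    using assms by (auto simp: Lp_def intro: integrable_locally_integrable)
  ultimately show "locally_integrable (\<lambda>x. 1 + norm (f x) powr p)" by (rule locally_integrable_add)
  show "AE x in lebesgue. norm (f x) \<le> norm (1 + norm (f x) powr p)"
    using le_one_plus_powr[OF _ assms(2)] by (intro AE_I2) simp
qed (use assms in \<open>auto simp: Lp_def\<close>)

section \<open>The Sobolev space\<close>

text \<open>\<open>weak_gradient\<close> is an arbitrary choice among the weak gradients, so an
  explicitly known gradient is recovered only almost everywhere.\<close>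

lemma sobolevI:
  assumes "Lp lebesgue p u" "has_weak_gradient u G" "Lp lebesgue p G" "p \<ge> 0"
  shows "u \<in> sobolev p" "AE x in lebesgue. weak_gradient u x = G x"
proof -
  show "u \<in> sobolev p" using assms by (auto simp: sobolev_def Lp_def)
  have "has_weak_gradient u (weak_gradient u)" unfolding weak_gradient_def by (rule someI[of _ G]) fact
  then show "AE x in lebesgue. weak_gradient u x = G x" using assms(2) by (rule has_weak_gradient_unique)
qed

lemma sobolevD:
  assumes "u \<in> sobolev p" "p \<ge> 0"
  shows "Lp lebesgue p u" "has_weak_gradient u (weak_gradient u)" "Lp lebesgue p (weak_gradient u)"
    "u \<in> borel_measurable lebesgue" "weak_gradient u \<in> borel_measurable lebesgue"
    "integrable lebesgue (\<lambda>x. \<bar>u x\<bar> powr p)" "integrable lebesgue (\<lambda>x. norm (weak_gradient u x) powr p)"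
proof -
  obtain G where G: "has_weak_gradient u G" "integrable lebesgue (\<lambda>x. norm (G x) powr p)" using assms by (auto simp: sobolev_def)
  show h: "has_weak_gradient u (weak_gradient u)" unfolding weak_gradient_def by (rule someI[of _ G]) fact
  have mG: "G \<in> borel_measurable lebesgue" using G by (auto simp: has_weak_gradient_def intro: locally_integrable_measurable)
  show mD: "weak_gradient u \<in> borel_measurable lebesgue" using h by (auto simp: has_weak_gradient_def intro: locally_integrable_measurable)
  \<comment> \<open>Membership in \<open>sobolev\<close> only promises some p-integrable gradient
    \<open>G\<close>, which need not be the chosen one; uniqueness a.e. transfers the
    integrability.\<close>
  show L: "Lp lebesgue p (weak_gradient u)"
    by (rule Lp_cong[OF _ has_weak_gradient_unique[OF G(1) h] mD assms(2)]) (use G mG in \<open>auto simp: Lp_def\<close>)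
  show "Lp lebesgue p u" "u \<in> borel_measurable lebesgue" "integrable lebesgue (\<lambda>x. \<bar>u x\<bar> powr p)"
    using assms by (auto simp: sobolev_def Lp_def)
  show "integrable lebesgue (\<lambda>x. norm (weak_gradient u x) powr p)" using L by (simp add: Lp_def)
qed

text \<open>The p-th power of the Sobolev norm, the quantity minimised in
  \<open>pcap\<close>.\<close>

definition energy :: "real \<Rightarrow> ('a::euclidean_space \<Rightarrow> real) \<Rightarrow> real" where
  "energy p u = (\<integral>x. norm (weak_gradient u x) powr p + \<bar>u x\<bar> powr p \<partial>lebesgue)"

lemma energy_nonneg: "energy p u \<ge> 0"
  unfolding energy_def by (intro integral_nonneg_AE) auto

lemma energy_integrable:
  "u \<in> sobolev p \<Longrightarrow> p \<ge> 0 \<Longrightarrow> integrable lebesgue (\<lambda>x. norm (weak_gradient u x) powr p + \<bar>u x\<bar> powr p)"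
  by (intro Bochner_Integration.integrable_add sobolevD)

lemma energy_nn:
  assumes "u \<in> sobolev p" "p \<ge> 0"
  shows "(\<integral>\<^sup>+x. ennreal (norm (weak_gradient u x) powr p + \<bar>u x\<bar> powr p) \<partial>lebesgue) = ennreal (energy p u)"
  unfolding energy_def using energy_integrable[OF assms] by (intro nn_integral_eq_integral) auto

lemma sobolev_lincomb:
  assumes "u \<in> sobolev p" "v \<in> sobolev p" "p > 0"
  shows "(\<lambda>x. s * u x + t * v x) \<in> sobolev p"
    and "AE x in lebesgue. weak_gradient (\<lambda>x. s * u x + t * v x) x = s *\<^sub>R weak_gradient u x + t *\<^sub>R weak_gradient v x"
proof -
  have p: "p \<ge> 0" using assms by simp
  note u = sobolevD[OF assms(1) p] and v = sobolevD[OF assms(2) p]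
  show "(\<lambda>x. s * u x + t * v x) \<in> sobolev p"
    "AE x in lebesgue. weak_gradient (\<lambda>x. s * u x + t * v x) x = s *\<^sub>R weak_gradient u x + t *\<^sub>R weak_gradient v x"
    by (rule sobolevI[OF Lp_add[OF Lp_cmult[OF u(1)] Lp_cmult[OF v(1)] assms(3)] has_weak_gradient_lincomb[OF u(2) v(2)]
        Lp_add[OF Lp_scaleR[OF u(3)] Lp_scaleR[OF v(3)] assms(3)] p])+
qed

lemma sobolev_add:
  assumes "u \<in> sobolev p" "v \<in> sobolev p" "p > 0"
  shows "(\<lambda>x. u x + v x) \<in> sobolev p"
    and "AE x in lebesgue. weak_gradient (\<lambda>x. u x + v x) x = weak_gradient u x + weak_gradient v x"
  using sobolev_lincomb[OF assms, of 1 1] by auto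

lemma sobolev_diff:
  assumes "u \<in> sobolev p" "v \<in> sobolev p" "p > 0"
  shows "(\<lambda>x. u x - v x) \<in> sobolev p"
    and "AE x in lebesgue. weak_gradient (\<lambda>x. u x - v x) x = weak_gradient u x - weak_gradient v x"
  using sobolev_lincomb[OF assms, of 1 "-1"] by auto

lemma sobolev_cmult:
  assumes "u \<in> sobolev p" "p > 0"
  shows "(\<lambda>x. c * u x) \<in> sobolev p"
    and "AE x in lebesgue. weak_gradient (\<lambda>x. c * u x) x = c *\<^sub>R weak_gradient u x"
  using sobolev_lincomb[OF assms(1) assms(1) assms(2), of c 0] by auto

lemma sobolev_zero:
  assumes "p > 0"
  shows "(\<lambda>x::'a::euclidean_space. 0) \<in> sobolev p" "AE x in lebesgue. weak_gradient (\<lambda>x::'a. 0) x = 0"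
    "energy p (\<lambda>x::'a. 0) = 0"
proof -
  have w: "has_weak_gradient (\<lambda>x. 0) (\<lambda>x::'a::euclidean_space. 0)"
    by (auto simp: has_weak_gradient_def locally_integrable_def set_integrable_def)
  show "(\<lambda>x::'a. 0) \<in> sobolev p" and *: "AE x in lebesgue. weak_gradient (\<lambda>x::'a. 0) x = 0"
    by (rule sobolevI[of p "\<lambda>x. 0" "\<lambda>x. 0"]; use w assms in \<open>simp add: Lp_def\<close>)+
  have "energy p (\<lambda>x::'a. 0) = (\<integral>x. 0 \<partial>(lebesgue::'a measure))"
    unfolding energy_def
    by (rule integral_cong_AE) (use * sobolevD(5)[OF \<open>(\<lambda>x::'a. 0) \<in> sobolev p\<close>] assms in \<open>auto\<close>)
  then show "energy p (\<lambda>x::'a. 0) = 0" by simp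
qed

lemma sobolev_abs:
  assumes "u \<in> sobolev p" "p \<ge> 0"
  shows "(\<lambda>x. \<bar>u x\<bar>) \<in> sobolev p"
    and "AE x in lebesgue. weak_gradient (\<lambda>x. \<bar>u x\<bar>) x = sgn (u x) *\<^sub>R weak_gradient u x"
    and "AE x in lebesgue. u x = 0 \<longrightarrow> weak_gradient u x = 0"
proof -
  note u = sobolevD[OF assms]
  have 1: "Lp lebesgue p (\<lambda>x. \<bar>u x\<bar>)" using u by (auto simp: Lp_def)
  have 2: "Lp lebesgue p (\<lambda>x. sgn (u x) *\<^sub>R weak_gradient u x)"
    by (rule Lp_bound[OF u(3)]) (use u assms in \<open>auto simp: sgn_if\<close>)
  show "(\<lambda>x. \<bar>u x\<bar>) \<in> sobolev p" "AE x in lebesgue. weak_gradient (\<lambda>x. \<bar>u x\<bar>) x = sgn (u x) *\<^sub>R weak_gradient u x"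
    by (rule sobolevI[OF 1 has_weak_gradient_abs(1)[OF u(2)] 2 assms(2)])+
  show "AE x in lebesgue. u x = 0 \<longrightarrow> weak_gradient u x = 0" by (rule has_weak_gradient_zero_set[OF u(2)])
qed

lemma energy_mono_AE:
  assumes "u \<in> sobolev p" "v \<in> sobolev p" "p \<ge> 0"
    "AE x in lebesgue. norm (weak_gradient u x) \<le> norm (weak_gradient v x) \<and> \<bar>u x\<bar> \<le> \<bar>v x\<bar>"
  shows "energy p u \<le> energy p v"
  unfolding energy_def
proof (rule integral_mono_AE[OF energy_integrable[OF assms(1,3)] energy_integrable[OF assms(2,3)]])
  show "AE x in lebesgue. norm (weak_gradient u x) powr p + \<bar>u x\<bar> powr p \<le> norm (weak_gradient v x) powr p + \<bar>v x\<bar> powr p"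
    using assms(4) by eventually_elim (use assms(3) in \<open>auto intro!: add_mono powr_mono2\<close>)
qed

lemma energy_abs:
  assumes "u \<in> sobolev p" "p \<ge> 0"
  shows "energy p (\<lambda>x. \<bar>u x\<bar>) \<le> energy p u"
proof (rule energy_mono_AE[OF sobolev_abs(1)[OF assms] assms])
  show "AE x in lebesgue. norm (weak_gradient (\<lambda>x. \<bar>u x\<bar>) x) \<le> norm (weak_gradient u x) \<and> \<bar>\<bar>u x\<bar>\<bar> \<le> \<bar>u x\<bar>"
    using sobolev_abs(2)[OF assms] by eventually_elim (auto simp: sgn_if)
qed

lemma energy_cmult:
  assumes "u \<in> sobolev p" "p > 0"
  shows "energy p (\<lambda>x. c * u x) = \<bar>c\<bar> powr p * energy p u"
proof -
  have p: "p \<ge> 0" using assms by simp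
  have "energy p (\<lambda>x. c * u x) = (\<integral>x. \<bar>c\<bar> powr p * (norm (weak_gradient u x) powr p + \<bar>u x\<bar> powr p) \<partial>lebesgue)"
    unfolding energy_def
  proof (rule integral_cong_AE)
    show "AE x in lebesgue. norm (weak_gradient (\<lambda>x. c * u x) x) powr p + \<bar>c * u x\<bar> powr p =
      \<bar>c\<bar> powr p * (norm (weak_gradient u x) powr p + \<bar>u x\<bar> powr p)"
      using sobolev_cmult(2)[OF assms, of c] by eventually_elim (simp add: powr_mult abs_mult algebra_simps)
  qed (use energy_integrable[OF sobolev_cmult(1)[OF assms] p] energy_integrable[OF assms(1) p] in auto)
  then show ?thesis by (simp add: energy_def)
qed

lemma energy_add_le:
  assumes "u \<in> sobolev p" "v \<in> sobolev p" "p > 0"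
  shows "energy p (\<lambda>x. u x + v x) \<le> 2 powr p * (energy p u + energy p v)"
proof -
  have p: "p \<ge> 0" using assms by simp
  note i = energy_integrable[OF assms(1) p] energy_integrable[OF assms(2) p]
  have "energy p (\<lambda>x. u x + v x) \<le> (\<integral>x. 2 powr p * ((norm (weak_gradient u x) powr p + \<bar>u x\<bar> powr p) + (norm (weak_gradient v x) powr p + \<bar>v x\<bar> powr p)) \<partial>lebesgue)"
    unfolding energy_def
  proof (rule integral_mono_AE[OF energy_integrable[OF sobolev_add(1)[OF assms] p]])
    show "AE x in lebesgue. norm (weak_gradient (\<lambda>x. u x + v x) x) powr p + \<bar>u x + v x\<bar> powr p
       \<le> 2 powr p * ((norm (weak_gradient u x) powr p + \<bar>u x\<bar> powr p) + (norm (weak_gradient v x) powr p + \<bar>v x\<bar> powr p))"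
      using sobolev_add(2)[OF assms]
    proof eventually_elim
      case (elim x)
      show ?case
        using powr_add_le[OF assms(3), of "weak_gradient u x" "weak_gradient v x"] powr_add_le[OF assms(3), of "u x" "v x"]
        by (simp add: elim algebra_simps)
    qed
  qed (use i in auto)
  then show ?thesis using i by (simp add: energy_def)
qed

text \<open>max(u, 0) = (u + |u|)/2, and almost everywhere on the zero set of \<open>u\<close> the
  gradient of \<open>u\<close> vanishes, which fixes the value there.\<close>

lemma sobolev_pos_part:
  assumes "u \<in> sobolev p" "p > 0"
  shows "(\<lambda>x. max (u x) 0) \<in> sobolev p"
    and "AE x in lebesgue. weak_gradient (\<lambda>x. max (u x) 0) x = (if u x > 0 then weak_gradient u x else 0)"
proof -
  have p: "p \<ge> 0" using assms by simp
  have eq: "(\<lambda>x. max (u x) 0) = (\<lambda>x. (1/2) * u x + (1/2) * \<bar>u x\<bar>)" by (auto simp: max_def)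
  note l = sobolev_lincomb[OF assms(1) sobolev_abs(1)[OF assms(1) p] assms(2), of "1/2" "1/2"]
  show "(\<lambda>x. max (u x) 0) \<in> sobolev p" unfolding eq by (rule l(1))
  show "AE x in lebesgue. weak_gradient (\<lambda>x. max (u x) 0) x = (if u x > 0 then weak_gradient u x else 0)"
    unfolding eq using l(2) sobolev_abs(2,3)[OF assms(1) p]
    by eventually_elim (auto simp: sgn_if simp flip: scaleR_left_distrib)
qed

lemma sobolev_mult_smooth:
  fixes u \<eta> :: "'a::euclidean_space \<Rightarrow> real"
  assumes "u \<in> sobolev p" "p > 0" and \<eta>: "\<And>k. Ck k \<eta>" "\<And>x. \<bar>\<eta> x\<bar> \<le> 1" "\<And>x. norm (grad \<eta> x) \<le> L"
  shows "(\<lambda>x. \<eta> x * u x) \<in> sobolev p"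
    and "AE x in lebesgue. weak_gradient (\<lambda>x. \<eta> x * u x) x = \<eta> x *\<^sub>R weak_gradient u x + u x *\<^sub>R grad \<eta> x"
proof -
  have p: "p \<ge> 0" using assms by simp
  note u = sobolevD[OF assms(1) p]
  have m: "\<eta> \<in> borel_measurable lebesgue" "grad \<eta> \<in> borel_measurable lebesgue"
    using smooth_continuous(1,3)[OF \<eta>(1)] by (auto intro: continuous_lebesgue_measurable)
  have 1: "Lp lebesgue p (\<lambda>x. \<eta> x * u x)"
    by (rule Lp_bound[OF u(1)]) (use u m p \<eta>(2) in \<open>auto simp: abs_mult mult_left_le_one_le\<close>)
  have 2: "Lp lebesgue p (\<lambda>x. \<eta> x *\<^sub>R weak_gradient u x)"
    by (rule Lp_bound[OF u(3)]) (use u m p \<eta>(2) in \<open>auto simp: mult_left_le_one_le\<close>)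
  have L: "L \<ge> 0" using \<eta>(3) norm_ge_zero order_trans by blast
  have 3: "Lp lebesgue p (\<lambda>x. u x *\<^sub>R grad \<eta> x)"
  proof (rule Lp_bound[OF Lp_cmult[OF u(1), of L]])
    show "AE x in lebesgue. norm (u x *\<^sub>R grad \<eta> x) \<le> norm (L * u x)"
      using mult_right_mono[OF \<eta>(3) abs_ge_zero] L by (intro AE_I2) (simp add: abs_mult mult.commute)
  qed (use u m p in auto)
  show "(\<lambda>x. \<eta> x * u x) \<in> sobolev p"
    "AE x in lebesgue. weak_gradient (\<lambda>x. \<eta> x * u x) x = \<eta> x *\<^sub>R weak_gradient u x + u x *\<^sub>R grad \<eta> x"
    by (rule sobolevI[OF 1 has_weak_gradient_mult_smooth[OF u(2) \<eta>(1)] Lp_add[OF 2 3 assms(2)] p])+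
qed

section \<open>Rapidly convergent series\<close>

text \<open>If the sum of \<open>wgt p k\<close> |a_k|^p is T, then each |a_k| is at most T^(1/p)
  2^-(k+1), and these bounds add up to T^(1/p). Hence the sum of the a_k has p-th power at most T,
  with no further constant.\<close>

definition wgt :: "real \<Rightarrow> nat \<Rightarrow> real" where
  "wgt p k = (2 ^ Suc k) powr p"

lemma wgt_pos: "wgt p k > 0" by (simp add: wgt_def)

lemma series_powr_bound:
  fixes a :: "nat \<Rightarrow> 'b::euclidean_space"
  assumes p: "p > 0" and S: "summable (\<lambda>k. wgt p k * norm (a k) powr p)"
  defines "T \<equiv> (\<Sum>k. wgt p k * norm (a k) powr p)"
  shows "summable (\<lambda>k. norm (a k))" "norm (\<Sum>k<n. a k) powr p \<le> T" "norm (\<Sum>k. a k) powr p \<le> T"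
proof -
  have T: "wgt p k * norm (a k) powr p \<le> T" for k
    unfolding T_def using sum_le_suminf[OF S, of "{k}"] by (simp add: wgt_def)
  have T0: "T \<ge> 0" unfolding T_def by (intro suminf_nonneg S) (simp add: wgt_def)
  define c where "c = T powr (1/p)"
  have b: "norm (a k) \<le> c * (1/2)^Suc k" for k
  proof -
    have "(2 ^ Suc k * norm (a k)) powr p \<le> T" using T[of k] by (simp add: wgt_def powr_mult)
    then have "((2 ^ Suc k * norm (a k)) powr p) powr (1/p) \<le> T powr (1/p)" using p by (intro powr_mono2) auto
    then have "2 ^ Suc k * norm (a k) \<le> c" using p by (simp add: powr_powr c_def)
    then show ?thesis by (simp add: field_simps)
  qed
  have gs: "(\<lambda>k. c * (1/2)^Suc k) sums c" using sums_mult[OF power_half_series, of c] by simp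
  show sm: "summable (\<lambda>k. norm (a k))"
    by (rule summable_comparison_test'[OF sums_summable[OF gs]]) (use b in auto)
  have tot: "(\<Sum>k. norm (a k)) \<le> c"
    using suminf_le[OF b sm sums_summable[OF gs]] gs by (simp add: sums_iff)
  have cp: "c powr p = T" using p T0 by (simp add: c_def powr_powr)
  have "norm (\<Sum>k<n. a k) \<le> (\<Sum>k<n. norm (a k))" by (rule norm_sum)
  also have "\<dots> \<le> (\<Sum>k. norm (a k))" by (rule sum_le_suminf[OF sm]) auto
  finally have "norm (\<Sum>k<n. a k) \<le> c" using tot by simp
  then show "norm (\<Sum>k<n. a k) powr p \<le> T" unfolding cp[symmetric] using p by (intro powr_mono2) auto
  have "norm (\<Sum>k. a k) \<le> c" using summable_norm[OF sm] tot by simp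
  then show "norm (\<Sum>k. a k) powr p \<le> T" unfolding cp[symmetric] using p by (intro powr_mono2) auto
qed

lemma AE_summable_integrals:
  fixes f :: "nat \<Rightarrow> 'm \<Rightarrow> real"
  assumes i: "\<And>k. integrable M (f k)" and nn: "\<And>k x. f k x \<ge> 0" and s: "summable (\<lambda>k. \<integral>x. f k x \<partial>M)"
  shows "AE x in M. summable (\<lambda>k. f k x)" "integrable M (\<lambda>x. \<Sum>k. f k x)" "(\<integral>x. (\<Sum>k. f k x) \<partial>M) = (\<Sum>k. \<integral>x. f k x \<partial>M)"
proof -
  have [measurable]: "f k \<in> borel_measurable M" for k using i by auto
  have "(\<integral>\<^sup>+x. (\<Sum>k. ennreal (f k x)) \<partial>M) = (\<Sum>k. \<integral>\<^sup>+x. ennreal (f k x) \<partial>M)"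
    by (rule nn_integral_suminf) measurable
  also have "\<dots> = (\<Sum>k. ennreal (\<integral>x. f k x \<partial>M))"
    using i nn by (subst nn_integral_eq_integral) auto
  also have "\<dots> = ennreal (\<Sum>k. \<integral>x. f k x \<partial>M)"
    using s nn by (intro suminf_ennreal_eq) (auto intro: integral_nonneg_AE summable_sums)
  finally have "(\<integral>\<^sup>+x. (\<Sum>k. ennreal (f k x)) \<partial>M) \<noteq> \<infinity>" by simp
  then have "AE x in M. (\<Sum>k. ennreal (f k x)) \<noteq> \<infinity>"
    by (intro nn_integral_PInf_AE) measurable
  then show ae: "AE x in M. summable (\<lambda>k. f k x)"
    by eventually_elim (use nn in \<open>auto intro: summable_suminf_not_top\<close>)
  have "AE x in M. summable (\<lambda>k. norm (f k x))" using ae nn by auto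
  moreover have "summable (\<lambda>k. \<integral>x. norm (f k x) \<partial>M)" using s nn by simp
  ultimately show "integrable M (\<lambda>x. \<Sum>k. f k x)" "(\<integral>x. (\<Sum>k. f k x) \<partial>M) = (\<Sum>k. \<integral>x. f k x \<partial>M)"
    using i by (auto intro: integrable_suminf integral_suminf)
qed

text \<open>\<open>series_powr_bound\<close> is applied at almost every point, to the values and to
  the gradients separately. It bounds all partial sums and the limit through one integrable
  function, so the partial sums and their gradients converge in local \<open>L^1\<close>, where weak
  gradients are closed.\<close>

lemma sobolev_series:
  fixes v :: "nat \<Rightarrow> 'a::euclidean_space \<Rightarrow> real"
  assumes p: "p > 1" and v: "\<And>k. v k \<in> sobolev p" and S: "summable (\<lambda>k. wgt p k * energy p (v k))"
  shows "(\<lambda>x. \<Sum>k. v k x) \<in> sobolev p"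
    and "AE x in lebesgue. summable (\<lambda>k. \<bar>v k x\<bar>)"
    and "AE x in lebesgue. summable (\<lambda>k. norm (weak_gradient (v k) x))"
    and "AE x in lebesgue. weak_gradient (\<lambda>x. \<Sum>k. v k x) x = (\<Sum>k. weak_gradient (v k) x)"
    and "energy p (\<lambda>x. \<Sum>k. v k x) \<le> (\<Sum>k. wgt p k * energy p (v k))"
proof -
  have p0: "p \<ge> 0" "p > 0" "p \<ge> 1" using p by auto
  note vD = sobolevD[OF v p0(1)]
  have [measurable]: "v k \<in> borel_measurable lebesgue" "weak_gradient (v k) \<in> borel_measurable lebesgue" for k
    using vD by auto
  define f where "f k x = wgt p k * (norm (weak_gradient (v k) x) powr p + \<bar>v k x\<bar> powr p)" for k x
  define T where "T x = (\<Sum>k. f k x)" for x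
  have fi: "integrable lebesgue (f k)" for k unfolding f_def using energy_integrable[OF v p0(1)] by simp
  have fe: "(\<integral>x. f k x \<partial>lebesgue) = wgt p k * energy p (v k)" for k
    unfolding f_def energy_def by simp
  have fn: "f k x \<ge> 0" for k x unfolding f_def using wgt_pos[of p k] by simp
  have ae: "AE x in lebesgue. summable (\<lambda>k. f k x)" and Ti: "integrable lebesgue T"
    and Te: "(\<integral>x. T x \<partial>lebesgue) = (\<Sum>k. wgt p k * energy p (v k))"
    using AE_summable_integrals[of lebesgue f, OF fi fn] S by (auto simp: fe T_def[abs_def])
  define V G where "V x = (\<Sum>k. v k x)" and "G x = (\<Sum>k. weak_gradient (v k) x)" for x
  define A B where "A x = (\<Sum>k. wgt p k * \<bar>v k x\<bar> powr p)"
    and "B x = (\<Sum>k. wgt p k * norm (weak_gradient (v k) x) powr p)" for x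
  have key: "AE x in lebesgue. summable (\<lambda>k. \<bar>v k x\<bar>) \<and> summable (\<lambda>k. norm (weak_gradient (v k) x)) \<and>
      A x + B x = T x \<and> A x \<ge> 0 \<and> B x \<ge> 0 \<and>
      (\<forall>n. \<bar>\<Sum>k<n. v k x\<bar> powr p \<le> A x \<and> norm (\<Sum>k<n. weak_gradient (v k) x) powr p \<le> B x) \<and>
      \<bar>V x\<bar> powr p \<le> A x \<and> norm (G x) powr p \<le> B x"
    using ae
  proof eventually_elim
    case (elim x)
    have sA: "summable (\<lambda>k. wgt p k * norm (v k x) powr p)"
      by (rule summable_comparison_test'[OF elim]) (simp add: f_def algebra_simps wgt_pos less_imp_le)
    have sB: "summable (\<lambda>k. wgt p k * norm (weak_gradient (v k) x) powr p)"
      by (rule summable_comparison_test'[OF elim]) (simp add: f_def algebra_simps wgt_pos less_imp_le)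
    have "A x + B x = T x" unfolding A_def B_def T_def f_def
      using suminf_add[OF sB sA] by (simp add: algebra_simps)
    moreover have "A x \<ge> 0" "B x \<ge> 0" unfolding A_def B_def
      using sA sB by (auto intro!: suminf_nonneg simp: wgt_pos less_imp_le)
    ultimately show ?case
      using series_powr_bound[OF p0(2) sA] series_powr_bound[OF p0(2) sB]
      by (simp add: A_def B_def V_def G_def)
  qed
  show "AE x in lebesgue. summable (\<lambda>k. \<bar>v k x\<bar>)" using key by eventually_elim simp
  show "AE x in lebesgue. summable (\<lambda>k. norm (weak_gradient (v k) x))" using key by eventually_elim simp
  have [measurable]: "V \<in> borel_measurable lebesgue" "G \<in> borel_measurable lebesgue"
    unfolding V_def[abs_def] G_def[abs_def] by measurable
  have LV: "Lp lebesgue p V" and LG: "Lp lebesgue p G"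
  proof -
    have "integrable lebesgue (\<lambda>x. \<bar>V x\<bar> powr p)"
      by (rule Bochner_Integration.integrable_bound[OF Ti]) (measurable, use key in eventually_elim, simp)
    moreover have "integrable lebesgue (\<lambda>x. norm (G x) powr p)"
      by (rule Bochner_Integration.integrable_bound[OF Ti]) (measurable, use key in eventually_elim, simp)
    ultimately show "Lp lebesgue p V" "Lp lebesgue p G" by (auto simp: Lp_def)
  qed
  have lV: "locally_integrable V" and lG: "locally_integrable G"
    using Lp_locally_integrable[OF LV p0(3)] Lp_locally_integrable[OF LG p0(3)] .
  have part: "(\<lambda>x. \<Sum>k<n. v k x) \<in> sobolev p \<and> (AE x in lebesgue. weak_gradient (\<lambda>x. \<Sum>k<n. v k x) x = (\<Sum>k<n. weak_gradient (v k) x))" for n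
  proof (induction n)
    case 0 show ?case using sobolev_zero[OF p0(2)] by simp
  next
    case (Suc n)
    from conjunct1[OF Suc] have 1: "(\<lambda>x. \<Sum>k<n. v k x) \<in> sobolev p" .
    show ?case
      unfolding sum.lessThan_Suc
    proof
      show "(\<lambda>x. (\<Sum>k<n. v k x) + v n x) \<in> sobolev p" by (rule sobolev_add(1)[OF 1 v p0(2)])
      show "AE x in lebesgue. weak_gradient (\<lambda>x. (\<Sum>k<n. v k x) + v n x) x = (\<Sum>k<n. weak_gradient (v k) x) + weak_gradient (v n) x"
        using sobolev_add(2)[OF 1 v p0(2)] conjunct2[OF Suc] by eventually_elim simp
    qed
  qed
  have wg: "has_weak_gradient (\<lambda>x. \<Sum>k<n. v k x) (\<lambda>x. \<Sum>k<n. weak_gradient (v k) x)" for n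
    by (rule has_weak_gradient_cong[OF sobolevD(2)[OF conjunct1[OF part[of n]] p0(1)]])
       (use part[of n] in auto)
  \<comment> \<open>Used for a partial sum and its limit: a bound for p-th powers is turned into a
    majorant of the difference that is integrable on balls.\<close>
  have bound: "\<bar>a - b\<bar> \<le> 2 * (1 + c)" if "\<bar>a\<bar> powr p \<le> c" "\<bar>b\<bar> powr p \<le> c" for a b c :: real
  proof -
    have "\<bar>a\<bar> \<le> 1 + c" "\<bar>b\<bar> \<le> 1 + c"
      using order_trans[OF le_one_plus_powr[OF abs_ge_zero p0(3)] add_left_mono[OF that(1)]]
        order_trans[OF le_one_plus_powr[OF abs_ge_zero p0(3)] add_left_mono[OF that(2)]] .
    then have "\<bar>a\<bar> + \<bar>b\<bar> \<le> (1 + c) + (1 + c)" by (rule add_mono)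
    with abs_triangle_ineq4[of a b] have "\<bar>a - b\<bar> \<le> (1 + c) + (1 + c)" by (rule order_trans)
    then show ?thesis by simp
  qed
  have domi: "integrable lebesgue (\<lambda>x. 2 * (1 + T x) * indicator (cball 0 R) x)" for R :: real
  proof -
    have "integrable lebesgue (\<lambda>x. 2 * indicat_real (cball (0::'a) R) x + 2 * (T x * indicator (cball 0 R) x))"
      using integrable_cball[OF integrable_locally_integrable[OF Ti], of R]
      by (intro Bochner_Integration.integrable_add integrable_mult_right integrable_real_indicator) (auto simp: emeasure_lborel_cball_finite[unfolded infinity_ennreal_def])
    then show ?thesis by (simp add: algebra_simps)
  qed
  have "has_weak_gradient V G"
  proof (rule has_weak_gradient_limit[OF wg lV lG])
    fix R :: real
    have "(\<lambda>n. L1c R (\<lambda>x. (\<Sum>k<n. v k x) - V x)) \<longlonglongrightarrow> (\<integral>x. 0 \<partial>(lebesgue::'a measure))"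
    proof (rule integral_dominated_convergence[OF _ _ domi[of R]])
      show "AE x in lebesgue. (\<lambda>n. \<bar>(\<Sum>k<n. v k x) - V x\<bar> * indicat_real (cball 0 R) x) \<longlonglongrightarrow> 0"
        using key
      proof eventually_elim
        case (elim x)
        then have "(\<lambda>n. \<Sum>k<n. v k x) \<longlonglongrightarrow> V x"
          unfolding V_def by (blast intro: summable_LIMSEQ[OF summable_rabs_cancel])
        then show ?case by (rule tendsto_mult_left_zero[OF tendsto_rabs_zero[OF LIM_zero]])
      qed
      show "AE x in lebesgue. norm (\<bar>(\<Sum>k<n. v k x) - V x\<bar> * indicat_real (cball 0 R) x) \<le> 2 * (1 + T x) * indicat_real (cball 0 R) x" for n
        using key
      proof eventually_elim
        case (elim x)
        have "\<bar>(\<Sum>k<n. v k x) - V x\<bar> \<le> 2 * (1 + T x)" by (rule bound) (use elim in \<open>auto intro: order_trans\<close>)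
        then show ?case by (auto simp: indicator_def)
      qed
    qed (auto intro!: borel_measurable_times borel_measurable_indicator)
    then show "(\<lambda>n. L1c R (\<lambda>x. (\<Sum>k<n. v k x) - V x)) \<longlonglongrightarrow> 0" by simp
    fix b :: 'a assume b: "b \<in> Basis"
    have "(\<lambda>n. L1c R (\<lambda>x. (\<Sum>k<n. weak_gradient (v k) x) \<bullet> b - G x \<bullet> b)) \<longlonglongrightarrow> (\<integral>x. 0 \<partial>(lebesgue::'a measure))"
    proof (rule integral_dominated_convergence[OF _ _ domi[of R]])
      show "AE x in lebesgue. (\<lambda>n. \<bar>(\<Sum>k<n. weak_gradient (v k) x) \<bullet> b - G x \<bullet> b\<bar> * indicat_real (cball 0 R) x) \<longlonglongrightarrow> 0"
        using key
      proof eventually_elim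
        case (elim x)
        then have "(\<lambda>n. \<Sum>k<n. weak_gradient (v k) x) \<longlonglongrightarrow> G x"
          unfolding G_def by (blast intro: summable_LIMSEQ[OF summable_norm_cancel])
        then have "(\<lambda>n. (\<Sum>k<n. weak_gradient (v k) x) \<bullet> b) \<longlonglongrightarrow> G x \<bullet> b" by (intro tendsto_inner tendsto_const)
        then show ?case by (rule tendsto_mult_left_zero[OF tendsto_rabs_zero[OF LIM_zero]])
      qed
      show "AE x in lebesgue. norm (\<bar>(\<Sum>k<n. weak_gradient (v k) x) \<bullet> b - G x \<bullet> b\<bar> * indicat_real (cball 0 R) x) \<le> 2 * (1 + T x) * indicat_real (cball 0 R) x" for n
        using key
      proof eventually_elim
        case (elim x)
        have c: "\<bar>y \<bullet> b\<bar> powr p \<le> T x" if "norm y powr p \<le> B x" for y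
        proof -
          have "\<bar>y \<bullet> b\<bar> powr p \<le> norm y powr p" using p0 b by (intro powr_mono2) (auto intro: Basis_le_norm)
          then show ?thesis using elim that by linarith
        qed
        have "\<bar>(\<Sum>k<n. weak_gradient (v k) x) \<bullet> b - G x \<bullet> b\<bar> \<le> 2 * (1 + T x)" by (rule bound; rule c) (use elim in auto)
        then show ?case by (auto simp: indicator_def)
      qed
    qed (auto intro!: borel_measurable_times borel_measurable_indicator)
    then show "(\<lambda>n. L1c R (\<lambda>x. (\<Sum>k<n. weak_gradient (v k) x) \<bullet> b - G x \<bullet> b)) \<longlonglongrightarrow> 0" by simp
  qed
  note fin = sobolevI[OF LV this LG p0(1)]
  show s: "(\<lambda>x. \<Sum>k. v k x) \<in> sobolev p" using fin(1) by (simp add: V_def[abs_def])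
  show g: "AE x in lebesgue. weak_gradient (\<lambda>x. \<Sum>k. v k x) x = (\<Sum>k. weak_gradient (v k) x)"
    using fin(2) by (simp add: V_def[abs_def] G_def)
  have "energy p (\<lambda>x. \<Sum>k. v k x) \<le> (\<integral>x. T x \<partial>lebesgue)"
    unfolding energy_def
  proof (rule integral_mono_AE[OF energy_integrable[OF s p0(1)] Ti])
    show "AE x in lebesgue. norm (weak_gradient (\<lambda>x. \<Sum>k. v k x) x) powr p + \<bar>\<Sum>k. v k x\<bar> powr p \<le> T x"
      using g key by eventually_elim (auto simp: V_def G_def)
  qed
  then show "energy p (\<lambda>x. \<Sum>k. v k x) \<le> (\<Sum>k. wgt p k * energy p (v k))" by (simp add: Te)
qed

section \<open>Capacity\<close>

lemma pcap_le_energy: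
  assumes "u \<in> sobolev p" "p \<ge> 0" "open U" "E \<subseteq> U" "AE x in lebesgue. x \<in> U \<longrightarrow> u x \<ge> 1"
  shows "pcap p E \<le> ennreal (energy p u)"
  unfolding energy_nn[OF assms(1,2), symmetric] pcap_def
  by (rule INF_lower) (use assms in auto)

lemma pcap_lessE:
  assumes "pcap p E < c" "p \<ge> 0"
  obtains u U where "u \<in> sobolev p" "open U" "E \<subseteq> U" "AE x in lebesgue. x \<in> U \<longrightarrow> u x \<ge> 1" "ennreal (energy p u) < c"
proof -
  obtain u where u: "u \<in> sobolev p" "\<exists>U. open U \<and> E \<subseteq> U \<and> (AE x in lebesgue. x \<in> U \<longrightarrow> u x \<ge> 1)"
    "(\<integral>\<^sup>+x. ennreal (norm (weak_gradient u x) powr p + \<bar>u x\<bar> powr p) \<partial>lebesgue) < c"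
    using assms(1) unfolding pcap_def INF_less_iff by blast
  then show thesis using that energy_nn[OF u(1) assms(2)] by auto
qed

lemma pcap_mono: "E \<subseteq> F \<Longrightarrow> pcap p E \<le> pcap p F"
  unfolding pcap_def by (rule INF_superset_mono) auto

lemma pcap_empty:
  assumes "p > 0" shows "pcap p ({}::'a::euclidean_space set) = 0"
proof -
  have "pcap p ({}::'a set) \<le> ennreal (energy p (\<lambda>x::'a. 0))"
    by (rule pcap_le_energy[OF sobolev_zero(1), of p "{}"]) (use assms in auto)
  then show ?thesis using assms by (simp add: sobolev_zero(3))
qed

text \<open>The sum of the |u_k| is admissible for the union, being at least 1 near each
  \<open>E k\<close>. The weights are the price for adding the functions instead of taking their
  supremum.\<close>

lemma pcap_UN_le:
  fixes E :: "nat \<Rightarrow> 'a::euclidean_space set"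
  assumes p: "p > 1" and E: "\<And>k. pcap p (E k) < ennreal (\<delta> k)" and S: "summable (\<lambda>k. wgt p k * \<delta> k)"
  shows "pcap p (\<Union>k. E k) \<le> ennreal (\<Sum>k. wgt p k * \<delta> k)"
proof -
  have p0: "p \<ge> 0" using p by simp
  define P where "P k u U \<longleftrightarrow> u \<in> sobolev p \<and> open U \<and> E k \<subseteq> U \<and> (AE x in lebesgue. x \<in> U \<longrightarrow> u x \<ge> 1) \<and> energy p u \<le> \<delta> k"
    for k u U
  have "\<exists>u U. P k u U" for k
  proof -
    obtain u U where u: "u \<in> sobolev p" "open U" "E k \<subseteq> U" "AE x in lebesgue. x \<in> U \<longrightarrow> u x \<ge> 1"
        and e: "ennreal (energy p u) < ennreal (\<delta> k)"
      by (rule pcap_lessE[OF E p0, of k])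
    have "energy p u \<le> \<delta> k" using e energy_nonneg[of p u] by (simp add: ennreal_less_iff)
    then have "P k u U" using u by (simp add: P_def)
    then show ?thesis by blast
  qed
  then obtain u U where "\<And>k. P k (u k) (U k)" by metis
  then have u: "\<And>k. u k \<in> sobolev p" and U: "\<And>k. open (U k)" "\<And>k. E k \<subseteq> U k"
    and ge: "\<And>k. AE x in lebesgue. x \<in> U k \<longrightarrow> u k x \<ge> 1" and en: "\<And>k. energy p (u k) \<le> \<delta> k"
    by (auto simp: P_def)
  define v where "v k x = \<bar>u k x\<bar>" for k x
  have v: "v k \<in> sobolev p" for k unfolding v_def using sobolev_abs(1)[OF u p0] .
  have ev: "energy p (v k) \<le> \<delta> k" for k unfolding v_def[abs_def] using energy_abs[OF u p0] en order_trans by blast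
  have le: "wgt p k * energy p (v k) \<le> wgt p k * \<delta> k" for k
    using ev[of k] wgt_pos[of p k] by simp
  have Sv: "summable (\<lambda>k. wgt p k * energy p (v k))"
  proof (rule summable_comparison_test'[OF S])
    show "norm (wgt p k * energy p (v k)) \<le> wgt p k * \<delta> k" for k
      using le[of k] energy_nonneg[of p "v k"] wgt_pos[of p k] by simp
  qed
  note ser = sobolev_series[OF p v Sv]
  have "pcap p (\<Union>k. E k) \<le> ennreal (energy p (\<lambda>x. \<Sum>k. v k x))"
  proof (rule pcap_le_energy[OF ser(1) p0, of "\<Union>k. U k"])
    show "open (\<Union>k. U k)" "(\<Union>k. E k) \<subseteq> (\<Union>k. U k)" using U by auto
    have "AE x in lebesgue. \<forall>k. x \<in> U k \<longrightarrow> u k x \<ge> 1" using ge by (simp add: AE_all_countable)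
    then show "AE x in lebesgue. x \<in> (\<Union>k. U k) \<longrightarrow> (\<Sum>k. v k x) \<ge> 1"
      using ser(2)
    proof eventually_elim
      case (elim x)
      show ?case
      proof
        assume "x \<in> (\<Union>k. U k)"
        then obtain k where "x \<in> U k" by blast
        then have "1 \<le> v k x" using elim by (force simp: v_def)
        also have "\<dots> \<le> (\<Sum>k. v k x)"
          using sum_le_suminf[of "\<lambda>k. v k x" "{k}"] elim by (auto simp: v_def)
        finally show "(\<Sum>k. v k x) \<ge> 1" .
      qed
    qed
  qed
  also have "\<dots> \<le> ennreal (\<Sum>k. wgt p k * \<delta> k)"
    by (intro ennreal_leI order_trans[OF ser(5)] suminf_le le Sv S)
  finally show ?thesis .
qed

lemma pcap_UN_small:
  assumes p: "p > 1" and "\<epsilon> > 0"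
  obtains \<delta> :: "nat \<Rightarrow> real" where "\<And>k. \<delta> k > 0"
    "\<And>E :: nat \<Rightarrow> 'a::euclidean_space set. (\<And>k. pcap p (E k) < ennreal (\<delta> k)) \<Longrightarrow> pcap p (\<Union>k. E k) < ennreal \<epsilon>"
proof
  \<comment> \<open>Cancels the weights of \<open>pcap_UN_le\<close> and leaves a geometric series
    with sum \<epsilon>/2; the factor 1/2 turns the weak inequality obtained there into a strict
    one.\<close>
  let ?\<delta> = "\<lambda>k. (\<epsilon>/2) * (1/2)^Suc k / wgt p k"
  show "?\<delta> k > 0" for k using assms wgt_pos[of p k] by simp
  fix E :: "nat \<Rightarrow> 'a set" assume E: "\<And>k. pcap p (E k) < ennreal (?\<delta> k)"
  have eq: "wgt p k * ?\<delta> k = (\<epsilon>/2) * (1/2)^Suc k" for k using wgt_pos[of p k] by simp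
  have s: "(\<lambda>k. wgt p k * ?\<delta> k) sums (\<epsilon>/2)" unfolding eq using sums_mult[OF power_half_series, of "\<epsilon>/2"] by simp
  have "pcap p (\<Union>k. E k) \<le> ennreal (\<epsilon>/2)"
    using pcap_UN_le[OF p E sums_summable[OF s]] unfolding sums_unique[OF s, symmetric] .
  also have "\<dots> < ennreal \<epsilon>" using assms by (simp add: ennreal_less_iff)
  finally show "pcap p (\<Union>k. E k) < ennreal \<epsilon>" .
qed

lemma pcap_Un_small:
  assumes p: "p > 1" and "\<epsilon> > 0"
  obtains \<delta> :: real where "\<delta> > 0"
    "\<And>A B :: 'a::euclidean_space set. pcap p A < ennreal \<delta> \<Longrightarrow> pcap p B < ennreal \<delta> \<Longrightarrow> pcap p (A \<union> B) < ennreal \<epsilon>"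
proof -
  obtain d :: "nat \<Rightarrow> real" where d: "\<And>k. d k > 0"
    "\<And>E :: nat \<Rightarrow> 'a::euclidean_space set. (\<And>k. pcap p (E k) < ennreal (d k)) \<Longrightarrow> pcap p (\<Union>k. E k) < ennreal \<epsilon>"
    using pcap_UN_small[OF assms] by blast
  show thesis
  proof (rule that[of "min (d 0) (d 1)"])
    fix A B :: "'a set" assume A: "pcap p A < ennreal (min (d 0) (d 1))" and B: "pcap p B < ennreal (min (d 0) (d 1))"
    let ?E = "\<lambda>k::nat. if k = 0 then A else if k = 1 then B else {}"
    have "pcap p (\<Union>k. ?E k) < ennreal \<epsilon>"
    proof (rule d(2))
      fix k
      have "ennreal (min (d 0) (d 1)) \<le> ennreal (d 0)" "ennreal (min (d 0) (d 1)) \<le> ennreal (d 1)"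
        by (auto intro!: ennreal_leI)
      then show "pcap p (?E k) < ennreal (d k)"
        using A B d(1)[of k] pcap_empty[of p, where 'a = 'a] p by (auto intro: less_le_trans)
    qed
    moreover have "(\<Union>k. ?E k) = A \<union> B" by (auto split: if_splits)
    ultimately show "pcap p (A \<union> B) < ennreal \<epsilon>" by simp
  qed (use d in simp)
qed

lemma ennreal_zeroI:
  fixes x :: ennreal
  assumes "\<And>\<epsilon>::real. \<epsilon> > 0 \<Longrightarrow> x < ennreal \<epsilon>" shows "x = 0"
proof (cases x rule: ennreal_cases)
  case (real r)
  then show ?thesis using assms[of r] by (cases "r = 0") auto
next
  case top
  then show ?thesis using assms[of 1] by simp
qed

lemma pcap_UN_zero:
  fixes E :: "nat \<Rightarrow> 'a::euclidean_space set"
  assumes p: "p > 1" and E: "\<And>k. pcap p (E k) = 0"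
  shows "pcap p (\<Union>k. E k) = 0"
proof (rule ennreal_zeroI)
  fix \<epsilon> :: real assume "\<epsilon> > 0"
  then obtain d :: "nat \<Rightarrow> real" where d: "\<And>k. d k > 0"
    "\<And>E :: nat \<Rightarrow> 'a::euclidean_space set. (\<And>k. pcap p (E k) < ennreal (d k)) \<Longrightarrow> pcap p (\<Union>k. E k) < ennreal \<epsilon>"
    using pcap_UN_small[OF p] by blast
  show "pcap p (\<Union>k. E k) < ennreal \<epsilon>" by (rule d(2)) (use d(1) E in simp)
qed

text \<open>Chebyshev's inequality: an admissible function is at least 1 a.e. on an open
  neighbourhood, so its energy bounds the Lebesgue measure of that neighbourhood.\<close>

lemma pcap_zero_null:
  fixes E :: "'a::euclidean_space set"
  assumes p: "p \<ge> 0" and E: "pcap p E = 0"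
  shows "E \<in> null_sets lebesgue"
proof -
  have "\<exists>U. open U \<and> E \<subseteq> U \<and> emeasure lebesgue U \<le> ennreal (1 / real (Suc n))" for n
  proof -
    have "pcap p E < ennreal (1 / real (Suc n))" using E by simp
    then obtain u U where u: "u \<in> sobolev p" "open U" "E \<subseteq> U" "AE x in lebesgue. x \<in> U \<longrightarrow> u x \<ge> 1"
      "ennreal (energy p u) < ennreal (1 / real (Suc n))" by (rule pcap_lessE[OF _ p])
    have "emeasure lebesgue U = (\<integral>\<^sup>+x. indicator U x \<partial>lebesgue)" using u(2) by simp
    also have "\<dots> \<le> (\<integral>\<^sup>+x. ennreal (norm (weak_gradient u x) powr p + \<bar>u x\<bar> powr p) \<partial>lebesgue)"
    proof (rule nn_integral_mono_AE)
      show "AE x in lebesgue. indicator U x \<le> ennreal (norm (weak_gradient u x) powr p + \<bar>u x\<bar> powr p)"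
        using u(4)
      proof eventually_elim
        case (elim x)
        show ?case
        proof (cases "x \<in> U")
          case True
          then have "1 \<le> \<bar>u x\<bar>" using elim by simp
          then have "1 \<le> \<bar>u x\<bar> powr p" using p by (rule ge_one_powr_ge_zero)
          then have "1 \<le> norm (weak_gradient u x) powr p + \<bar>u x\<bar> powr p" by (simp add: add_increasing)
          then have "ennreal 1 \<le> ennreal (norm (weak_gradient u x) powr p + \<bar>u x\<bar> powr p)" by (rule ennreal_leI)
          then show ?thesis using True by (simp only: indicator_simps(1)[OF True] ennreal_1)
        qed simp
      qed
    qed
    also have "\<dots> = ennreal (energy p u)" by (rule energy_nn[OF u(1) p])
    finally show ?thesis using u by (meson less_imp_le order_trans)
  qed
  then obtain U where U: "\<And>n. open (U n)" "\<And>n. E \<subseteq> U n" "\<And>n. emeasure lebesgue (U n) \<le> ennreal (1 / real (Suc n))" by metis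
  have "(\<Inter>n. U n) \<in> null_sets lebesgue"
  proof (rule null_setsI)
    have "emeasure lebesgue (\<Inter>n. U n) \<le> ennreal \<epsilon>" if \<open>\<epsilon> > 0\<close> for \<epsilon> :: real
    proof -
      obtain n where "1 / real (Suc n) < \<epsilon>" using nat_approx_posE[OF \<open>\<epsilon> > 0\<close>] by blast
      have "emeasure lebesgue (\<Inter>n. U n) \<le> emeasure lebesgue (U n)" using U(1) by (intro emeasure_mono) auto
      also have "\<dots> \<le> ennreal (1 / real (Suc n))" by (rule U(3))
      also have "\<dots> \<le> ennreal \<epsilon>" using \<open>1 / real (Suc n) < \<epsilon>\<close> by (intro ennreal_leI) simp
      finally show ?thesis .
    qed
    note le = this
    show "emeasure lebesgue (\<Inter>n. U n) = 0"
    proof (rule ennreal_zeroI)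
      fix \<epsilon> :: real assume "\<epsilon> > 0"
      have "emeasure lebesgue (\<Inter>n. U n) \<le> ennreal (\<epsilon>/2)" using le[of "\<epsilon>/2"] \<open>\<epsilon> > 0\<close> by simp
      also have "\<dots> < ennreal \<epsilon>" using \<open>\<epsilon> > 0\<close> by (simp add: ennreal_less_iff)
      finally show "emeasure lebesgue (\<Inter>n. U n) < ennreal \<epsilon>" .
    qed
    show "(\<Inter>n. U n) \<in> sets lebesgue" using U(1) by (intro sets.countable_INT') auto
  qed
  then show ?thesis using U(2) by (intro completion.complete2[of E "\<Inter>n. U n"]) auto
qed

section \<open>Quasi-everywhere statements and measures that vanish on sets of capacity zero\<close>

lemma qe_mono: "quasi_everywhere p P \<Longrightarrow> (\<And>x. P x \<Longrightarrow> Q x) \<Longrightarrow> quasi_everywhere p Q"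
  unfolding quasi_everywhere_def using pcap_mono[of "{x. \<not> Q x}" "{x. \<not> P x}" p]
  by (metis (mono_tags, lifting) Collect_mono le_zero_eq)

lemma qe_all_nat:
  assumes "p > 1" "\<And>n::nat. quasi_everywhere p (P n)" shows "quasi_everywhere p (\<lambda>x. \<forall>n. P n x)"
proof -
  have "{x. \<not> (\<forall>n. P n x)} = (\<Union>n. {x. \<not> P n x})" by auto
  then show ?thesis using pcap_UN_zero[OF assms(1), of "\<lambda>n. {x. \<not> P n x}"] assms(2)
    by (simp add: quasi_everywhere_def)
qed

lemma qe_conj:
  assumes "p > 1" "quasi_everywhere p P" "quasi_everywhere p Q"
  shows "quasi_everywhere p (\<lambda>x. P x \<and> Q x)"
proof -
  have "quasi_everywhere p (\<lambda>x. \<forall>n::nat. if n = 0 then P x else Q x)"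
  proof (rule qe_all_nat[OF assms(1)])
    show "quasi_everywhere p (\<lambda>x. if n = 0 then P x else Q x)" for n :: nat
      using assms by (cases "n = 0") auto
  qed
  then show ?thesis by (rule qe_mono) (metis zero_neq_one)
qed

lemma qe_AE: "p \<ge> 0 \<Longrightarrow> quasi_everywhere p P \<Longrightarrow> AE x in lebesgue. P x"
  unfolding quasi_everywhere_def
  by (drule (1) pcap_zero_null) (auto simp: completion.AE_iff_null_sets)

text \<open>Also satisfied by the Dirichlet restrictions of such a measure
  (\<open>cap_null_dirichlet\<close>), so that both kinds of measure fall under the same
  lemmas.\<close>

definition cap_null :: "real \<Rightarrow> 'a::euclidean_space measure \<Rightarrow> bool" where
  "cap_null p \<mu> \<longleftrightarrow> sets \<mu> = sets borel \<and> (\<forall>E. pcap p E = 0 \<longrightarrow> E \<in> null_sets (completion \<mu>))"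

lemma capacitary_cap_null: "\<mu> \<in> capacitary_measures p \<Longrightarrow> cap_null p \<mu>"
  by (auto simp: capacitary_measures_def cap_null_def)

lemma cap_nullD:
  assumes "cap_null p \<mu>"
  shows "sets \<mu> = sets borel" "space \<mu> = UNIV" "pcap p E = 0 \<Longrightarrow> E \<in> null_sets (completion \<mu>)"
proof -
  show *: "sets \<mu> = sets borel" "pcap p E = 0 \<Longrightarrow> E \<in> null_sets (completion \<mu>)"
    using assms by (auto simp: cap_null_def)
  show "space \<mu> = UNIV" using sets_eq_imp_space_eq[OF *(1)] by simp
qed

lemma qe_AE_mu:
  assumes "cap_null p \<mu>" "quasi_everywhere p P" shows "AE x in completion \<mu>. P x"
proof -
  have "{x. \<not> P x} \<in> null_sets (completion \<mu>)"
    using assms cap_nullD(3) by (auto simp: quasi_everywhere_def)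
  then show ?thesis using cap_nullD(2)[OF assms(1)] by (simp add: completion.AE_iff_null_sets)
qed

section \<open>Quasi-continuous functions\<close>

lemma quasi_continuousE:
  assumes "quasi_continuous p u" "\<epsilon> > 0"
  obtains G where "open G" "pcap p G < ennreal \<epsilon>" "continuous_on (- G) u"
  using assms by (auto simp: quasi_continuous_def)

lemma qc_continuous: "continuous_on UNIV u \<Longrightarrow> p > 0 \<Longrightarrow> quasi_continuous p u"
  unfolding quasi_continuous_def
  by (intro allI impI exI[of _ "{}"]) (auto simp: pcap_empty)

lemma qc_pair:
  assumes p: "p > 1" and u: "quasi_continuous p u" "quasi_continuous p v" and \<epsilon>: "\<epsilon> > 0"
  obtains G where "open G" "pcap p G < ennreal \<epsilon>" "continuous_on (- G) u" "continuous_on (- G) v"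
proof -
  obtain \<delta> where \<delta>: "\<delta> > 0"
    "\<And>A B :: 'a set. pcap p A < ennreal \<delta> \<Longrightarrow> pcap p B < ennreal \<delta> \<Longrightarrow> pcap p (A \<union> B) < ennreal \<epsilon>"
    using pcap_Un_small[OF p \<epsilon>, where 'a = 'a] by blast
  obtain G where G: "open G" "pcap p G < ennreal \<delta>" "continuous_on (- G) u" by (rule quasi_continuousE[OF u(1) \<delta>(1)])
  obtain H where H: "open H" "pcap p H < ennreal \<delta>" "continuous_on (- H) v" by (rule quasi_continuousE[OF u(2) \<delta>(1)])
  show thesis
  proof (rule that[of "G \<union> H"])
    show "continuous_on (- (G \<union> H)) u" "continuous_on (- (G \<union> H)) v"
      by (rule continuous_on_subset[OF G(3)], auto) (rule continuous_on_subset[OF H(3)], auto)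
  qed (use G H \<delta> in auto)
qed

text \<open>Continuity of \<open>h\<close> is expressed by its effect on compositions, so that each
  instance is settled by the continuity rules.\<close>

lemma qc_comp2:
  fixes h :: "real \<Rightarrow> real \<Rightarrow> real" and u v :: "'a::euclidean_space \<Rightarrow> real"
  assumes p: "p > 1" and u: "quasi_continuous p u" "quasi_continuous p v"
    and h: "\<And>(S :: 'a set) f g. continuous_on S f \<Longrightarrow> continuous_on S g \<Longrightarrow> continuous_on S (\<lambda>x. h (f x) (g x))"
  shows "quasi_continuous p (\<lambda>x. h (u x) (v x))"
  unfolding quasi_continuous_def
proof (intro allI impI)
  fix \<epsilon> :: real assume "\<epsilon> > 0"
  then obtain G where G: "open G" "pcap p G < ennreal \<epsilon>" "continuous_on (- G) u" "continuous_on (- G) v"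
    using qc_pair[OF p u] by blast
  show "\<exists>G. open G \<and> pcap p G < ennreal \<epsilon> \<and> continuous_on (- G) (\<lambda>x. h (u x) (v x))"
    using h[OF G(3,4)] G(1,2) by blast
qed

lemma qc_lincomb:
  assumes "p > 1" "quasi_continuous p u" "quasi_continuous p v"
  shows "quasi_continuous p (\<lambda>x. s * u x + t * v x)"
  using assms by (rule qc_comp2[where h = "\<lambda>a b. s * a + t * b"]) (intro continuous_intros)

lemma qc_mult:
  assumes "p > 1" "quasi_continuous p u" "quasi_continuous p v"
  shows "quasi_continuous p (\<lambda>x. u x * v x)"
  using assms by (rule qc_comp2[where h = "\<lambda>a b. a * b"]) (intro continuous_intros)

lemma qc_abs:
  assumes "p > 1" "quasi_continuous p u"
  shows "quasi_continuous p (\<lambda>x. \<bar>u x\<bar>)"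
  using assms(1,2,2) by (rule qc_comp2[where h = "\<lambda>a b. \<bar>a\<bar>"]) (intro continuous_intros)

lemma qc_max:
  assumes "p > 1" "quasi_continuous p u"
  shows "quasi_continuous p (\<lambda>x. max (u x) 0)"
  using assms(1,2,2) by (rule qc_comp2[where h = "\<lambda>a b. max a 0"]) (intro continuous_intros)

text \<open>If \<open>u\<close> and \<open>v\<close> are continuous off the open set \<open>G\<close>, then \<open>G \<union> {u > v}\<close> is open and has
  the same admissible functions as \<open>G\<close>, because it exceeds \<open>G\<close> by a null set.\<close>

lemma qc_AE_le_imp_qe:
  assumes p: "p > 1" and u: "quasi_continuous p u" "quasi_continuous p v" and le: "AE x in lebesgue. u x \<le> v x"
  shows "quasi_everywhere p (\<lambda>x. u x \<le> v x)"
  unfolding quasi_everywhere_def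
proof (rule ennreal_zeroI)
  fix \<epsilon> :: real assume "\<epsilon> > 0"
  obtain G where G: "open G" "pcap p G < ennreal \<epsilon>" "continuous_on (- G) u" "continuous_on (- G) v"
    using qc_pair[OF p u \<open>\<epsilon> > 0\<close>] by blast
  have "continuous_on (- G) (\<lambda>x. u x - v x)" using G by (intro continuous_intros)
  then obtain A where A: "open A" "A \<inter> - G = (\<lambda>x. u x - v x) -` {0<..} \<inter> - G"
    unfolding continuous_on_open_invariant by (metis open_greaterThan)
  have p0: "p \<ge> 0" using p by simp
  obtain z U where z: "z \<in> sobolev p" "open U" "G \<subseteq> U" "AE x in lebesgue. x \<in> U \<longrightarrow> z x \<ge> 1"
      "ennreal (energy p z) < ennreal \<epsilon>" by (rule pcap_lessE[OF G(2) p0])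
  have "pcap p {x. \<not> u x \<le> v x} \<le> ennreal (energy p z)"
  proof (rule pcap_le_energy[OF z(1) p0, of "A \<union> G"])
    show "open (A \<union> G)" using A G by auto
    show "{x. \<not> u x \<le> v x} \<subseteq> A \<union> G"
    proof
      fix x assume "x \<in> {x. \<not> u x \<le> v x}"
      then have "x \<in> - G \<Longrightarrow> x \<in> (\<lambda>x. u x - v x) -` {0<..} \<inter> - G" by simp
      then show "x \<in> A \<union> G" unfolding A(2)[symmetric] by blast
    qed
    show "AE x in lebesgue. x \<in> A \<union> G \<longrightarrow> 1 \<le> z x"
      using z(4) le
    proof eventually_elim
      case (elim x)
      show ?case
      proof
        assume "x \<in> A \<union> G"
        moreover have "x \<notin> A \<inter> - G" unfolding A(2) using elim by simp
        ultimately show "1 \<le> z x" using elim z(3) by blast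
      qed
    qed
  qed
  then show "pcap p {x. \<not> u x \<le> v x} < ennreal \<epsilon>" using z(5) by (rule le_less_trans)
qed

lemma complete_measurable_cong:
  assumes f: "f \<in> borel_measurable (completion M)" and ae: "AE x in completion M. f x = g x"
  shows "g \<in> borel_measurable (completion M)"
proof (rule measurableI)
  fix A :: "'b set" assume A: "A \<in> sets borel"
  have 1: "f -` A \<inter> space (completion M) \<in> sets (completion M)" using f A by (rule measurable_sets)
  obtain N where N: "N \<in> null_sets (completion M)" "{x \<in> space (completion M). f x \<noteq> g x} \<subseteq> N"
    using ae by (auto simp: eventually_ae_filter)
  have 2: "(g -` A \<inter> space (completion M)) \<inter> N \<in> null_sets (completion M)"
    by (rule completion.complete2[OF _ N(1)]) auto
  have "g -` A \<inter> space (completion M) = ((f -` A \<inter> space (completion M)) - N) \<union> ((g -` A \<inter> space (completion M)) \<inter> N)"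
    using N(2) by auto
  also have "\<dots> \<in> sets (completion M)" using 1 2 N(1) by (intro sets.Un sets.Diff) auto
  finally show "g -` A \<inter> space (completion M) \<in> sets (completion M)" .
qed simp

text \<open>\<open>u\<close> is continuous off open sets \<open>G n\<close> of capacity below
  1/(n+1). Their intersection has capacity zero, hence is null for the completion of \<mu>, and the
  closed complements cover the rest by countably many pieces on each of which \<open>u\<close> is
  continuous.\<close>

lemma qc_measurable_mu:
  assumes p: "p > 1" and \<mu>: "cap_null p \<mu>" and u: "quasi_continuous p u"
  shows "u \<in> borel_measurable (completion \<mu>)"
proof -
  have "\<exists>G. open G \<and> pcap p G < ennreal (1 / real (Suc n)) \<and> continuous_on (- G) u" for n
    by (rule quasi_continuousE[OF u, of "1 / real (Suc n)"]) auto
  then obtain G where G: "\<And>n. open (G n)" "\<And>n. pcap p (G n) < ennreal (1 / real (Suc n))" "\<And>n. continuous_on (- G n) u" by metis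
  define N where "N = (\<Inter>n. G n)"
  have "pcap p N = 0"
  proof (rule ennreal_zeroI)
    fix \<epsilon> :: real assume "\<epsilon> > 0"
    then obtain n where n: "1 / real (Suc n) < \<epsilon>" using nat_approx_posE by blast
    have "pcap p N \<le> pcap p (G n)" by (rule pcap_mono) (auto simp: N_def)
    also have "\<dots> < ennreal (1 / real (Suc n))" by (rule G)
    also have "\<dots> \<le> ennreal \<epsilon>" using n by (intro ennreal_leI) simp
    finally show "pcap p N < ennreal \<epsilon>" .
  qed
  then have N: "N \<in> null_sets (completion \<mu>)" by (rule cap_nullD(3)[OF \<mu>])
  note sp = cap_nullD(1,2)[OF \<mu>]
  define g where "g x = (if x \<in> N then 0 else u x)" for x
  define A where "A k = (case k of 0 \<Rightarrow> N | Suc n \<Rightarrow> - G n)" for k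
  have "g \<in> borel_measurable (completion \<mu>)"
  proof (rule measurable_piecewise_restrict2[of A])
    have "- G n \<in> sets borel" for n using G(1)[of n] by simp
    then show "A k \<in> sets (completion \<mu>)" for k
      using N sp(1) by (cases k) (auto simp: A_def)
    have "x \<in> (\<Union>k. A k)" for x
    proof (cases "x \<in> N")
      case True then show ?thesis by (auto simp: A_def intro!: exI[of _ 0])
    next
      case False
      then obtain n where "x \<in> - G n" by (auto simp: N_def)
      then show ?thesis by (auto simp: A_def intro!: exI[of _ "Suc n"])
    qed
    then show "space (completion \<mu>) = (\<Union>k. A k)" using sp by auto
    fix k
    show "\<exists>h\<in>borel_measurable (completion \<mu>). \<forall>x\<in>A k. g x = h x"
    proof (cases k)
      case 0 then show ?thesis by (intro bexI[of _ "\<lambda>_. 0"]) (auto simp: A_def g_def)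
    next
      case (Suc n)
      have "(\<lambda>x. indicator (- G n) x *\<^sub>R u x) \<in> borel_measurable borel"
        using G by (intro borel_measurable_continuous_on_indicator) auto
      then have "(\<lambda>x. indicator (- G n) x *\<^sub>R u x) \<in> borel_measurable (completion \<mu>)"
        using sp(1) by (intro measurable_completion) (simp cong: measurable_cong_sets)
      then show ?thesis by (rule bexI[rotated]) (auto simp: Suc A_def g_def N_def)
    qed
  qed
  moreover have "AE x in completion \<mu>. g x = u x"
    using AE_not_in[OF N] by eventually_elim (simp add: g_def)
  ultimately show ?thesis by (rule complete_measurable_cong)
qed

section \<open>Quasi-uniform convergence and completeness\<close>

lemma sobolev_qc_lincomb:
  assumes "p > 1" "u \<in> sobolev_qc p" "v \<in> sobolev_qc p"
  shows "(\<lambda>x. s * u x + t * v x) \<in> sobolev_qc p"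
  using assms by (auto simp: sobolev_qc_def intro!: sobolev_lincomb(1) qc_lincomb)

lemma sobolev_qc_sum:
  assumes "p > 1" "\<And>k. v k \<in> sobolev_qc p"
  shows "(\<lambda>x. \<Sum>k<n::nat. v k x) \<in> sobolev_qc p"
proof (induction n)
  case 0
  show ?case using assms(1) sobolev_zero(1)[of p] by (auto simp: sobolev_qc_def intro: qc_continuous)
next
  case (Suc n)
  show ?case using sobolev_qc_lincomb[OF assms(1) Suc assms(2), of 1 1 n] by simp
qed

text \<open>Off open sets of small capacity |v_k| \<le> 2^-k holds for all large k, so the series
  converges uniformly there. Of the three powers of the weight in the energy bound, one pays for the
  height 2^-k in Chebyshev's inequality, one for the weights in \<open>pcap_UN_le\<close>, and one
  is left over to make the tails summable.\<close>

lemma qc_series: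
  fixes v :: "nat \<Rightarrow> 'a::euclidean_space \<Rightarrow> real"
  assumes p: "p > 1" and v: "\<And>k. v k \<in> sobolev_qc p" and e: "\<And>k. energy p (v k) \<le> 1 / wgt p k ^ 3"
  shows "summable (\<lambda>k. wgt p k * energy p (v k))"
    and "(\<lambda>x. \<Sum>k. v k x) \<in> sobolev_qc p"
    and "quasi_everywhere p (\<lambda>x. summable (\<lambda>k. \<bar>v k x\<bar>))"
proof -
  have p0: "p \<ge> 0" "p > 0" using p by auto
  have wg: "wgt p k = (2 powr p) ^ Suc k" for k
  proof -
    have "wgt p k = (2 powr real (Suc k)) powr p" unfolding wgt_def by (subst powr_realpow) auto
    also have "\<dots> = (2 powr p) powr real (Suc k)" by (simp only: powr_powr mult.commute)
    also have "\<dots> = (2 powr p) ^ Suc k" by (rule powr_realpow) simp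
    finally show ?thesis .
  qed
  have w1: "wgt p k \<ge> 1" for k unfolding wg using p by (intro one_le_power) (simp add: ge_one_powr_ge_zero)
  have iw: "summable (\<lambda>k. 1 / wgt p k)"
  proof -
    have "1 / 2 powr p < 1" using p by (simp add: powr_def)
    then have "summable (\<lambda>k. (1 / 2 powr p) ^ k)" by (intro summable_geometric) simp
    then have "summable (\<lambda>k. (1 / 2 powr p) ^ Suc k)" using summable_Suc_iff by blast
    then show ?thesis by (simp add: wg power_one_over)
  qed
  show S: "summable (\<lambda>k. wgt p k * energy p (v k))"
  proof (rule summable_comparison_test'[OF iw])
    fix k
    have "wgt p k * energy p (v k) \<le> wgt p k * (1 / wgt p k ^ 3)" using e[of k] w1[of k] by (intro mult_left_mono) auto
    also have "\<dots> = 1 / (wgt p k * wgt p k)" using w1[of k] by (simp add: field_simps power3_eq_cube)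
    also have "\<dots> \<le> 1 / wgt p k" using w1[of k] by (intro divide_left_mono) auto
    finally show "norm (wgt p k * energy p (v k)) \<le> 1 / wgt p k"
      using w1[of k] energy_nonneg[of p "v k"] by (simp add: abs_mult)
  qed
  have vs: "v k \<in> sobolev p" and vq: "quasi_continuous p (v k)" for k using v[of k] by (auto simp: sobolev_qc_def)
  \<comment> \<open>A bound for the energy of \<open>y\<close> below: each of its two summands has
    energy at most \<open>1 / wgt p k ^ 2\<close>, and \<open>energy_add_le\<close> contributes the
    factor 2^p.\<close>
  define \<delta> where "\<delta> k = 2 powr p * (1 / wgt p k ^ 2 + 1 / wgt p k ^ 2)" for k
  have O: "\<exists>W. open W \<and> {x. \<bar>v k x\<bar> > (1/2)^k} \<subseteq> W \<and> pcap p W < ennreal (\<delta> k) \<and> continuous_on (- W) (v k)" for k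
  proof -
    have "1 / wgt p k ^ 2 > 0" using w1[of k] by simp
    then obtain G where G: "open G" "pcap p G < ennreal (1 / wgt p k ^ 2)" "continuous_on (- G) (v k)"
      by (rule quasi_continuousE[OF vq])
    obtain z U where z: "z \<in> sobolev p" "open U" "G \<subseteq> U" "AE x in lebesgue. x \<in> U \<longrightarrow> z x \<ge> 1"
      "ennreal (energy p z) < ennreal (1 / wgt p k ^ 2)" by (rule pcap_lessE[OF G(2) p0(1)])
    have ez: "energy p z < 1 / wgt p k ^ 2" using z(5) by (simp only: ennreal_less_iff[OF energy_nonneg])
    have "continuous_on (- G) (\<lambda>x. \<bar>v k x\<bar>)" using G by (intro continuous_intros)
    then obtain A where A: "open A" "A \<inter> - G = (\<lambda>x. \<bar>v k x\<bar>) -` {(1/2)^k<..} \<inter> - G"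
      unfolding continuous_on_open_invariant by (metis open_greaterThan)
    \<comment> \<open>Admissible for the open set \<open>A \<union> G\<close>: the first summand
      exceeds 1 where |v_k| > 2^-k, and the second is at least 1 almost everywhere on
      \<open>G\<close>.\<close>
    define y where "y x = \<bar>2^k * v k x\<bar> + \<bar>z x\<bar>" for x
    have cs: "(\<lambda>x. 2^k * v k x) \<in> sobolev p" by (rule sobolev_cmult(1)[OF vs p0(2)])
    have ys: "y \<in> sobolev p" unfolding y_def
      by (intro sobolev_add(1) sobolev_abs(1) cs z p0)
    have "energy p y \<le> 2 powr p * (energy p (\<lambda>x. \<bar>2^k * v k x\<bar>) + energy p (\<lambda>x. \<bar>z x\<bar>))"
      unfolding y_def by (rule energy_add_le[OF sobolev_abs(1)[OF cs p0(1)] sobolev_abs(1)[OF z(1) p0(1)] p0(2)])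
    also have "\<dots> \<le> 2 powr p * (energy p (\<lambda>x. 2^k * v k x) + energy p z)"
      using energy_abs[OF cs p0(1)] energy_abs[OF z(1) p0(1)] by simp
    also have "energy p (\<lambda>x. 2^k * v k x) = (2^k) powr p * energy p (v k)"
      using energy_cmult[OF vs p0(2), of "2^k"] by simp
    also have "(2^k) powr p * energy p (v k) \<le> wgt p k * (1 / wgt p k ^ 3)"
    proof (rule mult_mono)
      show "(2^k) powr p \<le> wgt p k" unfolding wgt_def using p0 by (intro powr_mono2) auto
    qed (use e energy_nonneg w1[of k] in auto)
    also have "wgt p k * (1 / wgt p k ^ 3) = 1 / wgt p k ^ 2"
      using w1[of k] by (simp add: field_simps power3_eq_cube power2_eq_square)
    finally have "energy p y \<le> 2 powr p * (1 / wgt p k ^ 2 + energy p z)" by simp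
    also have "\<dots> < \<delta> k" unfolding \<delta>_def by (intro mult_strict_left_mono add_strict_left_mono ez) simp
    finally have ey: "energy p y < \<delta> k" .
    have "pcap p (A \<union> G) \<le> ennreal (energy p y)"
    proof (rule pcap_le_energy[OF ys p0(1), of "A \<union> G"])
      show "AE x in lebesgue. x \<in> A \<union> G \<longrightarrow> 1 \<le> y x"
        using z(4)
      proof eventually_elim
        case (elim x)
        show ?case
        proof
          assume x: "x \<in> A \<union> G"
          show "1 \<le> y x"
          proof (cases "x \<in> G")
            case True
            then have "1 \<le> z x" using elim z(3) by blast
            then show ?thesis by (simp add: y_def)
          next
            case False
            then have "x \<in> (\<lambda>x. \<bar>v k x\<bar>) -` {(1/2)^k<..} \<inter> - G" using x unfolding A(2)[symmetric] by blast
            then have "(1/2)^k < \<bar>v k x\<bar>" by simp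
            then have "1 < 2^k * \<bar>v k x\<bar>" by (simp add: field_simps)
            then show ?thesis by (simp add: y_def abs_mult)
          qed
        qed
      qed
    qed (use A G in auto)
    also have "\<dots> < ennreal (\<delta> k)" using ey by (simp only: ennreal_less_iff[OF energy_nonneg])
    finally have "pcap p (A \<union> G) < ennreal (\<delta> k)" .
    moreover have "{x. \<bar>v k x\<bar> > (1/2)^k} \<subseteq> A \<union> G"
    proof
      fix x assume "x \<in> {x. \<bar>v k x\<bar> > (1/2)^k}"
      then have "x \<in> - G \<Longrightarrow> x \<in> (\<lambda>x. \<bar>v k x\<bar>) -` {(1/2)^k<..} \<inter> - G" by simp
      then show "x \<in> A \<union> G" unfolding A(2)[symmetric] by blast
    qed
    moreover have "continuous_on (- (A \<union> G)) (v k)" by (rule continuous_on_subset[OF G(3)]) auto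
    ultimately show ?thesis using A G by blast
  qed
  obtain W where W: "\<And>k. open (W k)" "\<And>k. {x. \<bar>v k x\<bar> > (1/2)^k} \<subseteq> W k" "\<And>k. pcap p (W k) < ennreal (\<delta> k)"
      "\<And>k. continuous_on (- W k) (v k)" using O by metis
  have tail: "pcap p (\<Union>j. W (j + m)) \<le> ennreal (2 * 2 powr p * (\<Sum>j. 1 / wgt p (j + m)))" for m
  proof -
    have le: "wgt p j * \<delta> (j + m) \<le> 2 * 2 powr p * (1 / wgt p (j + m))" for j
    proof -
      \<comment> \<open>\<open>pcap_UN_le\<close> numbers the sets of the tail from 0 and so weights
        by \<open>j\<close>, while \<delta> is taken at \<open>j + m\<close>; monotonicity of the
        weights reconciles the two.\<close>
      have "wgt p j \<le> wgt p (j + m)" unfolding wgt_def using p0 by (intro powr_mono2 power_increasing) auto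
      then have "wgt p j * \<delta> (j + m) \<le> wgt p (j + m) * \<delta> (j + m)"
        by (intro mult_right_mono) (auto simp: \<delta>_def)
      also have "\<dots> = 2 * 2 powr p * (1 / wgt p (j + m))"
        unfolding \<delta>_def using w1[of "j + m"] by (simp add: field_simps power2_eq_square)
      finally show ?thesis .
    qed
    have iw': "summable (\<lambda>j. 2 * 2 powr p * (1 / wgt p (j + m)))"
      using iw summable_iff_shift[of "\<lambda>k. 1 / wgt p k" m] by (intro summable_mult) simp
    have s: "summable (\<lambda>j. wgt p j * \<delta> (j + m))"
      by (rule summable_comparison_test'[OF iw']) (use le wgt_pos in \<open>auto simp: abs_mult \<delta>_def less_imp_le abs_of_nonneg\<close>)
    have "pcap p (\<Union>j. W (j + m)) \<le> ennreal (\<Sum>j. wgt p j * \<delta> (j + m))"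
      by (rule pcap_UN_le[OF p W(3) s])
    also have "\<dots> \<le> ennreal (\<Sum>j. 2 * 2 powr p * (1 / wgt p (j + m)))"
      by (intro ennreal_leI suminf_le le s iw')
    also have "(\<Sum>j. 2 * 2 powr p * (1 / wgt p (j + m))) = 2 * 2 powr p * (\<Sum>j. 1 / wgt p (j + m))"
      using iw summable_iff_shift[of "\<lambda>k. 1 / wgt p k" m] by (intro suminf_mult) simp
    finally show ?thesis .
  qed
  have small: "\<exists>m. pcap p (\<Union>j. W (j + m)) < ennreal \<epsilon>" if "\<epsilon> > 0" for \<epsilon>
  proof -
    have "(\<lambda>m. 2 * 2 powr p * (\<Sum>j. 1 / wgt p (j + m))) \<longlonglongrightarrow> 2 * 2 powr p * 0"
      by (intro tendsto_mult_left suminf_exist_split2 iw)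
    then have "\<forall>\<^sub>F m in sequentially. 2 * 2 powr p * (\<Sum>j. 1 / wgt p (j + m)) < \<epsilon>"
      using that by (intro order_tendstoD) auto
    then obtain m where m: "2 * 2 powr p * (\<Sum>j. 1 / wgt p (j + m)) < \<epsilon>" by (auto simp: eventually_sequentially)
    have "ennreal (2 * 2 powr p * (\<Sum>j. 1 / wgt p (j + m))) < ennreal \<epsilon>" using m that by (rule ennreal_lessI[rotated])
    then show ?thesis using tail[of m] le_less_trans by blast
  qed
  have half: "summable (\<lambda>k. (1/2::real)^k)" by (rule summable_geometric) simp
  have vb: "\<bar>v (j + m) x\<bar> \<le> (1/2)^j" if "x \<notin> (\<Union>j. W (j + m))" for x j m
  proof -
    have "\<bar>v (j + m) x\<bar> \<le> (1/2)^(j + m)" using that W(2)[of "j + m"] by (force simp: not_less)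
    also have "\<dots> \<le> (1/2)^j" by (intro power_decreasing) auto
    finally show ?thesis .
  qed
  have sm: "summable (\<lambda>k. \<bar>v k x\<bar>)" if "x \<notin> (\<Union>j. W (j + m))" for x m
  proof -
    have "summable (\<lambda>j. \<bar>v (j + m) x\<bar>)"
      by (rule summable_comparison_test'[OF half]) (use vb[OF that] in auto)
    then show ?thesis using summable_iff_shift[of "\<lambda>k. \<bar>v k x\<bar>" m] by simp
  qed
  show "quasi_everywhere p (\<lambda>x. summable (\<lambda>k. \<bar>v k x\<bar>))"
    unfolding quasi_everywhere_def
  proof (rule ennreal_zeroI)
    fix \<epsilon> :: real assume "\<epsilon> > 0"
    then obtain m where m: "pcap p (\<Union>j. W (j + m)) < ennreal \<epsilon>" using small by blast
    have "{x. \<not> summable (\<lambda>k. \<bar>v k x\<bar>)} \<subseteq> (\<Union>j. W (j + m))" using sm[of _ m] by blast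
    then show "pcap p {x. \<not> summable (\<lambda>k. \<bar>v k x\<bar>)} < ennreal \<epsilon>" using m pcap_mono le_less_trans by blast
  qed
  have "quasi_continuous p (\<lambda>x. \<Sum>k. v k x)"
    unfolding quasi_continuous_def
  proof (intro allI impI)
    fix \<epsilon> :: real assume \<epsilon>: "\<epsilon> > 0"
    obtain d where d: "d > 0"
      "\<And>A B :: 'a set. pcap p A < ennreal d \<Longrightarrow> pcap p B < ennreal d \<Longrightarrow> pcap p (A \<union> B) < ennreal \<epsilon>"
      using pcap_Un_small[OF p \<epsilon>, where 'a = 'a] by blast
    obtain m where m: "pcap p (\<Union>j. W (j + m)) < ennreal d" using small d(1) by blast
    have "quasi_continuous p (\<lambda>x. \<Sum>k<m. v k x)" using sobolev_qc_sum[of p v m, OF p v] by (simp add: sobolev_qc_def)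
    then obtain G where G: "open G" "pcap p G < ennreal d" "continuous_on (- G) (\<lambda>x. \<Sum>k<m. v k x)"
      using d(1) by (rule quasi_continuousE)
    \<comment> \<open>Off \<open>H\<close> the finite initial sum is continuous and the shifted tail
      converges uniformly with majorant 2^-j.\<close>
    define H where "H = (\<Union>j. W (j + m)) \<union> G"
    have ul: "uniform_limit (- H) (\<lambda>n x. \<Sum>j<n. v (j + m) x) (\<lambda>x. \<Sum>j. v (j + m) x) sequentially"
    proof (rule Weierstrass_m_test[OF _ half])
      fix n x assume "x \<in> - H"
      then have "x \<notin> (\<Union>j. W (j + m))" by (auto simp: H_def)
      then show "norm (v (n + m) x) \<le> (1/2)^n" using vb by simp
    qed
    have uc: "\<forall>\<^sub>F n in sequentially. continuous_on (- H) (\<lambda>x. \<Sum>j<n. v (j + m) x)"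
    proof (rule always_eventually, rule allI, rule continuous_on_sum)
      fix n j
      show "continuous_on (- H) (v (j + m))" by (rule continuous_on_subset[OF W(4)]) (auto simp: H_def)
    qed
    have "continuous_on (- H) (\<lambda>x. \<Sum>j. v (j + m) x)"
      by (rule uniform_limit_theorem[OF uc ul]) simp
    moreover have "continuous_on (- H) (\<lambda>x. \<Sum>k<m. v k x)" by (rule continuous_on_subset[OF G(3)]) (auto simp: H_def)
    ultimately have "continuous_on (- H) (\<lambda>x. (\<Sum>j. v (j + m) x) + (\<Sum>k<m. v k x))" by (rule continuous_on_add)
    moreover have "(\<Sum>k. v k x) = (\<Sum>j. v (j + m) x) + (\<Sum>k<m. v k x)" if "x \<in> - H" for x
    proof -
      have "summable (\<lambda>k. \<bar>v k x\<bar>)" using that by (intro sm[of x m]) (auto simp: H_def)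
      then show ?thesis by (rule suminf_split_initial_segment[OF summable_rabs_cancel])
    qed
    ultimately have "continuous_on (- H) (\<lambda>x. \<Sum>k. v k x)" by (rule continuous_on_eq[OF _ sym])
    moreover have "open H" using W(1) G(1) by (auto simp: H_def)
    moreover have "pcap p H < ennreal \<epsilon>" unfolding H_def by (rule d(2)[OF m G(2)])
    ultimately show "\<exists>G. open G \<and> pcap p G < ennreal \<epsilon> \<and> continuous_on (- G) (\<lambda>x. \<Sum>k. v k x)" by blast
  qed
  then show "(\<lambda>x. \<Sum>k. v k x) \<in> sobolev_qc p"
    using sobolev_series(1)[OF p vs S] by (simp add: sobolev_qc_def)
qed

text \<open>The increments of a rapidly Cauchy sequence form a series to which
  \<open>qc_series\<close> applies. Convergence of the gradients a.e. is recorded as well, because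
  lower semicontinuity of the energy will rest on Fatou's lemma.\<close>

lemma sobolev_qc_complete:
  fixes u :: "nat \<Rightarrow> 'a::euclidean_space \<Rightarrow> real"
  assumes p: "p > 1" and u: "\<And>n. u n \<in> sobolev_qc p" and e: "\<And>n. energy p (\<lambda>x. u (Suc n) x - u n x) \<le> 1 / wgt p n ^ 3"
  obtains w where "w \<in> sobolev_qc p" "quasi_everywhere p (\<lambda>x. (\<lambda>n. u n x) \<longlonglongrightarrow> w x)"
    "AE x in lebesgue. (\<lambda>n. weak_gradient (u n) x) \<longlonglongrightarrow> weak_gradient w x"
proof -
  have p0: "p > 0" using p by simp
  define v where "v k x = u (Suc k) x - u k x" for k x
  have us: "u n \<in> sobolev p" for n using u[of n] by (simp add: sobolev_qc_def)
  have v: "v k \<in> sobolev_qc p" for k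
    unfolding v_def using sobolev_qc_lincomb[OF p u u, of 1 "Suc k" "-1" k] by simp
  have vs: "v k \<in> sobolev p" for k using v[of k] by (simp add: sobolev_qc_def)
  have ev: "energy p (v k) \<le> 1 / wgt p k ^ 3" for k unfolding v_def[abs_def] by (rule e)
  note ser = qc_series[OF p v ev] and ser' = sobolev_series[OF p vs qc_series(1)[OF p v ev]]
  define w where "w x = u 0 x + (\<Sum>k. v k x)" for x
  have tel: "(\<Sum>k<n. v k x) = u n x - u 0 x" for n x unfolding v_def by (rule sum_lessThan_telescope)
  show thesis
  proof (rule that[of w])
    show "w \<in> sobolev_qc p" unfolding w_def[abs_def] using sobolev_qc_lincomb[OF p u ser(2), of 1 0 1] by simp
    show "quasi_everywhere p (\<lambda>x. (\<lambda>n. u n x) \<longlonglongrightarrow> w x)"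
    proof (rule qe_mono[OF ser(3)])
      fix x assume "summable (\<lambda>k. \<bar>v k x\<bar>)"
      then have "(\<lambda>n. \<Sum>k<n. v k x) \<longlonglongrightarrow> (\<Sum>k. v k x)" by (rule summable_LIMSEQ[OF summable_rabs_cancel])
      from tendsto_add[OF tendsto_const[of "u 0 x"] this] show "(\<lambda>n. u n x) \<longlonglongrightarrow> w x" by (simp add: tel w_def)
    qed
    have "AE x in lebesgue. \<forall>k. weak_gradient (v k) x = weak_gradient (u (Suc k)) x - weak_gradient (u k) x"
      unfolding AE_all_countable v_def[abs_def] using sobolev_diff(2)[OF us us p0] by blast
    moreover have "AE x in lebesgue. weak_gradient w x = weak_gradient (u 0) x + weak_gradient (\<lambda>x. \<Sum>k. v k x) x"
      unfolding w_def[abs_def] by (rule sobolev_add(2)[OF us ser'(1) p0])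
    ultimately show "AE x in lebesgue. (\<lambda>n. weak_gradient (u n) x) \<longlonglongrightarrow> weak_gradient w x"
      using ser'(3) ser'(4)
    proof eventually_elim
      case (elim x)
      have "(\<lambda>n. \<Sum>k<n. weak_gradient (v k) x) \<longlonglongrightarrow> (\<Sum>k. weak_gradient (v k) x)"
        by (rule summable_LIMSEQ[OF summable_norm_cancel[OF elim(3)]])
      moreover have "(\<Sum>k<n. weak_gradient (v k) x) = weak_gradient (u n) x - weak_gradient (u 0) x" for n
        unfolding elim(1)[rule_format] by (rule sum_lessThan_telescope)
      ultimately have "(\<lambda>n. weak_gradient (u n) x - weak_gradient (u 0) x) \<longlonglongrightarrow> (\<Sum>k. weak_gradient (v k) x)" by simp
      from tendsto_add[OF tendsto_const[of "weak_gradient (u 0) x"] this] show ?case by (simp add: elim)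
    qed
  qed
qed

section \<open>Convexity of the \<open>p\<close>-th power\<close>

text \<open>For \<open>p < 2\<close> the value at \<open>0\<close> is still \<open>0\<close>.\<close>

definition pvec :: "real \<Rightarrow> 'b::euclidean_space \<Rightarrow> 'b" where
  "pvec p a = norm a powr (p - 2) *\<^sub>R a"

text \<open>The case t = 0 is included because 0 raised to any power by \<open>powr\<close> is
  0.\<close>

lemma powr_mult_norm:
  fixes t p :: real
  assumes "t \<ge> 0" shows "t powr (p - 1) * t = t powr p"
proof (cases "t = 0")
  case False
  have "t powr (p - 1) * t powr 1 = t powr (p - 1 + 1)" by (rule powr_add[symmetric])
  then show ?thesis using False assms by simp
qed simp

lemma norm_pvec: "norm (pvec p a) = norm a powr (p - 1)"
  using powr_mult_norm[of "norm a" "p - 1"] by (simp add: pvec_def)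

lemma pvec_inner_self: "pvec p a \<bullet> a = norm a powr p"
proof -
  have "pvec p a \<bullet> a = (norm a powr (p - 2) * norm a) * norm a"
    by (simp add: pvec_def dot_square_norm power2_eq_square)
  also have "norm a powr (p - 2) * norm a = norm a powr (p - 1)"
    using powr_mult_norm[of "norm a" "p - 1"] by simp
  finally show ?thesis by (simp add: powr_mult_norm)
qed

lemma pvec_inner_le: "\<bar>pvec p a \<bullet> b\<bar> \<le> norm a powr (p - 1) * norm b"
  using Cauchy_Schwarz_ineq2[of "pvec p a" b] by (simp add: norm_pvec)

text \<open>The mean value theorem together with strict monotonicity of t^(p-1), once for each order
  of a and b.\<close>

lemma powr_tangent_strict:
  fixes a b p :: real
  assumes p: "p > 1" and ab: "a \<ge> 0" "b \<ge> 0" "a \<noteq> b"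
  shows "a powr p + p * a powr (p - 1) * (b - a) < b powr p"
proof -
  have cont: "continuous_on {x..y} (\<lambda>t::real. t powr p)" if "x \<ge> 0" for x y
    using p that by (intro continuous_on_powr' continuous_intros) auto
  have der: "((\<lambda>t. t powr p) has_real_derivative p * x powr (p - 1)) (at x)" if "x > 0" for x
    by (rule has_real_derivative_powr[OF that])
  show ?thesis
  proof (cases "a < b")
    case True
    obtain l z where z: "a < z" "z < b" "((\<lambda>t. t powr p) has_real_derivative l) (at z)" "b powr p - a powr p = (b - a) * l"
      using MVT[OF True cont] der ab(1) by (metis le_less_trans real_differentiable_def)
    have "l = p * z powr (p - 1)" using z(3) der[of z] ab(1) z(1) DERIV_unique by (metis le_less_trans)
    moreover have "a powr (p - 1) < z powr (p - 1)" using z ab p by (intro powr_less_mono2) auto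
    ultimately have "p * a powr (p - 1) * (b - a) < (b - a) * l" using True p by (simp add: mult.commute)
    then show ?thesis using z(4) by simp
  next
    case False
    then have ba: "b < a" using ab by simp
    obtain l z where z: "b < z" "z < a" "((\<lambda>t. t powr p) has_real_derivative l) (at z)" "a powr p - b powr p = (a - b) * l"
      using MVT[OF ba cont] der ab(2) by (metis le_less_trans real_differentiable_def)
    have "l = p * z powr (p - 1)" using z(3) der[of z] ab(2) z(1) DERIV_unique by (metis le_less_trans)
    moreover have "z powr (p - 1) < a powr (p - 1)" using z ab p by (intro powr_less_mono2) auto
    ultimately have "(a - b) * l < p * a powr (p - 1) * (a - b)" using ba p by (simp add: mult.commute)
    then show ?thesis using z(4) by (simp add: algebra_simps)
  qed
qed

lemma powr_tangent:
  fixes a b p :: real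
  assumes "p > 1" "a \<ge> 0" "b \<ge> 0"
  shows "a powr p + p * a powr (p - 1) * (b - a) \<le> b powr p"
  using powr_tangent_strict[OF assms] by (cases "a = b") (auto intro: less_imp_le)

text \<open>The scalar tangent inequality for the norms, combined with the Cauchy-Schwarz inequality
  for \<open>pvec p a\<close>, whose norm is |a|^(p-1).\<close>

lemma pvec_tangent:
  fixes a b :: "'b::euclidean_space"
  assumes p: "p > 1"
  shows "norm a powr p + p * (pvec p a \<bullet> (b - a)) \<le> norm b powr p"
    and "a \<noteq> b \<Longrightarrow> norm a powr p + p * (pvec p a \<bullet> (b - a)) < norm b powr p"
proof -
  have 1: "pvec p a \<bullet> (b - a) = pvec p a \<bullet> b - norm a powr p" by (simp add: inner_diff_right pvec_inner_self)
  have 2: "norm a powr (p - 1) * (norm b - norm a) = norm a powr (p - 1) * norm b - norm a powr p"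
    by (simp add: right_diff_distrib powr_mult_norm)
  have 3: "pvec p a \<bullet> b \<le> norm a powr (p - 1) * norm b" using pvec_inner_le[of p a b] by simp
  have le: "p * (pvec p a \<bullet> (b - a)) \<le> p * norm a powr (p - 1) * (norm b - norm a)"
    unfolding 1 mult.assoc 2 using 3 p by simp
  show "norm a powr p + p * (pvec p a \<bullet> (b - a)) \<le> norm b powr p"
    using le powr_tangent[OF p norm_ge_zero[of a] norm_ge_zero[of b]] by linarith
  assume ne: "a \<noteq> b"
  show "norm a powr p + p * (pvec p a \<bullet> (b - a)) < norm b powr p"
  proof (cases "norm a = norm b")
    case False
    then show ?thesis using le powr_tangent_strict[OF p norm_ge_zero[of a] norm_ge_zero[of b]] by linarith
  next
    case True
    \<comment> \<open>For equal norms the scalar inequality is an equality. Strictness now comes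
      from |b - a|^2 > 0, which says that the Cauchy-Schwarz step is strict.\<close>
    then have a: "norm a > 0" using ne by auto
    have "(b - a) \<bullet> (b - a) > 0" using ne by simp
    moreover have "(b - a) \<bullet> (b - a) = b \<bullet> b - 2 * (a \<bullet> b) + a \<bullet> a"
      by (simp add: inner_diff_left inner_diff_right inner_commute)
    moreover have "a \<bullet> a = b \<bullet> b" using True by (simp add: dot_square_norm)
    ultimately have "a \<bullet> b < a \<bullet> a" by linarith
    then have "norm a powr (p - 2) * (a \<bullet> b) < norm a powr (p - 2) * (a \<bullet> a)" using a by simp
    then have "pvec p a \<bullet> b < norm a powr p" unfolding pvec_inner_self[of p a, symmetric] by (simp add: pvec_def)
    then have "p * (pvec p a \<bullet> (b - a)) < 0" unfolding 1 using p by (simp add: mult_less_0_iff)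
    then show ?thesis using True by simp
  qed
qed

text \<open>The sum of the tangent inequalities at a and at b.\<close>

lemma pvec_monotone:
  fixes a b :: "'b::euclidean_space"
  assumes p: "p > 1"
  shows "(pvec p a - pvec p b) \<bullet> (a - b) \<ge> 0"
    and "(pvec p a - pvec p b) \<bullet> (a - b) = 0 \<Longrightarrow> a = b"
proof -
  have eq: "(pvec p a - pvec p b) \<bullet> (a - b) = - (pvec p a \<bullet> (b - a)) - pvec p b \<bullet> (a - b)"
    by (simp add: inner_diff_left inner_diff_right)
  have "p * (pvec p a \<bullet> (b - a)) + p * (pvec p b \<bullet> (a - b)) \<le> 0"
    using pvec_tangent(1)[OF p, of a b] pvec_tangent(1)[OF p, of b a] by linarith
  then have "p * ((pvec p a - pvec p b) \<bullet> (a - b)) \<ge> 0" unfolding eq by (simp add: algebra_simps)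
  then show "(pvec p a - pvec p b) \<bullet> (a - b) \<ge> 0" using p by (simp add: zero_le_mult_iff)
  assume z: "(pvec p a - pvec p b) \<bullet> (a - b) = 0"
  show "a = b"
  proof (rule ccontr)
    assume ne: "a \<noteq> b"
    have "p * (pvec p a \<bullet> (b - a)) + p * (pvec p b \<bullet> (a - b)) < 0"
      using pvec_tangent(2)[OF p ne] pvec_tangent(1)[OF p, of b a] by linarith
    then have "p * ((pvec p a - pvec p b) \<bullet> (a - b)) > 0" unfolding eq by (simp add: algebra_simps)
    then show False using z by simp
  qed
qed

text \<open>The tangent at the midpoint m is evaluated at a and at b; the linear terms cancel
  because (a - m) + (b - m) = 0.\<close>

lemma powr_midpoint:
  fixes a b :: "'b::euclidean_space"
  assumes p: "p > 1"
  shows "norm ((1/2) *\<^sub>R (a + b)) powr p \<le> norm a powr p / 2 + norm b powr p / 2"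
    and "a \<noteq> b \<Longrightarrow> norm ((1/2) *\<^sub>R (a + b)) powr p < norm a powr p / 2 + norm b powr p / 2"
proof -
  define m where "m = (1/2) *\<^sub>R (a + b)"
  have "m + m = a + b" by (simp add: m_def flip: scaleR_2)
  then have z: "(a - m) + (b - m) = 0" by (simp add: algebra_simps)
  then have s: "pvec p m \<bullet> (a - m) + pvec p m \<bullet> (b - m) = 0" by (metis inner_add_right inner_zero_right)
  then have s': "p * (pvec p m \<bullet> (a - m)) + p * (pvec p m \<bullet> (b - m)) = 0" by (metis distrib_left mult_zero_right)
  show "norm ((1/2) *\<^sub>R (a + b)) powr p \<le> norm a powr p / 2 + norm b powr p / 2"
    using pvec_tangent(1)[OF p, of m a] pvec_tangent(1)[OF p, of m b] s' unfolding m_def[symmetric] by linarith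
  assume "a \<noteq> b"
  then have "m \<noteq> a" using z by auto
  then show "norm ((1/2) *\<^sub>R (a + b)) powr p < norm a powr p / 2 + norm b powr p / 2"
    using pvec_tangent(2)[OF p, of m a] pvec_tangent(1)[OF p, of m b] s' unfolding m_def[symmetric] by linarith
qed

text \<open>By homogeneity it suffices to find \<open>C\<close> on the unit sphere of \<open>\<bar>a\<bar>\<^sup>p + \<bar>b\<bar>\<^sup>p\<close>, where the
  convexity defect has a positive minimum on the compact set \<open>\<bar>a - b\<bar>\<^sup>p \<ge> \<epsilon>\<close>.\<close>

lemma powr_uniformly_convex:
  assumes p: "p > 1" and \<epsilon>: "\<epsilon> > 0"
  obtains C where "C > 0" "\<And>a b :: 'b::euclidean_space. norm (a - b) powr p \<le> \<epsilon> * (norm a powr p + norm b powr p)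
     + C * (norm a powr p / 2 + norm b powr p / 2 - norm ((1/2) *\<^sub>R (a + b)) powr p)"
proof -
  define S where "S z = norm (fst z) powr p + norm (snd z) powr p" for z :: "'b \<times> 'b"
  define D where "D z = norm (fst z) powr p / 2 + norm (snd z) powr p / 2 - norm ((1/2) *\<^sub>R (fst z + snd z)) powr p" for z :: "'b \<times> 'b"
  define T where "T z = norm (fst z - snd z) powr p" for z :: "'b \<times> 'b"
  have cS: "continuous_on UNIV S" and cD: "continuous_on UNIV D" and cT: "continuous_on UNIV T"
    unfolding S_def[abs_def] D_def[abs_def] T_def[abs_def] using p
    by (auto intro!: continuous_intros continuous_on_powr')
  have T_le: "T z \<le> 2 powr p * S z" for z
    using powr_add_le[of p "fst z" "- snd z"] p by (simp add: T_def S_def)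
  have D0: "D z \<ge> 0" for z using powr_midpoint(1)[OF p, of "fst z" "snd z"] by (simp add: D_def)
  define K where "K = {z. S z = 1 \<and> T z \<ge> \<epsilon>}"
  have "compact K"
    unfolding compact_eq_bounded_closed
  proof
    have "norm (fst z) \<le> 1 \<and> norm (snd z) \<le> 1" if "z \<in> K" for z
    proof -
      have "norm (fst z) powr p \<le> 1" "norm (snd z) powr p \<le> 1"
        using that by (auto simp: K_def S_def) (metis add_increasing2 le_add_same_cancel1 order_refl powr_ge_zero add.commute)+
      moreover have "n \<le> 1" if "n powr p \<le> 1" for n :: real
      proof (rule ccontr)
        assume "\<not> n \<le> 1"
        then have "1 powr p < n powr p" using p by (intro powr_less_mono2) auto
        then have "1 < n powr p" by (simp only: powr_one_eq_one)
        then show False using leD[OF that] by blast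
      qed
      ultimately show ?thesis by blast
    qed
    then have "K \<subseteq> cball 0 1 \<times> cball 0 1" by (auto simp: mem_Times_iff)
    then show "bounded K" by (rule bounded_subset[rotated]) (intro bounded_Times bounded_cball)
    have "closed (S -` {1})" "closed (T -` {\<epsilon>..})"
      using cS cT by (auto intro!: continuous_closed_vimage simp: continuous_on_eq_continuous_at)
    moreover have "K = S -` {1} \<inter> T -` {\<epsilon>..}" by (auto simp: K_def)
    ultimately show "closed K" by auto
  qed
  have "\<exists>\<delta>>0. \<forall>z\<in>K. D z \<ge> \<delta>"
  proof (cases "K = {}")
    case False
    have "continuous_on K D" using cD continuous_on_subset by blast
    then obtain z where z: "z \<in> K" "\<And>y. y \<in> K \<Longrightarrow> D z \<le> D y"
      using continuous_attains_inf[OF \<open>compact K\<close> False] by blast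
    have "fst z \<noteq> snd z" using z(1) \<epsilon> by (auto simp: K_def T_def)
    then have "D z > 0" using powr_midpoint(2)[OF p] by (simp add: D_def)
    then show ?thesis using z by blast
  qed (auto intro: exI[of _ 1])
  then obtain \<delta> where \<delta>: "\<delta> > 0" "\<And>z. z \<in> K \<Longrightarrow> D z \<ge> \<delta>" by blast
  define C where "C = 2 powr p / \<delta>"
  have C: "C > 0" using \<delta> by (simp add: C_def)
  have unit: "T z \<le> \<epsilon> + C * D z" if "S z = 1" for z
  proof (cases "T z \<ge> \<epsilon>")
    case True
    then have "D z \<ge> \<delta>" using that \<delta>(2) by (simp add: K_def)
    then have "2 powr p \<le> C * D z" using \<delta>(1) by (simp add: C_def field_simps)
    then show ?thesis using T_le[of z] that \<epsilon> by simp
  next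
    case False
    have "0 \<le> C * D z" using C D0[of z] by simp
    then show ?thesis using False by linarith
  qed
  have "T z \<le> \<epsilon> * S z + C * D z" for z
  proof (cases "S z = 0")
    case True
    have "0 \<le> C * D z" using C D0[of z] by simp
    then show ?thesis using T_le[of z] True by simp
  next
    case False
    have "S z \<ge> 0" by (simp add: S_def)
    then have Sp: "S z > 0" using False by simp
    define s where "s = S z powr (- 1 / p)"
    have s: "s > 0" using Sp by (simp add: s_def)
    have "s powr p = S z powr (- 1 / p * p)" by (simp only: s_def powr_powr)
    then have sp: "s powr p = 1 / S z" using Sp p by (simp add: powr_minus_divide)
    have hS: "S (s *\<^sub>R z) = s powr p * S z" and hT: "T (s *\<^sub>R z) = s powr p * T z"
      using s by (simp_all add: S_def T_def powr_mult algebra_simps flip: scaleR_diff_right)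
    have hD: "D (s *\<^sub>R z) = s powr p * D z"
    proof -
      have "(1/2) *\<^sub>R (s *\<^sub>R fst z + s *\<^sub>R snd z) = s *\<^sub>R ((1/2) *\<^sub>R (fst z + snd z))" by (simp add: algebra_simps)
      then have "norm ((1/2) *\<^sub>R (s *\<^sub>R fst z + s *\<^sub>R snd z)) powr p = s powr p * norm ((1/2) *\<^sub>R (fst z + snd z)) powr p"
        using s by (simp only: norm_scaleR powr_mult abs_of_pos)
      then show ?thesis using s by (simp add: D_def powr_mult algebra_simps)
    qed
    have "T (s *\<^sub>R z) \<le> \<epsilon> + C * D (s *\<^sub>R z)" using Sp by (intro unit) (simp add: hS sp)
    then show ?thesis unfolding hT hD sp using Sp by (simp add: field_simps)
  qed
  then show thesis using C that[of C] by (simp add: T_def S_def D_def split_paired_all)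
qed

text \<open>The pointwise inequality is integrated. \<open>C\<close> is chosen before the measure
  and the functions, so that one constant serves both Lebesgue measure and the completion of
  \<mu>.\<close>

lemma Lp_uniformly_convex:
  assumes p: "p > 1" and \<epsilon>: "\<epsilon> > 0"
  obtains C where "C > 0" "\<And>M f g :: 'm \<Rightarrow> 'b::euclidean_space. Lp M p f \<Longrightarrow> Lp M p g \<Longrightarrow>
     (\<integral>x. norm (f x - g x) powr p \<partial>M) \<le> \<epsilon> * ((\<integral>x. norm (f x) powr p \<partial>M) + (\<integral>x. norm (g x) powr p \<partial>M))
     + C * ((\<integral>x. norm (f x) powr p \<partial>M) / 2 + (\<integral>x. norm (g x) powr p \<partial>M) / 2 - (\<integral>x. norm ((1/2) *\<^sub>R (f x + g x)) powr p \<partial>M))"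
proof -
  obtain C where C: "C > 0" "\<And>a b :: 'b::euclidean_space. norm (a - b) powr p \<le> \<epsilon> * (norm a powr p + norm b powr p)
     + C * (norm a powr p / 2 + norm b powr p / 2 - norm ((1/2) *\<^sub>R (a + b)) powr p)"
    using powr_uniformly_convex[OF p \<epsilon>] by blast
  show thesis
  proof (rule that[OF C(1)])
    fix M and f g :: "'m \<Rightarrow> 'b" assume f: "Lp M p f" and g: "Lp M p g"
    have p0: "p > 0" using p by simp
    have i: "integrable M (\<lambda>x. norm (f x) powr p)" "integrable M (\<lambda>x. norm (g x) powr p)"
      "integrable M (\<lambda>x. norm ((1/2) *\<^sub>R (f x + g x)) powr p)"
      using f g Lp_scaleR[OF Lp_add[OF f g p0], of "1/2"] unfolding Lp_def by blast+
    have "Lp M p (\<lambda>x. f x + (-1) *\<^sub>R g x)" by (intro Lp_add f Lp_scaleR g p0)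
    then have i4: "integrable M (\<lambda>x. norm (f x - g x) powr p)" by (simp add: Lp_def)
    have "(\<integral>x. norm (f x - g x) powr p \<partial>M) \<le> (\<integral>x. \<epsilon> * (norm (f x) powr p + norm (g x) powr p)
     + C * (norm (f x) powr p / 2 + norm (g x) powr p / 2 - norm ((1/2) *\<^sub>R (f x + g x)) powr p) \<partial>M)"
      by (rule integral_mono[OF i4 _ C(2)])
         (intro Bochner_Integration.integrable_add Bochner_Integration.integrable_diff integrable_mult_right integrable_divide i)
    also have "\<dots> = \<epsilon> * ((\<integral>x. norm (f x) powr p \<partial>M) + (\<integral>x. norm (g x) powr p \<partial>M))
     + C * ((\<integral>x. norm (f x) powr p \<partial>M) / 2 + (\<integral>x. norm (g x) powr p \<partial>M) / 2 - (\<integral>x. norm ((1/2) *\<^sub>R (f x + g x)) powr p \<partial>M))"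
      using i by (simp only: Bochner_Integration.integral_add Bochner_Integration.integral_diff integral_mult_right_zero integral_divide_zero
        Bochner_Integration.integrable_add Bochner_Integration.integrable_diff integrable_mult_right integrable_divide)
    finally show "(\<integral>x. norm (f x - g x) powr p \<partial>M) \<le> \<epsilon> * ((\<integral>x. norm (f x) powr p \<partial>M) + (\<integral>x. norm (g x) powr p \<partial>M))
     + C * ((\<integral>x. norm (f x) powr p \<partial>M) / 2 + (\<integral>x. norm (g x) powr p \<partial>M) / 2 - (\<integral>x. norm ((1/2) *\<^sub>R (f x + g x)) powr p \<partial>M))" .
  qed
qed

lemma Lp_midpoint:
  fixes f g :: "'m \<Rightarrow> 'b::euclidean_space"
  assumes p: "p > 1" and f: "Lp M p f" and g: "Lp M p g"
  shows "(\<integral>x. norm ((1/2) *\<^sub>R (f x + g x)) powr p \<partial>M) \<le> (\<integral>x. norm (f x) powr p \<partial>M) / 2 + (\<integral>x. norm (g x) powr p \<partial>M) / 2"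
proof -
  have p0: "p > 0" using p by simp
  have i: "integrable M (\<lambda>x. norm (f x) powr p)" "integrable M (\<lambda>x. norm (g x) powr p)"
      "integrable M (\<lambda>x. norm ((1/2) *\<^sub>R (f x + g x)) powr p)"
    using f g Lp_scaleR[OF Lp_add[OF f g p0], of "1/2"] unfolding Lp_def by blast+
  have "(\<integral>x. norm ((1/2) *\<^sub>R (f x + g x)) powr p \<partial>M) \<le> (\<integral>x. norm (f x) powr p / 2 + norm (g x) powr p / 2 \<partial>M)"
    by (rule integral_mono[OF i(3) _ powr_midpoint(1)[OF p]]) (use i in auto)
  then show ?thesis using i by simp
qed

section \<open>The pairing\<close>

text \<open>The tangent inequality of t^p at a, rearranged and divided by p.\<close>

lemma young_powr:
  fixes a b p :: real
  assumes "p > 1" "a \<ge> 0" "b \<ge> 0"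
  shows "a powr (p - 1) * b \<le> (1 - 1/p) * a powr p + b powr p / p"
proof -
  have "a powr p + p * (a powr (p - 1) * b) - p * a powr p \<le> b powr p"
  proof -
    have "p * a powr (p - 1) * (b - a) = p * (a powr (p - 1) * b) - p * (a powr (p - 1) * a)"
      by (simp add: algebra_simps)
    then show ?thesis using powr_tangent[OF assms] by (simp add: powr_mult_norm[OF assms(2)])
  qed
  then show ?thesis using assms(1) by (simp add: field_simps)
qed

lemma pvec_inner_bound:
  fixes a b :: "'b::euclidean_space"
  assumes "p > 1" shows "\<bar>pvec p a \<bullet> b\<bar> \<le> (1 - 1/p) * norm a powr p + norm b powr p / p"
  using pvec_inner_le[of p a b] young_powr[OF assms norm_ge_zero[of a] norm_ge_zero[of b]] by linarith

lemma pvec_measurable [measurable]: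
  fixes f :: "'m \<Rightarrow> 'b::euclidean_space"
  assumes [measurable]: "f \<in> borel_measurable M" shows "(\<lambda>x. pvec p (f x)) \<in> borel_measurable M"
  unfolding pvec_def by measurable

lemma pvec_integrable:
  fixes f g :: "'m \<Rightarrow> 'b::euclidean_space"
  assumes p: "p > 1" and f: "Lp M p f" and g: "Lp M p g"
  shows "integrable M (\<lambda>x. pvec p (f x) \<bullet> g x)"
proof (rule Bochner_Integration.integrable_bound)
  have [measurable]: "f \<in> borel_measurable M" "g \<in> borel_measurable M" using f g by (auto simp: Lp_def)
  show "integrable M (\<lambda>x. (1 - 1/p) * norm (f x) powr p + norm (g x) powr p / p)" using f g by (simp add: Lp_def)
  show "(\<lambda>x. pvec p (f x) \<bullet> g x) \<in> borel_measurable M" by measurable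
  show "AE x in M. norm (pvec p (f x) \<bullet> g x) \<le> norm ((1 - 1/p) * norm (f x) powr p + norm (g x) powr p / p)"
  proof (rule AE_I2)
    fix x
    show "norm (pvec p (f x) \<bullet> g x) \<le> norm ((1 - 1/p) * norm (f x) powr p + norm (g x) powr p / p)"
      using order_trans[OF pvec_inner_bound[OF p] abs_ge_self] by simp
  qed
qed

text \<open>For a different from 0 this is continuity. At a = 0 the factor |a|^(p-2) may be
  singular, but homogeneity gives the value t^(p-1) |b|^p explicitly, and p > 1 makes it tend to
  0.\<close>

lemma pvec_tendsto:
  fixes a b :: "'b::euclidean_space"
  assumes p: "p > 1"
  shows "(\<lambda>n. pvec p (a + (1 / real (Suc n)) *\<^sub>R b) \<bullet> b) \<longlonglongrightarrow> pvec p a \<bullet> b"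
proof (cases "a = 0")
  case False
  have "(\<lambda>n. a + (1 / real (Suc n)) *\<^sub>R b) \<longlonglongrightarrow> a + 0 *\<^sub>R b"
    by (intro tendsto_intros LIMSEQ_Suc[OF lim_1_over_n, unfolded o_def])
  then have l: "(\<lambda>n. a + (1 / real (Suc n)) *\<^sub>R b) \<longlonglongrightarrow> a" by simp
  show ?thesis unfolding pvec_def using False by (intro tendsto_intros l) auto
next
  case True
  have eq: "pvec p (a + (1 / real (Suc n)) *\<^sub>R b) \<bullet> b = (1 / real (Suc n)) powr (p - 1) * norm b powr p" for n
  proof -
    define t where "t = 1 / real (Suc n)"
    have t: "t > 0" by (simp add: t_def)
    have "pvec p (t *\<^sub>R b) \<bullet> b = (t powr (p - 2) * t) * (pvec p b \<bullet> b)"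
      using t by (simp add: pvec_def powr_mult)
    also have "t powr (p - 2) * t = t powr (p - 1)" using powr_mult_norm[of t "p - 1"] t by simp
    finally show ?thesis using True by (simp add: pvec_inner_self t_def)
  qed
  have "(\<lambda>n. (1 / real (Suc n)) powr (p - 1)) \<longlonglongrightarrow> 0"
    using p by (intro tendsto_zero_powrI LIMSEQ_Suc[OF lim_1_over_n, unfolded o_def] tendsto_const) auto
  then show ?thesis unfolding eq using tendsto_mult_left_zero True by (auto simp: pvec_def)
qed

text \<open>Takes the place of differentiation under the integral. Convexity bounds the increment by
  p t times the pairing at the perturbed point, and the second part lets t tend to 0 along 1/(n+1).
  A one-sided bound is enough, since every direction will be tested together with its
  negative.\<close>

lemma Lp_variation:
  fixes f g :: "'m \<Rightarrow> 'b::euclidean_space"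
  assumes p: "p > 1" and f: "Lp M p f" and g: "Lp M p g"
  shows "(\<integral>x. norm (f x + t *\<^sub>R g x) powr p \<partial>M) - (\<integral>x. norm (f x) powr p \<partial>M) \<le> p * t * (\<integral>x. pvec p (f x + t *\<^sub>R g x) \<bullet> g x \<partial>M)"
    and "(\<lambda>n. \<integral>x. pvec p (f x + (1 / real (Suc n)) *\<^sub>R g x) \<bullet> g x \<partial>M) \<longlonglongrightarrow> (\<integral>x. pvec p (f x) \<bullet> g x \<partial>M)"
proof -
  have p0: "p > 0" using p by simp
  have [measurable]: "f \<in> borel_measurable M" "g \<in> borel_measurable M" using f g by (auto simp: Lp_def)
  have L: "Lp M p (\<lambda>x. f x + t *\<^sub>R g x)" for t by (intro Lp_add f Lp_scaleR g p0)
  have i: "integrable M (\<lambda>x. norm (f x + t *\<^sub>R g x) powr p)" "integrable M (\<lambda>x. norm (f x) powr p)" for t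
    using L[of t] f by (auto simp: Lp_def)
  have j: "integrable M (\<lambda>x. pvec p (f x + t *\<^sub>R g x) \<bullet> g x)" for t by (rule pvec_integrable[OF p L g])
  have "(\<integral>x. norm (f x + t *\<^sub>R g x) powr p - norm (f x) powr p \<partial>M) \<le> (\<integral>x. p * t * (pvec p (f x + t *\<^sub>R g x) \<bullet> g x) \<partial>M)"
  proof (rule integral_mono)
    fix x
    show "norm (f x + t *\<^sub>R g x) powr p - norm (f x) powr p \<le> p * t * (pvec p (f x + t *\<^sub>R g x) \<bullet> g x)"
      using pvec_tangent(1)[OF p, of "f x + t *\<^sub>R g x" "f x"] by (simp add: algebra_simps)
  qed (use i j in auto)
  then show "(\<integral>x. norm (f x + t *\<^sub>R g x) powr p \<partial>M) - (\<integral>x. norm (f x) powr p \<partial>M) \<le> p * t * (\<integral>x. pvec p (f x + t *\<^sub>R g x) \<bullet> g x \<partial>M)"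
    using i by simp
  show "(\<lambda>n. \<integral>x. pvec p (f x + (1 / real (Suc n)) *\<^sub>R g x) \<bullet> g x \<partial>M) \<longlonglongrightarrow> (\<integral>x. pvec p (f x) \<bullet> g x \<partial>M)"
  proof (rule integral_dominated_convergence)
    let ?w = "\<lambda>x. 2 powr p * (norm (f x) powr p + norm (g x) powr p) + norm (g x) powr p"
    show "integrable M ?w" using f g by (simp add: Lp_def)
    show "AE x in M. norm (pvec p (f x + (1 / real (Suc n)) *\<^sub>R g x) \<bullet> g x) \<le> ?w x" for n
    proof (rule AE_I2)
      fix x
      define t where "t = 1 / real (Suc n)"
      have t: "0 \<le> t" "t \<le> 1" by (auto simp: t_def)
      have "\<bar>pvec p (f x + t *\<^sub>R g x) \<bullet> g x\<bar> \<le> (1 - 1/p) * norm (f x + t *\<^sub>R g x) powr p + norm (g x) powr p / p"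
        by (rule pvec_inner_bound[OF p])
      also have "\<dots> \<le> 1 * norm (f x + t *\<^sub>R g x) powr p + norm (g x) powr p"
      proof (intro add_mono mult_right_mono)
        show "norm (g x) powr p / p \<le> norm (g x) powr p"
          using p mult_left_mono[of 1 p "norm (g x) powr p"] by (simp add: field_simps)
      qed (use p in auto)
      also have "norm (f x + t *\<^sub>R g x) powr p \<le> 2 powr p * (norm (f x) powr p + norm (t *\<^sub>R g x) powr p)"
        by (rule powr_add_le[OF p0])
      also have "norm (t *\<^sub>R g x) powr p \<le> norm (g x) powr p"
        using t p0 by (intro powr_mono2) (auto simp: mult_left_le_one_le)
      finally show "norm (pvec p (f x + (1 / real (Suc n)) *\<^sub>R g x) \<bullet> g x) \<le> ?w x" by (simp add: t_def)
    qed
    show "AE x in M. (\<lambda>n. pvec p (f x + (1 / real (Suc n)) *\<^sub>R g x) \<bullet> g x) \<longlonglongrightarrow> pvec p (f x) \<bullet> g x"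
      by (intro AE_I2 pvec_tendsto p)
  qed measurable
qed

section \<open>The Dirichlet restriction\<close>

text \<open>The admissible functions come with open neighbourhoods whose capacities are as small as
  desired; their countable intersection is the hull.\<close>

lemma pcap_zero_borel:
  fixes E :: "'a::euclidean_space set"
  assumes p: "p > 1" and E: "pcap p E = 0"
  obtains N where "N \<in> sets borel" "E \<subseteq> N" "pcap p N = 0"
proof -
  have p0: "p \<ge> 0" using p by simp
  have "\<exists>U. open U \<and> E \<subseteq> U \<and> pcap p U < ennreal (1 / real (Suc n))" for n
  proof -
    have "pcap p E < ennreal (1 / real (Suc n))" using E by simp
    then obtain u U where u: "u \<in> sobolev p" "open U" "E \<subseteq> U" "AE x in lebesgue. x \<in> U \<longrightarrow> u x \<ge> 1"
      "ennreal (energy p u) < ennreal (1 / real (Suc n))" by (rule pcap_lessE[OF _ p0])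
    have "pcap p U \<le> ennreal (energy p u)" by (rule pcap_le_energy[OF u(1) p0 u(2) order_refl u(4)])
    then show ?thesis using u by (meson le_less_trans)
  qed
  then obtain U where U: "\<And>n. open (U n)" "\<And>n. E \<subseteq> U n" "\<And>n. pcap p (U n) < ennreal (1 / real (Suc n))" by metis
  show thesis
  proof (rule that[of "\<Inter>n. U n"])
    show "(\<Inter>n. U n) \<in> sets borel" using U(1) by (intro sets.countable_INT') auto
    show "pcap p (\<Inter>n. U n) = 0"
    proof (rule ennreal_zeroI)
      fix \<epsilon> :: real assume "\<epsilon> > 0"
      then obtain n where n: "1 / real (Suc n) < \<epsilon>" using nat_approx_posE by blast
      have "pcap p (\<Inter>n. U n) \<le> pcap p (U n)" by (rule pcap_mono) auto
      also have "\<dots> < ennreal (1 / real (Suc n))" by (rule U)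
      also have "\<dots> \<le> ennreal \<epsilon>" using n by (intro ennreal_leI) simp
      finally show "pcap p (\<Inter>n. U n) < ennreal \<epsilon>" .
    qed
  qed (use U in blast)
qed

lemma pcap_Un_zero:
  fixes A B :: "'a::euclidean_space set"
  assumes "p > 1" "pcap p A = 0" "pcap p B = 0" shows "pcap p (A \<union> B) = 0"
proof -
  have "quasi_everywhere p (\<lambda>x. x \<notin> A \<and> x \<notin> B)"
    by (rule qe_conj[OF assms(1)]) (use assms in \<open>auto simp: quasi_everywhere_def\<close>)
  then show ?thesis by (simp add: quasi_everywhere_def Un_def)
qed

lemma dirichlet_restriction_sets: "sets (dirichlet_restriction p \<mu> \<Omega>) = sets borel"
  unfolding dirichlet_restriction_def by (simp add: sets_measure_of sets.sigma_sets_eq[of borel, simplified])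

text \<open>The point is countable additivity of the infinite part. By \<open>pcap_UN_zero\<close>
  it vanishes on a union if it vanishes on every piece; otherwise some piece makes both sides
  infinite.\<close>

lemma dirichlet_restriction_emeasure:
  fixes \<mu> :: "'a::euclidean_space measure"
  assumes p: "p > 1" and s: "sets \<mu> = sets borel" and B: "B \<in> sets borel"
  shows "emeasure (dirichlet_restriction p \<mu> \<Omega>) B = emeasure \<mu> B + infinity_on p (- \<Omega>) B"
  unfolding dirichlet_restriction_def
proof (rule emeasure_measure_of_sigma[OF _ _ _ B])
  show "sigma_algebra UNIV (sets (borel :: 'a measure))" using sets.sigma_algebra_axioms[of borel] by simp
  show "positive (sets borel) (\<lambda>B. emeasure \<mu> B + infinity_on p (- \<Omega>) B)"
    using pcap_empty[of p, where 'a = 'a] p by (simp add: positive_def infinity_on_def)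
  show "countably_additive (sets borel) (\<lambda>B. emeasure \<mu> B + infinity_on p (- \<Omega>) B)"
    unfolding countably_additive_def
  proof (intro allI impI)
    fix A :: "nat \<Rightarrow> 'a set" assume A: "range A \<subseteq> sets borel" "disjoint_family A"
    have 1: "(\<Sum>i. emeasure \<mu> (A i)) = emeasure \<mu> (\<Union>i. A i)"
      using A s by (intro suminf_emeasure) auto
    have 2: "(\<Sum>i. infinity_on p (- \<Omega>) (A i)) = infinity_on p (- \<Omega>) (\<Union>i. A i)"
    proof (cases "\<forall>i. pcap p (A i \<inter> - \<Omega>) = 0")
      case True
      have "pcap p (\<Union>i. A i \<inter> - \<Omega>) = 0" using True by (intro pcap_UN_zero p) auto
      moreover have "(\<Union>i. A i \<inter> - \<Omega>) = (\<Union>i. A i) \<inter> - \<Omega>" by auto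
      ultimately show ?thesis using True by (simp add: infinity_on_def)
    next
      case False
      then obtain i where i: "pcap p (A i \<inter> - \<Omega>) \<noteq> 0" by blast
      have "pcap p (A i \<inter> - \<Omega>) \<le> pcap p ((\<Union>i. A i) \<inter> - \<Omega>)" by (rule pcap_mono) auto
      then have "pcap p ((\<Union>i. A i) \<inter> - \<Omega>) \<noteq> 0" using i by auto
      moreover have "infinity_on p (- \<Omega>) (A i) \<le> (\<Sum>i. infinity_on p (- \<Omega>) (A i))"
        using sum_le_suminf[of "\<lambda>i. infinity_on p (- \<Omega>) (A i)" "{i}"] by simp
      ultimately show ?thesis using i by (simp add: infinity_on_def top_unique)
    qed
    show "(\<Sum>i. emeasure \<mu> (A i) + infinity_on p (- \<Omega>) (A i)) = emeasure \<mu> (\<Union>i. A i) + infinity_on p (- \<Omega>) (\<Union>i. A i)"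
      unfolding 1[symmetric] 2[symmetric] by (rule suminf_add[symmetric]) auto
  qed
qed

lemma cap_null_borel:
  assumes "cap_null p \<mu>" "pcap p N = 0" "N \<in> sets borel" shows "emeasure \<mu> N = 0"
proof -
  have "N \<in> null_sets (completion \<mu>)" by (rule cap_nullD(3)[OF assms(1,2)])
  then have "N \<in> null_sets \<mu>" using assms(3) cap_nullD(1)[OF assms(1)] by (simp add: null_sets_completion_iff)
  then show ?thesis by auto
qed

lemma cap_null_dirichlet:
  fixes \<mu> :: "'a::euclidean_space measure"
  assumes p: "p > 1" and \<mu>: "cap_null p \<mu>"
  shows "cap_null p (dirichlet_restriction p \<mu> \<Omega>)"
  unfolding cap_null_def
proof (intro conjI allI impI dirichlet_restriction_sets)
  fix E :: "'a set" assume "pcap p E = 0"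
  then obtain N where N: "N \<in> sets borel" "E \<subseteq> N" "pcap p N = 0" using pcap_zero_borel[OF p] by blast
  have "pcap p (N \<inter> - \<Omega>) \<le> 0" unfolding N(3)[symmetric] by (rule pcap_mono) auto
  then have "emeasure (dirichlet_restriction p \<mu> \<Omega>) N = 0"
    using dirichlet_restriction_emeasure[OF p cap_nullD(1)[OF \<mu>] N(1)] cap_null_borel[OF \<mu> N(3,1)]
    by (simp add: infinity_on_def)
  then have "N \<in> null_sets (dirichlet_restriction p \<mu> \<Omega>)" using N(1) by (simp add: null_sets_def dirichlet_restriction_sets)
  then show "E \<in> null_sets (completion (dirichlet_restriction p \<mu> \<Omega>))"
    using N(2) by (rule null_sets_completion_subset[rotated, OF null_sets_completionI])
qed

lemma sobolev_mu_iff: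
  assumes "p > 1" "cap_null p \<mu>"
  shows "u \<in> sobolev_mu p \<mu> \<longleftrightarrow> u \<in> sobolev_qc p \<and> Lp (completion \<mu>) p u"
  using qc_measurable_mu[OF assms] by (auto simp: sobolev_mu_def Lp_def sobolev_qc_def)

lemma integrable_iff_nn:
  fixes f :: "'m \<Rightarrow> real"
  assumes "f \<in> borel_measurable (completion M)" "\<And>x. f x \<ge> 0"
  shows "integrable (completion M) f \<longleftrightarrow> (\<integral>\<^sup>+x. ennreal (f x) \<partial>M) < \<infinity>"
  using assms by (simp add: integrable_iff_bounded nn_integral_completion)

text \<open>A Borel set of finite measure for the restriction meets the complement of \<Omega> in
  capacity zero. This applies to the level sets of a Borel representative \<open>g\<close> of |u|^p,
  by Chebyshev's inequality, and also to the null set \<open>N\<close> that contains the points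
  where \<open>g\<close> differs from |u|^p.\<close>

lemma dirichlet_integrable_zero:
  fixes u :: "'a::euclidean_space \<Rightarrow> real"
  assumes p: "p > 1" and \<mu>: "cap_null p \<mu>" and i: "integrable (completion (dirichlet_restriction p \<mu> \<Omega>)) (\<lambda>x. \<bar>u x\<bar> powr p)"
  shows "pcap p ({x. u x \<noteq> 0} \<inter> - \<Omega>) = 0"
proof -
  define \<nu> where "\<nu> = dirichlet_restriction p \<mu> \<Omega>"
  note em = dirichlet_restriction_emeasure[OF p cap_nullD(1)[OF \<mu>], of _ \<Omega>, folded \<nu>_def]
  have s: "sets \<nu> = sets borel" by (simp add: \<nu>_def dirichlet_restriction_sets)
  have fin: "pcap p (B \<inter> - \<Omega>) = 0" if "B \<in> sets borel" "emeasure \<nu> B < \<infinity>" for B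
    using em[OF that(1)] that(2) by (auto simp: infinity_on_def split: if_splits)
  obtain g where g: "g \<in> borel_measurable \<nu>" "AE x in \<nu>. \<bar>u x\<bar> powr p = g x"
    using completion_ex_borel_measurable_real[OF borel_measurable_integrable[OF i, folded \<nu>_def]] by blast
  obtain N where N: "N \<in> null_sets \<nu>" "{x \<in> space \<nu>. \<bar>u x\<bar> powr p \<noteq> g x} \<subseteq> N"
    using g(2) by (auto simp: eventually_ae_filter)
  have sp: "space \<nu> = UNIV" using sets_eq_imp_space_eq[OF s] by simp
  have capN: "pcap p (N \<inter> - \<Omega>) = 0" using N(1) s by (intro fin) auto
  have gi: "(\<integral>\<^sup>+x. ennreal (g x) \<partial>\<nu>) < \<infinity>"
  proof -
    have "(\<integral>\<^sup>+x. ennreal (g x) \<partial>\<nu>) = (\<integral>\<^sup>+x. ennreal (\<bar>u x\<bar> powr p) \<partial>\<nu>)"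
    proof (rule nn_integral_cong_AE)
      show "AE x in \<nu>. ennreal (g x) = ennreal (\<bar>u x\<bar> powr p)" using g(2) by eventually_elim simp
    qed
    then show ?thesis using i by (simp add: integrable_iff_bounded nn_integral_completion \<nu>_def)
  qed
  define A where "A n = {x. g x \<ge> 1 / real (Suc n)}" for n
  have A: "A n \<in> sets \<nu>" for n
  proof -
    have "{x \<in> space \<nu>. g x \<ge> 1 / real (Suc n)} \<in> sets \<nu>" using g(1) by measurable
    then show ?thesis by (simp add: A_def sp)
  qed
  have "pcap p (A n \<inter> - \<Omega>) = 0" for n
  proof (rule fin)
    show "A n \<in> sets borel" using A s by simp
    have "emeasure \<nu> (A n) = (\<integral>\<^sup>+x. indicator (A n) x \<partial>\<nu>)" using A by simp
    also have "\<dots> \<le> (\<integral>\<^sup>+x. ennreal (real (Suc n)) * ennreal (g x) \<partial>\<nu>)"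
    proof (rule nn_integral_mono)
      fix x
      show "indicator (A n) x \<le> ennreal (real (Suc n)) * ennreal (g x)"
      proof (cases "x \<in> A n")
        case True
        then have "1 / real (Suc n) \<le> g x" by (simp add: A_def)
        then have "1 \<le> real (Suc n) * g x" by (simp add: field_simps)
        then have "ennreal 1 \<le> ennreal (real (Suc n) * g x)" by (rule ennreal_leI)
        then show ?thesis using True by (simp only: indicator_simps(1)[OF True] ennreal_1 ennreal_mult' of_nat_0_le_iff)
      qed simp
    qed
    also have "\<dots> = ennreal (real (Suc n)) * (\<integral>\<^sup>+x. ennreal (g x) \<partial>\<nu>)" using g(1) by (intro nn_integral_cmult) measurable
    also have "\<dots> < \<infinity>" using gi by (simp add: ennreal_mult_less_top)
    finally show "emeasure \<nu> (A n) < \<infinity>" .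
  qed
  then have "pcap p (\<Union>n. A n \<inter> - \<Omega>) = 0" by (rule pcap_UN_zero[OF p])
  then have "pcap p ((\<Union>n. A n \<inter> - \<Omega>) \<union> (N \<inter> - \<Omega>)) = 0" using capN by (rule pcap_Un_zero[OF p])
  moreover have "{x. u x \<noteq> 0} \<inter> - \<Omega> \<subseteq> (\<Union>n. A n \<inter> - \<Omega>) \<union> (N \<inter> - \<Omega>)"
  proof
    fix x assume x: "x \<in> {x. u x \<noteq> 0} \<inter> - \<Omega>"
    show "x \<in> (\<Union>n. A n \<inter> - \<Omega>) \<union> (N \<inter> - \<Omega>)"
    proof (cases "x \<in> N")
      case False
      then have "x \<notin> {x \<in> space \<nu>. \<bar>u x\<bar> powr p \<noteq> g x}" using N(2) by blast
      then have "g x = \<bar>u x\<bar> powr p" by (simp add: sp)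
      then have "g x > 0" using x by simp
      then obtain n where "1 / real (Suc n) < g x" using nat_approx_posE by blast
      then have "x \<in> A n" by (simp add: A_def)
      then show ?thesis using x by blast
    qed (use x in blast)
  qed
  ultimately show ?thesis using pcap_mono by (metis le_zero_eq)
qed

text \<open>Trades the restricted measure for a condition on the functions. In the direction from
  the condition to integrability, both measures agree on subsets of \<open>C\<close>, the ball
  enlarged by a Borel set of capacity zero, and \<open>u\<close> vanishes off
  \<open>C\<close>.\<close>

lemma sobolev_mu_dirichlet:
  fixes \<mu> :: "'a::euclidean_space measure"
  assumes p: "p > 1" and \<mu>: "cap_null p \<mu>"
  shows "u \<in> sobolev_mu p (dirichlet_restriction p \<mu> (ball 0 R)) \<longleftrightarrow>
    u \<in> sobolev_mu p \<mu> \<and> quasi_everywhere p (\<lambda>x. norm x \<ge> R \<longrightarrow> u x = 0)"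
proof -
  let ?\<Omega> = "ball (0::'a) R"
  define \<nu> where "\<nu> = dirichlet_restriction p \<mu> ?\<Omega>"
  note em = dirichlet_restriction_emeasure[OF p cap_nullD(1)[OF \<mu>], of _ ?\<Omega>, folded \<nu>_def]
  have s: "sets \<nu> = sets borel" by (simp add: \<nu>_def dirichlet_restriction_sets)
  have s\<mu>: "sets \<mu> = sets borel" by (rule cap_nullD(1)[OF \<mu>])
  have \<nu>: "cap_null p \<nu>" unfolding \<nu>_def by (rule cap_null_dirichlet[OF p \<mu>])
  have set_eq: "{x. \<not> (norm x \<ge> R \<longrightarrow> u x = 0)} = {x. u x \<noteq> 0} \<inter> - ?\<Omega>" by auto
  have key: "(\<integral>\<^sup>+x. ennreal (\<bar>u x\<bar> powr p) \<partial>\<nu>) < \<infinity> \<longleftrightarrow> (\<integral>\<^sup>+x. ennreal (\<bar>u x\<bar> powr p) \<partial>\<mu>) < \<infinity> \<and> pcap p ({x. u x \<noteq> 0} \<inter> - ?\<Omega>) = 0"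
    if u: "u \<in> sobolev_qc p"
  proof
    have qc: "quasi_continuous p u" using u by (simp add: sobolev_qc_def)
    assume a: "(\<integral>\<^sup>+x. ennreal (\<bar>u x\<bar> powr p) \<partial>\<nu>) < \<infinity>"
    have "(\<integral>\<^sup>+x. ennreal (\<bar>u x\<bar> powr p) \<partial>\<mu>) \<le> (\<integral>\<^sup>+x. ennreal (\<bar>u x\<bar> powr p) \<partial>\<nu>)"
    proof (rule nn_integral_mono_measure)
      have "emeasure \<mu> B \<le> emeasure \<nu> B" for B
      proof (cases "B \<in> sets borel")
        case True then show ?thesis by (simp add: em)
      qed (simp add: emeasure_notin_sets s\<mu>)
      then show "\<mu> \<le> \<nu>" using s s\<mu> cap_nullD(2)[OF \<mu>] cap_nullD(2)[OF \<nu>] by (simp add: le_measure_iff le_fun_def)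
    qed (simp add: s s\<mu>)
    then have 1: "(\<integral>\<^sup>+x. ennreal (\<bar>u x\<bar> powr p) \<partial>\<mu>) < \<infinity>" using a by (rule le_less_trans)
    have "integrable (completion \<nu>) (\<lambda>x. \<bar>u x\<bar> powr p)"
      using qc_measurable_mu[OF p \<nu> qc] a by (subst integrable_iff_nn) auto
    then show "(\<integral>\<^sup>+x. ennreal (\<bar>u x\<bar> powr p) \<partial>\<mu>) < \<infinity> \<and> pcap p ({x. u x \<noteq> 0} \<inter> - ?\<Omega>) = 0"
      using dirichlet_integrable_zero[OF p \<mu>, of ?\<Omega> u] 1 by (simp add: \<nu>_def)
  next
    assume a: "(\<integral>\<^sup>+x. ennreal (\<bar>u x\<bar> powr p) \<partial>\<mu>) < \<infinity> \<and> pcap p ({x. u x \<noteq> 0} \<inter> - ?\<Omega>) = 0"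
    then obtain N where N: "N \<in> sets borel" "{x. u x \<noteq> 0} \<inter> - ?\<Omega> \<subseteq> N" "pcap p N = 0"
      using pcap_zero_borel[OF p] by blast
    define C where "C = ?\<Omega> \<union> N"
    have C: "C \<in> sets borel" using N(1) by (simp add: C_def)
    have eq: "restrict_space \<nu> C = restrict_space \<mu> C"
    proof (rule measure_eqI)
      show "sets (restrict_space \<nu> C) = sets (restrict_space \<mu> C)" using s s\<mu> by (simp add: sets_restrict_space)
      fix A assume "A \<in> sets (restrict_space \<nu> C)"
      then have A: "A \<in> sets borel" "A \<subseteq> C" using C s by (auto simp: sets_restrict_space_iff)
      have "A \<inter> - ?\<Omega> \<subseteq> N" using A(2) by (auto simp: C_def)
      then have "pcap p (A \<inter> - ?\<Omega>) = 0" using N(3) pcap_mono by (metis le_zero_eq)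
      then have "emeasure \<nu> A = emeasure \<mu> A" using em[OF A(1)] by (simp add: infinity_on_def)
      then show "emeasure (restrict_space \<nu> C) A = emeasure (restrict_space \<mu> C) A"
        using A C s s\<mu> cap_nullD(2)[OF \<mu>] cap_nullD(2)[OF \<nu>] by (subst (1 2) emeasure_restrict_space) auto
    qed
    have z: "u x = 0" if "x \<notin> C" for x using that N(2) by (auto simp: C_def)
    have ind: "ennreal (\<bar>u x\<bar> powr p) * indicator C x = ennreal (\<bar>u x\<bar> powr p)" for x
      using z[of x] by (cases "x \<in> C") auto
    have "(\<integral>\<^sup>+x. ennreal (\<bar>u x\<bar> powr p) \<partial>\<nu>) = (\<integral>\<^sup>+x. ennreal (\<bar>u x\<bar> powr p) \<partial>restrict_space \<nu> C)"
      using C s cap_nullD(2)[OF \<nu>] by (subst nn_integral_restrict_space) (auto simp: ind)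
    also have "\<dots> = (\<integral>\<^sup>+x. ennreal (\<bar>u x\<bar> powr p) \<partial>\<mu>)"
      unfolding eq using C s\<mu> cap_nullD(2)[OF \<mu>] by (subst nn_integral_restrict_space) (auto simp: ind)
    finally show "(\<integral>\<^sup>+x. ennreal (\<bar>u x\<bar> powr p) \<partial>\<nu>) < \<infinity>" using a by simp
  qed
  have "integrable (completion M) (\<lambda>x. \<bar>u x\<bar> powr p) \<longleftrightarrow> (\<integral>\<^sup>+x. ennreal (\<bar>u x\<bar> powr p) \<partial>M) < \<infinity>"
    if "u \<in> sobolev_qc p" "cap_null p M" for M
    using qc_measurable_mu[OF p that(2), of u] that(1) by (subst integrable_iff_nn) (auto simp: sobolev_qc_def)
  then show ?thesis
    unfolding sobolev_mu_def quasi_everywhere_def set_eq \<nu>_def[symmetric] using key \<nu> \<mu> by auto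
qed

section \<open>Existence of the resolvent\<close>

lemma lin_le_powr:
  fixes p \<delta> :: real
  assumes "p > 1" "\<delta> > 0"
  obtains c where "c \<ge> 0" "\<And>t. t \<ge> 0 \<Longrightarrow> t \<le> \<delta> * t powr p + c"
proof
  \<comment> \<open>The point where \<delta> t^(p-1) = 1: beyond it the power dominates t, below it
    the constant does.\<close>
  let ?c = "(1/\<delta>) powr (1/(p-1))"
  show "?c \<ge> 0" by simp
  fix t :: real assume t: "t \<ge> 0"
  show "t \<le> \<delta> * t powr p + ?c"
  proof (cases "t \<le> ?c")
    case True
    moreover have "0 \<le> \<delta> * t powr p" using assms by simp
    ultimately show ?thesis by linarith
  next
    case False
    have "?c powr (p - 1) = (1/\<delta>) powr (1/(p-1) * (p-1))" by (simp only: powr_powr)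
    also have "\<dots> = 1/\<delta>" using assms by simp
    finally have "1/\<delta> \<le> t powr (p - 1)" using False assms powr_mono2[of "p - 1" ?c t] by simp
    then have "1 \<le> \<delta> * t powr (p - 1)" using assms by (simp add: field_simps)
    then have "t \<le> (\<delta> * t powr (p - 1)) * t" using t mult_right_mono[of 1 "\<delta> * t powr (p - 1)" t] by simp
    also have "\<dots> = \<delta> * t powr p" using powr_mult_norm[OF t, of p] by (simp add: mult.assoc)
    finally show ?thesis by (simp add: add_increasing2)
  qed
qed

text \<open>Fatou's lemma for convergent nonnegative sequences. The form "eventually, up to \<eta>"
  allows the inequalities for several integrals to be used at one common index.\<close>

lemma fatou_eventually:
  fixes f :: "nat \<Rightarrow> 'm \<Rightarrow> real"
  assumes f: "\<And>n. integrable M (f n)" "\<And>n x. f n x \<ge> 0" and g: "g \<in> borel_measurable M"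
    and lim: "AE x in M. (\<lambda>n. f n x) \<longlonglongrightarrow> g x" and K: "\<And>n. (\<integral>x. f n x \<partial>M) \<le> K"
  shows "integrable M g" and "\<eta> > 0 \<Longrightarrow> \<forall>\<^sub>F n in sequentially. (\<integral>x. g x \<partial>M) \<le> (\<integral>x. f n x \<partial>M) + \<eta>"
proof -
  have gn: "AE x in M. g x \<ge> 0"
    using lim by eventually_elim (rule LIMSEQ_le_const, use f(2) in auto)
  have nn: "(\<integral>\<^sup>+x. ennreal (f n x) \<partial>M) = ennreal (\<integral>x. f n x \<partial>M)" for n
    using f by (intro nn_integral_eq_integral) auto
  have "(\<integral>\<^sup>+x. ennreal (g x) \<partial>M) = (\<integral>\<^sup>+x. liminf (\<lambda>n. ennreal (f n x)) \<partial>M)"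
  proof (rule nn_integral_cong_AE)
    show "AE x in M. ennreal (g x) = liminf (\<lambda>n. ennreal (f n x))"
      using lim by eventually_elim (metis lim_imp_Liminf tendsto_ennrealI trivial_limit_sequentially)
  qed
  also have "\<dots> \<le> liminf (\<lambda>n. \<integral>\<^sup>+x. ennreal (f n x) \<partial>M)"
    using f(1) by (intro nn_integral_liminf) auto
  finally have L: "(\<integral>\<^sup>+x. ennreal (g x) \<partial>M) \<le> liminf (\<lambda>n. ennreal (\<integral>x. f n x \<partial>M))" by (simp add: nn)
  also have "\<dots> \<le> ennreal K"
  proof -
    have "liminf (\<lambda>n. ennreal (\<integral>x. f n x \<partial>M)) \<le> liminf (\<lambda>n::nat. ennreal K)"
      by (rule Liminf_mono) (auto intro!: always_eventually ennreal_leI K)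
    then show ?thesis by (simp add: Liminf_const)
  qed
  finally have "(\<integral>\<^sup>+x. ennreal (g x) \<partial>M) < \<infinity>" by (simp add: le_less_trans)
  then show i: "integrable M g"
    by (intro integrableI_nonneg g gn) auto
  assume \<eta>: "\<eta> > 0"
  have G: "(\<integral>\<^sup>+x. ennreal (g x) \<partial>M) = ennreal (\<integral>x. g x \<partial>M)" using i gn by (rule nn_integral_eq_integral)
  have fi: "(\<integral>x. f n x \<partial>M) \<ge> 0" for n using f(2) by (intro integral_nonneg_AE) auto
  show "\<forall>\<^sub>F n in sequentially. (\<integral>x. g x \<partial>M) \<le> (\<integral>x. f n x \<partial>M) + \<eta>"
  proof (cases "(\<integral>x. g x \<partial>M) - \<eta> < 0")
    case True
    then have "(\<integral>x. g x \<partial>M) \<le> (\<integral>x. f n x \<partial>M) + \<eta>" for n using fi[of n] by linarith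
    then show ?thesis by simp
  next
    case False
    then have "ennreal ((\<integral>x. g x \<partial>M) - \<eta>) < ennreal (\<integral>x. g x \<partial>M)" using \<eta> by (subst ennreal_less_iff) auto
    then have "ennreal ((\<integral>x. g x \<partial>M) - \<eta>) < liminf (\<lambda>n. ennreal (\<integral>x. f n x \<partial>M))" using L unfolding G by (rule less_le_trans)
    then have "\<forall>\<^sub>F n in sequentially. ennreal ((\<integral>x. g x \<partial>M) - \<eta>) < ennreal (\<integral>x. f n x \<partial>M)" by (rule less_LiminfD)
    then show ?thesis
    proof eventually_elim
      case (elim n)
      then have "(\<integral>x. g x \<partial>M) - \<eta> < (\<integral>x. f n x \<partial>M)" using False by (subst (asm) ennreal_less_iff) auto
      then show ?case by simp
    qed
  qed
qed

lemma fast_subsequence: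
  fixes d :: "nat \<Rightarrow> nat \<Rightarrow> real"
  assumes "\<And>\<eta>. \<eta> > 0 \<Longrightarrow> \<exists>N. \<forall>i\<ge>N. \<forall>j\<ge>N. d i j \<le> \<eta>" and "\<And>k. e k > (0::real)"
  obtains r :: "nat \<Rightarrow> nat" where "strict_mono r" "\<And>k. d (r (Suc k)) (r k) \<le> e k"
proof -
  have "\<forall>k. \<exists>N. \<forall>i\<ge>N. \<forall>j\<ge>N. d i j \<le> e k" using assms by blast
  then obtain g where g: "\<And>k i j. i \<ge> g k \<Longrightarrow> j \<ge> g k \<Longrightarrow> d i j \<le> e k" by metis
  \<comment> \<open>Partial sums of the moduli \<open>g\<close>, each increased by 1: strictly
    increasing, with \<open>r k\<close> beyond \<open>g k\<close>.\<close>
  define r where "r k = (\<Sum>i\<le>k. Suc (g i))" for k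
  have "strict_mono r" by (rule strict_monoI_Suc) (simp add: r_def)
  moreover have gr: "g k \<le> r k" for k
  proof -
    have "Suc (g k) \<le> r k" unfolding r_def by (rule member_le_sum) auto
    then show ?thesis by simp
  qed
  moreover have "r k \<le> r (Suc k)" for k by (simp add: r_def)
  ultimately show thesis using g that[of r] by (meson order_trans)
qed

section \<open>The energy space of \<mu> and the functional to be minimised\<close>

locale cap_space =
  fixes p :: real and \<mu> :: "'a::euclidean_space measure"
  assumes p: "p > 1" and \<mu>: "cap_null p \<mu>"
begin

lemma p0: "p > 0" "p \<ge> 0" "p \<ge> 1" using p by auto

definition W :: "('a \<Rightarrow> real) set" where "W = sobolev_mu p \<mu>"

text \<open>By \<open>V_eq\<close> this is the space in which the resolvent on the ball of radius
  \<open>R\<close> is sought.\<close>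

definition V :: "real \<Rightarrow> ('a \<Rightarrow> real) set" where
  "V R = {u \<in> W. quasi_everywhere p (\<lambda>x. norm x \<ge> R \<longrightarrow> u x = 0)}"

lemma V_eq: "sobolev_mu p (dirichlet_restriction p \<mu> (ball 0 R)) = V R"
  using sobolev_mu_dirichlet[OF p \<mu>] by (auto simp: V_def W_def)

lemma W_iff: "u \<in> W \<longleftrightarrow> u \<in> sobolev p \<and> quasi_continuous p u \<and> Lp (completion \<mu>) p u"
  unfolding W_def using sobolev_mu_iff[OF p \<mu>] by (auto simp: sobolev_qc_def)

lemma WD:
  assumes "u \<in> W"
  shows "u \<in> sobolev p" "quasi_continuous p u" "Lp (completion \<mu>) p u" "u \<in> sobolev_qc p"
    "Lp lebesgue p u" "Lp lebesgue p (weak_gradient u)"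
  using assms sobolevD[of u p] p0 by (auto simp: W_iff sobolev_qc_def)

lemma W_I: "u \<in> sobolev p \<Longrightarrow> quasi_continuous p u \<Longrightarrow> Lp (completion \<mu>) p u \<Longrightarrow> u \<in> W"
  by (simp add: W_iff)

lemma W_lincomb: "u \<in> W \<Longrightarrow> v \<in> W \<Longrightarrow> (\<lambda>x. s * u x + t * v x) \<in> W"
  by (intro W_I sobolev_lincomb(1) qc_lincomb Lp_add Lp_cmult p p0) (auto dest: WD)

lemma V_lincomb: "u \<in> V R \<Longrightarrow> v \<in> V R \<Longrightarrow> (\<lambda>x. s * u x + t * v x) \<in> V R"
proof -
  assume u: "u \<in> V R" and v: "v \<in> V R"
  then have "quasi_everywhere p (\<lambda>x. (norm x \<ge> R \<longrightarrow> u x = 0) \<and> (norm x \<ge> R \<longrightarrow> v x = 0))"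
    by (intro qe_conj[OF p]) (auto simp: V_def)
  then have "quasi_everywhere p (\<lambda>x. norm x \<ge> R \<longrightarrow> s * u x + t * v x = 0)" by (rule qe_mono) auto
  then show ?thesis using u v by (simp add: V_def W_lincomb)
qed

lemma W_zero: "(\<lambda>x. 0) \<in> W"
  using sobolev_zero(1)[OF p0(1)] by (intro W_I qc_continuous) (auto simp: Lp_def p0)

lemma V_zero: "(\<lambda>x. 0) \<in> V R"
  using W_zero pcap_empty[OF p0(1)] by (auto simp: V_def quasi_everywhere_def)

lemma V_W: "u \<in> V R \<Longrightarrow> u \<in> W" by (simp add: V_def)

text \<open>The \<open>p\<close>-th power of the norm of the space.\<close>

definition nrm :: "('a \<Rightarrow> real) \<Rightarrow> real" where
  "nrm u = (\<integral>x. norm (weak_gradient u x) powr p \<partial>lebesgue) + (\<integral>x. norm (u x) powr p \<partial>lebesgue) + (\<integral>x. norm (u x) powr p \<partial>completion \<mu>)"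

lemma energy_split: "u \<in> sobolev p \<Longrightarrow> energy p u = (\<integral>x. norm (weak_gradient u x) powr p \<partial>lebesgue) + (\<integral>x. norm (u x) powr p \<partial>lebesgue)"
  using sobolevD(6,7)[of u p] p0 by (simp add: energy_def)

lemma nrm_energy: "u \<in> W \<Longrightarrow> nrm u = energy p u + (\<integral>x. norm (u x) powr p \<partial>completion \<mu>)"
  using energy_split[OF WD(1)] by (simp add: nrm_def)

lemma nrm_nonneg: "nrm u \<ge> 0"
  unfolding nrm_def by (intro add_nonneg_nonneg integral_nonneg_AE) auto

lemma energy_le_nrm: "u \<in> W \<Longrightarrow> energy p u \<le> nrm u"
  by (auto simp: nrm_energy intro!: integral_nonneg_AE)

lemma sobolev_mu_norm_nrm: "u \<in> W \<Longrightarrow> sobolev_mu_norm p \<mu> u = nrm u powr (1/p)"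
  by (simp add: sobolev_mu_norm_def nrm_energy energy_def)

lemma grad_lincomb_integral:
  assumes "u \<in> sobolev p" "v \<in> sobolev p"
  shows "(\<integral>x. norm (weak_gradient (\<lambda>x. s * u x + t * v x) x) powr p \<partial>lebesgue) =
    (\<integral>x. norm (s *\<^sub>R weak_gradient u x + t *\<^sub>R weak_gradient v x) powr p \<partial>lebesgue)"
proof (rule integral_cong_AE)
  note m = sobolevD(5)[OF assms(1) p0(2)] sobolevD(5)[OF assms(2) p0(2)] sobolevD(5)[OF sobolev_lincomb(1)[OF assms p0(1)] p0(2)]
  show "(\<lambda>x. norm (weak_gradient (\<lambda>x. s * u x + t * v x) x) powr p) \<in> borel_measurable lebesgue"
    "(\<lambda>x. norm (s *\<^sub>R weak_gradient u x + t *\<^sub>R weak_gradient v x) powr p) \<in> borel_measurable lebesgue"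
    using m by measurable
  show "AE x in lebesgue. norm (weak_gradient (\<lambda>x. s * u x + t * v x) x) powr p =
    norm (s *\<^sub>R weak_gradient u x + t *\<^sub>R weak_gradient v x) powr p"
    using sobolev_lincomb(2)[OF assms p0(1), of s t] by eventually_elim simp
qed

lemma nrm_lincomb:
  assumes "u \<in> W" "v \<in> W"
  shows "nrm (\<lambda>x. s * u x + t * v x) = (\<integral>x. norm (s *\<^sub>R weak_gradient u x + t *\<^sub>R weak_gradient v x) powr p \<partial>lebesgue)
     + (\<integral>x. norm (s *\<^sub>R u x + t *\<^sub>R v x) powr p \<partial>lebesgue) + (\<integral>x. norm (s *\<^sub>R u x + t *\<^sub>R v x) powr p \<partial>completion \<mu>)"
  using assms by (simp add: nrm_def grad_lincomb_integral WD(1))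

text \<open>Three instances of \<open>Lp_uniformly_convex\<close>: the gradients, and the values
  with respect to either measure. The two constants may be raised to their maximum because each
  convexity defect is nonnegative by \<open>Lp_midpoint\<close>.\<close>

lemma nrm_uniformly_convex:
  assumes "\<epsilon> > 0"
  obtains C where "C > 0" "\<And>u v. u \<in> W \<Longrightarrow> v \<in> W \<Longrightarrow>
     nrm (\<lambda>x. u x - v x) \<le> \<epsilon> * (nrm u + nrm v) + C * (nrm u / 2 + nrm v / 2 - nrm (\<lambda>x. (1/2) * u x + (1/2) * v x))"
proof -
  obtain C1 where C1: "C1 > 0" "\<And>M f g :: 'a \<Rightarrow> 'a. Lp M p f \<Longrightarrow> Lp M p g \<Longrightarrow>
     (\<integral>x. norm (f x - g x) powr p \<partial>M) \<le> \<epsilon> * ((\<integral>x. norm (f x) powr p \<partial>M) + (\<integral>x. norm (g x) powr p \<partial>M))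
     + C1 * ((\<integral>x. norm (f x) powr p \<partial>M) / 2 + (\<integral>x. norm (g x) powr p \<partial>M) / 2 - (\<integral>x. norm ((1/2) *\<^sub>R (f x + g x)) powr p \<partial>M))"
    using Lp_uniformly_convex[OF p assms, where 'm = 'a and 'b = 'a] by blast
  obtain C2 where C2: "C2 > 0" "\<And>M f g :: 'a \<Rightarrow> real. Lp M p f \<Longrightarrow> Lp M p g \<Longrightarrow>
     (\<integral>x. norm (f x - g x) powr p \<partial>M) \<le> \<epsilon> * ((\<integral>x. norm (f x) powr p \<partial>M) + (\<integral>x. norm (g x) powr p \<partial>M))
     + C2 * ((\<integral>x. norm (f x) powr p \<partial>M) / 2 + (\<integral>x. norm (g x) powr p \<partial>M) / 2 - (\<integral>x. norm ((1/2) *\<^sub>R (f x + g x)) powr p \<partial>M))"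
    using Lp_uniformly_convex[OF p assms, where 'm = 'a and 'b = real] by blast
  define C where "C = max C1 C2"
  have up: "x \<le> e + C * d" if "x \<le> e + c * d" "d \<ge> 0" "c \<le> C" for x e c d :: real
    using that mult_right_mono[of c C d] by linarith
  show thesis
  proof (rule that)
    show "C > 0" using C1 by (simp add: C_def)
    fix u v assume u: "u \<in> W" and v: "v \<in> W"
    let ?I = "\<lambda>M f. \<integral>x. norm (f x) powr p \<partial>M"
    note U = WD[OF u] and Z = WD[OF v]
    have a: "(\<integral>x. norm (weak_gradient u x - weak_gradient v x) powr p \<partial>lebesgue) \<le> \<epsilon> * (?I lebesgue (weak_gradient u) + ?I lebesgue (weak_gradient v))
      + C * (?I lebesgue (weak_gradient u) / 2 + ?I lebesgue (weak_gradient v) / 2 - (\<integral>x. norm ((1/2) *\<^sub>R (weak_gradient u x + weak_gradient v x)) powr p \<partial>lebesgue))"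
      by (rule up[OF C1(2)[OF U(6) Z(6)]]) (use Lp_midpoint[OF p U(6) Z(6)] in \<open>auto simp: C_def\<close>)
    have b: "(\<integral>x. norm (u x - v x) powr p \<partial>lebesgue) \<le> \<epsilon> * (?I lebesgue u + ?I lebesgue v)
      + C * (?I lebesgue u / 2 + ?I lebesgue v / 2 - (\<integral>x. norm ((1/2) *\<^sub>R (u x + v x)) powr p \<partial>lebesgue))"
      by (rule up[OF C2(2)[OF U(5) Z(5)]]) (use Lp_midpoint[OF p U(5) Z(5)] in \<open>auto simp: C_def\<close>)
    have c: "(\<integral>x. norm (u x - v x) powr p \<partial>completion \<mu>) \<le> \<epsilon> * (?I (completion \<mu>) u + ?I (completion \<mu>) v)
      + C * (?I (completion \<mu>) u / 2 + ?I (completion \<mu>) v / 2 - (\<integral>x. norm ((1/2) *\<^sub>R (u x + v x)) powr p \<partial>completion \<mu>))"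
      by (rule up[OF C2(2)[OF U(3) Z(3)]]) (use Lp_midpoint[OF p U(3) Z(3)] in \<open>auto simp: C_def\<close>)
    have d: "nrm (\<lambda>x. u x - v x) = (\<integral>x. norm (weak_gradient u x - weak_gradient v x) powr p \<partial>lebesgue)
       + (\<integral>x. norm (u x - v x) powr p \<partial>lebesgue) + (\<integral>x. norm (u x - v x) powr p \<partial>completion \<mu>)"
      using nrm_lincomb[OF u v, of 1 "-1"] by simp
    have e: "nrm (\<lambda>x. (1/2) * u x + (1/2) * v x) = (\<integral>x. norm ((1/2) *\<^sub>R (weak_gradient u x + weak_gradient v x)) powr p \<partial>lebesgue)
       + (\<integral>x. norm ((1/2) *\<^sub>R (u x + v x)) powr p \<partial>lebesgue) + (\<integral>x. norm ((1/2) *\<^sub>R (u x + v x)) powr p \<partial>completion \<mu>)"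
      using nrm_lincomb[OF u v, of "1/2" "1/2"] by (simp only: scaleR_add_right)
    show "nrm (\<lambda>x. u x - v x) \<le> \<epsilon> * (nrm u + nrm v) + C * (nrm u / 2 + nrm v / 2 - nrm (\<lambda>x. (1/2) * u x + (1/2) * v x))"
      using add_mono[OF add_mono[OF a b] c] unfolding d e nrm_def[of u] nrm_def[of v] by (simp add: algebra_simps add_divide_distrib)
  qed
qed

lemma V_AE: "u \<in> V R \<Longrightarrow> AE x in lebesgue. norm x \<ge> R \<longrightarrow> u x = 0"
  unfolding V_def using qe_AE[OF p0(2)] by blast

lemma V_AE_cball:
  assumes "u \<in> V R" shows "AE x in lebesgue. u x = u x * indicator (cball 0 R) x"
  using V_AE[OF assms] by eventually_elim (auto simp: indicator_def)

lemma V_integrable: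
  assumes "u \<in> V R" shows "integrable lebesgue u"
proof -
  have "locally_integrable u" using Lp_locally_integrable[OF WD(5)[OF V_W[OF assms]] p0(3)] .
  then have "integrable lebesgue (\<lambda>x. u x * indicator (cball 0 R) x)" by (rule integrable_cball)
  moreover have "u \<in> borel_measurable lebesgue" using WD(5)[OF V_W[OF assms]] by (simp add: Lp_def)
  ultimately show ?thesis using V_AE_cball[OF assms]
    by (subst integrable_cong_AE[where g = "\<lambda>x. u x * indicator (cball 0 R) x"]) auto
qed

text \<open>The resolvent equation is the Euler-Lagrange equation of this functional on
  \<open>V R\<close>.\<close>

definition J :: "('a \<Rightarrow> real) \<Rightarrow> real" where "J u = nrm u / p - (\<integral>x. u x \<partial>lebesgue)"

text \<open>Coercivity of \<open>J\<close>: members of \<open>V R\<close> live on a ball, so the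
  linear term is absorbed into any small multiple of \<open>nrm\<close> at the cost of a constant
  proportional to the volume of the ball.\<close>

lemma V_integral_bound:
  assumes \<delta>: "\<delta> > 0"
  obtains c where "c \<ge> 0" "\<And>u. u \<in> V R \<Longrightarrow> (\<integral>x. u x \<partial>lebesgue) \<le> \<delta> * nrm u + c"
proof -
  obtain c where c: "c \<ge> 0" "\<And>t. t \<ge> 0 \<Longrightarrow> t \<le> \<delta> * t powr p + c" using lin_le_powr[OF p \<delta>] by blast
  have fin: "integrable lebesgue (indicat_real (cball (0::'a) R))"
    by (auto simp: emeasure_lborel_cball_finite[unfolded infinity_ennreal_def] intro!: integrable_real_indicator)
  show thesis
  proof (rule that[of "c * measure lebesgue (cball (0::'a) R)"])
    fix u assume u: "u \<in> V R"
    have L: "integrable lebesgue (\<lambda>x. norm (u x) powr p)" using WD(5)[OF V_W[OF u]] by (simp add: Lp_def)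
    have "(\<integral>x. u x \<partial>lebesgue) \<le> (\<integral>x. \<delta> * norm (u x) powr p + c * indicator (cball 0 R) x \<partial>lebesgue)"
    proof (rule integral_mono_AE[OF V_integrable[OF u]])
      show "integrable lebesgue (\<lambda>x. \<delta> * norm (u x) powr p + c * indicat_real (cball 0 R) x)"
        using L fin by auto
      show "AE x in lebesgue. u x \<le> \<delta> * norm (u x) powr p + c * indicator (cball 0 R) x"
        using V_AE[OF u]
      proof eventually_elim
        case (elim x)
        show ?case using c(2)[of "\<bar>u x\<bar>"] elim by (cases "x \<in> cball 0 R") auto
      qed
    qed
    also have "\<dots> = \<delta> * (\<integral>x. norm (u x) powr p \<partial>lebesgue) + c * measure lebesgue (cball (0::'a) R)"
      using L fin by simp
    also have "(\<integral>x. norm (u x) powr p \<partial>lebesgue) \<le> nrm u"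
      unfolding nrm_def by (simp add: integral_nonneg_AE)
    finally show "(\<integral>x. u x \<partial>lebesgue) \<le> \<delta> * nrm u + c * measure lebesgue (cball (0::'a) R)" using \<delta> by simp
  qed (use c in simp)
qed

text \<open>Lower semicontinuity along the minimizing sequence is Fatou's lemma for the nonnegative
  integrand \<open>\<bar>u\<bar>\<^sup>p / p - u + 1\<close> on the ball.\<close>

lemma J_lsc:
  assumes u: "\<And>n. u n \<in> V R" and w: "w \<in> sobolev_qc p"
    and ae: "AE x in lebesgue. (\<lambda>n. u n x) \<longlonglongrightarrow> w x" "AE x in completion \<mu>. (\<lambda>n. u n x) \<longlonglongrightarrow> w x"
      "AE x in lebesgue. (\<lambda>n. weak_gradient (u n) x) \<longlonglongrightarrow> weak_gradient w x"
    and z: "quasi_everywhere p (\<lambda>x. norm x \<ge> R \<longrightarrow> w x = 0)"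
    and K: "\<And>n. nrm (u n) \<le> K" "\<And>n. J (u n) \<le> K" and lim: "(\<lambda>n. J (u n)) \<longlonglongrightarrow> m"
  shows "w \<in> V R" and "J w \<le> m"
proof -
  have ws: "w \<in> sobolev p" and wq: "quasi_continuous p w" using w by (auto simp: sobolev_qc_def)
  note wm = sobolevD(4,5)[OF ws p0(2)] qc_measurable_mu[OF p \<mu> wq]
  note uD = WD[OF V_W[OF u]]
  have i1: "integrable lebesgue (\<lambda>x. norm (weak_gradient (u n) x) powr p)"
    and i2: "integrable lebesgue (\<lambda>x. norm (u n x) powr p)"
    and i3: "integrable (completion \<mu>) (\<lambda>x. norm (u n x) powr p)" for n
    using uD[of n] by (auto simp: Lp_def)
  have powlim: "(\<lambda>n. norm (a n) powr p) \<longlonglongrightarrow> norm b powr p" if "a \<longlonglongrightarrow> b" for a :: "nat \<Rightarrow> 'b::real_normed_vector" and b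
    using that p0 by (intro tendsto_powr' tendsto_intros) auto
  have nn: "(\<integral>x. norm (weak_gradient (u n) x) powr p \<partial>lebesgue) \<ge> 0" "(\<integral>x. norm (u n x) powr p \<partial>lebesgue) \<ge> 0"
     "(\<integral>x. norm (u n x) powr p \<partial>completion \<mu>) \<ge> 0" for n by (auto intro!: integral_nonneg_AE)
  have Kb: "(\<integral>x. norm (weak_gradient (u n) x) powr p \<partial>lebesgue) \<le> K" "(\<integral>x. norm (u n x) powr p \<partial>lebesgue) \<le> K"
     "(\<integral>x. norm (u n x) powr p \<partial>completion \<mu>) \<le> K" for n using K(1)[of n, unfolded nrm_def] nn[of n] by linarith+
  have "AE x in completion \<mu>. (\<lambda>n. norm (u n x) powr p) \<longlonglongrightarrow> norm (w x) powr p"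
    using ae(2) by eventually_elim (rule powlim)
  from fatou_eventually[OF i3 _ _ this Kb(3)] wm(3)
  have f3: "integrable (completion \<mu>) (\<lambda>x. norm (w x) powr p)"
    and e3: "\<And>\<eta>. \<eta> > 0 \<Longrightarrow> \<forall>\<^sub>F n in sequentially. (\<integral>x. norm (w x) powr p \<partial>completion \<mu>) \<le> (\<integral>x. norm (u n x) powr p \<partial>completion \<mu>) + \<eta>"
    by auto
  show wV: "w \<in> V R" unfolding V_def using z ws wq f3 wm(3) by (auto intro!: W_I simp: Lp_def)
  have "AE x in lebesgue. (\<lambda>n. norm (weak_gradient (u n) x) powr p) \<longlonglongrightarrow> norm (weak_gradient w x) powr p"
    using ae(3) by eventually_elim (rule powlim)
  from fatou_eventually(2)[OF i1 _ _ this Kb(1)] wm(2)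
  have e1: "\<And>\<eta>. \<eta> > 0 \<Longrightarrow> \<forall>\<^sub>F n in sequentially. (\<integral>x. norm (weak_gradient w x) powr p \<partial>lebesgue) \<le> (\<integral>x. norm (weak_gradient (u n) x) powr p \<partial>lebesgue) + \<eta>"
    by auto
  define B where "B = (indicator (cball 0 R) :: 'a \<Rightarrow> real)"
  define f where "f v x = norm (v x) powr p / p - v x * B x + B x" for v :: "'a \<Rightarrow> real" and x
  have Bi: "integrable lebesgue B"
    unfolding B_def by (auto simp: emeasure_lborel_cball_finite[unfolded infinity_ennreal_def] intro!: integrable_real_indicator)
  have fv: "integrable lebesgue (f v)" "(\<integral>x. f v x \<partial>lebesgue) = (\<integral>x. norm (v x) powr p \<partial>lebesgue) / p - (\<integral>x. v x \<partial>lebesgue) + (\<integral>x. B x \<partial>lebesgue)"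
    if v: "v \<in> V R" for v
  proof -
    have a: "integrable lebesgue (\<lambda>x. norm (v x) powr p)" using WD(5)[OF V_W[OF v]] by (simp add: Lp_def)
    have b: "integrable lebesgue (\<lambda>x. v x * B x)"
      unfolding B_def by (rule integrable_cball[OF Lp_locally_integrable[OF WD(5)[OF V_W[OF v]] p0(3)]])
    have "(\<integral>x. v x * B x \<partial>lebesgue) = (\<integral>x. v x \<partial>lebesgue)"
      using V_AE_cball[OF v] b V_integrable[OF v] unfolding B_def by (intro integral_cong_AE) auto
    then show "integrable lebesgue (f v)" "(\<integral>x. f v x \<partial>lebesgue) = (\<integral>x. norm (v x) powr p \<partial>lebesgue) / p - (\<integral>x. v x \<partial>lebesgue) + (\<integral>x. B x \<partial>lebesgue)"
      using a b Bi by (auto simp: f_def[abs_def])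
  qed
  have f0: "f v x \<ge> 0" for v x
  proof (cases "x \<in> cball 0 R")
    case True
    have "v x \<le> \<bar>v x\<bar>" by simp
    also have "\<dots> \<le> (1 - 1/p) + \<bar>v x\<bar> powr p / p" using young_powr[OF p, of 1 "\<bar>v x\<bar>"] by simp
    also have "\<dots> \<le> 1 + \<bar>v x\<bar> powr p / p" using p by simp
    finally show ?thesis using True by (simp add: f_def B_def)
  next
    case False
    then show ?thesis using p0 by (simp add: f_def B_def)
  qed
  have Kf: "(\<integral>x. f (u n) x \<partial>lebesgue) \<le> K + (\<integral>x. B x \<partial>lebesgue)" for n
  proof -
    have "(\<integral>x. norm (u n x) powr p \<partial>lebesgue) / p \<le> nrm (u n) / p"
      using nn[of n] p0 by (intro divide_right_mono) (auto simp: nrm_def)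
    then show ?thesis using K(2)[of n] fv(2)[OF u[of n]] by (simp add: J_def)
  qed
  have flim: "AE x in lebesgue. (\<lambda>n. f (u n) x) \<longlonglongrightarrow> f w x"
    using ae(1)
  proof eventually_elim
    case (elim x)
    then show ?case unfolding f_def using p0 by (intro tendsto_intros powlim) auto
  qed
  have fwm: "f w \<in> borel_measurable lebesgue" using fv(1)[OF wV] by auto
  have e2: "\<And>\<eta>. \<eta> > 0 \<Longrightarrow> \<forall>\<^sub>F n in sequentially. (\<integral>x. f w x \<partial>lebesgue) \<le> (\<integral>x. f (u n) x \<partial>lebesgue) + \<eta>"
    by (rule fatou_eventually(2)[of lebesgue "\<lambda>n. f (u n)", OF fv(1)[OF u] f0 fwm flim Kf])
  have "J w \<le> m + \<eta>" if \<eta>: "\<eta> > 0" for \<eta>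
  proof -
    have "\<eta>/4 > 0" using \<eta> by simp
    have "\<forall>\<^sub>F n in sequentially. J (u n) < m + \<eta>/4" using order_tendstoD(2)[OF lim] \<eta> by simp
    then have "\<forall>\<^sub>F n in sequentially. J w \<le> m + \<eta>"
      using e1[OF \<open>\<eta>/4 > 0\<close>] e2[OF \<open>\<eta>/4 > 0\<close>] e3[OF \<open>\<eta>/4 > 0\<close>]
    proof eventually_elim
      case (elim n)
      have d: "a / p \<le> b / p + \<eta>/4" if "a \<le> b + \<eta>/4" for a b :: real
      proof -
        have "a / p \<le> (b + \<eta>/4) / p" using that p0 by (intro divide_right_mono) auto
        also have "\<dots> = b / p + (\<eta>/4) / p" by (simp add: add_divide_distrib)
        also have "(\<eta>/4) / p \<le> \<eta>/4" using p \<eta> by (simp add: divide_le_eq)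
        finally show ?thesis by simp
      qed
      show ?case
        using elim(1,3) d[OF elim(2)] d[OF elim(4)] unfolding J_def nrm_def fv(2)[OF wV] fv(2)[OF u]
        by (simp add: add_divide_distrib)
    qed
    then show ?thesis by (rule eventually_happens'[OF sequentially_bot, THEN exE])
  qed
  then show "J w \<le> m" by (rule field_le_epsilon)
qed

lemma minimizer_exists: "\<exists>w\<in>V R. \<forall>v\<in>V R. J w \<le> J v"
proof -
  \<comment> \<open>Half of the factor 1/p in \<open>J\<close>, so that \<open>J u + c\<close> still
    controls \<open>nrm u\<close>.\<close>
  have "1 / (2 * p) > 0" using p0 by simp
  then obtain c where c: "c \<ge> 0" "\<And>u. u \<in> V R \<Longrightarrow> (\<integral>x. u x \<partial>lebesgue) \<le> 1 / (2 * p) * nrm u + c"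
    using V_integral_bound by blast
  have Jb: "nrm u \<le> 2 * p * (J u + c)" if "u \<in> V R" for u
  proof -
    have "1 / (2 * p) * nrm u \<le> J u + c" using c(2)[OF that] by (simp add: J_def field_simps)
    then show ?thesis using p0 by (simp add: field_simps)
  qed
  have Jc: "J u \<ge> - c" if "u \<in> V R" for u
  proof -
    have "0 \<le> 2 * p * (J u + c)" using Jb[OF that] nrm_nonneg[of u] by linarith
    then show ?thesis using p0 by (simp add: zero_le_mult_iff)
  qed
  define m where "m = Inf (J ` V R)"
  have bdd: "bdd_below (J ` V R)" using Jc by (auto intro!: bdd_belowI[of _ "- c"])
  have ne: "J ` V R \<noteq> {}" using V_zero by blast
  have mle: "m \<le> J u" if "u \<in> V R" for u unfolding m_def using bdd that by (intro cInf_lower) auto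
  have "\<exists>u\<in>V R. J u < m + 1 / real (Suc n)" for n
    using cInf_less_iff[OF ne bdd, of "m + 1 / real (Suc n)"] by (auto simp: m_def)
  then obtain u where u: "\<And>n. u n \<in> V R" "\<And>n. J (u n) < m + 1 / real (Suc n)" by metis
  define K where "K = 2 * p * (m + 1 + c)"
  have uK: "nrm (u n) \<le> K" for n
  proof -
    have "1 / real (Suc n) \<le> 1" by simp
    then have "J (u n) + c \<le> m + 1 + c" using u(2)[of n] by linarith
    then have "2 * p * (J (u n) + c) \<le> K" unfolding K_def using p0 by (intro mult_left_mono) auto
    then show ?thesis using Jb[OF u(1)[of n]] by linarith
  qed
  have K0: "K \<ge> 0" using uK[of 0] nrm_nonneg[of "u 0"] by linarith
  have cauchy: "\<exists>N. \<forall>i\<ge>N. \<forall>j\<ge>N. nrm (\<lambda>x. u i x - u j x) \<le> \<eta>" if \<eta>: "\<eta> > 0" for \<eta>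
  proof -
    define \<epsilon> where "\<epsilon> = \<eta> / (4 * (K + 1))"
    have \<epsilon>: "\<epsilon> > 0" using \<eta> K0 by (simp add: \<epsilon>_def)
    obtain C where C: "C > 0" "\<And>u v. u \<in> W \<Longrightarrow> v \<in> W \<Longrightarrow>
       nrm (\<lambda>x. u x - v x) \<le> \<epsilon> * (nrm u + nrm v) + C * (nrm u / 2 + nrm v / 2 - nrm (\<lambda>x. (1/2) * u x + (1/2) * v x))"
      using nrm_uniformly_convex[OF \<epsilon>] by blast
    \<comment> \<open>The midpoint of two members is a competitor, so its \<open>J\<close> is at
      least \<open>m\<close>, and the linear term cancels. The convexity defect of two members
      beyond \<open>N\<close> is therefore at most p/(N+1), and \<open>C\<close> times it has to
      stay below \<eta>/2.\<close>
    have "\<eta> / (2 * C * p) > 0" using \<eta> C p0 by simp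
    then obtain N where N: "1 / real (Suc N) < \<eta> / (2 * C * p)" using nat_approx_posE by blast
    have "nrm (\<lambda>x. u i x - u j x) \<le> \<eta>" if ij: "i \<ge> N" "j \<ge> N" for i j
    proof -
      let ?v = "\<lambda>x. (1/2) * u i x + (1/2) * u j x"
      have vV: "?v \<in> V R" by (rule V_lincomb[OF u(1) u(1)])
      have Ji: "J (u k) \<le> m + 1 / real (Suc N)" if "k \<ge> N" for k
      proof -
        have "1 / real (Suc k) \<le> 1 / real (Suc N)" using that by (intro divide_left_mono) auto
        then show ?thesis using u(2)[of k] by linarith
      qed
      have iv: "(\<integral>x. ?v x \<partial>lebesgue) = (\<integral>x. u i x \<partial>lebesgue) / 2 + (\<integral>x. u j x \<partial>lebesgue) / 2"
        using V_integrable[OF u(1)] by simp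
      define d where "d = nrm (u i) / 2 + nrm (u j) / 2 - nrm ?v"
      have "d / p = J (u i) / 2 + J (u j) / 2 - J ?v"
        unfolding d_def J_def iv by (simp add: add_divide_distrib diff_divide_distrib)
      also have "\<dots> \<le> 1 / real (Suc N)" using Ji[OF ij(1)] Ji[OF ij(2)] mle[OF vV] by linarith
      also have "\<dots> \<le> \<eta> / (2 * C * p)" using N by simp
      finally have "C * d \<le> \<eta> / 2" using C p0 by (simp add: field_simps)
      moreover have "\<epsilon> * (nrm (u i) + nrm (u j)) \<le> \<epsilon> * (2 * (K + 1))"
        using uK[of i] uK[of j] \<epsilon> by (intro mult_left_mono) auto
      moreover have "\<epsilon> * (2 * (K + 1)) = \<eta> / 2"
      proof -
        have "K + 1 > 0" using K0 by simp
        then show ?thesis unfolding \<epsilon>_def by (simp only: times_divide_eq_left) (simp add: divide_eq_eq)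
      qed
      ultimately show ?thesis using C(2)[OF V_W[OF u(1)[of i]] V_W[OF u(1)[of j]]] unfolding d_def by linarith
    qed
    then show ?thesis by blast
  qed
  have "\<And>k. 1 / wgt p k ^ 3 > 0" by (simp add: wgt_pos)
  then obtain r where r: "strict_mono r" "\<And>k. nrm (\<lambda>x. u (r (Suc k)) x - u (r k) x) \<le> 1 / wgt p k ^ 3"
    using fast_subsequence[of "\<lambda>i j. nrm (\<lambda>x. u i x - u j x)" "\<lambda>k. 1 / wgt p k ^ 3"] cauchy by blast
  have er: "energy p (\<lambda>x. u (r (Suc k)) x - u (r k) x) \<le> 1 / wgt p k ^ 3" for k
  proof -
    have "(\<lambda>x. u (r (Suc k)) x - u (r k) x) \<in> W"
      using W_lincomb[OF V_W[OF u(1)] V_W[OF u(1)], of 1 "r (Suc k)" "-1" "r k"] by simp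
    then show ?thesis using energy_le_nrm r(2)[of k] order_trans by blast
  qed
  obtain w where w: "w \<in> sobolev_qc p" "quasi_everywhere p (\<lambda>x. (\<lambda>n. u (r n) x) \<longlonglongrightarrow> w x)"
    "AE x in lebesgue. (\<lambda>n. weak_gradient (u (r n)) x) \<longlonglongrightarrow> weak_gradient w x"
    using sobolev_qc_complete[OF p WD(4)[OF V_W[OF u(1)]] er] by blast
  have z: "quasi_everywhere p (\<lambda>x. norm x \<ge> R \<longrightarrow> w x = 0)"
  proof (rule qe_mono[OF qe_conj[OF p w(2) qe_all_nat[OF p]]])
    show "quasi_everywhere p (\<lambda>x. norm x \<ge> R \<longrightarrow> u (r n) x = 0)" for n using u(1) by (simp add: V_def)
    fix x assume a: "(\<lambda>n. u (r n) x) \<longlonglongrightarrow> w x \<and> (\<forall>n. norm x \<ge> R \<longrightarrow> u (r n) x = 0)"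
    show "norm x \<ge> R \<longrightarrow> w x = 0"
    proof
      assume "norm x \<ge> R"
      then have "(\<lambda>n. u (r n) x) = (\<lambda>n. 0)" using a by auto
      then show "w x = 0" using a by (metis LIMSEQ_const_iff)
    qed
  qed
  have lim: "(\<lambda>n. J (u n)) \<longlonglongrightarrow> m"
  proof (rule tendsto_sandwich[of "\<lambda>n. m" _ _ "\<lambda>n. m + 1 / real (Suc n)"])
    show "(\<lambda>n. m + 1 / real (Suc n)) \<longlonglongrightarrow> m"
      using tendsto_add[OF tendsto_const LIMSEQ_Suc[OF lim_1_over_n], of m] by simp
  qed (use mle[OF u(1)] less_imp_le[OF u(2)] in auto)
  have uJ: "J (u n) \<le> max K (m + 1)" for n
  proof -
    have "1 / real (Suc n) \<le> 1" by simp
    then show ?thesis using u(2)[of n] by linarith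
  qed
  have uK': "nrm (u n) \<le> max K (m + 1)" for n using uK[of n] by simp
  note res = J_lsc[OF u(1) w(1) qe_AE[OF p0(2) w(2)] qe_AE_mu[OF \<mu> w(2)] w(3) z uK' uJ LIMSEQ_subseq_LIMSEQ[OF lim r(1), unfolded o_def]]
  show ?thesis using res mle by (meson order_trans)
qed

section \<open>The weak equation of the minimizer\<close>

definition pairing :: "('a \<Rightarrow> real) \<Rightarrow> ('a \<Rightarrow> real) \<Rightarrow> real" where
  "pairing u \<phi> = (\<integral>x. pvec p (weak_gradient u x) \<bullet> weak_gradient \<phi> x \<partial>lebesgue) + (\<integral>x. pvec p (u x) \<bullet> \<phi> x \<partial>lebesgue)
     + (\<integral>x. pvec p (u x) \<bullet> \<phi> x \<partial>completion \<mu>)"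

text \<open>The definition integrates the gradient term and the zero-order term together. Both are
  integrable, so the integral splits, and all three terms can be handled by the same
  \<open>L^p\<close> lemmas about \<open>pvec\<close>.\<close>

lemma is_resolvent_iff:
  "is_resolvent_one p \<mu> R u \<longleftrightarrow> u \<in> V R \<and> (\<forall>\<phi>\<in>V R. pairing u \<phi> = (\<integral>x. \<phi> x \<partial>lebesgue))"
proof -
  have "(\<integral>x. norm (weak_gradient u x) powr (p - 2) * (weak_gradient u x \<bullet> weak_gradient \<phi> x)
             + \<bar>u x\<bar> powr (p - 2) * u x * \<phi> x \<partial>lebesgue)
        + (\<integral>x. \<bar>u x\<bar> powr (p - 2) * u x * \<phi> x \<partial>completion \<mu>) = pairing u \<phi>" if "u \<in> V R" "\<phi> \<in> V R" for \<phi>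
    unfolding pairing_def
    using Bochner_Integration.integral_add[OF pvec_integrable[OF p WD(6)[OF V_W[OF that(1)]] WD(6)[OF V_W[OF that(2)]]]
        pvec_integrable[OF p WD(5)[OF V_W[OF that(1)]] WD(5)[OF V_W[OF that(2)]]]]
    by (simp add: pvec_def)
  then show ?thesis by (auto simp: is_resolvent_one_def V_eq)
qed

text \<open>Minimality against w + t\<phi> with t > 0: the increment of \<open>nrm\<close> is
  estimated by \<open>Lp_variation\<close>, the factor t cancels, and t tends to 0 along
  1/(n+1).\<close>

lemma minimizer_pairing_ge:
  assumes w: "w \<in> V R" "\<And>v. v \<in> V R \<Longrightarrow> J w \<le> J v" and \<phi>: "\<phi> \<in> V R"
  shows "pairing w \<phi> \<ge> (\<integral>x. \<phi> x \<partial>lebesgue)"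
proof -
  note wD = WD[OF V_W[OF w(1)]] and fD = WD[OF V_W[OF \<phi>]]
  define D where "D t = (\<integral>x. pvec p (weak_gradient w x + t *\<^sub>R weak_gradient \<phi> x) \<bullet> weak_gradient \<phi> x \<partial>lebesgue)
     + (\<integral>x. pvec p (w x + t *\<^sub>R \<phi> x) \<bullet> \<phi> x \<partial>lebesgue) + (\<integral>x. pvec p (w x + t *\<^sub>R \<phi> x) \<bullet> \<phi> x \<partial>completion \<mu>)" for t
  have ge: "(\<integral>x. \<phi> x \<partial>lebesgue) \<le> D t" if t: "t > 0" for t
  proof -
    have vV: "(\<lambda>x. 1 * w x + t * \<phi> x) \<in> V R" by (rule V_lincomb[OF w(1) \<phi>])
    have I: "(\<integral>x. 1 * w x + t * \<phi> x \<partial>lebesgue) = (\<integral>x. w x \<partial>lebesgue) + t * (\<integral>x. \<phi> x \<partial>lebesgue)"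
      using V_integrable[OF w(1)] V_integrable[OF \<phi>] by simp
    have "nrm (\<lambda>x. 1 * w x + t * \<phi> x) - nrm w \<le> p * t * D t"
      unfolding nrm_lincomb[OF V_W[OF w(1)] V_W[OF \<phi>]] nrm_def[of w] D_def
      using Lp_variation(1)[OF p wD(6) fD(6), of t] Lp_variation(1)[OF p wD(5) fD(5), of t] Lp_variation(1)[OF p wD(3) fD(3), of t]
      by (simp add: algebra_simps)
    then have "(nrm (\<lambda>x. 1 * w x + t * \<phi> x) - nrm w) / p \<le> t * D t" using p0 by (simp add: field_simps)
    moreover have "t * (\<integral>x. \<phi> x \<partial>lebesgue) \<le> (nrm (\<lambda>x. 1 * w x + t * \<phi> x) - nrm w) / p"
      using w(2)[OF vV] unfolding J_def I by (simp add: diff_divide_distrib)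
    ultimately have "t * (\<integral>x. \<phi> x \<partial>lebesgue) \<le> t * D t" by linarith
    then show ?thesis using t by simp
  qed
  have "(\<lambda>n. D (1 / real (Suc n))) \<longlonglongrightarrow> pairing w \<phi>"
    unfolding D_def pairing_def
    by (intro tendsto_add Lp_variation(2)[OF p wD(6) fD(6)] Lp_variation(2)[OF p wD(5) fD(5)] Lp_variation(2)[OF p wD(3) fD(3)])
  then show ?thesis by (rule LIMSEQ_le_const) (use ge in auto)
qed

lemma pairing_uminus:
  assumes "u \<in> W" "\<phi> \<in> W"
  shows "pairing u (\<lambda>x. - \<phi> x) = - pairing u \<phi>"
proof -
  have "(\<integral>x. pvec p (weak_gradient u x) \<bullet> weak_gradient (\<lambda>x. - \<phi> x) x \<partial>lebesgue) = (\<integral>x. - (pvec p (weak_gradient u x) \<bullet> weak_gradient \<phi> x) \<partial>lebesgue)"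
  proof (rule integral_cong_AE)
    have "(\<lambda>x. - \<phi> x) \<in> W" using W_lincomb[OF assms(2,2), of "-1" 0] by simp
    then show "(\<lambda>x. pvec p (weak_gradient u x) \<bullet> weak_gradient (\<lambda>x. - \<phi> x) x) \<in> borel_measurable lebesgue"
      using pvec_integrable[OF p WD(6)[OF assms(1)] WD(6)] by blast
    show "(\<lambda>x. - (pvec p (weak_gradient u x) \<bullet> weak_gradient \<phi> x)) \<in> borel_measurable lebesgue"
      using pvec_integrable[OF p WD(6)[OF assms(1)] WD(6)[OF assms(2)]] by auto
    show "AE x in lebesgue. pvec p (weak_gradient u x) \<bullet> weak_gradient (\<lambda>x. - \<phi> x) x = - (pvec p (weak_gradient u x) \<bullet> weak_gradient \<phi> x)"
      using sobolev_cmult(2)[OF WD(1)[OF assms(2)] p0(1), of "-1"] by eventually_elim simp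
  qed
  then show ?thesis by (simp add: pairing_def)
qed

lemma resolvent_exists: "\<exists>w. is_resolvent_one p \<mu> R w"
proof -
  obtain w where w: "w \<in> V R" "\<And>v. v \<in> V R \<Longrightarrow> J w \<le> J v" using minimizer_exists[of R] by blast
  \<comment> \<open>Both \<phi> and -\<phi> are admissible and the pairing is odd in its second
    argument, so the inequality holds in both directions.\<close>
  have "pairing w \<phi> = (\<integral>x. \<phi> x \<partial>lebesgue)" if \<phi>: "\<phi> \<in> V R" for \<phi>
  proof -
    have "(\<lambda>x. - \<phi> x) \<in> V R" using V_lincomb[OF \<phi> \<phi>, of "-1" 0] by simp
    from minimizer_pairing_ge[OF w this] have "pairing w \<phi> \<le> (\<integral>x. \<phi> x \<partial>lebesgue)"
      by (simp add: pairing_uminus[OF V_W[OF w(1)] V_W[OF \<phi>]])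
    then show ?thesis using minimizer_pairing_ge[OF w \<phi>] by simp
  qed
  then show ?thesis using w(1) is_resolvent_iff by blast
qed

lemma resolvent_one:
  shows "resolvent_one p \<mu> R \<in> V R"
    and "\<phi> \<in> V R \<Longrightarrow> pairing (resolvent_one p \<mu> R) \<phi> = (\<integral>x. \<phi> x \<partial>lebesgue)"
proof -
  have "is_resolvent_one p \<mu> R (resolvent_one p \<mu> R)"
    unfolding resolvent_one_def by (rule someI_ex[OF resolvent_exists])
  then show "resolvent_one p \<mu> R \<in> V R" "\<phi> \<in> V R \<Longrightarrow> pairing (resolvent_one p \<mu> R) \<phi> = (\<integral>x. \<phi> x \<partial>lebesgue)"
    by (auto simp: is_resolvent_iff)
qed

end

section \<open>Comparison and the limit function\<close>

context cap_space
begin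

lemma W_pos:
  assumes "u \<in> W" shows "(\<lambda>x. max (u x) 0) \<in> W"
proof (rule W_I)
  note u = WD[OF assms]
  show "(\<lambda>x. max (u x) 0) \<in> sobolev p" by (rule sobolev_pos_part(1)[OF u(1) p0(1)])
  show "quasi_continuous p (\<lambda>x. max (u x) 0)" by (rule qc_max[OF p u(2)])
  show "Lp (completion \<mu>) p (\<lambda>x. max (u x) 0)"
    by (rule Lp_bound[OF u(3)]) (use u(3) p0 in \<open>auto simp: Lp_def max_def\<close>)
qed

lemma pairing_self: "u \<in> W \<Longrightarrow> pairing u u = nrm u"
  by (simp only: pairing_def nrm_def pvec_inner_self)

text \<open>Test with the negative part \<open>m\<close>. The pairing is nonpositive and the
  integral of \<open>m\<close> nonnegative, so \<open>m\<close> vanishes a.e.; quasi-continuity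
  upgrades this to quasi-everywhere.\<close>

lemma resolvent_nonneg: "quasi_everywhere p (\<lambda>x. resolvent_one p \<mu> R x \<ge> 0)"
proof -
  define u where "u = resolvent_one p \<mu> R"
  have uV: "u \<in> V R" unfolding u_def by (rule resolvent_one(1))
  define m where "m x = max (- u x) 0" for x
  have muW: "(\<lambda>x. - u x) \<in> W" using W_lincomb[OF V_W[OF uV] V_W[OF uV], of "-1" 0] by simp
  have mW: "m \<in> W" unfolding m_def by (rule W_pos[OF muW])
  have mV: "m \<in> V R" using mW uV unfolding V_def by (auto elim!: qe_mono simp: m_def)
  have grad_m: "AE x in lebesgue. weak_gradient m x = (if u x < 0 then - weak_gradient u x else 0)"
    using sobolev_pos_part(2)[OF WD(1)[OF muW] p0(1)] sobolev_cmult(2)[OF WD(1)[OF V_W[OF uV]] p0(1), of "-1"]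
    unfolding m_def[abs_def] by eventually_elim auto
  have m0: "m x \<ge> 0" for x by (simp add: m_def)
  have eq: "pairing u m = (\<integral>x. m x \<partial>lebesgue)" unfolding u_def by (rule resolvent_one(2)[folded u_def]) (use mV in simp)
  have nonpos: "pvec p (u x) \<bullet> m x \<le> 0" for x
  proof (cases "u x \<ge> 0")
    case False
    then have "pvec p (u x) \<bullet> m x = - (pvec p (u x) \<bullet> u x)" by (simp add: m_def)
    then show ?thesis by (simp only: pvec_inner_self) simp
  qed (simp add: m_def)
  have neg: "integral\<^sup>L M f \<le> 0" if "AE x in M. f x \<le> 0" for M :: "'a measure" and f :: "'a \<Rightarrow> real"
  proof -
    have "0 \<le> (\<integral>x. - f x \<partial>M)" by (rule integral_nonneg_AE) (use that in auto)
    then show ?thesis by simp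
  qed
  have "pairing u m \<le> 0"
    unfolding pairing_def
  proof (intro add_nonpos_nonpos neg)
    show "AE x in lebesgue. pvec p (weak_gradient u x) \<bullet> weak_gradient m x \<le> 0"
      using grad_m by eventually_elim (simp add: pvec_inner_self)
  qed (use nonpos in auto)
  then have "(\<integral>x. m x \<partial>lebesgue) \<le> 0" using eq by simp
  moreover have "(\<integral>x. m x \<partial>lebesgue) \<ge> 0" using m0 by (intro integral_nonneg_AE) auto
  ultimately have "(\<integral>x. m x \<partial>lebesgue) = 0" by simp
  then have "AE x in lebesgue. m x = 0"
    using integral_nonneg_eq_0_iff_AE[OF V_integrable[OF mV]] m0 by auto
  then have "AE x in lebesgue. 0 \<le> u x" by eventually_elim (auto simp: m_def max_def split: if_splits)
  then show ?thesis unfolding u_def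
    by (rule qc_AE_le_imp_qe[OF p qc_continuous[OF continuous_on_const p0(1)] WD(2)[OF V_W[OF uV]], unfolded u_def])
qed

text \<open>Both equations are tested with the positive part of u - v and subtracted. That function
  is admissible for the smaller ball because outside it u = 0 \<le> v quasi-everywhere. Monotonicity
  of \<open>pvec\<close> makes every term of the difference nonnegative, hence zero.\<close>

lemma resolvent_mono:
  assumes "R \<le> S"
  shows "quasi_everywhere p (\<lambda>x. resolvent_one p \<mu> R x \<le> resolvent_one p \<mu> S x)"
proof -
  define u v where "u = resolvent_one p \<mu> R" and "v = resolvent_one p \<mu> S"
  have uV: "u \<in> V R" and vV: "v \<in> V S" unfolding u_def v_def by (rule resolvent_one(1))+
  note uD = WD[OF V_W[OF uV]] and vD = WD[OF V_W[OF vV]]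
  define d where "d x = u x - v x" for x
  have dW: "d \<in> W" using W_lincomb[OF V_W[OF uV] V_W[OF vV], of 1 "-1"] by (simp add: d_def[abs_def])
  define f where "f x = max (d x) 0" for x
  have fW: "f \<in> W" unfolding f_def by (rule W_pos[OF dW])
  have "quasi_everywhere p (\<lambda>x. (norm x \<ge> R \<longrightarrow> u x = 0) \<and> 0 \<le> v x)"
    by (rule qe_conj[OF p]) (use uV resolvent_nonneg[of S] in \<open>auto simp: V_def v_def\<close>)
  then have fVR: "f \<in> V R" using fW unfolding V_def by (auto elim!: qe_mono simp: f_def d_def)
  then have fVS: "f \<in> V S" using assms unfolding V_def by (auto elim!: qe_mono)
  have eq: "pairing u f = pairing v f" using resolvent_one(2)[OF fVR] resolvent_one(2)[OF fVS] by (simp add: u_def v_def)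
  note fD = WD[OF fW]
  have gf: "AE x in lebesgue. weak_gradient f x = (if d x > 0 then weak_gradient u x - weak_gradient v x else 0)"
    using sobolev_pos_part(2)[OF WD(1)[OF dW] p0(1)] sobolev_diff(2)[OF uD(1) vD(1) p0(1)]
    unfolding f_def[abs_def] d_def[abs_def] by eventually_elim auto
  let ?a = "\<lambda>x. (pvec p (weak_gradient u x) - pvec p (weak_gradient v x)) \<bullet> weak_gradient f x"
  let ?b = "\<lambda>x. (pvec p (u x) - pvec p (v x)) \<bullet> f x"
  have sum0: "(\<integral>x. ?a x \<partial>lebesgue) + (\<integral>x. ?b x \<partial>lebesgue) + (\<integral>x. ?b x \<partial>completion \<mu>) = 0"
    using eq pvec_integrable[OF p uD(6) fD(6)] pvec_integrable[OF p vD(6) fD(6)]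
      pvec_integrable[OF p uD(5) fD(5)] pvec_integrable[OF p vD(5) fD(5)]
      pvec_integrable[OF p uD(3) fD(3)] pvec_integrable[OF p vD(3) fD(3)]
    unfolding pairing_def inner_diff_left by simp
  have b: "?b x = (if d x > 0 then (pvec p (u x) - pvec p (v x)) \<bullet> (u x - v x) else 0)" for x
    by (auto simp: f_def d_def)
  have b0: "?b x \<ge> 0" for x unfolding b using pvec_monotone(1)[OF p, of "u x" "v x"] by auto
  have "(\<integral>x. ?a x \<partial>lebesgue) \<ge> 0"
  proof (rule integral_nonneg_AE)
    show "AE x in lebesgue. 0 \<le> ?a x"
      using gf by eventually_elim (use pvec_monotone(1)[OF p] in auto)
  qed
  moreover have "(\<integral>x. ?b x \<partial>lebesgue) \<ge> 0" "(\<integral>x. ?b x \<partial>completion \<mu>) \<ge> 0" using b0 by (auto intro!: integral_nonneg_AE)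
  ultimately have z: "(\<integral>x. ?b x \<partial>lebesgue) = 0" using sum0 by linarith
  have bi: "integrable lebesgue ?b"
    unfolding inner_diff_left
    by (intro Bochner_Integration.integrable_diff pvec_integrable[OF p uD(5) fD(5)] pvec_integrable[OF p vD(5) fD(5)])
  have "AE x in lebesgue. ?b x = 0" using integral_nonneg_eq_0_iff_AE[OF bi] b0 z by auto
  then have "AE x in lebesgue. u x \<le> v x"
  proof eventually_elim
    case (elim x)
    show ?case
    proof (rule ccontr)
      assume "\<not> u x \<le> v x"
      then have "d x > 0" by (simp add: d_def)
      then have "(pvec p (u x) - pvec p (v x)) \<bullet> (u x - v x) = 0" using elim[unfolded b] by (simp only: if_True)
      then have "u x = v x" by (rule pvec_monotone(2)[OF p])
      then show False using \<open>\<not> u x \<le> v x\<close> by simp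
    qed
  qed
  then show ?thesis using qc_AE_le_imp_qe[OF p uD(2) vD(2)] by (simp add: u_def v_def)
qed

section \<open>Resolvents on integer radii and their limit\<close>

definition un :: "nat \<Rightarrow> 'a \<Rightarrow> real" where "un n = resolvent_one p \<mu> (real n)"

text \<open>For a given sequence of radii only countably many comparisons are needed, each
  \<open>R n\<close> against every integer. Outside one set of capacity zero the resolvents are then
  squeezed between the \<open>un m\<close>, and the supremum does not depend on the
  sequence.\<close>

lemma w_limit_exists: "is_w_limit p \<mu> (\<lambda>x. SUP n. ereal (un n x))"
  unfolding is_w_limit_def
proof (intro allI impI)
  fix R :: "nat \<Rightarrow> real" assume R: "filterlim R at_top sequentially"
  let ?r = "\<lambda>n. resolvent_one p \<mu> (R n)"
  have "quasi_everywhere p (\<lambda>x. \<forall>n m. (R n \<le> real m \<longrightarrow> ?r n x \<le> un m x) \<and> (real m \<le> R n \<longrightarrow> un m x \<le> ?r n x))"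
  proof (intro qe_all_nat p qe_conj)
    have T: "quasi_everywhere p (\<lambda>x. True)" using pcap_empty[OF p0(1)] by (simp add: quasi_everywhere_def)
    fix n m
    show "quasi_everywhere p (\<lambda>x. R n \<le> real m \<longrightarrow> ?r n x \<le> un m x)"
      by (cases "R n \<le> real m") (use resolvent_mono T in \<open>auto simp: un_def\<close>)
    show "quasi_everywhere p (\<lambda>x. real m \<le> R n \<longrightarrow> un m x \<le> ?r n x)"
      by (cases "real m \<le> R n") (use resolvent_mono T in \<open>auto simp: un_def\<close>)
  qed
  then show "quasi_everywhere p (\<lambda>x. (\<lambda>n. ereal (?r n x)) \<longlonglongrightarrow> (SUP n. ereal (un n x)))"
  proof (rule qe_mono)
    fix x assume x: "\<forall>n m. (R n \<le> real m \<longrightarrow> ?r n x \<le> un m x) \<and> (real m \<le> R n \<longrightarrow> un m x \<le> ?r n x)"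
    show "(\<lambda>n. ereal (?r n x)) \<longlonglongrightarrow> (SUP n. ereal (un n x))"
    proof (rule increasing_tendsto)
      show "\<forall>\<^sub>F n in sequentially. ereal (?r n x) \<le> (SUP n. ereal (un n x))"
      proof (rule always_eventually, rule allI)
        fix n
        obtain m where "R n \<le> real m" using real_arch_simple by blast
        then have "ereal (?r n x) \<le> ereal (un m x)" using x by simp
        also have "\<dots> \<le> (SUP n. ereal (un n x))" by (rule SUP_upper) simp
        finally show "ereal (?r n x) \<le> (SUP n. ereal (un n x))" .
      qed
      fix a assume "a < (SUP n. ereal (un n x))"
      then obtain m where m: "a < ereal (un m x)" by (auto simp: less_SUP_iff)
      have "\<forall>\<^sub>F n in sequentially. real m \<le> R n" using R by (simp add: filterlim_at_top)
      then show "\<forall>\<^sub>F n in sequentially. a < ereal (?r n x)"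
      proof eventually_elim
        case (elim n)
        then have "un m x \<le> ?r n x" using x by simp
        then show ?case using m by (metis ereal_less_eq(3) less_le_trans)
      qed
    qed
  qed
qed

lemma un_V: "un n \<in> V (real n)" unfolding un_def by (rule resolvent_one(1))

lemma un_W: "un n \<in> W" by (rule V_W[OF un_V])

lemma un_pairing: "\<phi> \<in> V (real n) \<Longrightarrow> pairing (un n) \<phi> = (\<integral>x. \<phi> x \<partial>lebesgue)"
  unfolding un_def by (rule resolvent_one(2))

lemma un_integrable: "integrable lebesgue (un n)" by (rule V_integrable[OF un_V])

lemma nrm_un: "nrm (un n) = (\<integral>x. un n x \<partial>lebesgue)"
  using un_pairing[OF un_V] pairing_self[OF un_W] by simp

lemma un_nonneg_AE: "AE x in lebesgue. \<forall>n. 0 \<le> un n x"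
  unfolding AE_all_countable un_def using qe_AE[OF p0(2) resolvent_nonneg] by blast

lemma w_mu_limit: "AE x in lebesgue. (\<lambda>n. ereal (un n x)) \<longlonglongrightarrow> w_mu p \<mu> x"
proof -
  have "is_w_limit p \<mu> (w_mu p \<mu>)" unfolding w_mu_def by (rule someI[where P = "is_w_limit p \<mu>", OF w_limit_exists])
  then have "quasi_everywhere p (\<lambda>x. (\<lambda>n. ereal (un n x)) \<longlonglongrightarrow> w_mu p \<mu> x)"
    unfolding is_w_limit_def un_def using filterlim_real_sequentially by blast
  then show ?thesis by (rule qe_AE[OF p0(2)])
qed

lemma un_le_w_AE: "AE x in lebesgue. \<forall>n. ereal (un n x) \<le> w_mu p \<mu> x"
proof -
  have "AE x in lebesgue. \<forall>n m. n \<le> m \<longrightarrow> un n x \<le> un m x"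
    unfolding AE_all_countable
  proof (intro allI)
    fix n m :: nat
    show "AE x in lebesgue. n \<le> m \<longrightarrow> un n x \<le> un m x"
      by (cases "n \<le> m") (use qe_AE[OF p0(2) resolvent_mono[of "real n" "real m"]] in \<open>auto simp: un_def\<close>)
  qed
  then show ?thesis using w_mu_limit
  proof eventually_elim
    case (elim x)
    show ?case
    proof
      fix n
      show "ereal (un n x) \<le> w_mu p \<mu> x"
        by (rule LIMSEQ_le_const[OF elim(2)]) (use elim(1) in \<open>auto intro!: exI[of _ n]\<close>)
    qed
  qed
qed

text \<open>\<open>w_mu\<close> is an arbitrary choice among the limit functions; measurability
  passes from the lower limit of the \<open>un n\<close> to it because Lebesgue measure is
  complete.\<close>

lemma w_mu_measurable: "w_mu p \<mu> \<in> borel_measurable lebesgue"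
proof (rule complete_measurable_cong)
  have [measurable]: "un n \<in> borel_measurable lebesgue" for n using un_integrable by auto
  show "(\<lambda>x. liminf (\<lambda>n. ereal (un n x))) \<in> borel_measurable lebesgue" by measurable
  show "AE x in lebesgue. liminf (\<lambda>n. ereal (un n x)) = w_mu p \<mu> x"
    using w_mu_limit by eventually_elim (rule lim_imp_Liminf, auto)
qed

text \<open>Connects the integrand in \<open>ereal_integrable\<close> with the resolvents. The
  modulus is harmless since \<open>w_mu\<close> lies above \<open>un 0\<close>, which is nonnegative
  a.e.\<close>

lemma w_mu_abs_AE: "AE x in lebesgue. (\<forall>n. ennreal (un n x) \<le> e2ennreal \<bar>w_mu p \<mu> x\<bar>) \<and> (\<lambda>n. ennreal (un n x)) \<longlonglongrightarrow> e2ennreal \<bar>w_mu p \<mu> x\<bar>"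
  using un_nonneg_AE un_le_w_AE w_mu_limit
proof eventually_elim
  case (elim x)
  have "0 \<le> ereal (un 0 x)" using elim(1) by simp
  also have "\<dots> \<le> w_mu p \<mu> x" using elim(2) by blast
  finally have w: "\<bar>w_mu p \<mu> x\<bar> = w_mu p \<mu> x" by simp
  have e: "ennreal (un n x) = e2ennreal (ereal (un n x))" for n by (simp add: ennreal.abs_eq e2ennreal_ereal)
  show ?case unfolding w e
  proof (intro conjI allI)
    show "e2ennreal (ereal (un n x)) \<le> e2ennreal (w_mu p \<mu> x)" for n by (rule e2ennreal_mono) (use elim in blast)
    show "(\<lambda>n. e2ennreal (ereal (un n x))) \<longlonglongrightarrow> e2ennreal (w_mu p \<mu> x)" by (rule tendsto_e2ennrealI[OF elim(3)])
  qed
qed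

text \<open>One direction is domination of the \<open>un n\<close> by the limit, the other Fatou's
  lemma.\<close>

lemma w_integrable_iff: "ereal_integrable (w_mu p \<mu>) \<longleftrightarrow> (\<exists>C. \<forall>n. (\<integral>x. un n x \<partial>lebesgue) \<le> C)"
proof -
  let ?w = "\<lambda>x. e2ennreal \<bar>w_mu p \<mu> x\<bar>"
  have nn: "(\<integral>\<^sup>+x. ennreal (un n x) \<partial>lebesgue) = ennreal (\<integral>x. un n x \<partial>lebesgue)" for n
    using un_nonneg_AE by (intro nn_integral_eq_integral un_integrable) auto
  have [measurable]: "un n \<in> borel_measurable lebesgue" for n using un_integrable by auto
  show ?thesis
  proof
    assume "ereal_integrable (w_mu p \<mu>)"
    then have fin: "(\<integral>\<^sup>+x. ?w x \<partial>lebesgue) < \<infinity>" by (simp add: ereal_integrable_def)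
    have "(\<integral>x. un n x \<partial>lebesgue) \<le> enn2real (\<integral>\<^sup>+x. ?w x \<partial>lebesgue)" for n
    proof -
      have "ennreal (\<integral>x. un n x \<partial>lebesgue) \<le> (\<integral>\<^sup>+x. ?w x \<partial>lebesgue)"
        unfolding nn[symmetric]
      proof (rule nn_integral_mono_AE)
        show "AE x in lebesgue. ennreal (un n x) \<le> ?w x" using w_mu_abs_AE by eventually_elim blast
      qed
      also have "\<dots> = ennreal (enn2real (\<integral>\<^sup>+x. ?w x \<partial>lebesgue))" using fin by simp
      finally show ?thesis by (simp add: ennreal_le_iff)
    qed
    then show "\<exists>C. \<forall>n. (\<integral>x. un n x \<partial>lebesgue) \<le> C" by blast
  next
    assume "\<exists>C. \<forall>n. (\<integral>x. un n x \<partial>lebesgue) \<le> C"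
    then obtain C where C: "\<And>n. (\<integral>x. un n x \<partial>lebesgue) \<le> C" by blast
    have "(\<integral>\<^sup>+x. ?w x \<partial>lebesgue) = (\<integral>\<^sup>+x. liminf (\<lambda>n. ennreal (un n x)) \<partial>lebesgue)"
    proof (rule nn_integral_cong_AE)
      show "AE x in lebesgue. ?w x = liminf (\<lambda>n. ennreal (un n x))"
        using w_mu_abs_AE by eventually_elim (rule lim_imp_Liminf[symmetric], auto)
    qed
    also have "\<dots> \<le> liminf (\<lambda>n. \<integral>\<^sup>+x. ennreal (un n x) \<partial>lebesgue)" by (rule nn_integral_liminf) measurable
    also have "\<dots> \<le> liminf (\<lambda>n::nat. ennreal C)"
      unfolding nn by (rule Liminf_mono) (auto intro!: always_eventually ennreal_leI C)
    also have "\<dots> < \<infinity>" by (simp add: Liminf_const)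
    finally show "ereal_integrable (w_mu p \<mu>)" using w_mu_measurable by (simp add: ereal_integrable_def)
  qed
qed

end

section \<open>Cut-off functions\<close>

text \<open>The factor \<open>exp 1\<close> normalises the value at 0 to 1. This value is attained
  only there, so the rescaled cut-offs tend to 1 pointwise without being equal to 1 on any
  ball.\<close>

definition bump :: "'a::euclidean_space \<Rightarrow> real" where
  "bump x = exp 1 * flat 0 (1 - (norm x)\<^sup>2)"

definition cutoff :: "real \<Rightarrow> 'a::euclidean_space \<Rightarrow> real" where
  "cutoff S x = bump ((1/S) *\<^sub>R x)"

text \<open>The squared norm is expanded in coordinates, since \<open>smooth_terms\<close> starts
  from constants and inner products with fixed vectors.\<close>

lemma cutoff_terms: "(cutoff S :: 'a::euclidean_space \<Rightarrow> real) \<in> smooth_terms"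
proof -
  have "(\<lambda>x::'a. exp 1 * flat 0 (1 + (\<Sum>b\<in>Basis. (- 1 / S^2) * ((x \<bullet> b) * (x \<bullet> b))))) \<in> smooth_terms"
    by (intro smooth_terms.mult smooth_terms.const smooth_terms.flat smooth_terms.add smooth_terms_sum smooth_terms.inner)
  moreover have "1 + (\<Sum>b\<in>Basis. (- 1 / S^2) * ((x \<bullet> b) * (x \<bullet> b))) = 1 - (norm ((1/S) *\<^sub>R x))\<^sup>2" for x :: 'a
  proof -
    have "(norm x)\<^sup>2 = (\<Sum>b\<in>Basis. (x \<bullet> b) * (x \<bullet> b))"
      by (simp add: power2_norm_eq_inner euclidean_inner[of x x])
    then show ?thesis by (simp add: power_mult_distrib power_divide sum_negf sum_divide_distrib)
  qed
  ultimately show ?thesis by (simp add: cutoff_def[abs_def] bump_def)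
qed

lemma bump_eq: "bump = cutoff 1" by (simp add: cutoff_def[abs_def])

lemma cutoff_smooth: "Ck k (cutoff S)" by (rule smooth_terms_Ck[OF cutoff_terms])

lemma flat_0_le: "t \<le> 1 \<Longrightarrow> exp 1 * flat 0 t \<le> 1"
proof (cases "t > 0")
  case True
  assume "t \<le> 1"
  then have "exp 1 \<le> exp (1/t)" using True by simp
  then show ?thesis using True by (simp add: flat_def)
qed (simp add: flat_def)

lemma cutoff_bounds: "0 \<le> cutoff S x" "cutoff S x \<le> 1"
  using flat_0_le[of "1 - (norm ((1/S) *\<^sub>R x))\<^sup>2"] by (simp_all add: cutoff_def bump_def flat_def)

lemma bump_zero:
  assumes "norm x \<ge> 1" shows "bump x = 0"
proof -
  have "1 \<le> (norm x)\<^sup>2" using assms by (rule one_le_power)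
  then have "\<not> 1 - (norm x)\<^sup>2 > 0" by linarith
  then show ?thesis unfolding bump_def flat_def by (simp only: if_False mult_zero_right)
qed

lemma cutoff_zero: "S > 0 \<Longrightarrow> norm x \<ge> S \<Longrightarrow> cutoff S x = 0"
  unfolding cutoff_def by (rule bump_zero) simp

lemma bump_test: "bump \<in> test_functions"
  by (rule test_functionI[of _ 1]) (use cutoff_terms[of 1] bump_zero in \<open>auto simp: bump_eq\<close>)

lemma cutoff_grad:
  assumes S: "S > 0" shows "grad (cutoff S) x = (1/S) *\<^sub>R grad bump ((1/S) *\<^sub>R (x::'a::euclidean_space))"
proof -
  let ?D = "frechet_derivative bump (at ((1/S) *\<^sub>R x))"
  have d: "bump differentiable (at y)" for y :: 'a by (rule test_differentiable[OF bump_test])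
  have "((\<lambda>x. (1/S) *\<^sub>R x) has_derivative (\<lambda>h. (1/S) *\<^sub>R h)) (at x)" by (auto intro!: derivative_eq_intros)
  moreover have "(bump has_derivative ?D) (at ((1/S) *\<^sub>R x))" using d by (simp add: frechet_derivative_works[symmetric])
  ultimately have "(cutoff S has_derivative (\<lambda>h. ?D ((1/S) *\<^sub>R h))) (at x)"
    unfolding cutoff_def[abs_def] by (rule has_derivative_compose)
  then have "frechet_derivative (cutoff S) (at x) = (\<lambda>h. ?D ((1/S) *\<^sub>R h))" by (metis frechet_derivative_at)
  moreover have "?D ((1/S) *\<^sub>R h) = (1/S) * ?D h" for h
    using linear_cmul[OF linear_frechet_derivative[OF d]] by simp
  ultimately show ?thesis by (simp add: grad_def scaleR_sum_right)
qed

text \<open>By scaling the gradient of \<open>cutoff S\<close> is 1/S times that of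
  \<open>bump\<close> at x/S, so \<open>B\<close> is the same for all radii.\<close>

lemma cutoff_grad_bound:
  obtains B where "B > 0" "\<And>S x. S > 0 \<Longrightarrow> norm (grad (cutoff S) (x::'a::euclidean_space)) \<le> B / S"
    "\<And>S x. S > 0 \<Longrightarrow> norm x \<ge> S \<Longrightarrow> grad (cutoff S) (x::'a) = 0"
proof -
  obtain B where B: "B > 0" "\<And>x b. b \<in> Basis \<Longrightarrow> \<bar>frechet_derivative bump (at (x::'a)) b\<bar> \<le> B"
    using test_bounded[OF bump_test] by metis
  have g: "norm (grad bump (x::'a)) \<le> DIM('a) * B" for x
  proof -
    have "norm (grad bump x) \<le> (\<Sum>b\<in>Basis. norm (frechet_derivative bump (at x) b *\<^sub>R b))" unfolding grad_def by (rule norm_sum)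
    also have "\<dots> \<le> (\<Sum>b\<in>(Basis::'a set). B)" by (rule sum_mono) (use B in auto)
    finally show ?thesis by simp
  qed
  have cont: "continuous_on UNIV (grad (bump :: 'a \<Rightarrow> real))"
    by (rule smooth_continuous(3)) (simp add: bump_eq cutoff_smooth)
  have z: "grad bump (x::'a) = 0" if "norm x > 1" for x
  proof -
    have "(bump has_derivative (\<lambda>h. 0)) (at x)"
    proof (rule has_derivative_transform_within_open[of "\<lambda>x. 0"])
      show "open (- cball (0::'a) 1)" by auto
      show "0 = bump y" if "y \<in> - cball 0 1" for y :: 'a using that bump_zero[of y] by simp
    qed (use that in auto)
    then have "frechet_derivative bump (at x) = (\<lambda>h. 0)" by (metis frechet_derivative_at)
    then show ?thesis by (simp add: grad_def)
  qed
  \<comment> \<open>On the unit sphere itself the gradient vanishes by continuity, as a limit along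
    points further out.\<close>
  have z1: "grad bump (x::'a) = 0" if "norm x \<ge> 1" for x
  proof -
    have "(\<lambda>n. grad bump ((1 + 1 / real (Suc n)) *\<^sub>R x)) \<longlonglongrightarrow> grad bump ((1 + 0) *\<^sub>R x)"
      using cont by (intro isCont_tendsto_compose[of _ "grad bump"] tendsto_intros LIMSEQ_Suc[OF lim_1_over_n, unfolded o_def])
        (simp add: continuous_on_eq_continuous_at)
    moreover have "grad bump ((1 + 1 / real (Suc n)) *\<^sub>R x) = 0" for n
    proof (rule z)
      have "1 < (1 + 1 / real (Suc n)) * 1" by simp
      also have "\<dots> \<le> (1 + 1 / real (Suc n)) * norm x" using that by (intro mult_left_mono) auto
      finally show "1 < norm ((1 + 1 / real (Suc n)) *\<^sub>R x)" by simp
    qed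
    ultimately show ?thesis by (simp add: LIMSEQ_const_iff)
  qed
  show thesis
  proof (rule that[of "DIM('a) * B"])
    show "norm (grad (cutoff S) (x::'a)) \<le> DIM('a) * B / S" if "S > 0" for S x
      using g[of "(1/S) *\<^sub>R x"] that by (simp add: cutoff_grad divide_right_mono)
    show "grad (cutoff S) (x::'a) = 0" if "S > 0" "norm x \<ge> S" for S x
      using z1[of "(1/S) *\<^sub>R x"] that by (simp add: cutoff_grad)
  qed (use B in simp)
qed

lemma cutoff_tendsto: "(\<lambda>n. cutoff (real n) x) \<longlonglongrightarrow> 1"
proof -
  have "(\<lambda>n. 1 - (norm ((1 / real n) *\<^sub>R x))\<^sup>2) \<longlonglongrightarrow> 1 - (norm (0 *\<^sub>R x))\<^sup>2"
    by (intro tendsto_intros lim_1_over_n)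
  moreover have "isCont (flat 0) 1" by (rule DERIV_isCont[OF flat_DERIV])
  ultimately have "(\<lambda>n. flat 0 (1 - (norm ((1 / real n) *\<^sub>R x))\<^sup>2)) \<longlonglongrightarrow> flat 0 1"
    by (intro isCont_tendsto_compose[of 1 "flat 0"]) auto
  from tendsto_mult_left[OF this, of "exp 1"] show ?thesis by (simp add: cutoff_def bump_def flat_def)
qed

section \<open>The weighted \<open>L\<^sup>1\<close> estimate\<close>

text \<open>The free factor \<open>k\<close> shifts weight between the two terms: small
  \<open>k\<close> makes the first coefficient small, large \<open>k\<close> the second, since 1 - p
  < 0. The two regimes serve the continuity and the tails respectively.\<close>

lemma young_scaled:
  fixes a b k p :: real
  assumes p: "p > 1" and k: "k > 0" and ab: "a \<ge> 0" "b \<ge> 0"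
  shows "a powr (p - 1) * b \<le> k powr p * a powr p + (k powr (1 - p)) powr p * b powr p"
proof -
  have "a powr (p - 1) * b = (k * a) powr (p - 1) * (k powr (1 - p) * b)"
  proof -
    have "k powr (p - 1) * k powr (1 - p) = k powr 0" by (simp flip: powr_add)
    then have "k powr (p - 1) * k powr (1 - p) = 1" using k by simp
    then have "(k * a) powr (p - 1) * (k powr (1 - p) * b) = a powr (p - 1) * b"
      using k ab by (simp add: powr_mult mult_ac)
    then show ?thesis by (rule sym)
  qed
  also have "\<dots> \<le> (1 - 1/p) * (k * a) powr p + (k powr (1 - p) * b) powr p / p"
    using k ab by (intro young_powr p) auto
  also have "\<dots> \<le> 1 * (k * a) powr p + (k powr (1 - p) * b) powr p"
  proof (intro add_mono mult_right_mono)
    show "(k powr (1 - p) * b) powr p / p \<le> (k powr (1 - p) * b) powr p"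
      using p mult_left_mono[of 1 p "(k powr (1 - p) * b) powr p"] by (simp add: field_simps)
  qed (use p in auto)
  finally show ?thesis using k ab by (simp add: powr_mult)
qed

lemma grad_mult:
  fixes f g :: "'a::euclidean_space \<Rightarrow> real"
  assumes "f differentiable (at x)" "g differentiable (at x)"
  shows "grad (\<lambda>x. f x * g x) x = f x *\<^sub>R grad g x + g x *\<^sub>R grad f x"
  unfolding grad_def frechet_derivative_mult_real[OF assms]
  by (simp add: scaleR_sum_right sum.distrib scaleR_left_distrib mult.commute)

lemma integrable_mult_bounded:
  fixes f \<eta> :: "'m \<Rightarrow> real"
  assumes "integrable M f" "\<eta> \<in> borel_measurable M" "\<And>x. \<bar>\<eta> x\<bar> \<le> 1"
  shows "integrable M (\<lambda>x. \<eta> x * f x)"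
proof (rule Bochner_Integration.integrable_bound[OF assms(1)])
  show "AE x in M. norm (\<eta> x * f x) \<le> norm (f x)"
    using assms(3) by (intro AE_I2) (simp add: abs_mult mult_left_le_one_le)
qed (use assms in auto)

context cap_space
begin

section \<open>Weighted test functions and weighted energies\<close>

lemma continuous_measurable_mu:
  fixes f :: "'a \<Rightarrow> real"
  assumes "continuous_on UNIV f" shows "f \<in> borel_measurable (completion \<mu>)"
  using borel_measurable_continuous_onI[OF assms] cap_nullD(1)[OF \<mu>]
  by (intro measurable_completion) (simp cong: measurable_cong_sets)

lemma W_abs:
  assumes "u \<in> W" shows "(\<lambda>x. \<bar>u x\<bar>) \<in> W"
proof (rule W_I)
  note u = WD[OF assms]
  show "(\<lambda>x. \<bar>u x\<bar>) \<in> sobolev p" by (rule sobolev_abs(1)[OF u(1) p0(2)])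
  show "quasi_continuous p (\<lambda>x. \<bar>u x\<bar>)" by (rule qc_abs[OF p u(2)])
  show "Lp (completion \<mu>) p (\<lambda>x. \<bar>u x\<bar>)" using u(3) by (auto simp: Lp_def)
qed

lemma W_mult_smooth:
  assumes u: "u \<in> W" and \<eta>: "\<And>k. Ck k \<eta>" "\<And>x. \<bar>\<eta> x\<bar> \<le> 1" "\<And>x. norm (grad \<eta> x) \<le> L"
  shows "(\<lambda>x. \<eta> x * u x) \<in> W"
proof (rule W_I)
  note uD = WD[OF u]
  show "(\<lambda>x. \<eta> x * u x) \<in> sobolev p" by (rule sobolev_mult_smooth(1)[OF uD(1) p0(1) \<eta>])
  show qc: "quasi_continuous p (\<lambda>x. \<eta> x * u x)"
    by (rule qc_mult[OF p qc_continuous[OF smooth_continuous(1)[OF \<eta>(1)] p0(1)] uD(2)])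
  show "Lp (completion \<mu>) p (\<lambda>x. \<eta> x * u x)"
  proof (rule Lp_bound[OF uD(3) qc_measurable_mu[OF p \<mu> qc]])
    show "AE x in completion \<mu>. norm (\<eta> x * u x) \<le> norm (u x)"
      using \<eta>(2) by (intro AE_I2) (simp add: abs_mult mult_left_le_one_le)
  qed (rule p0)
qed

lemma W_mult_V:
  assumes "u \<in> W" "\<And>k. Ck k \<eta>" "\<And>x. \<bar>\<eta> x\<bar> \<le> 1" "\<And>x. norm (grad \<eta> x) \<le> L" "\<And>x. norm x \<ge> R \<Longrightarrow> \<eta> x = 0"
  shows "(\<lambda>x. \<eta> x * u x) \<in> V R"
proof -
  have "quasi_everywhere p (\<lambda>x. norm x \<ge> R \<longrightarrow> \<eta> x * u x = 0)"
    using pcap_empty[OF p0(1)] assms(5) by (simp add: quasi_everywhere_def)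
  then show ?thesis using W_mult_smooth[OF assms(1-4)] by (simp add: V_def)
qed

lemma V_mult:
  assumes "u \<in> V R" "\<And>k. Ck k \<eta>" "\<And>x. \<bar>\<eta> x\<bar> \<le> 1" "\<And>x. norm (grad \<eta> x) \<le> L"
  shows "(\<lambda>x. \<eta> x * u x) \<in> V R"
  using W_mult_smooth[OF V_W[OF assms(1)] assms(2-4)] assms(1) by (auto simp: V_def elim!: qe_mono)

text \<open>\<open>nrm\<close> with the weight \<eta> placed on all three densities; \<eta> = 1
  gives back \<open>nrm\<close>.\<close>

definition wnrm :: "('a \<Rightarrow> real) \<Rightarrow> ('a \<Rightarrow> real) \<Rightarrow> real" where
  "wnrm \<eta> v = (\<integral>x. \<eta> x * norm (weak_gradient v x) powr p \<partial>lebesgue) + (\<integral>x. \<eta> x * norm (v x) powr p \<partial>lebesgue)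
     + (\<integral>x. \<eta> x * norm (v x) powr p \<partial>completion \<mu>)"

lemma W_powr_integrable:
  assumes "v \<in> W"
  shows "integrable lebesgue (\<lambda>x. norm (weak_gradient v x) powr p)" "integrable lebesgue (\<lambda>x. norm (v x) powr p)"
    "integrable (completion \<mu>) (\<lambda>x. norm (v x) powr p)"
  using WD(3,5,6)[OF assms] by (auto simp: Lp_def)

lemma wnrm_integrable:
  assumes "v \<in> W" "continuous_on UNIV \<eta>" "\<And>x. \<bar>\<eta> x\<bar> \<le> 1"
  shows "integrable lebesgue (\<lambda>x. \<eta> x * norm (weak_gradient v x) powr p)" "integrable lebesgue (\<lambda>x. \<eta> x * norm (v x) powr p)"
    "integrable (completion \<mu>) (\<lambda>x. \<eta> x * norm (v x) powr p)"
  using W_powr_integrable[OF assms(1)] continuous_lebesgue_measurable[OF assms(2)] continuous_measurable_mu[OF assms(2)] assms(3)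
  by (auto intro!: integrable_mult_bounded)

lemma nrm_parts:
  "(\<integral>x. norm (weak_gradient u x) powr p \<partial>lebesgue) + (\<integral>x. norm (u x) powr p \<partial>lebesgue) \<le> nrm u"
  "(\<integral>x. norm (weak_gradient u x) powr p \<partial>lebesgue) \<le> nrm u" "(\<integral>x. norm (u x) powr p \<partial>lebesgue) \<le> nrm u"
proof -
  have "(\<integral>x. norm (weak_gradient u x) powr p \<partial>lebesgue) \<ge> 0" "(\<integral>x. norm (u x) powr p \<partial>lebesgue) \<ge> 0"
     "(\<integral>x. norm (u x) powr p \<partial>completion \<mu>) \<ge> 0" by (auto intro!: integral_nonneg_AE)
  then show "(\<integral>x. norm (weak_gradient u x) powr p \<partial>lebesgue) + (\<integral>x. norm (u x) powr p \<partial>lebesgue) \<le> nrm u"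
    "(\<integral>x. norm (weak_gradient u x) powr p \<partial>lebesgue) \<le> nrm u" "(\<integral>x. norm (u x) powr p \<partial>lebesgue) \<le> nrm u"
    by (simp_all only: nrm_def)
qed

lemma young_sum:
  fixes a b :: real
  assumes "a \<ge> 0" "b \<ge> 0" shows "a powr (p - 1) * b \<le> a powr p + b powr p"
  using young_scaled[OF p zero_less_one assms] by simp

text \<open>Young's inequality under the weight \<eta> keeps \<eta> in front of the powers of
  \<open>v\<close> and drops it in front of those of \<open>u\<close>. The gradient of \<eta>
  produces the term with \<open>L\<close>, where Young's inequality with parameter 1 is good enough
  because \<open>L\<close> will be small or zero.\<close>

lemma pairing_weighted_le:
  assumes v: "v \<in> W" and u: "u \<in> W" and k: "k > 0" and L: "L \<ge> 0"
    and \<eta>: "\<And>k. Ck k \<eta>" "\<And>x. 0 \<le> \<eta> x" "\<And>x. \<eta> x \<le> 1" "\<And>x. norm (grad \<eta> x) \<le> L"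
  shows "pairing v (\<lambda>x. \<eta> x * \<bar>u x\<bar>) \<le> k powr p * wnrm \<eta> v + (k powr (1 - p)) powr p * nrm u + L * (nrm v + nrm u)"
proof -
  define B where "B = (k powr (1 - p)) powr p"
  have B0: "B \<ge> 0" by (simp add: B_def)
  have \<eta>1: "\<bar>\<eta> x\<bar> \<le> 1" for x using \<eta>(2,3)[of x] by simp
  have aW: "(\<lambda>x. \<bar>u x\<bar>) \<in> W" by (rule W_abs[OF u])
  have fW: "(\<lambda>x. \<eta> x * \<bar>u x\<bar>) \<in> W" by (rule W_mult_smooth[OF aW \<eta>(1) \<eta>1 \<eta>(4)])
  note vD = WD[OF v] and fD = WD[OF fW]
  note iv = W_powr_integrable[OF v] and iu = W_powr_integrable[OF u]
  note ie = wnrm_integrable[OF v smooth_continuous(1)[OF \<eta>(1)] \<eta>1]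
  have ys: "\<eta> x * (a powr (p - 1) * b) \<le> k powr p * (\<eta> x * a powr p) + B * b powr p" if "a \<ge> 0" "b \<ge> 0" for a b x
  proof -
    have "\<eta> x * (a powr (p - 1) * b) \<le> \<eta> x * (k powr p * a powr p + B * b powr p)"
      unfolding B_def by (intro mult_left_mono young_scaled[OF p k that] \<eta>)
    also have "\<dots> = k powr p * (\<eta> x * a powr p) + \<eta> x * (B * b powr p)" by (simp add: algebra_simps)
    also have "\<eta> x * (B * b powr p) \<le> B * b powr p" using \<eta>(2,3)[of x] B0 by (intro mult_left_le_one_le) auto
    finally show ?thesis by simp
  qed
  have 1: "(\<integral>x. pvec p (weak_gradient v x) \<bullet> weak_gradient (\<lambda>x. \<eta> x * \<bar>u x\<bar>) x \<partial>lebesgue) \<le>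
     (\<integral>x. k powr p * (\<eta> x * norm (weak_gradient v x) powr p) + B * norm (weak_gradient u x) powr p
        + L * (norm (weak_gradient v x) powr p + norm (u x) powr p) \<partial>lebesgue)"
  proof (rule integral_mono_AE[OF pvec_integrable[OF p vD(6) fD(6)]])
    show "integrable lebesgue (\<lambda>x. k powr p * (\<eta> x * norm (weak_gradient v x) powr p) + B * norm (weak_gradient u x) powr p
        + L * (norm (weak_gradient v x) powr p + norm (u x) powr p))"
      by (intro Bochner_Integration.integrable_add integrable_mult_right ie iv iu)
    show "AE x in lebesgue. pvec p (weak_gradient v x) \<bullet> weak_gradient (\<lambda>x. \<eta> x * \<bar>u x\<bar>) x
      \<le> k powr p * (\<eta> x * norm (weak_gradient v x) powr p) + B * norm (weak_gradient u x) powr p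
        + L * (norm (weak_gradient v x) powr p + norm (u x) powr p)"
      using sobolev_mult_smooth(2)[OF WD(1)[OF aW] p0(1) \<eta>(1) \<eta>1 \<eta>(4)] sobolev_abs(2)[OF WD(1)[OF u] p0(2)]
    proof eventually_elim
      case (elim x)
      let ?a = "norm (weak_gradient v x)" and ?b = "norm (weak_gradient u x)"
      have nb: "norm (sgn (u x) *\<^sub>R weak_gradient u x) \<le> ?b" by (simp add: sgn_if)
      have "pvec p (weak_gradient v x) \<bullet> (sgn (u x) *\<^sub>R weak_gradient u x) \<le> ?a powr (p - 1) * norm (sgn (u x) *\<^sub>R weak_gradient u x)"
        using pvec_inner_le[of p "weak_gradient v x" "sgn (u x) *\<^sub>R weak_gradient u x"] by simp
      also have "\<dots> \<le> ?a powr (p - 1) * ?b" by (intro mult_left_mono nb) simp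
      finally have "\<eta> x * (pvec p (weak_gradient v x) \<bullet> (sgn (u x) *\<^sub>R weak_gradient u x)) \<le> \<eta> x * (?a powr (p - 1) * ?b)"
        by (intro mult_left_mono \<eta>)
      also have "\<dots> \<le> k powr p * (\<eta> x * ?a powr p) + B * ?b powr p" by (rule ys) auto
      finally have A: "\<eta> x * (pvec p (weak_gradient v x) \<bullet> (sgn (u x) *\<^sub>R weak_gradient u x)) \<le> k powr p * (\<eta> x * ?a powr p) + B * ?b powr p" .
      have "pvec p (weak_gradient v x) \<bullet> grad \<eta> x \<le> ?a powr (p - 1) * norm (grad \<eta> x)"
        using pvec_inner_le[of p "weak_gradient v x" "grad \<eta> x"] by simp
      also have "\<dots> \<le> ?a powr (p - 1) * L" by (intro mult_left_mono \<eta>) simp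
      finally have "\<bar>u x\<bar> * (pvec p (weak_gradient v x) \<bullet> grad \<eta> x) \<le> \<bar>u x\<bar> * (?a powr (p - 1) * L)" by (intro mult_left_mono) auto
      also have "\<dots> = L * (?a powr (p - 1) * \<bar>u x\<bar>)" by simp
      also have "\<dots> \<le> L * (?a powr p + \<bar>u x\<bar> powr p)" by (intro mult_left_mono young_sum L) auto
      finally have C: "\<bar>u x\<bar> * (pvec p (weak_gradient v x) \<bullet> grad \<eta> x) \<le> L * (?a powr p + \<bar>u x\<bar> powr p)" .
      have "pvec p (weak_gradient v x) \<bullet> weak_gradient (\<lambda>x. \<eta> x * \<bar>u x\<bar>) x =
        \<eta> x * (pvec p (weak_gradient v x) \<bullet> (sgn (u x) *\<^sub>R weak_gradient u x)) + \<bar>u x\<bar> * (pvec p (weak_gradient v x) \<bullet> grad \<eta> x)"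
        by (simp only: elim inner_add_right inner_scaleR_right)
      then show ?case using add_mono[OF A C] by simp
    qed
  qed
  have gen: "(\<integral>x. pvec p (v x) \<bullet> (\<eta> x * \<bar>u x\<bar>) \<partial>M) \<le> (\<integral>x. k powr p * (\<eta> x * norm (v x) powr p) + B * norm (u x) powr p \<partial>M)"
    if "Lp M p v" "Lp M p (\<lambda>x. \<eta> x * \<bar>u x\<bar>)" "integrable M (\<lambda>x. \<eta> x * norm (v x) powr p)" "integrable M (\<lambda>x. norm (u x) powr p)" for M
  proof (rule integral_mono[OF pvec_integrable[OF p that(1,2)]])
    show "integrable M (\<lambda>x. k powr p * (\<eta> x * norm (v x) powr p) + B * norm (u x) powr p)" using that by auto
    fix x
    have "pvec p (v x) \<bullet> (\<eta> x * \<bar>u x\<bar>) = \<eta> x * (pvec p (v x) \<bullet> \<bar>u x\<bar>)" by simp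
    also have "\<dots> \<le> \<eta> x * (norm (v x) powr (p - 1) * norm \<bar>u x\<bar>)"
      using pvec_inner_le[of p "v x" "\<bar>u x\<bar>"] by (intro mult_left_mono \<eta>) linarith
    also have "\<dots> \<le> k powr p * (\<eta> x * norm (v x) powr p) + B * norm \<bar>u x\<bar> powr p" by (rule ys) auto
    finally show "pvec p (v x) \<bullet> (\<eta> x * \<bar>u x\<bar>) \<le> k powr p * (\<eta> x * norm (v x) powr p) + B * norm (u x) powr p" by simp
  qed
  have "pairing v (\<lambda>x. \<eta> x * \<bar>u x\<bar>) \<le> k powr p * wnrm \<eta> v + B * nrm u
      + L * ((\<integral>x. norm (weak_gradient v x) powr p \<partial>lebesgue) + (\<integral>x. norm (u x) powr p \<partial>lebesgue))"
  proof -
    have e1: "(\<integral>x. k powr p * (\<eta> x * norm (weak_gradient v x) powr p) + B * norm (weak_gradient u x) powr p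
        + L * (norm (weak_gradient v x) powr p + norm (u x) powr p) \<partial>lebesgue) =
      k powr p * (\<integral>x. \<eta> x * norm (weak_gradient v x) powr p \<partial>lebesgue) + B * (\<integral>x. norm (weak_gradient u x) powr p \<partial>lebesgue)
        + L * ((\<integral>x. norm (weak_gradient v x) powr p \<partial>lebesgue) + (\<integral>x. norm (u x) powr p \<partial>lebesgue))"
      using ie(1) iv(1) iu(1,2) by simp
    have e2: "(\<integral>x. k powr p * (\<eta> x * norm (v x) powr p) + B * norm (u x) powr p \<partial>M) =
       k powr p * (\<integral>x. \<eta> x * norm (v x) powr p \<partial>M) + B * (\<integral>x. norm (u x) powr p \<partial>M)"
      if "integrable M (\<lambda>x. \<eta> x * norm (v x) powr p)" "integrable M (\<lambda>x. norm (u x) powr p)" for M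
      using that by simp
    show ?thesis
      using 1[unfolded e1] gen[OF vD(5) fD(5) ie(2) iu(2), unfolded e2[OF ie(2) iu(2)]]
        gen[OF vD(3) fD(3) ie(3) iu(3), unfolded e2[OF ie(3) iu(3)]]
      unfolding pairing_def wnrm_def nrm_def by (simp only: distrib_left)
  qed
  also have "\<dots> \<le> k powr p * wnrm \<eta> v + B * nrm u + L * (nrm v + nrm u)"
    using nrm_parts(2)[of v] nrm_parts(3)[of u] L by (intro add_left_mono mult_left_mono) auto
  finally show ?thesis by (simp add: B_def)
qed

text \<open>A Caccioppoli-type estimate: the equation of \<open>un n\<close> is tested with \<eta>
  times \<open>un n\<close>. This lies in \<open>V (real n)\<close> because \<open>un n\<close>
  does, so \<eta> may have unbounded support.\<close>

lemma wnrm_un_le: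
  assumes L: "L \<ge> 0" and \<eta>: "\<And>k. Ck k \<eta>" "\<And>x. 0 \<le> \<eta> x" "\<And>x. \<eta> x \<le> 1" "\<And>x. norm (grad \<eta> x) \<le> L"
  shows "wnrm \<eta> (un n) \<le> (\<integral>x. \<eta> x * un n x \<partial>lebesgue) + L * nrm (un n)"
proof -
  have \<eta>1: "\<bar>\<eta> x\<bar> \<le> 1" for x using \<eta>(2,3)[of x] by simp
  have fV: "(\<lambda>x. \<eta> x * un n x) \<in> V (real n)" by (rule V_mult[OF un_V \<eta>(1) \<eta>1 \<eta>(4)])
  note vD = WD[OF un_W[of n]] and fD = WD[OF V_W[OF fV]]
  note iv = W_powr_integrable[OF un_W[of n]]
  note ie = wnrm_integrable[OF un_W[of n] smooth_continuous(1)[OF \<eta>(1)] \<eta>1]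
  let ?v = "un n"
  have I: "(\<integral>x. \<eta> x * norm (weak_gradient ?v x) powr p - L * (norm (weak_gradient ?v x) powr p + norm (?v x) powr p) \<partial>lebesgue) \<le>
     (\<integral>x. pvec p (weak_gradient ?v x) \<bullet> weak_gradient (\<lambda>x. \<eta> x * ?v x) x \<partial>lebesgue)"
  proof (rule integral_mono_AE[OF _ pvec_integrable[OF p vD(6) fD(6)]])
    show "integrable lebesgue (\<lambda>x. \<eta> x * norm (weak_gradient ?v x) powr p - L * (norm (weak_gradient ?v x) powr p + norm (?v x) powr p))"
      by (intro Bochner_Integration.integrable_add Bochner_Integration.integrable_diff integrable_mult_right ie iv)
    show "AE x in lebesgue. \<eta> x * norm (weak_gradient ?v x) powr p - L * (norm (weak_gradient ?v x) powr p + norm (?v x) powr p)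
       \<le> pvec p (weak_gradient ?v x) \<bullet> weak_gradient (\<lambda>x. \<eta> x * ?v x) x"
      using sobolev_mult_smooth(2)[OF vD(1) p0(1) \<eta>(1) \<eta>1 \<eta>(4)]
    proof eventually_elim
      case (elim x)
      let ?a = "norm (weak_gradient ?v x)"
      have "\<bar>?v x * (pvec p (weak_gradient ?v x) \<bullet> grad \<eta> x)\<bar> \<le> \<bar>?v x\<bar> * (?a powr (p - 1) * norm (grad \<eta> x))"
        unfolding abs_mult by (intro mult_left_mono pvec_inner_le) auto
      also have "\<dots> \<le> \<bar>?v x\<bar> * (?a powr (p - 1) * L)" by (intro mult_left_mono \<eta>) auto
      also have "\<dots> = L * (?a powr (p - 1) * \<bar>?v x\<bar>)" by simp
      also have "\<dots> \<le> L * (?a powr p + \<bar>?v x\<bar> powr p)" by (intro mult_left_mono young_sum L) auto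
      finally have C: "\<bar>?v x * (pvec p (weak_gradient ?v x) \<bullet> grad \<eta> x)\<bar> \<le> L * (?a powr p + \<bar>?v x\<bar> powr p)" .
      have "pvec p (weak_gradient ?v x) \<bullet> weak_gradient (\<lambda>x. \<eta> x * ?v x) x =
        \<eta> x * ?a powr p + ?v x * (pvec p (weak_gradient ?v x) \<bullet> grad \<eta> x)"
        by (simp only: elim inner_add_right inner_scaleR_right pvec_inner_self)
      then show ?case using C unfolding real_norm_def by linarith
    qed
  qed
  have P: "pvec p (?v x) \<bullet> (\<eta> x * ?v x) = \<eta> x * norm (?v x) powr p" for x
    using pvec_inner_self[of p "?v x"] by simp
  have Ie: "(\<integral>x. \<eta> x * norm (weak_gradient ?v x) powr p - L * (norm (weak_gradient ?v x) powr p + norm (?v x) powr p) \<partial>lebesgue) =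
    (\<integral>x. \<eta> x * norm (weak_gradient ?v x) powr p \<partial>lebesgue) - L * ((\<integral>x. norm (weak_gradient ?v x) powr p \<partial>lebesgue) + (\<integral>x. norm (?v x) powr p \<partial>lebesgue))"
    using ie(1) iv(1,2) by simp
  have "wnrm \<eta> ?v - L * ((\<integral>x. norm (weak_gradient ?v x) powr p \<partial>lebesgue) + (\<integral>x. norm (?v x) powr p \<partial>lebesgue)) \<le> pairing ?v (\<lambda>x. \<eta> x * ?v x)"
    using I[unfolded Ie] unfolding wnrm_def pairing_def P by linarith
  moreover have "L * ((\<integral>x. norm (weak_gradient ?v x) powr p \<partial>lebesgue) + (\<integral>x. norm (?v x) powr p \<partial>lebesgue)) \<le> L * nrm ?v"
    by (intro mult_left_mono nrm_parts L)
  ultimately show ?thesis unfolding un_pairing[OF fV] by linarith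
qed

text \<open>Continuity of the embedding and uniform tails are both instances. \<open>C0\<close>
  bounds the integrals of the resolvents and hence, by \<open>nrm_un\<close>, their energies; \<tau>
  carries the smallness of the weight; \<open>k\<close> balances the two against the norm of
  \<open>u\<close>.\<close>

lemma weighted_L1:
  assumes C0: "\<And>n. (\<integral>x. un n x \<partial>lebesgue) \<le> C0" and \<tau>: "\<And>n. (\<integral>x. \<zeta> x * un n x \<partial>lebesgue) \<le> \<tau>"
    and L: "L \<ge> 0" and \<zeta>: "\<And>k. Ck k \<zeta>" "\<And>x. 0 \<le> \<zeta> x" "\<And>x. \<zeta> x \<le> 1" "\<And>x. norm (grad \<zeta> x) \<le> L"
    and u: "u \<in> W" and k: "k > 0"
  shows "(\<integral>\<^sup>+x. ennreal (\<zeta> x * \<bar>u x\<bar>) \<partial>lebesgue) \<le>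
    ennreal (k powr p * (\<tau> + L * C0) + (k powr (1 - p)) powr p * nrm u + L * (C0 + nrm u))"
proof -
  obtain B where B: "B > 0" "\<And>S x. S > 0 \<Longrightarrow> norm (grad (cutoff S) (x::'a)) \<le> B / S"
    using cutoff_grad_bound[where 'a = 'a] by metis
  let ?D = "\<lambda>n. k powr p * (\<tau> + L * C0) + (k powr (1 - p)) powr p * nrm u + (L + B / real (Suc n)) * (C0 + nrm u)"
  \<comment> \<open>The cut-off puts the product with |u| into \<open>V (real (Suc n))\<close>. It
    costs B/(n+1) in the gradient bound, which disappears in the limit.\<close>
  define \<eta> where "\<eta> n x = \<zeta> x * cutoff (real (Suc n)) x" for n and x :: 'a
  have \<zeta>d: "\<zeta> differentiable (at x)" for x by (rule smooth_continuous(4)[OF \<zeta>(1)])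
  have cd: "cutoff S differentiable (at (x::'a))" for S x by (rule smooth_continuous(4)[OF cutoff_smooth])
  have \<eta>s: "Ck j (\<eta> n)" for j n unfolding \<eta>_def by (intro Ck_mult \<zeta> cutoff_smooth)
  have \<eta>b: "0 \<le> \<eta> n x" "\<eta> n x \<le> \<zeta> x" "\<eta> n x \<le> 1" for n x
    using \<zeta>(2,3)[of x] cutoff_bounds[of "real (Suc n)" x]
    by (auto simp: \<eta>_def mult_left_le mult_le_one)
  have \<eta>g: "norm (grad (\<eta> n) x) \<le> L + B / real (Suc n)" for n x
  proof -
    have "grad (\<eta> n) x = \<zeta> x *\<^sub>R grad (cutoff (real (Suc n))) x + cutoff (real (Suc n)) x *\<^sub>R grad \<zeta> x"
      unfolding \<eta>_def[abs_def] by (rule grad_mult[OF \<zeta>d cd])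
    also have "norm \<dots> \<le> norm (\<zeta> x *\<^sub>R grad (cutoff (real (Suc n))) x) + norm (cutoff (real (Suc n)) x *\<^sub>R grad \<zeta> x)"
      by (rule norm_triangle_ineq)
    also have "norm (\<zeta> x *\<^sub>R grad (cutoff (real (Suc n))) x) \<le> 1 * (B / real (Suc n))"
      unfolding norm_scaleR using \<zeta>(2,3)[of x] by (intro mult_mono B) auto
    also have "norm (cutoff (real (Suc n)) x *\<^sub>R grad \<zeta> x) \<le> 1 * L"
      unfolding norm_scaleR using cutoff_bounds[of "real (Suc n)" x] by (intro mult_mono \<zeta>) auto
    finally show ?thesis by simp
  qed
  have aW: "(\<lambda>x. \<bar>u x\<bar>) \<in> W" by (rule W_abs[OF u])
  have \<eta>1: "\<bar>\<eta> n x\<bar> \<le> 1" for n x using \<eta>b[of n x] by simp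
  have fV: "(\<lambda>x. \<eta> n x * \<bar>u x\<bar>) \<in> V (real (Suc n))" for n
    by (rule W_mult_V[OF aW \<eta>s \<eta>1 \<eta>g]) (auto simp: \<eta>_def cutoff_zero)
  have bound: "(\<integral>x. \<eta> n x * \<bar>u x\<bar> \<partial>lebesgue) \<le> ?D n" for n
  proof -
    let ?v = "un (Suc n)"
    have L': "L + B / real (Suc n) \<ge> 0" using L B by simp
    have nv: "nrm ?v \<le> C0" using nrm_un C0 by simp
    have "(\<integral>x. \<eta> n x * \<bar>u x\<bar> \<partial>lebesgue) = pairing ?v (\<lambda>x. \<eta> n x * \<bar>u x\<bar>)" by (rule un_pairing[OF fV, symmetric])
    also have "\<dots> \<le> k powr p * wnrm (\<eta> n) ?v + (k powr (1 - p)) powr p * nrm u + (L + B / real (Suc n)) * (nrm ?v + nrm u)"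
      by (rule pairing_weighted_le[OF un_W u k L' \<eta>s \<eta>b(1,3) \<eta>g])
    \<comment> \<open>The cut-off is discarded here: the test of the second estimate is a multiple
      of \<open>?v\<close>, which already vanishes outside its ball.\<close>
    also have "wnrm (\<eta> n) ?v \<le> wnrm \<zeta> ?v"
    proof -
      have z1: "\<bar>\<zeta> x\<bar> \<le> 1" for x using \<zeta>(2,3)[of x] by simp
      note i1 = wnrm_integrable[OF un_W[of "Suc n"] smooth_continuous(1)[OF \<eta>s] \<eta>1]
      note i2 = wnrm_integrable[OF un_W[of "Suc n"] smooth_continuous(1)[OF \<zeta>(1)] z1]
      show ?thesis unfolding wnrm_def
        by (intro add_mono integral_mono i1 i2 mult_right_mono \<eta>b) auto
    qed
    also have "wnrm \<zeta> ?v \<le> (\<integral>x. \<zeta> x * ?v x \<partial>lebesgue) + L * nrm ?v" by (rule wnrm_un_le[OF L \<zeta>])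
    also have "\<dots> \<le> \<tau> + L * C0" using \<tau>[of "Suc n"] nv L by (intro add_mono mult_left_mono) auto
    finally have "(\<integral>x. \<eta> n x * \<bar>u x\<bar> \<partial>lebesgue) \<le> k powr p * (\<tau> + L * C0) + (k powr (1 - p)) powr p * nrm u + (L + B / real (Suc n)) * (nrm ?v + nrm u)"
      by (simp add: mult_left_mono)
    also have "\<dots> \<le> ?D n" using nv L' by (intro add_left_mono mult_left_mono) auto
    finally show ?thesis .
  qed
  have um: "u \<in> borel_measurable lebesgue" using WD(5)[OF u] by (simp add: Lp_def)
  have nn: "(\<integral>\<^sup>+x. ennreal (\<eta> n x * \<bar>u x\<bar>) \<partial>lebesgue) = ennreal (\<integral>x. \<eta> n x * \<bar>u x\<bar> \<partial>lebesgue)" for n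
    using \<eta>b by (intro nn_integral_eq_integral V_integrable[OF fV]) auto
  have lim: "(\<lambda>n. ennreal (\<eta> n x * \<bar>u x\<bar>)) \<longlonglongrightarrow> ennreal (\<zeta> x * \<bar>u x\<bar>)" for x
  proof -
    have "(\<lambda>n. \<zeta> x * cutoff (real (Suc n)) x * \<bar>u x\<bar>) \<longlonglongrightarrow> \<zeta> x * 1 * \<bar>u x\<bar>"
      by (intro tendsto_mult tendsto_const LIMSEQ_Suc[OF cutoff_tendsto])
    then show ?thesis by (intro tendsto_ennrealI) (simp add: \<eta>_def)
  qed
  have Dlim: "(\<lambda>n. ennreal (?D n)) \<longlonglongrightarrow> ennreal (k powr p * (\<tau> + L * C0) + (k powr (1 - p)) powr p * nrm u + (L + B * 0) * (C0 + nrm u))"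
  proof -
    have "(\<lambda>n. L + B * (1 / real (Suc n))) \<longlonglongrightarrow> L + B * 0"
      by (intro tendsto_intros LIMSEQ_Suc[OF lim_1_over_n, unfolded o_def])
    then have l: "(\<lambda>n. L + B / real (Suc n)) \<longlonglongrightarrow> L + B * 0" by simp
    show ?thesis by (intro tendsto_ennrealI tendsto_add[OF tendsto_const] tendsto_mult[OF l] tendsto_const)
  qed
  have "(\<integral>\<^sup>+x. ennreal (\<zeta> x * \<bar>u x\<bar>) \<partial>lebesgue) = (\<integral>\<^sup>+x. liminf (\<lambda>n. ennreal (\<eta> n x * \<bar>u x\<bar>)) \<partial>lebesgue)"
    by (intro nn_integral_cong lim_imp_Liminf[OF _ lim, symmetric]) simp
  also have "\<dots> \<le> liminf (\<lambda>n. \<integral>\<^sup>+x. ennreal (\<eta> n x * \<bar>u x\<bar>) \<partial>lebesgue)"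
    using borel_measurable_integrable[OF V_integrable[OF fV]] by (intro nn_integral_liminf) auto
  also have "\<dots> \<le> liminf (\<lambda>n. ennreal (?D n))"
    unfolding nn by (rule Liminf_mono) (intro always_eventually allI ennreal_leI bound)
  also have "\<dots> = ennreal (k powr p * (\<tau> + L * C0) + (k powr (1 - p)) powr p * nrm u + (L + B * 0) * (C0 + nrm u))"
    by (rule lim_imp_Liminf[OF _ Dlim]) simp
  finally show ?thesis by simp
qed

end

section \<open>The embedding into \<open>L\<^sup>1\<close>\<close>

lemma grad_const: "grad (\<lambda>x. c) x = 0"
  by (simp add: grad_def frechet_derivative_const)

lemma powr_less_root:
  fixes a b p :: real
  assumes "p > 0" "a \<ge> 0" "b > 0" "a powr (1/p) < b powr (1/p)" shows "a < b"
proof (rule ccontr)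
  assume "\<not> a < b"
  then have "b powr (1/p) \<le> a powr (1/p)" using assms by (intro powr_mono2) auto
  then show False using assms(4) by simp
qed

context cap_space
begin

text \<open>\<open>weighted_L1\<close> with \<zeta> = 1, where \<open>L\<close> is 0 and \<tau> is
  \<open>C0\<close>.\<close>

lemma embedding_bound:
  assumes C0: "\<And>n. (\<integral>x. un n x \<partial>lebesgue) \<le> C0" and u: "u \<in> W"
  shows "integrable lebesgue u" and "k > 0 \<Longrightarrow> (\<integral>x. \<bar>u x\<bar> \<partial>lebesgue) \<le> k powr p * C0 + (k powr (1 - p)) powr p * nrm u"
proof -
  have um: "u \<in> borel_measurable lebesgue" using WD(5)[OF u] by (simp add: Lp_def)
  have C00: "C0 \<ge> 0" using C0[of 0] nrm_un[of 0] nrm_nonneg[of "un 0"] by linarith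
  have b: "(\<integral>\<^sup>+x. ennreal \<bar>u x\<bar> \<partial>lebesgue) \<le> ennreal (k powr p * C0 + (k powr (1 - p)) powr p * nrm u)" if "k > 0" for k
    using weighted_L1[OF C0, of "\<lambda>x. 1" C0 0 u k] C0 u that by (simp add: Ck_const grad_const)
  have "(\<integral>\<^sup>+x. ennreal (norm (u x)) \<partial>lebesgue) < \<infinity>" using b[of 1] by (auto intro: le_less_trans)
  then show i: "integrable lebesgue u" using um by (simp add: integrable_iff_bounded)
  assume k: "k > 0"
  have "ennreal (\<integral>x. \<bar>u x\<bar> \<partial>lebesgue) = (\<integral>\<^sup>+x. ennreal \<bar>u x\<bar> \<partial>lebesgue)" using i by (subst nn_integral_eq_integral) auto
  also have "\<dots> \<le> ennreal (k powr p * C0 + (k powr (1 - p)) powr p * nrm u)" by (rule b[OF k])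
  finally show "(\<integral>x. \<bar>u x\<bar> \<partial>lebesgue) \<le> k powr p * C0 + (k powr (1 - p)) powr p * nrm u"
    using C00 nrm_nonneg[of u] by (subst (asm) ennreal_le_iff) auto
qed

lemma embedding_small:
  assumes C0: "\<And>n. (\<integral>x. un n x \<partial>lebesgue) \<le> C0" and \<epsilon>: "\<epsilon> > 0"
  obtains \<delta> where "\<delta> > 0" "\<And>v. v \<in> W \<Longrightarrow> nrm v powr (1/p) < \<delta> \<Longrightarrow> (\<integral>x. \<bar>v x\<bar> \<partial>lebesgue) < \<epsilon>"
proof -
  have C00: "C0 \<ge> 0" using C0[of 0] nrm_un[of 0] nrm_nonneg[of "un 0"] by linarith
  \<comment> \<open>Makes k^p C0 at most \<epsilon>/2, after which the other term is a fixed
    multiple of \<open>nrm v\<close>. The summand 1 covers C0 = 0.\<close>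
  define k where "k = (\<epsilon> / (2 * (C0 + 1))) powr (1/p)"
  have kp: "k powr p = \<epsilon> / (2 * (C0 + 1))" using p0 \<epsilon> C00 by (simp add: k_def powr_powr)
  have k: "k > 0" using \<epsilon> C00 by (simp add: k_def)
  define B where "B = (k powr (1 - p)) powr p"
  have B: "B > 0" using k by (simp add: B_def)
  have C1: "C0 + 1 > 0" using C00 by simp
  have "k powr p * C0 \<le> k powr p * (C0 + 1)" by (intro mult_left_mono) auto
  also have "\<dots> = \<epsilon>/2" unfolding kp using C1 by (simp only: times_divide_eq_left) (simp add: divide_eq_eq)
  finally have h1: "k powr p * C0 \<le> \<epsilon>/2" .
  show thesis
  proof (rule that)
    show "(\<epsilon> / (2 * B)) powr (1/p) > 0" using \<epsilon> B by simp
    fix v assume v: "v \<in> W" and lt: "nrm v powr (1/p) < (\<epsilon> / (2 * B)) powr (1/p)"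
    have "nrm v < \<epsilon> / (2 * B)" by (rule powr_less_root[OF p0(1) nrm_nonneg _ lt]) (use \<epsilon> B in simp)
    then have "B * nrm v < \<epsilon>/2" using B by (simp add: field_simps)
    then show "(\<integral>x. \<bar>v x\<bar> \<partial>lebesgue) < \<epsilon>" using embedding_bound(2)[OF C0 v k] h1 by (simp add: B_def)
  qed
qed

lemma nrm_cmult: "u \<in> W \<Longrightarrow> nrm (\<lambda>x. c * u x) = \<bar>c\<bar> powr p * nrm u"
  using nrm_lincomb[of u u c 0] by (simp add: nrm_def powr_mult abs_mult distrib_left)

text \<open>Rescale \<open>un n\<close> by c to norm \<delta>/2. Since its integral s equals its
  \<open>nrm\<close>, the bound c s < 1 reads s^(1 - 1/p) < 2/\<delta>, and p > 1 makes the exponent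
  positive.\<close>

lemma bounded_from_continuity:
  assumes \<delta>: "\<delta> > 0" "\<And>v. v \<in> W \<Longrightarrow> nrm v powr (1/p) < \<delta> \<Longrightarrow> (\<integral>x. \<bar>v x\<bar> \<partial>lebesgue) < 1"
  shows "(\<integral>x. un n x \<partial>lebesgue) \<le> (2 / \<delta>) powr (p / (p - 1))"
proof (cases "nrm (un n) = 0")
  case True then show ?thesis using nrm_un[of n] by simp
next
  case False
  define s where "s = nrm (un n)"
  have s: "s > 0" using False nrm_nonneg[of "un n"] by (simp add: s_def)
  define c where "c = \<delta> / 2 / s powr (1/p)"
  have c: "c > 0" using s \<delta> by (simp add: c_def)
  have cW: "(\<lambda>x. c * un n x) \<in> W" using W_lincomb[OF un_W un_W, of c n 0 n] by simp
  have "nrm (\<lambda>x. c * un n x) powr (1/p) = (c powr p * s) powr (1/p)" using c by (simp add: nrm_cmult[OF un_W] s_def)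
  also have "\<dots> = c * s powr (1/p)" using c s p0 by (simp add: powr_mult powr_powr)
  also have "\<dots> = \<delta>/2" using s by (simp add: c_def)
  finally have "nrm (\<lambda>x. c * un n x) powr (1/p) < \<delta>" using \<delta>(1) by simp
  then have "(\<integral>x. \<bar>c * un n x\<bar> \<partial>lebesgue) < 1" by (rule \<delta>(2)[OF cW])
  moreover have "(\<integral>x. \<bar>c * un n x\<bar> \<partial>lebesgue) = c * s"
  proof -
    have "(\<integral>x. \<bar>c * un n x\<bar> \<partial>lebesgue) = (\<integral>x. c * un n x \<partial>lebesgue)"
      using un_integrable[of n] un_nonneg_AE c by (intro integral_cong_AE) (auto elim!: eventually_mono)
    then show ?thesis using nrm_un[of n] by (simp add: s_def)
  qed
  ultimately have "c * s < 1" by simp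
  then have "s / s powr (1/p) < 2 / \<delta>" using \<delta>(1) s by (simp add: c_def field_simps)
  moreover have "s / s powr (1/p) = s powr (1 - 1/p)" using s by (simp add: powr_diff)
  ultimately have lt: "s powr (1 - 1/p) \<le> 2 / \<delta>" by simp
  have "s = (s powr (1 - 1/p)) powr (p / (p - 1))"
  proof -
    have "(1 - 1/p) * (p / (p - 1)) = 1" using p by (simp add: field_simps)
    then show ?thesis using s by (simp only: powr_powr) simp
  qed
  also have "\<dots> \<le> (2 / \<delta>) powr (p / (p - 1))" using lt p by (intro powr_mono2) auto
  finally show ?thesis using nrm_un[of n] by (simp add: s_def)
qed

text \<open>Test the equations of the resolvents with \<open>(1 - cutoff) \<bar>u\<bar>\<close>.\<close>

lemma uniform_tails:
  assumes C0: "\<And>n. (\<integral>x. un n x \<partial>lebesgue) \<le> C0" and \<epsilon>: "\<epsilon> > 0" and K: "K \<ge> 0"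
  obtains m :: nat where "\<And>u. u \<in> W \<Longrightarrow> nrm u \<le> K \<Longrightarrow>
     (\<integral>\<^sup>+x. ennreal ((1 - cutoff (real (Suc m)) x) * \<bar>u x\<bar>) \<partial>lebesgue) \<le> ennreal \<epsilon>"
proof -
  have C00: "C0 \<ge> 0" using C0[of 0] nrm_un[of 0] nrm_nonneg[of "un 0"] by linarith
  obtain B where B: "B > 0" "\<And>S x. S > 0 \<Longrightarrow> norm (grad (cutoff S) (x::'a)) \<le> B / S"
    using cutoff_grad_bound[where 'a = 'a] by metis
  \<comment> \<open>For large \<open>m\<close> this weight is small on a given ball, though it is
    zero only at the origin; dominated convergence against an integrable majorant of the resolvents
    makes up for that.\<close>
  define \<zeta> where "\<zeta> m x = 1 + (-1) * cutoff (real (Suc m)) x" for m and x :: 'a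
  define L where "L m = B / real (Suc m)" for m
  have \<zeta>t: "\<zeta> m \<in> smooth_terms" for m
    unfolding \<zeta>_def by (intro smooth_terms.intros cutoff_terms)
  have \<zeta>s: "Ck k (\<zeta> m)" for k m by (rule smooth_terms_Ck[OF \<zeta>t])
  have \<zeta>b: "0 \<le> \<zeta> m x" "\<zeta> m x \<le> 1" for m x using cutoff_bounds[of "real (Suc m)" x] by (auto simp: \<zeta>_def)
  have \<zeta>g: "norm (grad (\<zeta> m) x) \<le> L m" for m x
  proof -
    have "(cutoff (real (Suc m)) has_derivative frechet_derivative (cutoff (real (Suc m))) (at x)) (at x)"
      using smooth_continuous(4)[OF cutoff_smooth] by (simp add: frechet_derivative_works[symmetric])
    then have "(\<zeta> m has_derivative (\<lambda>h. - frechet_derivative (cutoff (real (Suc m))) (at x) h)) (at x)"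
      unfolding \<zeta>_def[abs_def] by (auto intro!: derivative_eq_intros)
    then have "frechet_derivative (\<zeta> m) (at x) = (\<lambda>h. - frechet_derivative (cutoff (real (Suc m))) (at x) h)"
      by (metis frechet_derivative_at)
    then have "grad (\<zeta> m) x = - grad (cutoff (real (Suc m))) x" by (simp add: grad_def sum_negf)
    then show ?thesis using B(2)[of "real (Suc m)" x] by (simp add: L_def)
  qed
  have w: "(\<integral>\<^sup>+x. e2ennreal \<bar>w_mu p \<mu> x\<bar> \<partial>lebesgue) < \<infinity>"
    using w_integrable_iff C0 by (auto simp: ereal_integrable_def)
  have wm: "(\<lambda>x. e2ennreal \<bar>w_mu p \<mu> x\<bar>) \<in> borel_measurable lebesgue" using w_mu_measurable by measurable
  have wfin: "AE x in lebesgue. e2ennreal \<bar>w_mu p \<mu> x\<bar> \<noteq> \<infinity>"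
    using w by (intro nn_integral_PInf_AE wm) auto
  \<comment> \<open>A real-valued integrable majorant of all \<open>un n\<close>:
    \<open>w_mu\<close> may be infinite, but only on a null set.\<close>
  define \<omega> where "\<omega> x = enn2real (e2ennreal \<bar>w_mu p \<mu> x\<bar>)" for x
  have \<omega>m: "\<omega> \<in> borel_measurable lebesgue" unfolding \<omega>_def[abs_def] using wm by measurable
  have \<omega>0: "\<omega> x \<ge> 0" for x by (simp add: \<omega>_def)
  have \<omega>i: "integrable lebesgue \<omega>"
  proof (rule integrableI_nonneg[OF \<omega>m])
    have "(\<integral>\<^sup>+x. ennreal (\<omega> x) \<partial>lebesgue) = (\<integral>\<^sup>+x. e2ennreal \<bar>w_mu p \<mu> x\<bar> \<partial>lebesgue)"
    proof (rule nn_integral_cong_AE)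
      show "AE x in lebesgue. ennreal (\<omega> x) = e2ennreal \<bar>w_mu p \<mu> x\<bar>"
        using wfin by eventually_elim (simp add: \<omega>_def less_top)
    qed
    then show "(\<integral>\<^sup>+x. ennreal (\<omega> x) \<partial>lebesgue) < \<infinity>" using w by simp
  qed (simp add: \<omega>0)
  have un\<omega>: "AE x in lebesgue. \<forall>n. un n x \<le> \<omega> x"
    using w_mu_abs_AE wfin
  proof eventually_elim
    case (elim x)
    show ?case
    proof
      fix n
      have "ennreal (un n x) \<le> ennreal (\<omega> x)" using elim by (simp add: \<omega>_def less_top)
      then show "un n x \<le> \<omega> x" using \<omega>0[of x] by (simp add: ennreal_le_iff)
    qed
  qed
  have \<zeta>m: "\<zeta> m \<in> borel_measurable lebesgue" for m
    by (rule continuous_lebesgue_measurable[OF smooth_continuous(1)[OF \<zeta>s]])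
  have \<zeta>abs: "\<bar>\<zeta> m x\<bar> \<le> 1" for m x using \<zeta>b[of m x] by simp
  define \<tau> where "\<tau> m = (\<integral>x. \<zeta> m x * \<omega> x \<partial>lebesgue)" for m
  have \<tau>: "(\<integral>x. \<zeta> m x * un n x \<partial>lebesgue) \<le> \<tau> m" for m n
    unfolding \<tau>_def
  proof (rule integral_mono_AE)
    show "integrable lebesgue (\<lambda>x. \<zeta> m x * un n x)" "integrable lebesgue (\<lambda>x. \<zeta> m x * \<omega> x)"
      by (intro integrable_mult_bounded un_integrable \<omega>i \<zeta>m \<zeta>abs)+
    show "AE x in lebesgue. \<zeta> m x * un n x \<le> \<zeta> m x * \<omega> x"
      using un\<omega> by eventually_elim (auto intro!: mult_left_mono \<zeta>b)
  qed
  have \<tau>0: "\<tau> \<longlonglongrightarrow> 0"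
  proof -
    have "(\<lambda>m. \<integral>x. \<zeta> m x * \<omega> x \<partial>lebesgue) \<longlonglongrightarrow> (\<integral>x. 0 \<partial>(lebesgue::'a measure))"
    proof (rule integral_dominated_convergence[OF _ _ \<omega>i])
      show "AE x in lebesgue. (\<lambda>m. \<zeta> m x * \<omega> x) \<longlonglongrightarrow> 0"
      proof (rule AE_I2)
        fix x :: 'a
        have "(\<lambda>m. 1 + (-1) * cutoff (real (Suc m)) x) \<longlonglongrightarrow> 1 + (-1) * 1"
          by (intro tendsto_add tendsto_mult tendsto_const LIMSEQ_Suc[OF cutoff_tendsto])
        then have "(\<lambda>m. \<zeta> m x) \<longlonglongrightarrow> 0" by (simp add: \<zeta>_def)
        then show "(\<lambda>m. \<zeta> m x * \<omega> x) \<longlonglongrightarrow> 0" by (rule tendsto_mult_left_zero)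
      qed
      show "AE x in lebesgue. norm (\<zeta> m x * \<omega> x) \<le> \<omega> x" for m
        using \<zeta>b \<omega>0 by (intro AE_I2) (auto simp: abs_mult intro!: mult_left_le_one_le)
    qed (use \<zeta>m \<omega>m in auto)
    then show ?thesis by (simp add: \<tau>_def[abs_def])
  qed
  \<comment> \<open>The exponent makes (k^(1-p))^p equal to \<epsilon>/(2(K+1)), so that the term
    with \<open>nrm u\<close> is at most \<epsilon>/2. Only after \<open>k\<close> is fixed is
    \<open>m\<close> taken large.\<close>
  define k where "k = (\<epsilon> / (2 * (K + 1))) powr (1 / (p * (1 - p)))"
  have K1: "K + 1 > 0" using K by simp
  have e2: "\<epsilon> / (2 * (K + 1)) > 0" using \<epsilon> K1 by simp
  have k: "k > 0" unfolding k_def using e2 by (simp only: powr_gt_zero)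
  have "(k powr (1 - p)) powr p = (\<epsilon> / (2 * (K + 1))) powr (1 / (p * (1 - p)) * ((1 - p) * p))"
    unfolding k_def by (simp only: powr_powr mult.assoc)
  also have "1 / (p * (1 - p)) * ((1 - p) * p) = 1" using p by simp
  finally have kB: "(k powr (1 - p)) powr p = \<epsilon> / (2 * (K + 1))" by (simp only: powr_one[OF less_imp_le[OF e2]])
  have L0: "L \<longlonglongrightarrow> 0"
  proof -
    have "(\<lambda>m. B * (1 / real (Suc m))) \<longlonglongrightarrow> B * 0" by (intro tendsto_mult tendsto_const LIMSEQ_Suc[OF lim_1_over_n, unfolded o_def])
    then show ?thesis by (simp add: L_def[abs_def])
  qed
  have "(\<lambda>m. k powr p * (\<tau> m + L m * C0) + L m * (C0 + K)) \<longlonglongrightarrow> k powr p * (0 + 0 * C0) + 0 * (C0 + K)"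
    by (intro tendsto_intros \<tau>0 L0)
  then have "\<forall>\<^sub>F m in sequentially. k powr p * (\<tau> m + L m * C0) + L m * (C0 + K) < \<epsilon>/2"
    using \<epsilon> by (intro order_tendstoD(2)) auto
  then obtain m where m: "k powr p * (\<tau> m + L m * C0) + L m * (C0 + K) < \<epsilon>/2" by (auto simp: eventually_sequentially)
  show thesis
  proof (rule that[of m])
    fix u assume u: "u \<in> W" "nrm u \<le> K"
    have Lm: "L m \<ge> 0" using B by (simp add: L_def)
    have "(\<integral>\<^sup>+x. ennreal (\<zeta> m x * \<bar>u x\<bar>) \<partial>lebesgue) \<le>
       ennreal (k powr p * (\<tau> m + L m * C0) + (k powr (1 - p)) powr p * nrm u + L m * (C0 + nrm u))"
      by (rule weighted_L1[OF C0 \<tau> Lm \<zeta>s \<zeta>b \<zeta>g u(1) k])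
    also have "\<dots> \<le> ennreal \<epsilon>"
    proof (rule ennreal_leI)
      have "(k powr (1 - p)) powr p * nrm u \<le> \<epsilon> / (2 * (K + 1)) * (K + 1)"
        unfolding kB using u e2 nrm_nonneg[of u] by (intro mult_mono) auto
      also have "\<dots> = \<epsilon>/2" using K1 by (simp only: times_divide_eq_left) (simp add: divide_eq_eq)
      finally have 1: "(k powr (1 - p)) powr p * nrm u \<le> \<epsilon>/2" .
      have "L m * (C0 + nrm u) \<le> L m * (C0 + K)" using u Lm by (intro mult_left_mono) auto
      then show "k powr p * (\<tau> m + L m * C0) + (k powr (1 - p)) powr p * nrm u + L m * (C0 + nrm u) \<le> \<epsilon>"
        using 1 m by linarith
    qed
    finally show "(\<integral>\<^sup>+x. ennreal ((1 - cutoff (real (Suc m)) x) * \<bar>u x\<bar>) \<partial>lebesgue) \<le> ennreal \<epsilon>" by (simp add: \<zeta>_def)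
  qed
qed

end

section \<open>Local compactness\<close>

text \<open>The shift by \<open>z\<close> is carried out one coordinate at a time; translation
  invariance brings each increment into the form of \<open>weak_pd_translation_L1\<close>.\<close>

lemma weak_gradient_translation:
  fixes v :: "'a::euclidean_space \<Rightarrow> real"
  assumes w: "has_weak_gradient v G" and v: "v \<in> borel_measurable lebesgue"
    and D: "(\<integral>\<^sup>+x. ennreal (norm (G x)) \<partial>lebesgue) \<le> ennreal D"
  shows "(\<integral>\<^sup>+x. ennreal \<bar>v (x + z) - v x\<bar> \<partial>lebesgue) \<le> ennreal ((\<Sum>b\<in>Basis. \<bar>z \<bullet> b\<bar>) * D)"
proof -
  have step: "(\<integral>\<^sup>+x. ennreal \<bar>v (x + t *\<^sub>R b) - v x\<bar> \<partial>lebesgue) \<le> ennreal (\<bar>t\<bar> * D)" if b: "b \<in> Basis" for b t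
  proof -
    have "(\<integral>\<^sup>+x. ennreal \<bar>v (x + t *\<^sub>R b) - v x\<bar> \<partial>lebesgue) \<le> ennreal \<bar>t\<bar> * (\<integral>\<^sup>+x. ennreal \<bar>G x \<bullet> b\<bar> \<partial>lebesgue)"
      by (rule weak_pd_translation_L1) (use w b in \<open>auto simp: has_weak_gradient_iff\<close>)
    also have "\<dots> \<le> ennreal \<bar>t\<bar> * (\<integral>\<^sup>+x. ennreal (norm (G x)) \<partial>lebesgue)"
      using b by (intro mult_left_mono nn_integral_mono ennreal_leI) (auto intro: Basis_le_norm)
    also have "\<dots> \<le> ennreal \<bar>t\<bar> * ennreal D" by (intro mult_left_mono D) auto
    finally show ?thesis by (simp add: ennreal_mult')
  qed
  have "(\<integral>\<^sup>+x. ennreal \<bar>v (x + (\<Sum>b\<in>I. (z \<bullet> b) *\<^sub>R b)) - v x\<bar> \<partial>lebesgue) \<le> (\<Sum>b\<in>I. ennreal (\<bar>z \<bullet> b\<bar> * D))"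
    if "finite I" "I \<subseteq> Basis" for I
    using that
  proof (induction I)
    case (insert b I)
    let ?s = "\<Sum>b\<in>I. (z \<bullet> b) *\<^sub>R b" and ?t = "(z \<bullet> b) *\<^sub>R b"
    have m: "(\<lambda>x. v (x + c)) \<in> borel_measurable lebesgue" for c by (rule measurable_translate[OF v])
    have [measurable]: "v \<in> borel_measurable lebesgue" by (rule v)
    have "(\<integral>\<^sup>+x. ennreal \<bar>v (x + (?t + ?s)) - v x\<bar> \<partial>lebesgue) \<le>
       (\<integral>\<^sup>+x. ennreal \<bar>v ((x + ?s) + ?t) - v (x + ?s)\<bar> + ennreal \<bar>v (x + ?s) - v x\<bar> \<partial>lebesgue)"
    proof (rule nn_integral_mono)
      fix x
      have "\<bar>v (x + (?t + ?s)) - v x\<bar> \<le> \<bar>v ((x + ?s) + ?t) - v (x + ?s)\<bar> + \<bar>v (x + ?s) - v x\<bar>"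
        by (simp add: add_ac)
      then show "ennreal \<bar>v (x + (?t + ?s)) - v x\<bar> \<le> ennreal \<bar>v ((x + ?s) + ?t) - v (x + ?s)\<bar> + ennreal \<bar>v (x + ?s) - v x\<bar>"
        by (simp flip: ennreal_plus)
    qed
    also have "\<dots> = (\<integral>\<^sup>+x. ennreal \<bar>v ((x + ?s) + ?t) - v (x + ?s)\<bar> \<partial>lebesgue) + (\<integral>\<^sup>+x. ennreal \<bar>v (x + ?s) - v x\<bar> \<partial>lebesgue)"
      using m[of ?s] m[of "?s + ?t"] by (intro nn_integral_add) (auto simp: add.assoc)
    also have "(\<integral>\<^sup>+x. ennreal \<bar>v ((x + ?s) + ?t) - v (x + ?s)\<bar> \<partial>lebesgue) = (\<integral>\<^sup>+x. ennreal \<bar>v (x + ?t) - v x\<bar> \<partial>lebesgue)"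
      using m[of ?t] by (intro nn_integral_translate[of "\<lambda>x. ennreal \<bar>v (x + ?t) - v x\<bar>"]) auto
    also have "\<dots> + (\<integral>\<^sup>+x. ennreal \<bar>v (x + ?s) - v x\<bar> \<partial>lebesgue) \<le> ennreal (\<bar>z \<bullet> b\<bar> * D) + (\<Sum>b\<in>I. ennreal (\<bar>z \<bullet> b\<bar> * D))"
      using insert by (intro add_mono step) auto
    finally show ?case using insert by simp
  qed simp
  from this[OF finite_Basis subset_refl]
  have "(\<integral>\<^sup>+x. ennreal \<bar>v (x + z) - v x\<bar> \<partial>lebesgue) \<le> (\<Sum>b\<in>Basis. ennreal \<bar>z \<bullet> b\<bar> * ennreal D)"
    by (simp add: euclidean_representation ennreal_mult')
  also have "\<dots> = ennreal ((\<Sum>b\<in>Basis. \<bar>z \<bullet> b\<bar>) * D)"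
    by (simp add: ennreal_mult' sum_nonneg flip: sum_distrib_right)
  finally show ?thesis .
qed

text \<open>The integral is not divided by the volume of the box.\<close>

definition box_avg :: "real \<Rightarrow> ('a::euclidean_space \<Rightarrow> real) \<Rightarrow> 'a \<Rightarrow> real" where
  "box_avg h v x = (\<integral>y. v y * indicator (box x (x + h *\<^sub>R One)) y \<partial>lebesgue)"

lemma integrable_box_mult:
  fixes v :: "'a::euclidean_space \<Rightarrow> real"
  shows "integrable lebesgue v \<Longrightarrow> integrable lebesgue (\<lambda>y. v y * indicator (box a b) y)"
  using integrable_mult_indicator[of "box a b" lebesgue v] by (simp add: mult.commute)

lemma box_avg_bound:
  fixes v :: "'a::euclidean_space \<Rightarrow> real"
  assumes "integrable lebesgue v" shows "\<bar>box_avg h v x\<bar> \<le> (\<integral>y. \<bar>v y\<bar> \<partial>lebesgue)"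
  unfolding box_avg_def
  by (rule integral_abs_le[OF integrable_box_mult[OF assms]]) (use assms in \<open>auto simp: indicator_def\<close>)

text \<open>The difference of two averages is the integral of v(y + z) - v(y) over one box, which
  the translation estimate bounds. The Lipschitz constant therefore does not involve
  \<open>h\<close>.\<close>

lemma box_avg_lipschitz:
  fixes v :: "'a::euclidean_space \<Rightarrow> real" and h D :: real
  assumes v: "integrable lebesgue v" and T: "\<And>z. (\<integral>\<^sup>+x. ennreal \<bar>v (x + z) - v x\<bar> \<partial>lebesgue) \<le> ennreal ((\<Sum>b\<in>Basis. \<bar>z \<bullet> b\<bar>) * D)"
    and D: "D \<ge> 0"
  shows "\<bar>box_avg h v (x + z) - box_avg h v x\<bar> \<le> (\<Sum>b\<in>Basis. \<bar>z \<bullet> b\<bar>) * D"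
proof -
  have tr: "integrable lebesgue (\<lambda>y. v (y + z))" by (rule integrable_translate[OF v])
  have "box_avg h v (x + z) = (\<integral>y. v (y + z) * indicator (box (x + z) (x + z + h *\<^sub>R One)) (y + z) \<partial>lebesgue)"
    unfolding box_avg_def using borel_measurable_integrable[OF integrable_box_mult[OF v]]
    by (rule integral_translate[symmetric])
  also have "\<dots> = (\<integral>y. v (y + z) * indicator (box x (x + h *\<^sub>R One)) y \<partial>lebesgue)"
    by (intro Bochner_Integration.integral_cong) (auto simp: indicator_def box_def inner_add_left)
  finally have "box_avg h v (x + z) - box_avg h v x = (\<integral>y. (v (y + z) - v y) * indicator (box x (x + h *\<^sub>R One)) y \<partial>lebesgue)"
    unfolding box_avg_def using integrable_box_mult[OF tr] integrable_box_mult[OF v] by (simp add: left_diff_distrib)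
  also have "\<bar>\<dots>\<bar> \<le> (\<integral>y. \<bar>v (y + z) - v y\<bar> \<partial>lebesgue)"
    using tr v by (intro integral_abs_le integrable_box_mult) (auto simp: indicator_def)
  also have "\<dots> \<le> (\<Sum>b\<in>Basis. \<bar>z \<bullet> b\<bar>) * D"
  proof -
    have "ennreal (\<integral>y. \<bar>v (y + z) - v y\<bar> \<partial>lebesgue) \<le> ennreal ((\<Sum>b\<in>Basis. \<bar>z \<bullet> b\<bar>) * D)"
      using T[of z] tr v by (subst nn_integral_eq_integral[symmetric]) auto
    then show ?thesis using D by (subst (asm) ennreal_le_iff) (auto intro!: mult_nonneg_nonneg sum_nonneg)
  qed
  finally show ?thesis .
qed

text \<open>By Tonelli the error is at most the integral, over shifts z in the box, of the
  \<open>L^1\<close> norms of v(x + z) - v(x). Every coordinate of such a z is below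
  \<open>h\<close>, which gives the bound N h D, with N the dimension, times the volume of the box.
  A Borel representative makes the double integral meaningful.\<close>

lemma box_avg_approx:
  fixes v :: "'a::euclidean_space \<Rightarrow> real" and h D :: real
  assumes v: "integrable lebesgue v" and T: "\<And>z. (\<integral>\<^sup>+x. ennreal \<bar>v (x + z) - v x\<bar> \<partial>lebesgue) \<le> ennreal ((\<Sum>b\<in>Basis. \<bar>z \<bullet> b\<bar>) * D)"
    and D: "D \<ge> 0" and h: "h > 0"
  shows "(\<integral>\<^sup>+x. ennreal \<bar>box_avg h v x - h ^ DIM('a) * v x\<bar> \<partial>lebesgue) \<le> ennreal (h ^ DIM('a) * (DIM('a) * h * D))"
proof -
  let ?Q = "box 0 (h *\<^sub>R One) :: 'a set"
  have vm: "v \<in> borel_measurable (completion lborel)" using v by auto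
  obtain g where g [measurable]: "g \<in> borel_measurable lborel" and vg: "AE x in lborel. v x = g x"
    using completion_ex_borel_measurable_real[OF vm] by blast
  have vg': "AE x in lebesgue. v x = g x" using vg by (rule AE_completion)
  have gi: "integrable lebesgue g"
    using v vg' g by (subst integrable_cong_AE[symmetric, where f = v]) (auto intro: measurable_completion)
  have gm: "g \<in> borel_measurable borel" using g by simp
  have avg: "box_avg h v x = (\<integral>z. indicator ?Q z * g (x + z) \<partial>lborel)" for x
  proof -
    have "box_avg h v x = (\<integral>y. g y * indicator (box x (x + h *\<^sub>R One)) y \<partial>lebesgue)"
      unfolding box_avg_def
      by (rule integral_cong_AE[OF borel_measurable_integrable[OF integrable_box_mult[OF v]] borel_measurable_integrable[OF integrable_box_mult[OF gi]]])
         (use vg' in eventually_elim, simp)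
    also have "\<dots> = (\<integral>y. g (y + x) * indicator (box x (x + h *\<^sub>R One)) (y + x) \<partial>lebesgue)"
      by (rule integral_translate[symmetric, OF borel_measurable_integrable[OF integrable_box_mult[OF gi]]])
    also have "\<dots> = (\<integral>y. indicator ?Q y * g (x + y) \<partial>lebesgue)"
      by (intro Bochner_Integration.integral_cong) (auto simp: indicator_def box_def inner_add_left add.commute)
    also have "\<dots> = (\<integral>y. indicator ?Q y * g (x + y) \<partial>lborel)"
      using gm by (intro integral_completion) measurable
    finally show ?thesis .
  qed
  have eQ: "emeasure lborel ?Q = ennreal (h ^ DIM('a))"
    using h by (subst emeasure_lborel_box_eq) (auto simp: inner_diff_left)
  have ig: "integrable lborel (\<lambda>z. indicator ?Q z * g (x + z))" for x
  proof -
    have "integrable lebesgue (\<lambda>z. g (z + x))" by (rule integrable_translate[OF gi])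
    then have "integrable lebesgue (\<lambda>z. g (z + x) * indicator ?Q z)" by (rule integrable_box_mult)
    moreover have "(\<lambda>z. g (z + x) * indicator ?Q z) \<in> borel_measurable lborel" using gm by measurable
    ultimately have "integrable lborel (\<lambda>z. g (z + x) * indicator ?Q z)" by (simp add: integrable_completion)
    then show ?thesis by (simp add: mult.commute add.commute)
  qed
  have ic: "integrable lborel (\<lambda>z. indicator ?Q z * c)" and icv: "(\<integral>z. indicator ?Q z * c \<partial>lborel) = h ^ DIM('a) * c" for c :: real
    using eQ h by (auto simp: measure_def)
  have "(\<integral>\<^sup>+x. ennreal \<bar>box_avg h v x - h ^ DIM('a) * v x\<bar> \<partial>lebesgue) = (\<integral>\<^sup>+x. ennreal \<bar>box_avg h v x - h ^ DIM('a) * g x\<bar> \<partial>lebesgue)"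
  proof (rule nn_integral_cong_AE)
    show "AE x in lebesgue. ennreal \<bar>box_avg h v x - h ^ DIM('a) * v x\<bar> = ennreal \<bar>box_avg h v x - h ^ DIM('a) * g x\<bar>"
      using vg' by eventually_elim simp
  qed
  also have "\<dots> \<le> (\<integral>\<^sup>+x. (\<integral>\<^sup>+z. indicator ?Q z * ennreal \<bar>g (x + z) - g x\<bar> \<partial>lborel) \<partial>lebesgue)"
  proof (rule nn_integral_mono)
    fix x
    have "box_avg h v x - h ^ DIM('a) * g x = (\<integral>z. indicator ?Q z * g (x + z) - indicator ?Q z * g x \<partial>lborel)"
      unfolding avg icv[symmetric] by (rule Bochner_Integration.integral_diff[OF ig ic, symmetric])
    then have "ennreal \<bar>box_avg h v x - h ^ DIM('a) * g x\<bar> \<le> (\<integral>\<^sup>+z. ennreal \<bar>indicator ?Q z * g (x + z) - indicator ?Q z * g x\<bar> \<partial>lborel)"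
      by (simp only: nn_abs_integral_le)
    also have "\<dots> = (\<integral>\<^sup>+z. indicator ?Q z * ennreal \<bar>g (x + z) - g x\<bar> \<partial>lborel)"
      by (intro nn_integral_cong) (auto simp: indicator_def)
    finally show "ennreal \<bar>box_avg h v x - h ^ DIM('a) * g x\<bar> \<le> (\<integral>\<^sup>+z. indicator ?Q z * ennreal \<bar>g (x + z) - g x\<bar> \<partial>lborel)" .
  qed
  also have "\<dots> = (\<integral>\<^sup>+x. (\<integral>\<^sup>+z. indicator ?Q z * ennreal \<bar>g (x + z) - g x\<bar> \<partial>lborel) \<partial>lborel)"
    by (rule nn_integral_completion)
  also have "\<dots> = (\<integral>\<^sup>+z. (\<integral>\<^sup>+x. indicator ?Q z * ennreal \<bar>g (x + z) - g x\<bar> \<partial>lborel) \<partial>lborel)"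
    by (rule lborel_pair.Fubini') (use gm in measurable)
  also have "\<dots> \<le> (\<integral>\<^sup>+z. ennreal (DIM('a) * h * D) * indicator ?Q z \<partial>lborel)"
  proof (rule nn_integral_mono)
    fix z :: 'a
    show "(\<integral>\<^sup>+x. indicator ?Q z * ennreal \<bar>g (x + z) - g x\<bar> \<partial>lborel) \<le> ennreal (DIM('a) * h * D) * indicator ?Q z"
    proof (cases "z \<in> ?Q")
      case True
      have "(\<integral>\<^sup>+x. ennreal \<bar>g (x + z) - g x\<bar> \<partial>lborel) = (\<integral>\<^sup>+x. ennreal \<bar>g (x + z) - g x\<bar> \<partial>lebesgue)"
        by (rule nn_integral_completion[symmetric])
      also have "\<dots> = (\<integral>\<^sup>+x. ennreal \<bar>v (x + z) - v x\<bar> \<partial>lebesgue)"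
      proof (rule nn_integral_cong_AE)
        show "AE x in lebesgue. ennreal \<bar>g (x + z) - g x\<bar> = ennreal \<bar>v (x + z) - v x\<bar>"
          using AE_translate[OF vg', of z] vg' by eventually_elim simp
      qed
      also have "\<dots> \<le> ennreal ((\<Sum>b\<in>Basis. \<bar>z \<bullet> b\<bar>) * D)" by (rule T)
      also have "\<dots> \<le> ennreal (DIM('a) * h * D)"
      proof (intro ennreal_leI mult_right_mono D)
        have "(\<Sum>b\<in>Basis. \<bar>z \<bullet> b\<bar>) \<le> (\<Sum>b\<in>(Basis::'a set). h)"
          using True by (intro sum_mono) (auto simp: box_def abs_of_pos)
        then show "(\<Sum>b\<in>Basis. \<bar>z \<bullet> b\<bar>) \<le> DIM('a) * h" by simp
      qed
      finally show ?thesis using True by simp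
    qed simp
  qed
  also have "\<dots> = ennreal (DIM('a) * h * D) * emeasure lborel ?Q" by (rule nn_integral_cmult_indicator) simp
  also have "\<dots> = ennreal (h ^ DIM('a) * (DIM('a) * h * D))" unfolding eQ using h D by (simp add: mult.commute flip: ennreal_mult)
  finally show ?thesis .
qed

lemma sum_abs_inner_le: "(\<Sum>b\<in>Basis. \<bar>z \<bullet> b\<bar>) \<le> DIM('a) * norm (z::'a::euclidean_space)"
  using sum_bounded_above[of Basis "\<lambda>b. \<bar>z \<bullet> b\<bar>" "norm z"] by (simp add: Basis_le_norm)

text \<open>A box anchored at x stays within distance N h of x, N being the dimension, since the sum
  of the coordinates bounds the Euclidean norm.\<close>

lemma box_avg_zero:
  fixes v :: "'a::euclidean_space \<Rightarrow> real" and h S :: real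
  assumes h: "h > 0" and S: "\<And>y. norm y \<ge> S \<Longrightarrow> v y = 0" and x: "norm x \<ge> S + DIM('a) * h"
  shows "box_avg h v x = 0"
proof -
  have "v y * indicator (box x (x + h *\<^sub>R One)) y = 0" for y
  proof (cases "y \<in> box x (x + h *\<^sub>R One)")
    case True
    have "norm (y - x) \<le> (\<Sum>b\<in>Basis. \<bar>(y - x) \<bullet> b\<bar>)" by (rule norm_le_l1)
    also have "\<dots> \<le> (\<Sum>b\<in>(Basis::'a set). h)"
      using True by (intro sum_mono) (auto simp: box_def inner_diff_left inner_add_left abs_if algebra_simps less_imp_le)
    finally have "norm (y - x) \<le> DIM('a) * h" by simp
    then have "norm y \<ge> S" using x norm_triangle_sub[of x y] by (simp add: norm_minus_commute)
    then show ?thesis by (simp add: S)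
  qed simp
  then show ?thesis unfolding box_avg_def by (simp only: Bochner_Integration.integral_zero)
qed

text \<open>The averages over boxes of side \<open>h\<close> are equi-Lipschitz and uniformly \<open>L\<^sup>1\<close>-close to the
  functions, so convergence on a dense set of points is enough.\<close>

lemma L1_cauchy_of_box_avg:
  fixes v :: "nat \<Rightarrow> 'a::euclidean_space \<Rightarrow> real" and C D S \<epsilon> :: real
  assumes i: "\<And>n. integrable lebesgue (v n)" and C: "\<And>n. (\<integral>x. \<bar>v n x\<bar> \<partial>lebesgue) \<le> C"
    and T: "\<And>n z. (\<integral>\<^sup>+x. ennreal \<bar>v n (x + z) - v n x\<bar> \<partial>lebesgue) \<le> ennreal ((\<Sum>b\<in>Basis. \<bar>z \<bullet> b\<bar>) * D)"
    and D: "D \<ge> 0" and S: "\<And>n x. norm x \<ge> S \<Longrightarrow> v n x = 0"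
    and Q: "\<And>k q. q \<in> Q \<Longrightarrow> convergent (\<lambda>n. box_avg (1 / real (Suc k)) (v n) q)" "closure Q = UNIV"
    and \<epsilon>: "\<epsilon> > 0"
  shows "\<exists>M. \<forall>i\<ge>M. \<forall>j\<ge>M. (\<integral>x. \<bar>v i x - v j x\<bar> \<partial>lebesgue) \<le> \<epsilon>"
proof -
  let ?d = "real DIM('a)"
  have E: "?d * D \<ge> 0" using D by simp
  have "\<epsilon> / (4 * (?d * D + 1)) > 0" using \<epsilon> E by simp
  \<comment> \<open>The side of the boxes is chosen so that, relative to the volume of a box, the
    averages differ from the functions by at most \<epsilon>/4 in \<open>L^1\<close>. The summand 1
    covers D = 0.\<close>
  then obtain k where k: "1 / real (Suc k) < \<epsilon> / (4 * (?d * D + 1))" using nat_approx_posE by blast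
  define h where "h = 1 / real (Suc k)"
  have h: "h > 0" by (simp add: h_def)
  have hE: "?d * h * D \<le> \<epsilon>/4"
  proof -
    have "h * (?d * D) \<le> h * (?d * D + 1)" using h by (intro mult_left_mono) auto
    also have "\<dots> < \<epsilon>/4"
    proof -
      have "h < \<epsilon> / (4 * (?d * D + 1))" using k by (simp only: h_def)
      then have "h * (4 * (?d * D + 1)) < \<epsilon>" using E by (subst (asm) pos_less_divide_eq) auto
      then show ?thesis by (simp add: algebra_simps)
    qed
    finally show ?thesis by (simp add: mult_ac)
  qed
  define c where "c = h ^ DIM('a)"
  have c: "c > 0" using h by (simp add: c_def)
  define A where "A n x = box_avg h (v n) x" for n x
  have lip: "\<bar>A n x - A n y\<bar> \<le> ?d * D * norm (x - y)" for n x y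
  proof -
    have "\<bar>A n (y + (x - y)) - A n y\<bar> \<le> (\<Sum>b\<in>Basis. \<bar>(x - y) \<bullet> b\<bar>) * D"
      unfolding A_def by (rule box_avg_lipschitz[OF i T D])
    also have "\<dots> \<le> (?d * norm (x - y)) * D" by (intro mult_right_mono sum_abs_inner_le D)
    finally show ?thesis by (simp add: mult_ac)
  qed
  have conv: "convergent (\<lambda>n. A n x)" for x
  proof (rule Cauchy_convergent, rule metric_CauchyI)
    fix e :: real assume e: "e > 0"
    have "x \<in> closure Q" using Q(2) by simp
    then obtain q where q: "q \<in> Q" "dist q x < e / (4 * (?d * D + 1))"
      using e E unfolding closure_approachable by (metis zero_less_divide_iff mult_pos_pos zero_less_numeral add_nonneg_pos zero_less_one)
    have q2: "?d * D * norm (x - q) \<le> e/4"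
    proof -
      have "?d * D * norm (x - q) \<le> (?d * D + 1) * dist q x" by (simp add: dist_norm norm_minus_commute mult_right_mono)
      also have "\<dots> \<le> e/4" using q(2) E by (simp add: pos_less_divide_eq mult.assoc) (simp add: algebra_simps)
      finally show ?thesis .
    qed
    have "Cauchy (\<lambda>n. A n q)" using Q(1)[OF q(1), of k] by (simp add: A_def h_def convergent_Cauchy)
    then obtain M where M: "\<And>i j. i \<ge> M \<Longrightarrow> j \<ge> M \<Longrightarrow> dist (A i q) (A j q) < e/2"
      using e metric_CauchyD[of "\<lambda>n. A n q" "e/2"] by auto
    have "dist (A i x) (A j x) < e" if "i \<ge> M" "j \<ge> M" for i j
    proof -
      have "\<bar>A i x - A j x\<bar> \<le> \<bar>A i x - A i q\<bar> + \<bar>A i q - A j q\<bar> + \<bar>A j x - A j q\<bar>" by linarith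
      moreover have "\<bar>A i x - A i q\<bar> \<le> e/4" "\<bar>A j x - A j q\<bar> \<le> e/4" using lip[of i x q] lip[of j x q] q2 by linarith+
      ultimately show ?thesis using M[OF that] unfolding dist_real_def by linarith
    qed
    then show "\<exists>M. \<forall>i\<ge>M. \<forall>j\<ge>M. dist (A i x) (A j x) < e" by blast
  qed
  define L where "L x = lim (\<lambda>n. A n x)" for x
  have L: "(\<lambda>n. A n x) \<longlonglongrightarrow> L x" for x using conv[of x] by (simp add: L_def convergent_LIMSEQ_iff)
  have cont: "continuous_on UNIV (A n)" for n
    by (rule lipschitz_on_continuous_on[where L = "?d * D"])
       (use lip E in \<open>auto intro!: lipschitz_onI simp: dist_real_def dist_norm\<close>)
  have Am [measurable]: "A n \<in> borel_measurable lebesgue" for n by (rule continuous_lebesgue_measurable[OF cont])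
  have Lm [measurable]: "L \<in> borel_measurable lebesgue" by (rule borel_measurable_LIMSEQ_metric[OF Am L])
  \<comment> \<open>All averages are bounded by \<open>C\<close> and supported in one ball, so
    pointwise convergence becomes convergence in \<open>L^1\<close>.\<close>
  define I where "I = (indicator (cball 0 (S + ?d * h)) :: 'a \<Rightarrow> real)"
  have I: "integrable lebesgue I" unfolding I_def by (rule integrable_real_indicator) (use emeasure_bounded_finite[of "cball (0::'a) (S + ?d * h)"] in auto)
  have AI: "\<bar>A n x\<bar> \<le> C * I x" for n x
  proof (cases "x \<in> cball 0 (S + ?d * h)")
    case True then show ?thesis using box_avg_bound[OF i, of h n x] C[of n] by (simp add: A_def I_def)
  next
    case False
    then have "box_avg h (v n) x = 0" by (intro box_avg_zero[OF h S]) auto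
    then show ?thesis using False by (simp add: A_def I_def)
  qed
  have LI: "\<bar>L x\<bar> \<le> C * I x" for x
    by (rule tendsto_upperbound[OF tendsto_rabs[OF L]]) (simp_all add: AI)
  have CI: "integrable lebesgue (\<lambda>x. C * I x)" using I by simp
  have Ai: "integrable lebesgue (A n)" for n
    by (rule Bochner_Integration.integrable_bound[OF CI Am]) (intro AE_I2, simp only: real_norm_def, rule order_trans[OF AI abs_ge_self])
  have Li: "integrable lebesgue L"
    by (rule Bochner_Integration.integrable_bound[OF CI Lm]) (intro AE_I2, simp only: real_norm_def, rule order_trans[OF LI abs_ge_self])
  have "(\<lambda>n. \<integral>x. \<bar>A n x - L x\<bar> \<partial>lebesgue) \<longlonglongrightarrow> (\<integral>x. 0 \<partial>(lebesgue::'a measure))"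
  proof (rule integral_dominated_convergence[where w = "\<lambda>x. 2 * (C * I x)"])
    show "AE x in lebesgue. (\<lambda>n. \<bar>A n x - L x\<bar>) \<longlonglongrightarrow> 0"
      using tendsto_rabs_zero[OF LIM_zero[OF L]] by (intro AE_I2) simp
    show "AE x in lebesgue. norm \<bar>A n x - L x\<bar> \<le> 2 * (C * I x)" for n
    proof (rule AE_I2)
      fix x show "norm \<bar>A n x - L x\<bar> \<le> 2 * (C * I x)" using AI[of n x] LI[of x] by simp
    qed
  qed (use CI in auto)
  then have "(\<lambda>n. \<integral>x. \<bar>A n x - L x\<bar> \<partial>lebesgue) \<longlonglongrightarrow> 0" by simp
  then have "\<forall>\<^sub>F n in sequentially. (\<integral>x. \<bar>A n x - L x\<bar> \<partial>lebesgue) < c * \<epsilon>/8"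
    using c \<epsilon> by (intro order_tendstoD(2)) auto
  then obtain M where M: "\<And>n. n \<ge> M \<Longrightarrow> (\<integral>x. \<bar>A n x - L x\<bar> \<partial>lebesgue) < c * \<epsilon>/8" by (auto simp: eventually_sequentially)
  have app: "(\<integral>x. \<bar>A n x - c * v n x\<bar> \<partial>lebesgue) \<le> c * (\<epsilon>/4)" for n
  proof -
    have "ennreal (\<integral>x. \<bar>A n x - c * v n x\<bar> \<partial>lebesgue) = (\<integral>\<^sup>+x. ennreal \<bar>A n x - c * v n x\<bar> \<partial>lebesgue)"
      using Ai[of n] i[of n] by (subst nn_integral_eq_integral) auto
    also have "\<dots> \<le> ennreal (c * (?d * h * D))"
      unfolding A_def c_def by (rule box_avg_approx[OF i T D h])
    finally have "(\<integral>x. \<bar>A n x - c * v n x\<bar> \<partial>lebesgue) \<le> c * (?d * h * D)"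
      using c h D by (subst (asm) ennreal_le_iff) auto
    also have "\<dots> \<le> c * (\<epsilon>/4)" using c hE by (intro mult_left_mono) auto
    finally show ?thesis .
  qed
  have "(\<integral>x. \<bar>v i x - v j x\<bar> \<partial>lebesgue) \<le> \<epsilon>" if ij: "i \<ge> M" "j \<ge> M" for i j
  proof -
    note int = Ai[of i] Ai[of j] Li i[of i] i[of j]
    have "c * (\<integral>x. \<bar>v i x - v j x\<bar> \<partial>lebesgue) = (\<integral>x. c * \<bar>v i x - v j x\<bar> \<partial>lebesgue)" by simp
    also have "\<dots> \<le> (\<integral>x. (\<bar>A i x - c * v i x\<bar> + \<bar>A j x - c * v j x\<bar>) + (\<bar>A i x - L x\<bar> + \<bar>A j x - L x\<bar>) \<partial>lebesgue)"
    proof (rule integral_mono)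
      fix x
      have "c * \<bar>v i x - v j x\<bar> = \<bar>c * v i x - c * v j x\<bar>" using c by (simp add: abs_mult flip: right_diff_distrib)
      then show "c * \<bar>v i x - v j x\<bar> \<le> (\<bar>A i x - c * v i x\<bar> + \<bar>A j x - c * v j x\<bar>) + (\<bar>A i x - L x\<bar> + \<bar>A j x - L x\<bar>)" by linarith
    qed (use int in auto)
    also have "\<dots> = (\<integral>x. \<bar>A i x - c * v i x\<bar> \<partial>lebesgue) + (\<integral>x. \<bar>A j x - c * v j x\<bar> \<partial>lebesgue)
       + ((\<integral>x. \<bar>A i x - L x\<bar> \<partial>lebesgue) + (\<integral>x. \<bar>A j x - L x\<bar> \<partial>lebesgue))"
      using int by simp
    also have "\<dots> \<le> c * \<epsilon>" using app[of i] app[of j] M[OF ij(1)] M[OF ij(2)] mult_pos_pos[OF c \<epsilon>] by (simp add: algebra_simps)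
    finally show ?thesis using c by simp
  qed
  then show ?thesis by blast
qed

section \<open>Diagonal subsequences and completeness of \<open>L^1\<close>\<close>

lemma diagonal_convergent:
  fixes a :: "nat \<Rightarrow> nat \<Rightarrow> real"
  assumes "\<And>j. \<exists>B. \<forall>n. \<bar>a n j\<bar> \<le> B"
  obtains r where "strict_mono r" "\<And>j. convergent (\<lambda>n. a (r n) j)"
proof -
  interpret subseqs "\<lambda>j s. convergent (\<lambda>n. a (s n) j)"
  proof
    fix j and s :: "nat \<Rightarrow> nat" assume "strict_mono s"
    obtain B where B: "\<And>n. \<bar>a n j\<bar> \<le> B" using assms by blast
    then have "bounded (range (\<lambda>n. a (s n) j))" by (intro boundedI[of _ B]) auto
    from bounded_imp_convergent_subsequence[OF this]
    obtain l r where "strict_mono r" "((\<lambda>n. a (s n) j) \<circ> r) \<longlonglongrightarrow> l" by blast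
    then show "\<exists>r'. strict_mono r' \<and> convergent (\<lambda>n. a ((s \<circ> r') n) j)"
      by (auto simp: convergent_def o_def)
  qed
  have "convergent (\<lambda>n. a (diagseq n) j)" for j
  proof -
    have "convergent (\<lambda>n. a ((diagseq \<circ> (+) (Suc j)) n) j)"
    proof (rule diagseq_holds)
      fix r s :: "nat \<Rightarrow> nat" and n assume "strict_mono r" "convergent (\<lambda>m. a (s m) n)"
      then show "convergent (\<lambda>m. a ((s \<circ> r) m) n)"
        using convergent_subseq_convergent[of "\<lambda>m. a (s m) n" r] by (simp add: o_def)
    qed
    then have "convergent (\<lambda>n. a (diagseq (n + Suc j)) j)" by (simp add: o_def add.commute)
    then show ?thesis using convergent_ignore_initial_segment[of "\<lambda>n. a (diagseq n) j" "Suc j"] by simp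
  qed
  then show thesis by (rule that[OF subseq_diagseq])
qed

text \<open>A subsequence with geometrically small increments converges a.e. and is dominated by its
  first member plus the sum of all increments, both in modulus.\<close>

lemma L1_complete:
  fixes u :: "nat \<Rightarrow> 'm \<Rightarrow> real"
  assumes i: "\<And>n. integrable M (u n)"
    and cauchy: "\<And>\<epsilon>. \<epsilon> > 0 \<Longrightarrow> \<exists>N. \<forall>i\<ge>N. \<forall>j\<ge>N. (\<integral>x. \<bar>u i x - u j x\<bar> \<partial>M) \<le> \<epsilon>"
  obtains r v where "strict_mono r" "integrable M v" "(\<lambda>n. \<integral>x. \<bar>u (r n) x - v x\<bar> \<partial>M) \<longlonglongrightarrow> 0"
proof -
  obtain r where r: "strict_mono r" "\<And>k. (\<integral>x. \<bar>u (r (Suc k)) x - u (r k) x\<bar> \<partial>M) \<le> (1/2)^k"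
    using fast_subsequence[of "\<lambda>i j. \<integral>x. \<bar>u i x - u j x\<bar> \<partial>M" "\<lambda>k. (1/2)^k", OF cauchy] by auto
  define f where "f k x = \<bar>u (r (Suc k)) x - u (r k) x\<bar>" for k x
  have fi: "integrable M (f k)" for k unfolding f_def[abs_def] using i by (intro integrable_abs Bochner_Integration.integrable_diff)
  have f0: "f k x \<ge> 0" for k x by (simp add: f_def)
  have "summable (\<lambda>k. \<integral>x. f k x \<partial>M)"
    by (rule summable_comparison_test'[OF summable_geometric[of "1/2::real"], where N = 0]) (use r(2) in \<open>auto simp: f_def\<close>)
  note F = AE_summable_integrals[of M f, OF fi f0 this]
  have um [measurable]: "u n \<in> borel_measurable M" for n using i by auto
  define v where "v x = lim (\<lambda>n. u (r n) x)" for x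
  have vm [measurable]: "v \<in> borel_measurable M" unfolding v_def[abs_def] by (rule borel_measurable_lim_metric) measurable
  have tel: "u (r n) x = u (r 0) x + (\<Sum>k<n. u (r (Suc k)) x - u (r k) x)" for n x
    by (simp add: sum_lessThan_telescope[of "\<lambda>k. u (r k) x"])
  define w where "w x = \<bar>u (r 0) x\<bar> + (\<Sum>k. f k x)" for x
  have wi: "integrable M w" unfolding w_def[abs_def] using i F(2) by simp
  have lim: "AE x in M. (\<lambda>n. u (r n) x) \<longlonglongrightarrow> v x"
    using F(1)
  proof eventually_elim
    case (elim x)
    then have "summable (\<lambda>k. u (r (Suc k)) x - u (r k) x)" unfolding f_def by (rule summable_rabs_cancel)
    then have "convergent (\<lambda>n. \<Sum>k<n. u (r (Suc k)) x - u (r k) x)" by (simp add: summable_iff_convergent)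
    then have "convergent (\<lambda>n. u (r 0) x + (\<Sum>k<n. u (r (Suc k)) x - u (r k) x))" by (intro convergent_add convergent_const)
    then have "convergent (\<lambda>n. u (r n) x)" by (subst tel)
    then show ?case by (simp add: v_def convergent_LIMSEQ_iff)
  qed
  have dom: "AE x in M. norm (u (r n) x) \<le> w x" for n
    using F(1)
  proof eventually_elim
    case (elim x)
    have "\<bar>u (r n) x\<bar> \<le> \<bar>u (r 0) x\<bar> + (\<Sum>k<n. f k x)"
      unfolding tel[of n] f_def by (rule order_trans[OF abs_triangle_ineq add_left_mono[OF sum_abs]])
    also have "\<dots> \<le> w x" unfolding w_def using sum_le_suminf[OF elim, of "{..<n}"] f0 by simp
    finally show ?case by simp
  qed
  have vi: "integrable M v" by (rule integrable_dominated_convergence[OF vm um wi lim dom])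
  have "(\<lambda>n. \<integral>x. \<bar>u (r n) x - v x\<bar> \<partial>M) \<longlonglongrightarrow> (\<integral>x. 0 \<partial>M)"
  proof (rule integral_dominated_convergence[where w = "\<lambda>x. w x + \<bar>v x\<bar>"])
    show "AE x in M. (\<lambda>n. \<bar>u (r n) x - v x\<bar>) \<longlonglongrightarrow> 0"
      using lim
    proof eventually_elim
      case (elim x) then show ?case using tendsto_rabs_zero[OF LIM_zero[OF elim]] by simp
    qed
    show "AE x in M. norm \<bar>u (r n) x - v x\<bar> \<le> w x + \<bar>v x\<bar>" for n
      using dom[of n] by eventually_elim simp
  qed (use wi vi in auto)
  then show thesis by (intro that[OF r(1) vi]) simp
qed

section \<open>Compactness of bounded sequences\<close>

context cap_space
begin

text \<open>On the ball carrying the cut-off, t \<le> 1 + t^p turns the p-th power norm of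
  \<open>u\<close> into \<open>L^1\<close> bounds for the product and for its gradient.
  \<open>D\<close> depends on the cut-off and on \<open>K\<close> only, not on
  \<open>u\<close>.\<close>

lemma cutoff_W_bounds:
  fixes S L K :: real
  assumes u: "u \<in> W" "nrm u \<le> K" and S: "S > 0" and L: "L \<ge> 0"
    and g: "\<And>x. norm (grad (cutoff S) (x::'a)) \<le> L" and g0: "\<And>x. norm x \<ge> S \<Longrightarrow> grad (cutoff S) (x::'a) = 0"
  defines "v \<equiv> \<lambda>x. cutoff S x * u x" and "D \<equiv> (1 + L) * (measure lebesgue (cball (0::'a) S) + K)"
  shows "integrable lebesgue v" "(\<integral>x. \<bar>v x\<bar> \<partial>lebesgue) \<le> D"
    "(\<integral>\<^sup>+x. ennreal \<bar>v (x + z) - v x\<bar> \<partial>lebesgue) \<le> ennreal ((\<Sum>b\<in>Basis. \<bar>z \<bullet> b\<bar>) * D)"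
proof -
  note \<eta> = cutoff_smooth[of _ S]
  have \<eta>b: "0 \<le> cutoff S x" "cutoff S x \<le> 1" "\<bar>cutoff S x\<bar> \<le> 1" for x :: 'a
    using cutoff_bounds[of S x] by auto
  have vs: "v \<in> sobolev p" unfolding v_def by (rule sobolev_mult_smooth(1)[OF WD(1)[OF u(1)] p0(1) \<eta> \<eta>b(3) g])
  have Dv: "AE x in lebesgue. weak_gradient v x = cutoff S x *\<^sub>R weak_gradient u x + u x *\<^sub>R grad (cutoff S) x"
    unfolding v_def by (rule sobolev_mult_smooth(2)[OF WD(1)[OF u(1)] p0(1) \<eta> \<eta>b(3) g])
  note vD = sobolevD[OF vs p0(2)]
  define I where "I = (indicator (cball 0 S) :: 'a \<Rightarrow> real)"
  have I: "integrable lebesgue I" and Ii: "(\<integral>x. I x \<partial>lebesgue) = measure lebesgue (cball (0::'a) S)"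
    using emeasure_bounded_finite[of "cball (0::'a) S"] by (auto simp: I_def)
  note P = W_powr_integrable[OF u(1)]
  define F where "F x = (1 + L) * I x + norm (weak_gradient u x) powr p + (1 + L) * norm (u x) powr p" for x
  have Fi: "integrable lebesgue F" unfolding F_def[abs_def] using I P by simp
  have F0: "F x \<ge> 0" for x unfolding F_def I_def using L by (intro add_nonneg_nonneg mult_nonneg_nonneg) auto
  have FD: "(\<integral>x. F x \<partial>lebesgue) \<le> D"
  proof -
    have "(\<integral>x. F x \<partial>lebesgue) = (1 + L) * measure lebesgue (cball (0::'a) S) +
        ((\<integral>x. norm (weak_gradient u x) powr p \<partial>lebesgue) + (1 + L) * (\<integral>x. norm (u x) powr p \<partial>lebesgue))"
      unfolding F_def[abs_def] using I P Ii by simp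
    also have "(\<integral>x. norm (weak_gradient u x) powr p \<partial>lebesgue) + (1 + L) * (\<integral>x. norm (u x) powr p \<partial>lebesgue)
       \<le> (1 + L) * ((\<integral>x. norm (weak_gradient u x) powr p \<partial>lebesgue) + (\<integral>x. norm (u x) powr p \<partial>lebesgue))"
      using L by (simp add: distrib_left distrib_right integral_nonneg_AE)
    also have "\<dots> \<le> (1 + L) * K" using L nrm_parts(1)[of u] u(2) by (intro mult_left_mono) auto
    finally show ?thesis by (simp add: D_def distrib_left)
  qed
  have t1: "norm y \<le> 1 + norm y powr p" for y :: "'b::real_normed_vector" by (rule le_one_plus_powr) (use p0 in auto)
  have vF: "\<bar>v x\<bar> \<le> F x" for x
  proof (cases "norm x \<ge> S")
    case True then show ?thesis using F0[of x] cutoff_zero[OF S True] by (simp add: v_def)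
  next
    case False
    then have "I x = 1" by (simp add: I_def)
    have "\<bar>v x\<bar> \<le> norm (u x)" using \<eta>b[of x] by (simp add: v_def abs_mult mult_left_le_one_le)
    also have "\<dots> \<le> 1 + norm (u x) powr p" by (rule t1)
    also have "\<dots> \<le> F x" using \<open>I x = 1\<close> L by (simp add: F_def distrib_right)
    finally show ?thesis .
  qed
  show vi: "integrable lebesgue v"
    by (rule Bochner_Integration.integrable_bound[OF Fi vD(4)]) (use vF F0 in auto)
  show "(\<integral>x. \<bar>v x\<bar> \<partial>lebesgue) \<le> D"
    by (rule order_trans[OF integral_mono FD]) (use vi Fi vF in auto)
  have "(\<integral>\<^sup>+x. ennreal (norm (weak_gradient v x)) \<partial>lebesgue) \<le> (\<integral>\<^sup>+x. ennreal (F x) \<partial>lebesgue)"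
  proof (rule nn_integral_mono_AE)
    show "AE x in lebesgue. ennreal (norm (weak_gradient v x)) \<le> ennreal (F x)"
      using Dv
    proof eventually_elim
      case (elim x)
      show ?case
      proof (cases "norm x \<ge> S")
        case True then show ?thesis using F0 cutoff_zero[OF S True] g0[OF True] elim by simp
      next
        case False
        then have I1: "I x = 1" by (simp add: I_def)
        have "norm (weak_gradient v x) \<le> norm (weak_gradient u x) + norm (u x) * L"
          unfolding elim by (rule norm_triangle_le) (use \<eta>b[of x] g[of x] in \<open>auto intro!: add_mono mult_left_mono mult_left_le_one_le\<close>)
        also have "\<dots> \<le> (1 + norm (weak_gradient u x) powr p) + (1 + norm (u x) powr p) * L"
          by (intro add_mono mult_right_mono t1 L)
        also have "\<dots> \<le> F x" using I1 by (simp add: F_def algebra_simps)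
        finally show ?thesis by (rule ennreal_leI)
      qed
    qed
  qed
  also have "\<dots> \<le> ennreal D" using Fi F0 FD by (subst nn_integral_eq_integral) (auto intro: ennreal_leI)
  finally show "(\<integral>\<^sup>+x. ennreal \<bar>v (x + z) - v x\<bar> \<partial>lebesgue) \<le> ennreal ((\<Sum>b\<in>Basis. \<bar>z \<bullet> b\<bar>) * D)"
    by (rule weak_gradient_translation[OF vD(2,4)])
qed

text \<open>Read off from uniform convexity with \<epsilon> = 1. Some bound linear in
  \<open>K\<close> is all that the tail estimate asks for.\<close>

lemma nrm_diff_bounded:
  obtains c where "c > 0" "\<And>u v K. u \<in> W \<Longrightarrow> v \<in> W \<Longrightarrow> nrm u \<le> K \<Longrightarrow> nrm v \<le> K \<Longrightarrow> nrm (\<lambda>x. u x - v x) \<le> c * K"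
proof -
  obtain C where C: "C > 0" "\<And>u v. u \<in> W \<Longrightarrow> v \<in> W \<Longrightarrow>
     nrm (\<lambda>x. u x - v x) \<le> 1 * (nrm u + nrm v) + C * (nrm u / 2 + nrm v / 2 - nrm (\<lambda>x. (1/2) * u x + (1/2) * v x))"
    using nrm_uniformly_convex[of 1] by auto
  have "nrm (\<lambda>x. u x - v x) \<le> (2 + C) * K" if "u \<in> W" "v \<in> W" "nrm u \<le> K" "nrm v \<le> K" for u v K
  proof -
    have "C * (nrm u / 2 + nrm v / 2 - nrm (\<lambda>x. (1/2) * u x + (1/2) * v x)) \<le> C * K"
      using that C(1) nrm_nonneg[of "\<lambda>x. (1/2) * u x + (1/2) * v x"] by (intro mult_left_mono) auto
    then show ?thesis using C(2)[OF that(1,2)] that(3,4) by (simp add: distrib_right)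
  qed
  then show thesis using C(1) by (intro that[of "2 + C"]) auto
qed

lemma compact_L1:
  fixes u :: "nat \<Rightarrow> 'a \<Rightarrow> real"
  assumes C0: "\<And>n. (\<integral>x. un n x \<partial>lebesgue) \<le> C0" and u: "\<And>n. u n \<in> W" "\<And>n. nrm (u n) \<le> K"
  obtains r :: "nat \<Rightarrow> nat" and v where "strict_mono r" "integrable lebesgue v" "(\<lambda>n. \<integral>x. \<bar>u (r n) x - v x\<bar> \<partial>lebesgue) \<longlonglongrightarrow> 0"
proof -
  have K: "K \<ge> 0" using u(2)[of 0] nrm_nonneg[of "u 0"] by linarith
  obtain B where B: "B > 0" "\<And>S x. S > 0 \<Longrightarrow> norm (grad (cutoff S) (x::'a)) \<le> B / S"
    "\<And>S x. S > 0 \<Longrightarrow> norm x \<ge> S \<Longrightarrow> grad (cutoff S) (x::'a) = 0"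
    using cutoff_grad_bound[where 'a = 'a] by metis
  define D where "D m = (1 + B / real (Suc m)) * (measure lebesgue (cball (0::'a) (real (Suc m))) + K)" for m
  define \<nu> where "\<nu> m n x = cutoff (real (Suc m)) x * u n x" for m n x
  have cb: "integrable lebesgue (\<nu> m n)" "(\<integral>x. \<bar>\<nu> m n x\<bar> \<partial>lebesgue) \<le> D m"
    "(\<integral>\<^sup>+x. ennreal \<bar>\<nu> m n (x + z) - \<nu> m n x\<bar> \<partial>lebesgue) \<le> ennreal ((\<Sum>b\<in>Basis. \<bar>z \<bullet> b\<bar>) * D m)" for m n z
  proof -
    have S: "real (Suc m) > 0" and L: "B / real (Suc m) \<ge> 0" using B by auto
    note c = cutoff_W_bounds[OF u S L B(2)[OF S] B(3)[OF S]]
    show "integrable lebesgue (\<nu> m n)" "(\<integral>x. \<bar>\<nu> m n x\<bar> \<partial>lebesgue) \<le> D m"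
      "(\<integral>\<^sup>+x. ennreal \<bar>\<nu> m n (x + z) - \<nu> m n x\<bar> \<partial>lebesgue) \<le> ennreal ((\<Sum>b\<in>Basis. \<bar>z \<bullet> b\<bar>) * D m)"
      unfolding \<nu>_def[abs_def] D_def by (rule c, assumption)+
  qed
  have D0: "D m \<ge> 0" for m using B(1) K by (simp add: D_def)
  obtain Q :: "'a set" where Q: "countable Q" "\<And>X. open X \<Longrightarrow> X \<noteq> {} \<Longrightarrow> \<exists>d\<in>Q. d \<in> X"
    using countable_dense_exists[where 'a = 'a] by blast
  have Qne: "Q \<noteq> {}" using Q(2)[of UNIV] by auto
  have Qd: "closure Q = UNIV"
  proof -
    have "x \<in> closure Q" for x
      unfolding closure_approachable using Q(2)[of "ball x e" for e] by (metis centre_in_ball dist_commute empty_iff mem_ball open_ball)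
    then show ?thesis by auto
  qed
  define q where "q = from_nat_into Q"
  have qQ: "range q = Q" unfolding q_def by (rule range_from_nat_into[OF Qne Q(1)])
  \<comment> \<open>One index encodes the side of the box, the cut-off radius and the dense point,
    so that a single diagonal subsequence makes all these averages converge.\<close>
  define a where "a n j = (case prod_decode j of (k, j') \<Rightarrow> case prod_decode j' of (m, i) \<Rightarrow>
      box_avg (1 / real (Suc k)) (\<nu> m n) (q i))" for n j
  have a_enc: "a n (prod_encode (k, prod_encode (m, i))) = box_avg (1 / real (Suc k)) (\<nu> m n) (q i)" for n k m i
    by (simp add: a_def)
  have "\<exists>B. \<forall>n. \<bar>a n j\<bar> \<le> B" for j
  proof -
    obtain k m i where j: "j = prod_encode (k, prod_encode (m, i))" by (metis prod_decode_inverse surj_pair)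
    have "\<bar>a n j\<bar> \<le> D m" for n unfolding j a_enc by (rule order_trans[OF box_avg_bound[OF cb(1)] cb(2)])
    then show ?thesis by blast
  qed
  from diagonal_convergent[of a, OF this] obtain r where r: "strict_mono r" "\<And>j. convergent (\<lambda>n. a (r n) j)" by blast
  have avg: "convergent (\<lambda>n. box_avg (1 / real (Suc k)) (\<nu> m (r n)) y)" if "y \<in> Q" for k m y
  proof -
    obtain i where "y = q i" using \<open>y \<in> Q\<close> qQ by blast
    then show ?thesis using r(2)[of "prod_encode (k, prod_encode (m, i))"] by (simp only: a_enc)
  qed
  obtain c where c: "c > 0" "\<And>u v K. u \<in> W \<Longrightarrow> v \<in> W \<Longrightarrow> nrm u \<le> K \<Longrightarrow> nrm v \<le> K \<Longrightarrow> nrm (\<lambda>x. u x - v x) \<le> c * K"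
    using nrm_diff_bounded by blast
  have ui: "integrable lebesgue (u n)" for n by (rule embedding_bound(1)[OF C0 u(1)])
  have "\<exists>N. \<forall>i\<ge>N. \<forall>j\<ge>N. (\<integral>x. \<bar>u (r i) x - u (r j) x\<bar> \<partial>lebesgue) \<le> \<epsilon>" if \<epsilon>: "\<epsilon> > 0" for \<epsilon>
  proof -
    have \<epsilon>2: "\<epsilon>/2 > 0" and cK: "c * K \<ge> 0" using \<epsilon> c K by auto
    \<comment> \<open>The tail estimate is applied to differences of members of the sequence, whose
      \<open>nrm\<close> is at most \<open>c * K\<close>.\<close>
    obtain m where m: "\<And>u. u \<in> W \<Longrightarrow> nrm u \<le> c * K \<Longrightarrow>
       (\<integral>\<^sup>+x. ennreal ((1 - cutoff (real (Suc m)) x) * \<bar>u x\<bar>) \<partial>lebesgue) \<le> ennreal (\<epsilon>/2)"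
      using uniform_tails[OF C0 \<epsilon>2 cK] by blast
    obtain N where N: "\<And>i j. i \<ge> N \<Longrightarrow> j \<ge> N \<Longrightarrow> (\<integral>x. \<bar>\<nu> m (r i) x - \<nu> m (r j) x\<bar> \<partial>lebesgue) \<le> \<epsilon>/2"
      using L1_cauchy_of_box_avg[of "\<lambda>n. \<nu> m (r n)", OF cb D0 _ avg Qd \<epsilon>2, of "real (Suc m)"]
      by (auto simp: \<nu>_def cutoff_zero)
    have "(\<integral>x. \<bar>u (r i) x - u (r j) x\<bar> \<partial>lebesgue) \<le> \<epsilon>" if ij: "i \<ge> N" "j \<ge> N" for i j
    proof -
      let ?w = "\<lambda>x. u (r i) x - u (r j) x" and ?\<eta> = "cutoff (real (Suc m))"
      have wW: "?w \<in> W" using W_lincomb[OF u(1) u(1), of 1 "r i" "-1" "r j"] by simp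
      have wi: "integrable lebesgue ?w" using ui by simp
      have \<nu>w: "\<nu> m (r i) x - \<nu> m (r j) x = ?\<eta> x * ?w x" for x by (simp add: \<nu>_def right_diff_distrib)
      have \<eta>b: "0 \<le> ?\<eta> x" "?\<eta> x \<le> 1" for x :: 'a by (rule cutoff_bounds)+
      have \<eta>m: "?\<eta> \<in> borel_measurable lebesgue"
        by (rule continuous_lebesgue_measurable[OF smooth_continuous(1)[OF cutoff_smooth]])
      have "ennreal (\<integral>x. \<bar>?w x\<bar> \<partial>lebesgue) = (\<integral>\<^sup>+x. ennreal \<bar>?w x\<bar> \<partial>lebesgue)"
        using wi by (subst nn_integral_eq_integral) auto
      also have "\<dots> = (\<integral>\<^sup>+x. ennreal ((1 - ?\<eta> x) * \<bar>?w x\<bar>) + ennreal \<bar>\<nu> m (r i) x - \<nu> m (r j) x\<bar> \<partial>lebesgue)"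
      proof (rule nn_integral_cong)
        fix x
        have "\<bar>?w x\<bar> = (1 - ?\<eta> x) * \<bar>?w x\<bar> + \<bar>\<nu> m (r i) x - \<nu> m (r j) x\<bar>"
          unfolding \<nu>w abs_mult using \<eta>b[of x] by (simp add: left_diff_distrib)
        then show "ennreal \<bar>?w x\<bar> = ennreal ((1 - ?\<eta> x) * \<bar>?w x\<bar>) + ennreal \<bar>\<nu> m (r i) x - \<nu> m (r j) x\<bar>"
          using \<eta>b[of x] by (metis ennreal_plus abs_ge_zero diff_ge_0_iff_ge mult_nonneg_nonneg)
      qed
      also have "\<dots> = (\<integral>\<^sup>+x. ennreal ((1 - ?\<eta> x) * \<bar>?w x\<bar>) \<partial>lebesgue) + (\<integral>\<^sup>+x. ennreal \<bar>\<nu> m (r i) x - \<nu> m (r j) x\<bar> \<partial>lebesgue)"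
      proof (rule nn_integral_add)
        note [measurable] = \<eta>m borel_measurable_integrable[OF wi] borel_measurable_integrable[OF cb(1)]
        show "(\<lambda>x. ennreal ((1 - ?\<eta> x) * \<bar>?w x\<bar>)) \<in> borel_measurable lebesgue"
          by (intro measurable_compose[OF _ measurable_ennreal] borel_measurable_times borel_measurable_diff borel_measurable_const
              borel_measurable_abs \<eta>m borel_measurable_integrable[OF wi] borel_measurable_integrable[OF ui])
        show "(\<lambda>x. ennreal \<bar>\<nu> m (r i) x - \<nu> m (r j) x\<bar>) \<in> borel_measurable lebesgue" by measurable
      qed
      also have "\<dots> \<le> ennreal (\<epsilon>/2) + ennreal (\<epsilon>/2)"
      proof (rule add_mono)
        show "(\<integral>\<^sup>+x. ennreal ((1 - ?\<eta> x) * \<bar>?w x\<bar>) \<partial>lebesgue) \<le> ennreal (\<epsilon>/2)"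
          by (rule m[OF wW c(2)[OF u(1) u(1) u(2) u(2)]])
        show "(\<integral>\<^sup>+x. ennreal \<bar>\<nu> m (r i) x - \<nu> m (r j) x\<bar> \<partial>lebesgue) \<le> ennreal (\<epsilon>/2)"
          using N[OF ij] cb(1) by (subst nn_integral_eq_integral) (auto intro: ennreal_leI)
      qed
      also have "\<dots> = ennreal \<epsilon>" using \<epsilon> by (simp flip: ennreal_plus)
      finally show ?thesis using \<epsilon> by (subst (asm) ennreal_le_iff) auto
    qed
    then show ?thesis by blast
  qed
  from L1_complete[of lebesgue "\<lambda>n. u (r n)", OF ui this] obtain s v where
    s: "strict_mono s" "integrable lebesgue v" "(\<lambda>n. \<integral>x. \<bar>u (r (s n)) x - v x\<bar> \<partial>lebesgue) \<longlonglongrightarrow> 0" by blast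
  show thesis by (rule that[OF strict_mono_o[OF r(1) s(1)] s(2)]) (use s(3) in \<open>simp add: o_def\<close>)
qed

lemma W_diff: "u \<in> W \<Longrightarrow> v \<in> W \<Longrightarrow> (\<lambda>x. u x - v x) \<in> W"
  using W_lincomb[of u v 1 "-1"] by simp

lemma embedding_of_bound:
  assumes C0: "\<And>n. (\<integral>x. un n x \<partial>lebesgue) \<le> C0"
  shows "embedded_in_L1 p \<mu> \<and> continuous_injection_L1 p \<mu>" "compact_embedding_L1 p \<mu>"
proof -
  have emb: "embedded_in_L1 p \<mu>" using embedding_bound(1)[OF C0] by (auto simp: embedded_in_L1_def W_def)
  have cont: "continuous_injection_L1 p \<mu>"
    unfolding continuous_injection_L1_def W_def[symmetric]
  proof (intro ballI allI impI)
    fix u and \<epsilon> :: real assume u: "u \<in> W" and \<epsilon>: "\<epsilon> > 0"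
    obtain \<delta> where \<delta>: "\<delta> > 0" "\<And>v. v \<in> W \<Longrightarrow> nrm v powr (1/p) < \<delta> \<Longrightarrow> (\<integral>x. \<bar>v x\<bar> \<partial>lebesgue) < \<epsilon>"
      using embedding_small[OF C0 \<epsilon>] by blast
    then show "\<exists>\<delta>>0. \<forall>v\<in>W. sobolev_mu_norm p \<mu> (\<lambda>x. v x - u x) < \<delta> \<longrightarrow> L1_norm (\<lambda>x. v x - u x) < \<epsilon>"
      using u by (intro exI[of _ \<delta>]) (simp add: sobolev_mu_norm_nrm W_diff L1_norm_def)
  qed
  show "embedded_in_L1 p \<mu> \<and> continuous_injection_L1 p \<mu>" using emb cont by blast
  show "compact_embedding_L1 p \<mu>"
    unfolding compact_embedding_L1_def W_def[symmetric]
  proof (intro conjI emb cont allI impI)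
    fix u :: "nat \<Rightarrow> 'a \<Rightarrow> real"
    assume "(\<forall>n. u n \<in> W) \<and> (\<exists>C. \<forall>n. sobolev_mu_norm p \<mu> (u n) \<le> C)"
    then obtain C where u: "\<And>n. u n \<in> W" and C: "\<And>n. sobolev_mu_norm p \<mu> (u n) \<le> C" by blast
    have "nrm (u n) \<le> C powr p" for n
    proof -
      have "nrm (u n) powr (1/p) \<le> C" using C[of n] by (simp add: sobolev_mu_norm_nrm[OF u])
      then have "(nrm (u n) powr (1/p)) powr p \<le> C powr p" using p0 by (intro powr_mono2) auto
      then show ?thesis using p0 nrm_nonneg[of "u n"] by (simp add: powr_powr)
    qed
    from compact_L1[of C0 u, OF C0 u this] obtain r v where
      "strict_mono (r :: nat \<Rightarrow> nat)" "integrable lebesgue v" "(\<lambda>n. \<integral>x. \<bar>u (r n) x - v x\<bar> \<partial>lebesgue) \<longlonglongrightarrow> 0" .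
    then show "\<exists>r v. strict_mono (r :: nat \<Rightarrow> nat) \<and> integrable lebesgue v \<and>
           (\<lambda>n. L1_norm (\<lambda>x. u (r n) x - v x)) \<longlonglongrightarrow> 0"
      unfolding L1_norm_def by (intro exI[of _ r] exI[of _ v] conjI)
  qed
qed

text \<open>Continuity at the zero function with tolerance 1 is all that the scaling argument
  consumes.\<close>

lemma bound_of_embedding:
  assumes "continuous_injection_L1 p \<mu>"
  obtains C0 where "\<And>n. (\<integral>x. un n x \<partial>lebesgue) \<le> C0"
proof -
  have "\<exists>\<delta>>0. \<forall>v\<in>W. sobolev_mu_norm p \<mu> (\<lambda>x. v x - 0) < \<delta> \<longrightarrow> L1_norm (\<lambda>x. v x - 0) < 1"
    using assms[unfolded continuous_injection_L1_def W_def[symmetric], rule_format, OF W_zero zero_less_one] .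
  then obtain \<delta> where \<delta>: "\<delta> > 0" "\<And>v. v \<in> W \<Longrightarrow> nrm v powr (1/p) < \<delta> \<Longrightarrow> (\<integral>x. \<bar>v x\<bar> \<partial>lebesgue) < 1"
    by (auto simp: sobolev_mu_norm_nrm L1_norm_def)
  show thesis by (rule that[OF bounded_from_continuity[OF \<delta>]])
qed

end

theorem theorem6p2:
  fixes p :: real and \<mu> :: "(real ^ 'n) measure"
  assumes "1 < p" and "\<mu> \<in> capacitary_measures p"
  shows "(ereal_integrable (w_mu p \<mu>) \<longleftrightarrow>
            embedded_in_L1 p \<mu> \<and> continuous_injection_L1 p \<mu>) \<and>
         (ereal_integrable (w_mu p \<mu>) \<or>
            (embedded_in_L1 p \<mu> \<and> continuous_injection_L1 p \<mu>) \<longrightarrow>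
          compact_embedding_L1 p \<mu>)"
proof -
  interpret cap_space p \<mu> by unfold_locales (use assms capacitary_cap_null in auto)
  have "ereal_integrable (w_mu p \<mu>) \<Longrightarrow> embedded_in_L1 p \<mu> \<and> continuous_injection_L1 p \<mu>"
    using embedding_of_bound(1) by (auto simp: w_integrable_iff)
  moreover have "embedded_in_L1 p \<mu> \<and> continuous_injection_L1 p \<mu> \<Longrightarrow> ereal_integrable (w_mu p \<mu>)"
    using bound_of_embedding by (metis w_integrable_iff)
  moreover have "ereal_integrable (w_mu p \<mu>) \<Longrightarrow> compact_embedding_L1 p \<mu>"
    using embedding_of_bound(2) by (auto simp: w_integrable_iff)
  ultimately show ?thesis by blast
qed

end
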